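(* Let $G$ be a finite group and let $T$ be a local, multiplicatively cohomological $G$-Tambara functor with maximal ideal $\mathfrak{m}$. If $P$ is a finitely generated projective $T$-module such that $P/\mathfrak{m}P$ is a free $T/\mathfrak{m}$-module, then $P$ is a free $T$-module.
   Context: A $G$-Tambara functor $T$ assigns to each finite $G$-set $X$ a commutative ring $T(X)$ and to each $G$-map $f\colon X\to Y$ a ring homomorphism $f^*\colon T(Y)\to T(X)$ (restriction), a homomorphism of additive groups $f_+\colon T(X)\to T(Y)$ (transfer) and a homomorphism of multiplicative monoids $f_\times\colon T(X)\to T(Y)$ (norm) such that: $f^*$ is contravariantly functorial and $f_+,f_\times$ are covariantly functorial; $T(X\amalg Y)\cong T(X)\times T(Y)$ via the restrictions, and $T(\emptyset)=0$; for each pullback square with $f\colon X\to Y$, $g\colon Y'\to Y$, $X'=X\times_Y Y'$ and projections $f'\colon X'\to Y'$, $g'\colon X'\to X$ one has $g^*f_+=f'_+g'^*$ and $g^*f_\times=f'_\times g'^*$; and for $q\colon A\to X$, $f\colon X\to Y$, setting $\Pi=\{(y,s): y\in Y,\ s\colon f^{-1}(y)\to A,\ q\circ s=\mathrm{id}\}$, with $p\colon\Pi\to Y$ and $r\colon X\times_Y\Pi\to\Pi$ the projections and $e\colon X\times_Y\Pi\to A$, $(x,(y,s))\mapsto s(x)$, one has $f_\times q_+=p_+r_\times e^*$. Maps of Tambara functors are families of ring homomorphisms commuting with all operations. For $H\le K\le G$, $\mathrm{res}^K_H$, $\mathrm{tr}^K_H$, $\mathrm{nm}^K_H$ are the restriction,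 transfer and norm along the projection $G/H\to G/K$. $T$ is multiplicatively cohomological if for all $H\le K\le G$ the composite $\mathrm{nm}^K_H\circ\mathrm{res}^K_H$ on $T(G/K)$ is the $|K/H|$-th power map. An ideal $I$ of $T$ is a collection of ring ideals $I(G/H)\subseteq T(G/H)$ that occurs as the levelwise kernel of a map of Tambara functors with source $T$; the quotient $T/I$ (taken levelwise) is a Tambara functor. An ideal is maximal if it is proper and not properly contained in another proper ideal. $T$ is local if it has exactly one maximal ideal. A $G$-Mackey functor $M$ is defined like a Tambara functor but with values abelian groups and only additive restrictions and transfers $f^*,f_+$ (functoriality, additivity on disjoint unions, and base change for pullback squares). The box product $\boxtimes$ is the symmetric monoidal product of Mackey functors (Day convolution): maps $M\boxtimes N\to P$ correspond to families of bilinear maps $M(X)\times N(X)\to P(X)$, $(m,n)\mapsto m\cdot n$, with $f^*(m\cdot n)=f^*m\cdot f^*n$, $f_+(m\cdot f^*n)=f_+m\cdot n$, $f_+(f^*m\cdot n)=m\cdot f_+n$. Every Tambara functor is a commutative monoid for $\boxtimes$. A $T$-module is a Mackey functor $M$ with an associative unital action $T\boxtimes M\to M$; $T$-modules form an abelian category, and projective means projective object there. For an ideal $I\subseteq T$, $IM\subseteq M$ is the image of $I\boxtimes M\to T\boxtimes M\to M$. For a finite $G$-set $X$, $A_X$ denotes the Mackey functor representing evaluation at $X$, i.e. $\mathrm{Hom}(A_X,M)\cong M(X)$ naturally in Mackey functors $M$, and $T_X:=T\boxtimes A_X$ with its evident $T$-module structure. A $T$-module is (finite) free if it is isomorphic to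 $T_X$ for some finite $G$-set $X$; it is finitely generated if it admits a surjection from $T_X$ for some finite $G$-set $X$. All free modules considered are finite free. *)

theory Defs
  imports
    "HOL-Algebra.Group_Action"
    "HOL-Algebra.QuotRing"
    "HOL-Algebra.Free_Abelian_Groups"
    "HOL-Library.FSet"
begin

section \<open>Finite G-sets\<close>

text \<open>
  The points of all finite $G$-sets are taken from one type, the hereditarily finite sets over
  the elements of $G$. It is infinite and closed under pairs, tagged copies, finite graphs of
  functions and cosets, so that every finite $G$-set is isomorphic to one with points in this
  type, and orbits, disjoint unions, fibre products and dependent products exist literally.
\<close>

datatype 'g hf =
    HElem 'g
  | HInl "'g hf"
  | HInr "'g hf"
  | HPair (hfst: "'g hf") (hsnd: "'g hf")
  | HSet (hset: "'g hf fset")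

type_synonym 'g hfmap = "'g hf \<Rightarrow> 'g hf"

record 'g gset =
  pts :: "'g hf set"
  action :: "'g \<Rightarrow> 'g hfmap"

definition fin_gset :: "('g, 'b) monoid_scheme \<Rightarrow> 'g gset \<Rightarrow> bool" where
  "fin_gset G X \<longleftrightarrow> finite (pts X) \<and> group_action G (pts X) (action X)"

text \<open>Maps are extensional on their domain, so that equality of $G$-maps is equality in HOL.\<close>

definition gmap :: "('g, 'b) monoid_scheme \<Rightarrow> 'g gset \<Rightarrow> 'g gset \<Rightarrow> 'g hfmap set" where
  "gmap G X Y = {f \<in> pts X \<rightarrow>\<^sub>E pts Y.
     \<forall>g\<in>carrier G. \<forall>x\<in>pts X. f (action X g x) = action Y g (f x)}"

definition gid :: "'g gset \<Rightarrow> 'g hfmap" where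
  "gid X = (\<lambda>x\<in>pts X. x)"

definition gcomp :: "'g gset \<Rightarrow> 'g hfmap \<Rightarrow> 'g hfmap \<Rightarrow> 'g hfmap" where
  "gcomp X h f = compose (pts X) h f"

definition gsum :: "'g gset \<Rightarrow> 'g gset \<Rightarrow> 'g gset" where
  "gsum X Y =
    \<lparr>pts = HInl ` pts X \<union> HInr ` pts Y,
     action = \<lambda>g. \<lambda>z\<in>HInl ` pts X \<union> HInr ` pts Y.
       (case z of HInl x \<Rightarrow> HInl (action X g x) | HInr y \<Rightarrow> HInr (action Y g y) | _ \<Rightarrow> undefined)\<rparr>"

definition ginl :: "'g gset \<Rightarrow> 'g hfmap" where
  "ginl X = (\<lambda>x\<in>pts X. HInl x)"

definition ginr :: "'g gset \<Rightarrow> 'g hfmap" where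
  "ginr Y = (\<lambda>y\<in>pts Y. HInr y)"

definition gcopair :: "'g gset \<Rightarrow> 'g gset \<Rightarrow> 'g hfmap \<Rightarrow> 'g hfmap \<Rightarrow> 'g hfmap" where
  "gcopair X Y a b = (\<lambda>z\<in>pts (gsum X Y).
     (case z of HInl x \<Rightarrow> a x | HInr y \<Rightarrow> b y | _ \<Rightarrow> undefined))"

text \<open>The fibre product of \<open>f: X \<rightarrow> Y\<close> and \<open>h: Z \<rightarrow> Y\<close>, with its two projections.\<close>

definition gpb_pts :: "'g gset \<Rightarrow> 'g hfmap \<Rightarrow> 'g gset \<Rightarrow> 'g hfmap \<Rightarrow> 'g hf set" where
  "gpb_pts X f Z h = {HPair x z | x z. x \<in> pts X \<and> z \<in> pts Z \<and> f x = h z}"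

definition gpb :: "'g gset \<Rightarrow> 'g hfmap \<Rightarrow> 'g gset \<Rightarrow> 'g hfmap \<Rightarrow> 'g gset" where
  "gpb X f Z h =
    \<lparr>pts = gpb_pts X f Z h,
     action = \<lambda>g. \<lambda>p\<in>gpb_pts X f Z h. HPair (action X g (hfst p)) (action Z g (hsnd p))\<rparr>"

definition gpb_fst :: "'g gset \<Rightarrow> 'g hfmap \<Rightarrow> 'g gset \<Rightarrow> 'g hfmap \<Rightarrow> 'g hfmap" where
  "gpb_fst X f Z h = (\<lambda>p\<in>gpb_pts X f Z h. hfst p)"

definition gpb_snd :: "'g gset \<Rightarrow> 'g hfmap \<Rightarrow> 'g gset \<Rightarrow> 'g hfmap \<Rightarrow> 'g hfmap" where
  "gpb_snd X f Z h = (\<lambda>p\<in>gpb_pts X f Z h. hsnd p)"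

text \<open>
  For \<open>q: A \<rightarrow> X\<close> and \<open>f: X \<rightarrow> Y\<close>, the set of pairs \<open>(y, s)\<close> with \<open>s\<close> a section of \<open>q\<close> over the
  fibre of \<open>f\<close> at \<open>y\<close>. The section is stored as its graph, on which $G$ acts by conjugation.
\<close>

definition hgraph :: "'g hf set \<Rightarrow> 'g hfmap \<Rightarrow> 'g hf" where
  "hgraph D s = HSet (Abs_fset ((\<lambda>x. HPair x (s x)) ` D))"

definition gdep_pts ::
    "'g gset \<Rightarrow> 'g gset \<Rightarrow> 'g gset \<Rightarrow> 'g hfmap \<Rightarrow> 'g hfmap \<Rightarrow> 'g hf set" where
  "gdep_pts A X Y q f =
    {HPair y (hgraph {x \<in> pts X. f x = y} s) | y s.
       y \<in> pts Y \<and> (\<forall>x\<in>pts X. f x = y \<longrightarrow> s x \<in> pts A \<and> q (s x) = x)}"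

definition gdep :: "'g gset \<Rightarrow> 'g gset \<Rightarrow> 'g gset \<Rightarrow> 'g hfmap \<Rightarrow> 'g hfmap \<Rightarrow> 'g gset" where
  "gdep A X Y q f =
    \<lparr>pts = gdep_pts A X Y q f,
     action = \<lambda>g. \<lambda>p\<in>gdep_pts A X Y q f.
       HPair (action Y g (hfst p))
             (HSet ((\<lambda>z. HPair (action X g (hfst z)) (action A g (hsnd z))) |`| hset (hsnd p)))\<rparr>"

definition gdep_proj ::
    "'g gset \<Rightarrow> 'g gset \<Rightarrow> 'g gset \<Rightarrow> 'g hfmap \<Rightarrow> 'g hfmap \<Rightarrow> 'g hfmap" where
  "gdep_proj A X Y q f = (\<lambda>p\<in>gdep_pts A X Y q f. hfst p)"

definition gdep_dom ::
    "'g gset \<Rightarrow> 'g gset \<Rightarrow> 'g gset \<Rightarrow> 'g hfmap \<Rightarrow> 'g hfmap \<Rightarrow> 'g gset" where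
  "gdep_dom A X Y q f = gpb X f (gdep A X Y q f) (gdep_proj A X Y q f)"

definition gdep_snd ::
    "'g gset \<Rightarrow> 'g gset \<Rightarrow> 'g gset \<Rightarrow> 'g hfmap \<Rightarrow> 'g hfmap \<Rightarrow> 'g hfmap" where
  "gdep_snd A X Y q f = gpb_snd X f (gdep A X Y q f) (gdep_proj A X Y q f)"

definition gdep_eval ::
    "'g gset \<Rightarrow> 'g gset \<Rightarrow> 'g gset \<Rightarrow> 'g hfmap \<Rightarrow> 'g hfmap \<Rightarrow> 'g hfmap" where
  "gdep_eval A X Y q f = (\<lambda>z\<in>pts (gdep_dom A X Y q f).
     (THE a. HPair (hfst z) a |\<in>| hset (hsnd (hsnd z))))"

definition hcoset :: "'g set \<Rightarrow> 'g hf" where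
  "hcoset C = HSet (Abs_fset (HElem ` C))"

definition helems :: "'g hf \<Rightarrow> 'g set" where
  "helems z = {a. HElem a |\<in>| hset z}"

definition orbit_pts :: "('g, 'b) monoid_scheme \<Rightarrow> 'g set \<Rightarrow> 'g hf set" where
  "orbit_pts G H = (\<lambda>a. hcoset (a <#\<^bsub>G\<^esub> H)) ` carrier G"

definition gorbit :: "('g, 'b) monoid_scheme \<Rightarrow> 'g set \<Rightarrow> 'g gset" where
  "gorbit G H =
    \<lparr>pts = orbit_pts G H,
     action = \<lambda>g. \<lambda>z\<in>orbit_pts G H. hcoset (g <#\<^bsub>G\<^esub> helems z)\<rparr>"

text \<open>The projection \<open>G/H \<rightarrow> G/K\<close> for \<open>H \<le> K\<close>: the coset \<open>aH\<close> goes to \<open>aH K = aK\<close>.\<close>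

definition orbit_proj :: "('g, 'b) monoid_scheme \<Rightarrow> 'g set \<Rightarrow> 'g set \<Rightarrow> 'g hfmap" where
  "orbit_proj G H K = (\<lambda>z\<in>orbit_pts G H. hcoset (helems z <#>\<^bsub>G\<^esub> K))"


section \<open>Mackey functors\<close>

text \<open>
  Values of Mackey functors are abelian groups in the sense of \<^locale>\<open>comm_group\<close>; so the
  addition of the value groups is written \<open>\<otimes>\<close> and their zero \<open>\<one>\<close>.
  For \<open>f: X \<rightarrow> Y\<close>, the restriction \<open>mres M X Y f\<close> goes from \<open>M(Y)\<close> to \<open>M(X)\<close> and the transfer
  \<open>mtr M X Y f\<close> from \<open>M(X)\<close> to \<open>M(Y)\<close>.
\<close>

record ('g, 'm) mackey =
  mval :: "'g gset \<Rightarrow> 'm monoid"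
  mres :: "'g gset \<Rightarrow> 'g gset \<Rightarrow> 'g hfmap \<Rightarrow> 'm \<Rightarrow> 'm"
  mtr :: "'g gset \<Rightarrow> 'g gset \<Rightarrow> 'g hfmap \<Rightarrow> 'm \<Rightarrow> 'm"

locale mackey_functor =
  fixes G :: "('g, 'b) monoid_scheme" and M :: "('g, 'm, 'z) mackey_scheme"
  assumes val: "fin_gset G X \<Longrightarrow> comm_group (mval M X)"
    and res_hom: "\<lbrakk>fin_gset G X; fin_gset G Y; f \<in> gmap G X Y\<rbrakk>
      \<Longrightarrow> mres M X Y f \<in> hom (mval M Y) (mval M X)"
    and tr_hom: "\<lbrakk>fin_gset G X; fin_gset G Y; f \<in> gmap G X Y\<rbrakk>
      \<Longrightarrow> mtr M X Y f \<in> hom (mval M X) (mval M Y)"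
    and res_id: "\<lbrakk>fin_gset G X; m \<in> carrier (mval M X)\<rbrakk> \<Longrightarrow> mres M X X (gid X) m = m"
    and tr_id: "\<lbrakk>fin_gset G X; m \<in> carrier (mval M X)\<rbrakk> \<Longrightarrow> mtr M X X (gid X) m = m"
    and res_comp: "\<lbrakk>fin_gset G X; fin_gset G Y; fin_gset G Z; f \<in> gmap G X Y; h \<in> gmap G Y Z;
        m \<in> carrier (mval M Z)\<rbrakk>
      \<Longrightarrow> mres M X Z (gcomp X h f) m = mres M X Y f (mres M Y Z h m)"
    and tr_comp: "\<lbrakk>fin_gset G X; fin_gset G Y; fin_gset G Z; f \<in> gmap G X Y; h \<in> gmap G Y Z;
        m \<in> carrier (mval M X)\<rbrakk>
      \<Longrightarrow> mtr M X Z (gcomp X h f) m = mtr M Y Z h (mtr M X Y f m)"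
    and sum: "\<lbrakk>fin_gset G X; fin_gset G Y\<rbrakk>
      \<Longrightarrow> bij_betw (\<lambda>m. (mres M X (gsum X Y) (ginl X) m, mres M Y (gsum X Y) (ginr Y) m))
            (carrier (mval M (gsum X Y))) (carrier (mval M X) \<times> carrier (mval M Y))"
    and empty: "\<lbrakk>fin_gset G X; pts X = {}\<rbrakk> \<Longrightarrow> carrier (mval M X) = {\<one>\<^bsub>mval M X\<^esub>}"
    and base_change: "\<lbrakk>fin_gset G X; fin_gset G Y; fin_gset G Y'; f \<in> gmap G X Y;
        h \<in> gmap G Y' Y; m \<in> carrier (mval M X)\<rbrakk>
      \<Longrightarrow> mres M Y' Y h (mtr M X Y f m)
        = mtr M (gpb X f Y' h) Y' (gpb_snd X f Y' h)
            (mres M (gpb X f Y' h) X (gpb_fst X f Y' h) m)"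


section \<open>Tambara functors\<close>

record ('g, 'a) tambara =
  tval :: "'g gset \<Rightarrow> 'a ring"
  tres :: "'g gset \<Rightarrow> 'g gset \<Rightarrow> 'g hfmap \<Rightarrow> 'a \<Rightarrow> 'a"
  ttr :: "'g gset \<Rightarrow> 'g gset \<Rightarrow> 'g hfmap \<Rightarrow> 'a \<Rightarrow> 'a"
  tnm :: "'g gset \<Rightarrow> 'g gset \<Rightarrow> 'g hfmap \<Rightarrow> 'a \<Rightarrow> 'a"

locale tambara_functor =
  fixes G :: "('g, 'b) monoid_scheme" and T :: "('g, 'a) tambara"
  assumes val: "fin_gset G X \<Longrightarrow> cring (tval T X)"
    and res_hom: "\<lbrakk>fin_gset G X; fin_gset G Y; f \<in> gmap G X Y\<rbrakk>
      \<Longrightarrow> tres T X Y f \<in> ring_hom (tval T Y) (tval T X)"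
    and tr_hom: "\<lbrakk>fin_gset G X; fin_gset G Y; f \<in> gmap G X Y\<rbrakk>
      \<Longrightarrow> ttr T X Y f \<in> hom (add_monoid (tval T X)) (add_monoid (tval T Y))"
    and nm_hom: "\<lbrakk>fin_gset G X; fin_gset G Y; f \<in> gmap G X Y\<rbrakk>
      \<Longrightarrow> tnm T X Y f \<in> hom (tval T X) (tval T Y)"
    and nm_one: "\<lbrakk>fin_gset G X; fin_gset G Y; f \<in> gmap G X Y\<rbrakk>
      \<Longrightarrow> tnm T X Y f \<one>\<^bsub>tval T X\<^esub> = \<one>\<^bsub>tval T Y\<^esub>"
    and res_id: "\<lbrakk>fin_gset G X; t \<in> carrier (tval T X)\<rbrakk> \<Longrightarrow> tres T X X (gid X) t = t"
    and tr_id: "\<lbrakk>fin_gset G X; t \<in> carrier (tval T X)\<rbrakk> \<Longrightarrow> ttr T X X (gid X) t = t"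
    and nm_id: "\<lbrakk>fin_gset G X; t \<in> carrier (tval T X)\<rbrakk> \<Longrightarrow> tnm T X X (gid X) t = t"
    and res_comp: "\<lbrakk>fin_gset G X; fin_gset G Y; fin_gset G Z; f \<in> gmap G X Y; h \<in> gmap G Y Z;
        t \<in> carrier (tval T Z)\<rbrakk>
      \<Longrightarrow> tres T X Z (gcomp X h f) t = tres T X Y f (tres T Y Z h t)"
    and tr_comp: "\<lbrakk>fin_gset G X; fin_gset G Y; fin_gset G Z; f \<in> gmap G X Y; h \<in> gmap G Y Z;
        t \<in> carrier (tval T X)\<rbrakk>
      \<Longrightarrow> ttr T X Z (gcomp X h f) t = ttr T Y Z h (ttr T X Y f t)"
    and nm_comp: "\<lbrakk>fin_gset G X; fin_gset G Y; fin_gset G Z; f \<in> gmap G X Y; h \<in> gmap G Y Z;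
        t \<in> carrier (tval T X)\<rbrakk>
      \<Longrightarrow> tnm T X Z (gcomp X h f) t = tnm T Y Z h (tnm T X Y f t)"
    and sum: "\<lbrakk>fin_gset G X; fin_gset G Y\<rbrakk>
      \<Longrightarrow> bij_betw (\<lambda>t. (tres T X (gsum X Y) (ginl X) t, tres T Y (gsum X Y) (ginr Y) t))
            (carrier (tval T (gsum X Y))) (carrier (tval T X) \<times> carrier (tval T Y))"
    and empty: "\<lbrakk>fin_gset G X; pts X = {}\<rbrakk> \<Longrightarrow> carrier (tval T X) = {\<zero>\<^bsub>tval T X\<^esub>}"
    and tr_base_change: "\<lbrakk>fin_gset G X; fin_gset G Y; fin_gset G Y'; f \<in> gmap G X Y;
        h \<in> gmap G Y' Y; t \<in> carrier (tval T X)\<rbrakk>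
      \<Longrightarrow> tres T Y' Y h (ttr T X Y f t)
        = ttr T (gpb X f Y' h) Y' (gpb_snd X f Y' h)
            (tres T (gpb X f Y' h) X (gpb_fst X f Y' h) t)"
    and nm_base_change: "\<lbrakk>fin_gset G X; fin_gset G Y; fin_gset G Y'; f \<in> gmap G X Y;
        h \<in> gmap G Y' Y; t \<in> carrier (tval T X)\<rbrakk>
      \<Longrightarrow> tres T Y' Y h (tnm T X Y f t)
        = tnm T (gpb X f Y' h) Y' (gpb_snd X f Y' h)
            (tres T (gpb X f Y' h) X (gpb_fst X f Y' h) t)"
    and exponential: "\<lbrakk>fin_gset G A; fin_gset G X; fin_gset G Y; q \<in> gmap G A X; f \<in> gmap G X Y;
        t \<in> carrier (tval T A)\<rbrakk>
      \<Longrightarrow> tnm T X Y f (ttr T A X q t)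
        = ttr T (gdep A X Y q f) Y (gdep_proj A X Y q f)
            (tnm T (gdep_dom A X Y q f) (gdep A X Y q f) (gdep_snd A X Y q f)
              (tres T (gdep_dom A X Y q f) A (gdep_eval A X Y q f) t))"

definition tambara_map ::
    "('g, 'b) monoid_scheme \<Rightarrow> ('g, 'a) tambara \<Rightarrow> ('g, 'c) tambara
      \<Rightarrow> ('g gset \<Rightarrow> 'a \<Rightarrow> 'c) \<Rightarrow> bool" where
  "tambara_map G T S \<phi> \<longleftrightarrow>
    (\<forall>X. fin_gset G X \<longrightarrow> \<phi> X \<in> ring_hom (tval T X) (tval S X)) \<and>
    (\<forall>X Y f. fin_gset G X \<and> fin_gset G Y \<and> f \<in> gmap G X Y \<longrightarrow>
      (\<forall>t\<in>carrier (tval T Y). \<phi> X (tres T X Y f t) = tres S X Y f (\<phi> Y t)) \<and>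
      (\<forall>t\<in>carrier (tval T X). \<phi> Y (ttr T X Y f t) = ttr S X Y f (\<phi> X t)) \<and>
      (\<forall>t\<in>carrier (tval T X). \<phi> Y (tnm T X Y f t) = tnm S X Y f (\<phi> X t)))"

definition mult_cohomological :: "('g, 'b) monoid_scheme \<Rightarrow> ('g, 'a) tambara \<Rightarrow> bool" where
  "mult_cohomological G T \<longleftrightarrow>
    (\<forall>H K. subgroup H G \<and> subgroup K G \<and> H \<subseteq> K \<longrightarrow>
      (\<forall>t\<in>carrier (tval T (gorbit G K)).
        tnm T (gorbit G H) (gorbit G K) (orbit_proj G H K)
          (tres T (gorbit G H) (gorbit G K) (orbit_proj G H K) t)
        = t [^]\<^bsub>tval T (gorbit G K)\<^esub> card ((\<lambda>k. k <#\<^bsub>G\<^esub> H) ` K)))"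

text \<open>
  An ideal is recorded by its values on all finite $G$-sets; by additivity these are determined
  by the values on orbits. The family is extensional, so that ideals with the same values are
  equal. Letting the target of the map range over Tambara functors with values in the type of
  sets of elements of $T$ is no restriction: a kernel is also the kernel of the projection to the
  levelwise quotient, whose elements are cosets.
\<close>

definition tambara_ideal ::
    "('g, 'b) monoid_scheme \<Rightarrow> ('g, 'a) tambara \<Rightarrow> ('g gset \<Rightarrow> 'a set) \<Rightarrow> bool" where
  "tambara_ideal G T I \<longleftrightarrow>
    I \<in> extensional {X. fin_gset G X} \<and>
    (\<exists>(S :: ('g, 'a set) tambara) \<phi>. tambara_functor G S \<and> tambara_map G T S \<phi> \<and>
      (\<forall>X. fin_gset G X \<longrightarrow> I X = a_kernel (tval T X) (tval S X) (\<phi> X)))"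

definition proper_family ::
    "('g, 'b) monoid_scheme \<Rightarrow> ('g, 'a) tambara \<Rightarrow> ('g gset \<Rightarrow> 'a set) \<Rightarrow> bool" where
  "proper_family G T I \<longleftrightarrow> (\<exists>X. fin_gset G X \<and> I X \<noteq> carrier (tval T X))"

definition maximal_tambara_ideal ::
    "('g, 'b) monoid_scheme \<Rightarrow> ('g, 'a) tambara \<Rightarrow> ('g gset \<Rightarrow> 'a set) \<Rightarrow> bool" where
  "maximal_tambara_ideal G T I \<longleftrightarrow>
    tambara_ideal G T I \<and> proper_family G T I \<and>
    (\<forall>J. tambara_ideal G T J \<and> proper_family G T J \<and> (\<forall>X. fin_gset G X \<longrightarrow> I X \<subseteq> J X)
      \<longrightarrow> J = I)"

definition local_tambara :: "('g, 'b) monoid_scheme \<Rightarrow> ('g, 'a) tambara \<Rightarrow> bool" where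
  "local_tambara G T \<longleftrightarrow> (\<exists>!I. maximal_tambara_ideal G T I)"

text \<open>
  In the quotients below, an operation is applied to a coset by taking the union of the cosets of
  the results on its elements, as in \<^const>\<open>rcoset_mult\<close>; for ideals and submodules all these
  cosets coincide.
\<close>

definition tambara_quot ::
    "('g, 'a) tambara \<Rightarrow> ('g gset \<Rightarrow> 'a set) \<Rightarrow> ('g, 'a set) tambara" where
  "tambara_quot T I =
    \<lparr>tval = \<lambda>X. tval T X Quot I X,
     tres = \<lambda>X Y f C. (\<Union>c\<in>C. I X +>\<^bsub>tval T X\<^esub> tres T X Y f c),
     ttr = \<lambda>X Y f C. (\<Union>c\<in>C. I Y +>\<^bsub>tval T Y\<^esub> ttr T X Y f c),
     tnm = \<lambda>X Y f C. (\<Union>c\<in>C. I Y +>\<^bsub>tval T Y\<^esub> tnm T X Y f c)\<rparr>"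

definition tambara_mackey :: "('g, 'a) tambara \<Rightarrow> ('g, 'a) mackey" where
  "tambara_mackey T =
    \<lparr>mval = \<lambda>X. add_monoid (tval T X), mres = tres T, mtr = ttr T\<rparr>"

definition ideal_mackey :: "('g, 'a) tambara \<Rightarrow> ('g gset \<Rightarrow> 'a set) \<Rightarrow> ('g, 'a) mackey" where
  "ideal_mackey T I =
    \<lparr>mval = \<lambda>X. (add_monoid (tval T X))\<lparr>carrier := I X\<rparr>, mres = tres T, mtr = ttr T\<rparr>"


section \<open>Abelian groups by generators and relations\<close>

definition relations :: "'s set \<Rightarrow> ('s \<Rightarrow>\<^sub>0 int) set \<Rightarrow> ('s \<Rightarrow>\<^sub>0 int) set" where
  "relations S R = generate (free_Abelian_group S) R"

definition presented :: "'s set \<Rightarrow> ('s \<Rightarrow>\<^sub>0 int) set \<Rightarrow> ('s \<Rightarrow>\<^sub>0 int) set monoid" where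
  "presented S R = free_Abelian_group S Mod relations S R"

text \<open>The homomorphism into \<open>presented S R\<close> given by \<open>\<phi>\<close> on the generators.\<close>

definition presented_map ::
    "'s set \<Rightarrow> ('s \<Rightarrow>\<^sub>0 int) set \<Rightarrow> ('r \<Rightarrow> 's) \<Rightarrow> ('r \<Rightarrow>\<^sub>0 int) set \<Rightarrow> ('s \<Rightarrow>\<^sub>0 int) set" where
  "presented_map S R \<phi> C =
    (\<Union>c\<in>C. relations S R #>\<^bsub>free_Abelian_group S\<^esub> frag_extend (\<lambda>x. frag_of (\<phi> x)) c)"

text \<open>The homomorphism into an abelian group \<open>A\<close> given by \<open>\<phi>\<close> on the generators.\<close>

definition presented_lift ::
    "('a, 'z) monoid_scheme \<Rightarrow> ('r \<Rightarrow> 'a) \<Rightarrow> ('r \<Rightarrow>\<^sub>0 int) set \<Rightarrow> 'a" where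
  "presented_lift A \<phi> C =
    (THE a. \<exists>c\<in>C. a = finprod A (\<lambda>x. \<phi> x [^]\<^bsub>A\<^esub> Poly_Mapping.lookup c x) (Poly_Mapping.keys c))"


section \<open>Representable Mackey functors\<close>

text \<open>
  \<open>A\<^sub>X(Y)\<close> is the group completion of the monoid, under disjoint union, of isomorphism classes of
  spans \<open>Y \<leftarrow> Z \<rightarrow> X\<close>; the element \<open>n\<close> of \<open>M(X)\<close> corresponds to the map \<open>A\<^sub>X \<rightarrow> M\<close> that sends the
  class of a span \<open>(Z, a, b)\<close> to \<open>a\<^sub>+ b\<^sup>* n\<close>.
\<close>

type_synonym 'g span = "'g gset \<times> 'g hfmap \<times> 'g hfmap"

definition spans :: "('g, 'b) monoid_scheme \<Rightarrow> 'g gset \<Rightarrow> 'g gset \<Rightarrow> 'g span set" where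
  "spans G Y X = {(Z, a, b). fin_gset G Z \<and> a \<in> gmap G Z Y \<and> b \<in> gmap G Z X}"

inductive_set span_rels ::
    "('g, 'b) monoid_scheme \<Rightarrow> 'g gset \<Rightarrow> 'g gset \<Rightarrow> ('g span \<Rightarrow>\<^sub>0 int) set"
  for G :: "('g, 'b) monoid_scheme" and Y X :: "'g gset" where
  iso: "\<lbrakk>(Z', a, b) \<in> spans G Y X; fin_gset G Z; h \<in> gmap G Z Z'; bij_betw h (pts Z) (pts Z')\<rbrakk>
    \<Longrightarrow> frag_of (Z, gcomp Z a h, gcomp Z b h) - frag_of (Z', a, b) \<in> span_rels G Y X"
| sum: "\<lbrakk>(Z, a, b) \<in> spans G Y X; (Z', a', b') \<in> spans G Y X\<rbrakk>
    \<Longrightarrow> frag_of (gsum Z Z', gcopair Z Z' a a', gcopair Z Z' b b')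
          - frag_of (Z, a, b) - frag_of (Z', a', b') \<in> span_rels G Y X"

definition representable ::
    "('g, 'b) monoid_scheme \<Rightarrow> 'g gset \<Rightarrow> ('g, ('g span \<Rightarrow>\<^sub>0 int) set) mackey" where
  "representable G X =
    \<lparr>mval = \<lambda>Y. presented (spans G Y X) (span_rels G Y X),
     mres = \<lambda>Y Y' f. presented_map (spans G Y X) (span_rels G Y X)
       (\<lambda>(Z, a, b). (gpb Z a Y f, gpb_snd Z a Y f,
                     gcomp (gpb Z a Y f) b (gpb_fst Z a Y f))),
     mtr = \<lambda>Y Y' f. presented_map (spans G Y' X) (span_rels G Y' X)
       (\<lambda>(Z, a, b). (Z, gcomp Z f a, b))\<rparr>"


section \<open>The box product\<close>

text \<open>
  The coend for Day convolution: \<open>(M \<box> N)(X)\<close> is generated by symbols \<open>(Y, f, m, n)\<close> with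
  \<open>f: Y \<rightarrow> X\<close>, \<open>m \<in> M(Y)\<close> and \<open>n \<in> N(Y)\<close>, standing for \<open>f\<^sub>+(m \<cdot> n)\<close>, subject to bilinearity and
  Frobenius reciprocity. The universal pairing sends \<open>(m, n)\<close> to the class of \<open>(X, id, m, n)\<close>.
\<close>

type_synonym ('g, 'm, 'n) box_gen = "'g gset \<times> 'g hfmap \<times> 'm \<times> 'n"

definition box_gens ::
    "('g, 'b) monoid_scheme \<Rightarrow> ('g, 'm, 'y) mackey_scheme \<Rightarrow> ('g, 'n, 'z) mackey_scheme
      \<Rightarrow> 'g gset \<Rightarrow> ('g, 'm, 'n) box_gen set" where
  "box_gens G M N X =
    {(Y, f, m, n). fin_gset G Y \<and> f \<in> gmap G Y X \<and> m \<in> carrier (mval M Y) \<and> n \<in> carrier (mval N Y)}"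

inductive_set box_rels ::
    "('g, 'b) monoid_scheme \<Rightarrow> ('g, 'm, 'y) mackey_scheme \<Rightarrow> ('g, 'n, 'z) mackey_scheme
      \<Rightarrow> 'g gset \<Rightarrow> (('g, 'm, 'n) box_gen \<Rightarrow>\<^sub>0 int) set"
  for G :: "('g, 'b) monoid_scheme"
    and M :: "('g, 'm, 'y) mackey_scheme" and N :: "('g, 'n, 'z) mackey_scheme"
    and X :: "'g gset" where
  add_left: "\<lbrakk>(Y, f, m, n) \<in> box_gens G M N X; m' \<in> carrier (mval M Y)\<rbrakk>
    \<Longrightarrow> frag_of (Y, f, m \<otimes>\<^bsub>mval M Y\<^esub> m', n) - frag_of (Y, f, m, n) - frag_of (Y, f, m', n)
          \<in> box_rels G M N X"
| add_right: "\<lbrakk>(Y, f, m, n) \<in> box_gens G M N X; n' \<in> carrier (mval N Y)\<rbrakk>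
    \<Longrightarrow> frag_of (Y, f, m, n \<otimes>\<^bsub>mval N Y\<^esub> n') - frag_of (Y, f, m, n) - frag_of (Y, f, m, n')
          \<in> box_rels G M N X"
| frobenius_left: "\<lbrakk>fin_gset G Y; fin_gset G Y'; h \<in> gmap G Y Y'; f \<in> gmap G Y' X;
      m \<in> carrier (mval M Y); n \<in> carrier (mval N Y')\<rbrakk>
    \<Longrightarrow> frag_of (Y, gcomp Y f h, m, mres N Y Y' h n) - frag_of (Y', f, mtr M Y Y' h m, n)
          \<in> box_rels G M N X"
| frobenius_right: "\<lbrakk>fin_gset G Y; fin_gset G Y'; h \<in> gmap G Y Y'; f \<in> gmap G Y' X;
      m \<in> carrier (mval M Y'); n \<in> carrier (mval N Y)\<rbrakk>
    \<Longrightarrow> frag_of (Y, gcomp Y f h, mres M Y Y' h m, n) - frag_of (Y', f, m, mtr N Y Y' h n)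
          \<in> box_rels G M N X"

definition box ::
    "('g, 'b) monoid_scheme \<Rightarrow> ('g, 'm, 'y) mackey_scheme \<Rightarrow> ('g, 'n, 'z) mackey_scheme
      \<Rightarrow> ('g, (('g, 'm, 'n) box_gen \<Rightarrow>\<^sub>0 int) set) mackey" where
  "box G M N =
    \<lparr>mval = \<lambda>X. presented (box_gens G M N X) (box_rels G M N X),
     mres = \<lambda>X X' f. presented_map (box_gens G M N X) (box_rels G M N X)
       (\<lambda>(Y, h, m, n). (gpb Y h X f, gpb_snd Y h X f,
          mres M (gpb Y h X f) Y (gpb_fst Y h X f) m,
          mres N (gpb Y h X f) Y (gpb_fst Y h X f) n)),
     mtr = \<lambda>X X' f. presented_map (box_gens G M N X') (box_rels G M N X')
       (\<lambda>(Y, h, m, n). (Y, gcomp Y f h, m, n))\<rparr>"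

text \<open>The map \<open>M \<box> N \<rightarrow> P\<close> that corresponds to a family of bilinear maps \<open>\<mu>\<close>.\<close>

definition box_lift ::
    "('g, 'p, 'x) mackey_scheme \<Rightarrow> ('g gset \<Rightarrow> 'm \<Rightarrow> 'n \<Rightarrow> 'p)
      \<Rightarrow> 'g gset \<Rightarrow> (('g, 'm, 'n) box_gen \<Rightarrow>\<^sub>0 int) set \<Rightarrow> 'p" where
  "box_lift P \<mu> X = presented_lift (mval P X) (\<lambda>(Y, f, m, n). mtr P Y X f (\<mu> Y m n))"


section \<open>Modules\<close>

record ('g, 't, 'm) tmodule = "('g, 'm) mackey" +
  mact :: "'g gset \<Rightarrow> 't \<Rightarrow> 'm \<Rightarrow> 'm"

text \<open>The action \<open>T \<box> M \<rightarrow> M\<close> is given by the corresponding family of bilinear maps.\<close>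

locale tambara_module = mackey_functor G M
  for G :: "('g, 'b) monoid_scheme" and T :: "('g, 't) tambara" and M :: "('g, 't, 'm) tmodule" +
  assumes act_closed: "\<lbrakk>fin_gset G X; t \<in> carrier (tval T X); m \<in> carrier (mval M X)\<rbrakk>
      \<Longrightarrow> mact M X t m \<in> carrier (mval M X)"
    and act_add_left: "\<lbrakk>fin_gset G X; s \<in> carrier (tval T X); t \<in> carrier (tval T X);
        m \<in> carrier (mval M X)\<rbrakk>
      \<Longrightarrow> mact M X (s \<oplus>\<^bsub>tval T X\<^esub> t) m = mact M X s m \<otimes>\<^bsub>mval M X\<^esub> mact M X t m"
    and act_add_right: "\<lbrakk>fin_gset G X; t \<in> carrier (tval T X); m \<in> carrier (mval M X);
        n \<in> carrier (mval M X)\<rbrakk>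
      \<Longrightarrow> mact M X t (m \<otimes>\<^bsub>mval M X\<^esub> n) = mact M X t m \<otimes>\<^bsub>mval M X\<^esub> mact M X t n"
    and act_res: "\<lbrakk>fin_gset G X; fin_gset G Y; f \<in> gmap G X Y; t \<in> carrier (tval T Y);
        m \<in> carrier (mval M Y)\<rbrakk>
      \<Longrightarrow> mres M X Y f (mact M Y t m) = mact M X (tres T X Y f t) (mres M X Y f m)"
    and act_tr_left: "\<lbrakk>fin_gset G X; fin_gset G Y; f \<in> gmap G X Y; t \<in> carrier (tval T X);
        m \<in> carrier (mval M Y)\<rbrakk>
      \<Longrightarrow> mtr M X Y f (mact M X t (mres M X Y f m)) = mact M Y (ttr T X Y f t) m"
    and act_tr_right: "\<lbrakk>fin_gset G X; fin_gset G Y; f \<in> gmap G X Y; t \<in> carrier (tval T Y);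
        m \<in> carrier (mval M X)\<rbrakk>
      \<Longrightarrow> mtr M X Y f (mact M X (tres T X Y f t) m) = mact M Y t (mtr M X Y f m)"
    and act_one: "\<lbrakk>fin_gset G X; m \<in> carrier (mval M X)\<rbrakk>
      \<Longrightarrow> mact M X \<one>\<^bsub>tval T X\<^esub> m = m"
    and act_assoc: "\<lbrakk>fin_gset G X; s \<in> carrier (tval T X); t \<in> carrier (tval T X);
        m \<in> carrier (mval M X)\<rbrakk>
      \<Longrightarrow> mact M X (s \<otimes>\<^bsub>tval T X\<^esub> t) m = mact M X s (mact M X t m)"

definition tmodule_map ::
    "('g, 'b) monoid_scheme \<Rightarrow> ('g, 't) tambara \<Rightarrow> ('g, 't, 'm) tmodule \<Rightarrow> ('g, 't, 'n) tmodule
      \<Rightarrow> ('g gset \<Rightarrow> 'm \<Rightarrow> 'n) \<Rightarrow> bool" where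
  "tmodule_map G T M N \<phi> \<longleftrightarrow>
    (\<forall>X. fin_gset G X \<longrightarrow> \<phi> X \<in> hom (mval M X) (mval N X)) \<and>
    (\<forall>X Y f. fin_gset G X \<and> fin_gset G Y \<and> f \<in> gmap G X Y \<longrightarrow>
      (\<forall>m\<in>carrier (mval M Y). \<phi> X (mres M X Y f m) = mres N X Y f (\<phi> Y m)) \<and>
      (\<forall>m\<in>carrier (mval M X). \<phi> Y (mtr M X Y f m) = mtr N X Y f (\<phi> X m))) \<and>
    (\<forall>X. fin_gset G X \<longrightarrow> (\<forall>t\<in>carrier (tval T X). \<forall>m\<in>carrier (mval M X).
      \<phi> X (mact M X t m) = mact N X t (\<phi> X m)))"

definition tmodule_epi ::
    "('g, 'b) monoid_scheme \<Rightarrow> ('g, 't) tambara \<Rightarrow> ('g, 't, 'm) tmodule \<Rightarrow> ('g, 't, 'n) tmodule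
      \<Rightarrow> ('g gset \<Rightarrow> 'm \<Rightarrow> 'n) \<Rightarrow> bool" where
  "tmodule_epi G T M N \<phi> \<longleftrightarrow> tmodule_map G T M N \<phi> \<and>
    (\<forall>X. fin_gset G X \<longrightarrow> \<phi> X ` carrier (mval M X) = carrier (mval N X))"

definition tmodule_iso ::
    "('g, 'b) monoid_scheme \<Rightarrow> ('g, 't) tambara \<Rightarrow> ('g, 't, 'm) tmodule \<Rightarrow> ('g, 't, 'n) tmodule
      \<Rightarrow> ('g gset \<Rightarrow> 'm \<Rightarrow> 'n) \<Rightarrow> bool" where
  "tmodule_iso G T M N \<phi> \<longleftrightarrow> tmodule_map G T M N \<phi> \<and>
    (\<forall>X. fin_gset G X \<longrightarrow> bij_betw (\<phi> X) (carrier (mval M X)) (carrier (mval N X)))"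

text \<open>
  The module \<open>T\<^sub>X = T \<box> A\<^sub>X\<close>; by Frobenius reciprocity, multiplication by \<open>t\<close> sends
  \<open>f\<^sub>+(s \<cdot> a)\<close> to \<open>f\<^sub>+((f\<^sup>* t) s \<cdot> a)\<close>.
\<close>

type_synonym ('g, 't) free_elem =
  "(('g, 't, ('g span \<Rightarrow>\<^sub>0 int) set) box_gen \<Rightarrow>\<^sub>0 int) set"

definition free_tmodule ::
    "('g, 'b) monoid_scheme \<Rightarrow> ('g, 't) tambara \<Rightarrow> 'g gset
      \<Rightarrow> ('g, 't, ('g, 't) free_elem) tmodule" where
  "free_tmodule G T X =
    (let T\<^sub>0 = tambara_mackey T; A = representable G X; B = box G T\<^sub>0 A in
     \<lparr>mval = mval B, mres = mres B, mtr = mtr B,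
      mact = \<lambda>Y t. presented_map (box_gens G T\<^sub>0 A Y) (box_rels G T\<^sub>0 A Y)
        (\<lambda>(Z, f, s, a). (Z, f, tres T Z Y f t \<otimes>\<^bsub>tval T Z\<^esub> s, a))\<rparr>)"

definition is_free ::
    "('g, 'b) monoid_scheme \<Rightarrow> ('g, 't) tambara \<Rightarrow> ('g, 't, 'm) tmodule \<Rightarrow> bool" where
  "is_free G T M \<longleftrightarrow> (\<exists>X \<phi>. fin_gset G X \<and> tmodule_iso G T (free_tmodule G T X) M \<phi>)"

definition is_fin_gen ::
    "('g, 'b) monoid_scheme \<Rightarrow> ('g, 't) tambara \<Rightarrow> ('g, 't, 'm) tmodule \<Rightarrow> bool" where
  "is_fin_gen G T M \<longleftrightarrow> (\<exists>X \<phi>. fin_gset G X \<and> tmodule_epi G T (free_tmodule G T X) M \<phi>)"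

text \<open>
  HOL cannot quantify over all types inside a formula, so the lifting problems range over modules
  with values in one type, which is large enough for this to be projectivity: it has room for the
  values of \<open>P\<close> itself and of a direct sum of modules \<open>T\<^sub>X\<close> that surjects onto \<open>P\<close>, and \<open>P\<close> is
  projective as soon as such a surjection splits. Epimorphisms of modules are the levelwise
  surjective maps.
\<close>

type_synonym ('g, 't, 'p) test_elem = "('p \<times> ('g, 't) free_elem) list"

definition is_projective ::
    "('g, 'b) monoid_scheme \<Rightarrow> ('g, 't) tambara \<Rightarrow> ('g, 't, 'p) tmodule \<Rightarrow> bool" where
  "is_projective G T P \<longleftrightarrow>
    (\<forall>(M :: ('g, 't, ('g, 't, 'p) test_elem) tmodule) (N :: ('g, 't, ('g, 't, 'p) test_elem) tmodule)
        \<epsilon> \<phi>. tambara_module G T M \<and> tambara_module G T N \<and> tmodule_epi G T M N \<epsilon> \<and>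
        tmodule_map G T P N \<phi> \<longrightarrow>
      (\<exists>\<psi>. tmodule_map G T P M \<psi> \<and>
        (\<forall>X. fin_gset G X \<longrightarrow> (\<forall>p\<in>carrier (mval P X). \<epsilon> X (\<psi> X p) = \<phi> X p))))"

text \<open>The image of \<open>I \<box> M \<rightarrow> T \<box> M \<rightarrow> M\<close>.\<close>

definition ideal_mult ::
    "('g, 'b) monoid_scheme \<Rightarrow> ('g, 't) tambara \<Rightarrow> ('g gset \<Rightarrow> 't set) \<Rightarrow> ('g, 't, 'm) tmodule
      \<Rightarrow> 'g gset \<Rightarrow> 'm set" where
  "ideal_mult G T I M X =
    box_lift M (mact M) X ` carrier (mval (box G (ideal_mackey T I) M) X)"

definition tmodule_quot ::
    "('g, 't, 'm) tmodule \<Rightarrow> ('g gset \<Rightarrow> 'm set) \<Rightarrow> ('g, 't set, 'm set) tmodule" where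
  "tmodule_quot M N =
    \<lparr>mval = \<lambda>X. mval M X Mod N X,
     mres = \<lambda>X Y f C. (\<Union>c\<in>C. N X #>\<^bsub>mval M X\<^esub> mres M X Y f c),
     mtr = \<lambda>X Y f C. (\<Union>c\<in>C. N Y #>\<^bsub>mval M Y\<^esub> mtr M X Y f c),
     mact = \<lambda>X B C. (\<Union>b\<in>B. \<Union>c\<in>C. N X #>\<^bsub>mval M X\<^esub> mact M X b c)\<rparr>"

end

theory Submission
  imports Defs "HOL-Algebra.Ring_Divisibility"
begin

text \<open>
  Every proper $G$-invariant ideal of \<open>T(G/e)\<close> is the value of a proper Tambara ideal, hence lies
  in \<open>\<mm>(G/e)\<close> because \<open>T\<close> is local. Applied to the norm of \<open>1 - a\<close> with \<open>a \<in> \<mm>(G/e)\<close>, this shows that \<open>1 - a\<close> is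
  a unit. As \<open>nm res b\<close> is a power of \<open>b\<close>, units of \<open>T(G/H)\<close> are detected in \<open>T(G/e)\<close>, so \<open>\<mm>(G/H)\<close>
  lies in the Jacobson radical of \<open>T(G/H)\<close> for all \<open>H\<close>. An induction on the size of orbits turns
  this into Nakayama's lemma for submodules of \<open>T\<^sub>W(Y) = T(Y \<times> W)\<close>.

  An isomorphism \<open>(T/\<mm>)\<^sub>W \<rightarrow> P/\<mm>P\<close> is given by an element of \<open>(P/\<mm>P)(W)\<close>. A lift of it to \<open>P(W)\<close>
  gives \<open>\<phi>: T\<^sub>W \<rightarrow> P\<close>, which is surjective by Nakayama's lemma for a free module that covers \<open>P\<close>.
  Since \<open>P\<close> is projective, \<open>\<phi>\<close> has a section \<open>\<sigma>\<close>, and \<open>\<sigma> \<phi>\<close> is the identity modulo \<open>\<mm>\<close>, hence the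
  identity by Nakayama's lemma applied to its fixed points.
\<close>

section \<open>Finite G-sets\<close>

text \<open>The value at \<open>Y\<close> of \<open>\<mm>\<close> times a module contains transfers
  from all orbits that map to \<open>Y\<close>. It may be larger than \<open>\<mm> Y\<close> times
  the value at \<open>Y\<close>, so the classical lemma of Nakayama cannot be applied level by
  level. Orbits are therefore treated in order of decreasing size, down from \<open>G/e\<close>. A
  map of transitive G-sets is onto, so an orbit over a transitive \<open>Y\<close> is either
  strictly larger, and its transfers are in the submodule by induction, or isomorphic to
  \<open>Y\<close>. Modulo the submodule, \<open>T(Y \<times> W)\<close> is thus spanned over
  \<open>T(Y)\<close> by the finitely many transfers of 1 along graphs of maps from \<open>Y\<close>
  to \<open>W\<close>, and elements of \<open>\<mm>(Y \<times> W)\<close> need only coefficients in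
  \<open>\<mm> Y\<close>. There the ring-theoretic lemma works, since \<open>1 - a\<close> is a unit
  for \<open>a\<close> in \<open>\<mm> Y\<close>. Working with submodules of a free module instead
  of quotients of \<open>P\<close> has the effect that only subsets of the rings
  \<open>T(Y \<times> W)\<close> occur. The free modules of the statement are box products given by
  generators and relations; a large part of the proof identifies them with
  \<open>Y \<mapsto> T(Y \<times> W)\<close>.\<close>

lemma gcomp_apply [simp]: "x \<in> pts X \<Longrightarrow> gcomp X h f x = h (f x)"
  by (simp add: gcomp_def compose_def)

lemma gid_apply [simp]: "x \<in> pts X \<Longrightarrow> gid X x = x"
  by (simp add: gid_def)

lemma gmap_closed: "f \<in> gmap G X Y \<Longrightarrow> x \<in> pts X \<Longrightarrow> f x \<in> pts Y"
  by (auto simp: gmap_def)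

lemma gmap_equiv:
  "f \<in> gmap G X Y \<Longrightarrow> g \<in> carrier G \<Longrightarrow> x \<in> pts X \<Longrightarrow> f (action X g x) = action Y g (f x)"
  by (auto simp: gmap_def)

lemma gmap_eqI:
  "f \<in> gmap G X Y \<Longrightarrow> h \<in> gmap G X Y' \<Longrightarrow> (\<And>x. x \<in> pts X \<Longrightarrow> f x = h x) \<Longrightarrow> f = h"
  by (rule extensionalityI[of f "pts X"]) (auto simp: gmap_def PiE_def)

lemma gmapI:
  assumes "f \<in> extensional (pts X)" "\<And>x. x \<in> pts X \<Longrightarrow> f x \<in> pts Y"
    "\<And>g x. g \<in> carrier G \<Longrightarrow> x \<in> pts X \<Longrightarrow> f (action X g x) = action Y g (f x)"
  shows "f \<in> gmap G X Y"
  using assms by (auto simp: gmap_def PiE_def)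

section \<open>Products, stable subsets, orbits, coverings and fibre products of G-sets\<close>

definition gprod :: "'g gset \<Rightarrow> 'g gset \<Rightarrow> 'g gset" where
  "gprod X Y =
    \<lparr>pts = {HPair x y | x y. x \<in> pts X \<and> y \<in> pts Y},
     action = \<lambda>g. \<lambda>p\<in>{HPair x y | x y. x \<in> pts X \<and> y \<in> pts Y}.
       HPair (action X g (hfst p)) (action Y g (hsnd p))\<rparr>"

definition gfst :: "'g gset \<Rightarrow> 'g gset \<Rightarrow> 'g hfmap" where
  "gfst X Y = (\<lambda>p\<in>pts (gprod X Y). hfst p)"

definition gsnd :: "'g gset \<Rightarrow> 'g gset \<Rightarrow> 'g hfmap" where
  "gsnd X Y = (\<lambda>p\<in>pts (gprod X Y). hsnd p)"

definition gpair :: "'g gset \<Rightarrow> 'g hfmap \<Rightarrow> 'g hfmap \<Rightarrow> 'g hfmap" where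
  "gpair Z a b = (\<lambda>z\<in>pts Z. HPair (a z) (b z))"

definition gtimes :: "'g gset \<Rightarrow> 'g gset \<Rightarrow> 'g hfmap \<Rightarrow> 'g hfmap" where
  "gtimes X W f = (\<lambda>p\<in>pts (gprod X W). HPair (f (hfst p)) (hsnd p))"

definition gsub :: "'g gset \<Rightarrow> 'g hf set \<Rightarrow> 'g gset" where
  "gsub X S = \<lparr>pts = S, action = \<lambda>g. restrict (action X g) S\<rparr>"

definition ginc :: "'g hf set \<Rightarrow> 'g hfmap" where
  "ginc S = (\<lambda>x\<in>S. x)"

lemma ginc_apply [simp]: "x \<in> S \<Longrightarrow> ginc S x = x"
  by (simp add: ginc_def)

lemma pts_gsub [simp]: "pts (gsub X S) = S"
  by (simp add: gsub_def)

lemma action_gsub [simp]: "x \<in> S \<Longrightarrow> action (gsub X S) g x = action X g x"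
  by (simp add: gsub_def)

definition gstable :: "('g, 'b) monoid_scheme \<Rightarrow> 'g gset \<Rightarrow> 'g hf set \<Rightarrow> bool" where
  "gstable G X S \<longleftrightarrow> S \<subseteq> pts X \<and> (\<forall>g\<in>carrier G. \<forall>x\<in>S. action X g x \<in> S)"

definition gtransitive :: "('g, 'b) monoid_scheme \<Rightarrow> 'g gset \<Rightarrow> bool" where
  "gtransitive G X \<longleftrightarrow> pts X \<noteq> {} \<and>
    (\<forall>x\<in>pts X. \<forall>y\<in>pts X. \<exists>g\<in>carrier G. action X g x = y)"

text \<open>The map that sends the coset \<open>aH\<close> to \<open>a x\<close>. Any element of the
  coset may serve as \<open>a\<close> once \<open>H\<close> fixes \<open>x\<close>.\<close>

definition gorbit_map :: "('g, 'b) monoid_scheme \<Rightarrow> 'g gset \<Rightarrow> 'g set \<Rightarrow> 'g hf \<Rightarrow> 'g hfmap" where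
  "gorbit_map G X H x = (\<lambda>z\<in>orbit_pts G H. action X (SOME a. a \<in> carrier G \<and> a \<in> helems z) x)"

text \<open>\<open>X\<close> as an internal disjoint union. This covers both the literal sums
  \<open>gsum\<close> and the splitting of a G-set into a stable subset and its complement.\<close>

definition gcover :: "('g, 'b) monoid_scheme \<Rightarrow> 'g gset \<Rightarrow> 'g gset \<Rightarrow> 'g gset \<Rightarrow> 'g hfmap \<Rightarrow> 'g hfmap \<Rightarrow> bool"
  where
  "gcover G X\<^sub>1 X\<^sub>2 X u\<^sub>1 u\<^sub>2 \<longleftrightarrow> fin_gset G X\<^sub>1 \<and> fin_gset G X\<^sub>2 \<and> fin_gset G X \<and>
    u\<^sub>1 \<in> gmap G X\<^sub>1 X \<and> u\<^sub>2 \<in> gmap G X\<^sub>2 X \<and> inj_on u\<^sub>1 (pts X\<^sub>1) \<and> inj_on u\<^sub>2 (pts X\<^sub>2) \<and>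
    u\<^sub>1 ` pts X\<^sub>1 \<inter> u\<^sub>2 ` pts X\<^sub>2 = {} \<and> u\<^sub>1 ` pts X\<^sub>1 \<union> u\<^sub>2 ` pts X\<^sub>2 = pts X"

text \<open>\<open>X'\<close> is, via \<open>f'\<close> and \<open>g'\<close>, a fibre product of \<open>f: X \<rightarrow> Y\<close> and \<open>h: Y' \<rightarrow> Y\<close>.\<close>

definition gpullback ::
    "('g, 'b) monoid_scheme \<Rightarrow> 'g gset \<Rightarrow> 'g gset \<Rightarrow> 'g gset \<Rightarrow> 'g gset
      \<Rightarrow> 'g hfmap \<Rightarrow> 'g hfmap \<Rightarrow> 'g hfmap \<Rightarrow> 'g hfmap \<Rightarrow> bool" where
  "gpullback G X' X Y' Y f h f' g' \<longleftrightarrow>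
    fin_gset G X' \<and> fin_gset G X \<and> fin_gset G Y' \<and> fin_gset G Y \<and>
    f \<in> gmap G X Y \<and> h \<in> gmap G Y' Y \<and> f' \<in> gmap G X' Y' \<and> g' \<in> gmap G X' X \<and>
    bij_betw (\<lambda>x. HPair (g' x) (f' x)) (pts X') (gpb_pts X f Y' h)"

context group
begin

text \<open>A \<open>group_action\<close> is a homomorphism into the group of extensional bijections
  of \<open>pts X\<close>. The action of \<open>inv g\<close> inverts that of \<open>g\<close>, so
  the pointwise laws together with extensionality suffice.\<close>

lemma fin_gsetI:
  assumes fin: "finite (pts X)"
    and ext: "\<And>g. g \<in> carrier G \<Longrightarrow> action X g \<in> extensional (pts X)"
    and closed: "\<And>g x. g \<in> carrier G \<Longrightarrow> x \<in> pts X \<Longrightarrow> action X g x \<in> pts X"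
    and one: "\<And>x. x \<in> pts X \<Longrightarrow> action X \<one> x = x"
    and mult: "\<And>g h x. g \<in> carrier G \<Longrightarrow> h \<in> carrier G \<Longrightarrow> x \<in> pts X
      \<Longrightarrow> action X (g \<otimes> h) x = action X g (action X h x)"
  shows "fin_gset G X"
proof -
  have bij: "action X g \<in> Bij (pts X)" if "g \<in> carrier G" for g
  proof -
    have "bij_betw (action X g) (pts X) (pts X)"
      by (rule bij_betw_byWitness[of _ "action X (inv g)"])
        (use that closed one mult[of "inv g" g] mult[of g "inv g"] in auto)
    then show ?thesis using ext[OF that] by (simp add: Bij_def)
  qed
  have "action X \<in> hom G (BijGroup (pts X))"
  proof (rule homI)
    fix g h assume gh: "g \<in> carrier G" "h \<in> carrier G"
    show "action X (g \<otimes> h) = action X g \<otimes>\<^bsub>BijGroup (pts X)\<^esub> action X h"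
      using gh bij ext mult
      by (auto simp: BijGroup_def compose_def fun_eq_iff extensional_def)
  qed (use bij in \<open>simp add: BijGroup_def\<close>)
  then show ?thesis
    using fin group_BijGroup is_group
    by (simp add: fin_gset_def group_action_def group_hom_def group_hom_axioms_def)
qed

lemma fin_gset_finite: "fin_gset G X \<Longrightarrow> finite (pts X)"
  by (simp add: fin_gset_def)

lemma act_closed: "fin_gset G X \<Longrightarrow> g \<in> carrier G \<Longrightarrow> x \<in> pts X \<Longrightarrow> action X g x \<in> pts X"
  by (auto simp: fin_gset_def group_action_def group_hom_def group_hom_axioms_def hom_def
      BijGroup_def Bij_def bij_betw_def)

lemma act_one: "fin_gset G X \<Longrightarrow> x \<in> pts X \<Longrightarrow> action X \<one> x = x"
  unfolding fin_gset_def by (metis group_action.id_eq_one restrict_apply')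

lemma act_mult:
  "fin_gset G X \<Longrightarrow> g \<in> carrier G \<Longrightarrow> h \<in> carrier G \<Longrightarrow> x \<in> pts X
    \<Longrightarrow> action X (g \<otimes> h) x = action X g (action X h x)"
  unfolding fin_gset_def by (metis group_action.composition_rule)

lemma act_inv_left:
  "fin_gset G X \<Longrightarrow> g \<in> carrier G \<Longrightarrow> x \<in> pts X \<Longrightarrow> action X (inv g) (action X g x) = x"
  by (metis act_mult act_one inv_closed l_inv)

lemma act_inv_right:
  "fin_gset G X \<Longrightarrow> g \<in> carrier G \<Longrightarrow> x \<in> pts X \<Longrightarrow> action X g (action X (inv g) x) = x"
  by (metis act_mult act_one inv_closed r_inv)

lemma gid_gmap: "fin_gset G X \<Longrightarrow> gid X \<in> gmap G X X"
  by (rule gmapI) (auto simp: gid_def act_closed)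

lemma gcomp_gmap: "f \<in> gmap G X Y \<Longrightarrow> h \<in> gmap G Y Z \<Longrightarrow> fin_gset G X \<Longrightarrow> gcomp X h f \<in> gmap G X Z"
  by (rule gmapI) (auto simp: gcomp_def compose_def act_closed gmap_closed gmap_equiv)

lemma finite_gmap: "fin_gset G X \<Longrightarrow> fin_gset G Y \<Longrightarrow> finite (gmap G X Y)"
  by (rule finite_subset[of _ "pts X \<rightarrow>\<^sub>E pts Y"])
    (auto simp: gmap_def fin_gset_finite intro: finite_PiE)

lemma gmap_inverse:
  assumes X: "fin_gset G X" and f: "f \<in> gmap G X Y" and bij: "bij_betw f (pts X) (pts Y)"
  obtains h where "h \<in> gmap G Y X" "gcomp X h f = gid X" "gcomp Y f h = gid Y"
    "bij_betw h (pts Y) (pts X)"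
proof
  let ?h = "\<lambda>y\<in>pts Y. inv_into (pts X) f y"
  have closed: "y \<in> pts Y \<Longrightarrow> inv_into (pts X) f y \<in> pts X" for y
    using bij by (metis bij_betw_imp_surj_on inv_into_into)
  have f_inv: "y \<in> pts Y \<Longrightarrow> f (inv_into (pts X) f y) = y" for y
    using bij by (metis bij_betw_inv_into_right)
  have inv_f: "x \<in> pts X \<Longrightarrow> inv_into (pts X) f (f x) = x" for x
    using bij by (metis bij_betw_inv_into_left)
  have eq: "action Y g y = f (action X g (inv_into (pts X) f y))"
    if "g \<in> carrier G" "y \<in> pts Y" for g y
    using that closed f_inv gmap_equiv[OF f] by metis
  show h: "?h \<in> gmap G Y X"
  proof (rule gmapI)
    fix g y assume gy: "g \<in> carrier G" "y \<in> pts Y"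
    have "action Y g y \<in> pts Y" using eq[OF gy] gmap_closed[OF f] act_closed[OF X] closed gy by simp
    then show "?h (action Y g y) = action X g (?h y)"
      using gy eq[OF gy] inv_f act_closed[OF X] closed by simp
  qed (use closed in auto)
  show "gcomp X ?h f = gid X"
    using inv_f gmap_closed[OF f] by (auto simp: gcomp_def compose_def gid_def fun_eq_iff)
  show "gcomp Y f ?h = gid Y"
    using f_inv closed by (auto simp: gcomp_def compose_def gid_def fun_eq_iff)
  show "bij_betw ?h (pts Y) (pts X)"
    by (rule bij_betw_byWitness[of _ f]) (use f_inv inv_f closed gmap_closed[OF f] in auto)
qed

lemma pts_gsum: "pts (gsum X Y) = HInl ` pts X \<union> HInr ` pts Y"
  by (simp add: gsum_def)

lemma action_gsum [simp]:
  "x \<in> pts X \<Longrightarrow> action (gsum X Y) g (HInl x) = HInl (action X g x)"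
  "y \<in> pts Y \<Longrightarrow> action (gsum X Y) g (HInr y) = HInr (action Y g y)"
  by (auto simp: gsum_def)

lemma fin_gset_gsum: "fin_gset G X \<Longrightarrow> fin_gset G Y \<Longrightarrow> fin_gset G (gsum X Y)"
proof (rule fin_gsetI)
  show "action (gsum X Y) g \<in> extensional (pts (gsum X Y))" for g
    by (simp add: gsum_def)
qed (auto simp: pts_gsum fin_gset_finite act_closed act_one act_mult)

lemma ginl_apply [simp]: "x \<in> pts X \<Longrightarrow> ginl X x = HInl x"
  by (simp add: ginl_def)

lemma ginr_apply [simp]: "x \<in> pts X \<Longrightarrow> ginr X x = HInr x"
  by (simp add: ginr_def)

lemma ginl_gmap: "fin_gset G X \<Longrightarrow> ginl X \<in> gmap G X (gsum X Y)"
  by (rule gmapI) (auto simp: ginl_def pts_gsum act_closed)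

lemma ginr_gmap: "fin_gset G Y \<Longrightarrow> ginr Y \<in> gmap G Y (gsum X Y)"
  by (rule gmapI) (auto simp: ginr_def pts_gsum act_closed)

lemma gcopair_apply [simp]:
  "x \<in> pts X \<Longrightarrow> gcopair X Y a b (HInl x) = a x"
  "y \<in> pts Y \<Longrightarrow> gcopair X Y a b (HInr y) = b y"
  by (auto simp: gcopair_def pts_gsum)

lemma gcopair_gmap:
  "fin_gset G X \<Longrightarrow> fin_gset G Y \<Longrightarrow> a \<in> gmap G X Z \<Longrightarrow> b \<in> gmap G Y Z
    \<Longrightarrow> gcopair X Y a b \<in> gmap G (gsum X Y) Z"
proof (rule gmapI)
  show "gcopair X Y a b \<in> extensional (pts (gsum X Y))" by (simp add: gcopair_def)
qed (auto simp: pts_gsum gmap_closed gmap_equiv act_closed)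

lemma gcover_gsum: "fin_gset G X \<Longrightarrow> fin_gset G Y \<Longrightarrow> gcover G X Y (gsum X Y) (ginl X) (ginr Y)"
  by (auto simp: gcover_def fin_gset_gsum ginl_gmap ginr_gmap inj_on_def pts_gsum)

lemma pts_gprod: "pts (gprod X Y) = {HPair x y | x y. x \<in> pts X \<and> y \<in> pts Y}"
  by (simp add: gprod_def)

lemma mem_gprod [simp]: "HPair x y \<in> pts (gprod X Y) \<longleftrightarrow> x \<in> pts X \<and> y \<in> pts Y"
  by (simp add: gprod_def)

lemma action_gprod [simp]:
  "x \<in> pts X \<Longrightarrow> y \<in> pts Y \<Longrightarrow> action (gprod X Y) g (HPair x y) = HPair (action X g x) (action Y g y)"
  by (simp add: gprod_def)

lemma gprod_cases:
  assumes "p \<in> pts (gprod X Y)"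
  obtains x y where "p = HPair x y" "x \<in> pts X" "y \<in> pts Y"
  using assms by (auto simp: pts_gprod)

lemma fin_gset_gprod: assumes "fin_gset G X" "fin_gset G Y" shows "fin_gset G (gprod X Y)"
proof (rule fin_gsetI)
  have "pts (gprod X Y) = case_prod HPair ` (pts X \<times> pts Y)"
    by (auto simp: pts_gprod)
  then show "finite (pts (gprod X Y))" using assms by (simp add: fin_gset_finite)
  show "action (gprod X Y) g \<in> extensional (pts (gprod X Y))" for g
    by (simp add: gprod_def)
qed (use assms in \<open>auto simp: act_closed act_one act_mult elim!: gprod_cases\<close>)

lemma gfst_apply [simp]: "x \<in> pts X \<Longrightarrow> y \<in> pts Y \<Longrightarrow> gfst X Y (HPair x y) = x"
  by (simp add: gfst_def)

lemma gsnd_apply [simp]: "x \<in> pts X \<Longrightarrow> y \<in> pts Y \<Longrightarrow> gsnd X Y (HPair x y) = y"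
  by (simp add: gsnd_def)

lemma gtimes_apply [simp]:
  "x \<in> pts X \<Longrightarrow> y \<in> pts Y \<Longrightarrow> gtimes X Y f (HPair x y) = HPair (f x) y"
  by (simp add: gtimes_def)

lemma gpair_apply [simp]: "z \<in> pts Z \<Longrightarrow> gpair Z a b z = HPair (a z) (b z)"
  by (simp add: gpair_def)

lemma gfst_gmap: "fin_gset G X \<Longrightarrow> fin_gset G Y \<Longrightarrow> gfst X Y \<in> gmap G (gprod X Y) X"
  by (rule gmapI) (auto simp: act_closed elim!: gprod_cases, auto simp: gfst_def)

lemma gsnd_gmap: "fin_gset G X \<Longrightarrow> fin_gset G Y \<Longrightarrow> gsnd X Y \<in> gmap G (gprod X Y) Y"
  by (rule gmapI) (auto simp: act_closed elim!: gprod_cases, auto simp: gsnd_def)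

lemma gtimes_gmap:
  "fin_gset G X \<Longrightarrow> fin_gset G W \<Longrightarrow> f \<in> gmap G X Y \<Longrightarrow> gtimes X W f \<in> gmap G (gprod X W) (gprod Y W)"
  by (rule gmapI)
    (auto simp: act_closed gmap_closed gmap_equiv elim!: gprod_cases, auto simp: gtimes_def)

lemma gpair_gmap:
  "fin_gset G Z \<Longrightarrow> a \<in> gmap G Z X \<Longrightarrow> b \<in> gmap G Z Y \<Longrightarrow> gpair Z a b \<in> gmap G Z (gprod X Y)"
  by (rule gmapI) (auto simp: gpair_def act_closed gmap_closed gmap_equiv)

lemma mem_gpb_pts [simp]: "HPair x z \<in> gpb_pts X f Z h \<longleftrightarrow> x \<in> pts X \<and> z \<in> pts Z \<and> f x = h z"
  by (auto simp: gpb_pts_def)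

lemma gpb_cases:
  assumes "p \<in> gpb_pts X f Z h"
  obtains x z where "p = HPair x z" "x \<in> pts X" "z \<in> pts Z" "f x = h z"
  using assms by (auto simp: gpb_pts_def)

lemma pts_gpb [simp]: "pts (gpb X f Z h) = gpb_pts X f Z h"
  by (simp add: gpb_def)

lemma action_gpb [simp]:
  "HPair x z \<in> gpb_pts X f Z h \<Longrightarrow> action (gpb X f Z h) g (HPair x z) = HPair (action X g x) (action Z g z)"
  by (simp add: gpb_def)

lemma gpb_fst_apply [simp]: "HPair x z \<in> gpb_pts X f Z h \<Longrightarrow> gpb_fst X f Z h (HPair x z) = x"
  by (simp add: gpb_fst_def)

lemma gpb_snd_apply [simp]: "HPair x z \<in> gpb_pts X f Z h \<Longrightarrow> gpb_snd X f Z h (HPair x z) = z"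
  by (simp add: gpb_snd_def)

lemma fin_gset_gpb:
  assumes X: "fin_gset G X" and Z: "fin_gset G Z" and f: "f \<in> gmap G X Y" and h: "h \<in> gmap G Z Y"
  shows "fin_gset G (gpb X f Z h)"
proof (rule fin_gsetI)
  have "gpb_pts X f Z h \<subseteq> case_prod HPair ` (pts X \<times> pts Z)"
    by (auto simp: gpb_pts_def)
  then show "finite (pts (gpb X f Z h))"
    using X Z by (auto intro: finite_subset simp: fin_gset_finite)
  show "action (gpb X f Z h) g \<in> extensional (pts (gpb X f Z h))" for g
    by (simp add: gpb_def)
qed (auto elim!: gpb_cases simp: act_closed[OF X] act_closed[OF Z] act_one[OF X] act_one[OF Z]
      act_mult[OF X] act_mult[OF Z] gmap_equiv[OF f] gmap_equiv[OF h])

lemma gpb_fst_gmap: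
  assumes X: "fin_gset G X" and Z: "fin_gset G Z" and f: "f \<in> gmap G X Y" and h: "h \<in> gmap G Z Y"
  shows "gpb_fst X f Z h \<in> gmap G (gpb X f Z h) X"
  by (rule gmapI) (auto elim!: gpb_cases simp: act_closed[OF X] act_closed[OF Z]
       gmap_equiv[OF f] gmap_equiv[OF h], auto simp: gpb_fst_def)

lemma gpb_snd_gmap:
  assumes X: "fin_gset G X" and Z: "fin_gset G Z" and f: "f \<in> gmap G X Y" and h: "h \<in> gmap G Z Y"
  shows "gpb_snd X f Z h \<in> gmap G (gpb X f Z h) Z"
  by (rule gmapI) (auto elim!: gpb_cases simp: act_closed[OF X] act_closed[OF Z]
       gmap_equiv[OF f] gmap_equiv[OF h], auto simp: gpb_snd_def)

lemma gpullback_gpb: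
  assumes "fin_gset G X" "fin_gset G Z" "fin_gset G Y" "f \<in> gmap G X Y" "h \<in> gmap G Z Y"
  shows "gpullback G (gpb X f Z h) X Z Y f h (gpb_snd X f Z h) (gpb_fst X f Z h)"
proof -
  have "bij_betw (\<lambda>x. HPair (gpb_fst X f Z h x) (gpb_snd X f Z h x)) (gpb_pts X f Z h) (gpb_pts X f Z h)"
    by (rule bij_betw_byWitness[of _ "\<lambda>x. x"]) (auto elim!: gpb_cases)
  then show ?thesis
    using assms by (auto simp: gpullback_def fin_gset_gpb gpb_fst_gmap gpb_snd_gmap)
qed

lemma gpullbackI:
  assumes "fin_gset G X'" "fin_gset G X" "fin_gset G Y'" "fin_gset G Y"
    "f \<in> gmap G X Y" "h \<in> gmap G Y' Y" "f' \<in> gmap G X' Y'" "g' \<in> gmap G X' X"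
    and comm: "\<And>x. x \<in> pts X' \<Longrightarrow> f (g' x) = h (f' x)"
    and inj: "\<And>x z. x \<in> pts X' \<Longrightarrow> z \<in> pts X' \<Longrightarrow> g' x = g' z \<Longrightarrow> f' x = f' z \<Longrightarrow> x = z"
    and surj: "\<And>x y. x \<in> pts X \<Longrightarrow> y \<in> pts Y' \<Longrightarrow> f x = h y \<Longrightarrow> \<exists>z\<in>pts X'. g' z = x \<and> f' z = y"
  shows "gpullback G X' X Y' Y f h f' g'"
proof -
  have "bij_betw (\<lambda>x. HPair (g' x) (f' x)) (pts X') (gpb_pts X f Y' h)"
    unfolding bij_betw_def
  proof
    show "inj_on (\<lambda>x. HPair (g' x) (f' x)) (pts X')" using inj by (auto simp: inj_on_def)
    show "(\<lambda>x. HPair (g' x) (f' x)) ` pts X' = gpb_pts X f Y' h"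
      using comm surj assms(7,8)
        by (auto simp: gmap_closed elim!: gpb_cases) (force simp: image_iff)
  qed
  then show ?thesis using assms by (simp add: gpullback_def)
qed

lemma fin_gset_gsub: "fin_gset G X \<Longrightarrow> gstable G X S \<Longrightarrow> fin_gset G (gsub X S)"
proof (rule fin_gsetI)
  assume "fin_gset G X" "gstable G X S"
  then show "finite (pts (gsub X S))"
    by (auto simp: gstable_def intro: finite_subset fin_gset_finite)
  show "action (gsub X S) g \<in> extensional (pts (gsub X S))" for g
    by (simp add: gsub_def)
qed (auto simp: gstable_def act_one act_mult subset_iff)

lemma ginc_gmap: "gstable G X S \<Longrightarrow> ginc S \<in> gmap G (gsub X S) X"
  by (rule gmapI) (auto simp: gstable_def ginc_def)

lemma gstable_orbit: "fin_gset G X \<Longrightarrow> x \<in> pts X \<Longrightarrow> gstable G X (orbit G (action X) x)"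
  by (auto simp: gstable_def orbit_def act_closed) (metis act_mult m_closed)

lemma gstable_Diff: assumes "fin_gset G X" "gstable G X S" shows "gstable G X (pts X - S)"
  using assms by (auto simp: gstable_def act_closed) (metis act_inv_left inv_closed)

lemma orbit_self: "fin_gset G X \<Longrightarrow> x \<in> pts X \<Longrightarrow> x \<in> orbit G (action X) x"
  by (auto simp: orbit_def intro!: exI[of _ \<one>]) (simp add: act_one)

lemma gtransitive_orbit:
  assumes X: "fin_gset G X" and x: "x \<in> pts X"
  shows "gtransitive G (gsub X (orbit G (action X) x))"
proof -
  have "\<exists>k\<in>carrier G. action (gsub X (orbit G (action X) x)) k y = z"
    if yz: "y \<in> orbit G (action X) x" "z \<in> orbit G (action X) x" for y z
  proof -
    obtain g h where gh: "g \<in> carrier G" "h \<in> carrier G" "y = action X g x" "z = action X h x"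
      using yz by (auto simp: orbit_def)
    have "action (gsub X (orbit G (action X) x)) (h \<otimes> inv g) y = z"
      using gh yz X x by (simp add: act_mult act_closed act_inv_left)
    then show ?thesis using gh by blast
  qed
  then show ?thesis
    using orbit_self[OF assms] by (auto simp: gtransitive_def)
qed

lemma gcover_gsub:
  assumes "fin_gset G X" "gstable G X S"
  shows "gcover G (gsub X S) (gsub X (pts X - S)) X (ginc S) (ginc (pts X - S))"
  using assms gstable_Diff[OF assms]
  by (auto simp: gcover_def fin_gset_gsub ginc_gmap inj_on_def gstable_def)

lemma gmap_surj:
  assumes "fin_gset G X" "pts X \<noteq> {}" "gtransitive G Y" "f \<in> gmap G X Y"
  shows "f ` pts X = pts Y"
proof
  show "f ` pts X \<subseteq> pts Y" using assms gmap_closed by fast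
  show "pts Y \<subseteq> f ` pts X"
  proof
    fix y assume y: "y \<in> pts Y"
    obtain x where x: "x \<in> pts X" using assms by auto
    then obtain g where "g \<in> carrier G" "action Y g (f x) = y"
      using assms(3) y gmap_closed[OF assms(4) x] unfolding gtransitive_def by blast
    then show "y \<in> f ` pts X"
      using gmap_equiv[OF assms(4)] x act_closed[OF assms(1)] by (metis imageI)
  qed
qed

end

section \<open>Graphs of sections and dependent products of G-sets\<close>

lemma fset_Abs [simp]: "finite S \<Longrightarrow> fset (Abs_fset S) = S"
  by (simp add: Abs_fset_inverse)

lemma fset_hgraph: "finite D \<Longrightarrow> fset (hset (hgraph D s)) = (\<lambda>x. HPair x (s x)) ` D"
  by (simp add: hgraph_def)

lemma hgraph_eqI: "finite D \<Longrightarrow> fset F = (\<lambda>x. HPair x (s x)) ` D \<Longrightarrow> HSet F = hgraph D s"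
  by (metis fset_inverse hgraph_def)

lemma hgraph_cong: "(\<And>x. x \<in> D \<Longrightarrow> s x = s' x) \<Longrightarrow> hgraph D s = hgraph D s'"
  by (simp add: hgraph_def cong: image_cong)

lemma gdep_cases:
  assumes "p \<in> gdep_pts A X Y q f"
  obtains y s where "p = HPair y (hgraph {x \<in> pts X. f x = y} s)" "y \<in> pts Y"
    "\<And>x. x \<in> pts X \<Longrightarrow> f x = y \<Longrightarrow> s x \<in> pts A" "\<And>x. x \<in> pts X \<Longrightarrow> f x = y \<Longrightarrow> q (s x) = x"
  using assms by (auto simp: gdep_pts_def)

lemma gdep_ptsI:
  assumes "y \<in> pts Y" "\<And>x. x \<in> pts X \<Longrightarrow> f x = y \<Longrightarrow> s x \<in> pts A \<and> q (s x) = x"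
  shows "HPair y (hgraph {x \<in> pts X. f x = y} s) \<in> gdep_pts A X Y q f"
  using assms by (auto simp: gdep_pts_def)

lemma pts_gdep [simp]: "pts (gdep A X Y q f) = gdep_pts A X Y q f"
  by (simp add: gdep_def)

lemma gdep_eval_apply:
  assumes "finite (pts X)" "x \<in> pts X" "HPair (f x) (hgraph {z \<in> pts X. f z = f x} s) \<in> gdep_pts A X Y q f"
  shows "gdep_eval A X Y q f (HPair x (HPair (f x) (hgraph {z \<in> pts X. f z = f x} s))) = s x"
proof -
  have "(THE a. HPair x a \<in> fset (hset (hgraph {z \<in> pts X. f z = f x} s))) = s x"
    by (rule the_equality) (use assms in \<open>auto simp: fset_hgraph\<close>)
  then show ?thesis
    using assms(2,3) by (simp add: gdep_eval_def gdep_dom_def gpb_def gpb_pts_def gdep_proj_def)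
qed

locale dep_data = group G for G (structure) +
  fixes A X Y :: "'a gset" and q f :: "'a hfmap"
  assumes A: "fin_gset G A" and X: "fin_gset G X" and Y: "fin_gset G Y"
    and q: "q \<in> gmap G A X" and f: "f \<in> gmap G X Y"
begin

abbreviation fib :: "'a hf \<Rightarrow> 'a hf set" where "fib y \<equiv> {x \<in> pts X. f x = y}"

lemma finite_fib: "finite (fib y)"
  using X by (simp add: fin_gset_finite)

text \<open>The encoding by graphs moves both entries of each pair; substituting
  \<open>action X (inv g) x\<close> for the first entry turns this into conjugation of the
  section.\<close>

lemma gdep_action:
  assumes g: "g \<in> carrier G" and mem: "HPair y (hgraph (fib y) s) \<in> gdep_pts A X Y q f"
  shows "action (gdep A X Y q f) g (HPair y (hgraph (fib y) s))
    = HPair (action Y g y)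
        (hgraph (fib (action Y g y)) (\<lambda>x. action A g (s (action X (inv g) x))))"
proof -
  have y: "y \<in> pts Y" using mem by (auto simp: gdep_pts_def)
  have "(\<lambda>z. HPair (action X g (hfst z)) (action A g (hsnd z))) ` (\<lambda>x. HPair x (s x)) ` fib y
    = (\<lambda>x. HPair x (action A g (s (action X (inv g) x)))) ` fib (action Y g y)" (is "?L = ?R")
  proof
    show "?L \<subseteq> ?R"
    proof
      fix z assume "z \<in> ?L"
      then obtain x where x: "x \<in> pts X" "f x = y" "z = HPair (action X g x) (action A g (s x))"
        by auto
      then show "z \<in> ?R"
        using g by (intro image_eqI[of _ _ "action X g x"])
          (simp_all add: act_inv_left[OF X] gmap_equiv[OF f] act_closed[OF X])
    qed
    show "?R \<subseteq> ?L"
    proof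
      fix z assume "z \<in> ?R"
      then obtain x where x: "x \<in> pts X" "f x = action Y g y"
        "z = HPair x (action A g (s (action X (inv g) x)))" by auto
      have "f (action X (inv g) x) = y"
        using x g y by (simp add: gmap_equiv[OF f] act_inv_left[OF Y])
      then have "HPair (action X (inv g) x) (s (action X (inv g) x)) \<in> (\<lambda>x. HPair x (s x)) ` fib y"
        using x g by (simp add: act_closed[OF X])
      then show "z \<in> ?L"
        by (rule image_eqI[rotated]) (use x g in \<open>simp add: act_inv_right[OF X]\<close>)
    qed
  qed
  then show ?thesis
    using mem by (simp add: gdep_def) (intro hgraph_eqI, auto simp: finite_fib fset_hgraph)
qed

lemma gdep_action_section:
  assumes g: "g \<in> carrier G" and y: "y \<in> pts Y"
    and s: "\<And>x. x \<in> fib y \<Longrightarrow> s x \<in> pts A \<and> q (s x) = x"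
    and x: "x \<in> pts X" "f x = action Y g y"
  shows "action A g (s (action X (inv g) x)) \<in> pts A \<and> q (action A g (s (action X (inv g) x))) = x"
proof -
  have "action X (inv g) x \<in> fib y"
    using x g y by (simp add: gmap_equiv[OF f] act_inv_left[OF Y] act_closed[OF X])
  from s[OF this] show ?thesis
    using g x by (simp add: act_closed[OF A] gmap_equiv[OF q] act_inv_right[OF X])
qed

lemma gdep_action_mem:
  assumes "g \<in> carrier G" "y \<in> pts Y"
    "\<And>x. x \<in> pts X \<Longrightarrow> f x = y \<Longrightarrow> s x \<in> pts A" "\<And>x. x \<in> pts X \<Longrightarrow> f x = y \<Longrightarrow> q (s x) = x"
  shows "HPair (action Y g y) (hgraph (fib (action Y g y)) (\<lambda>x. action A g (s (action X (inv g) x))))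
    \<in> gdep_pts A X Y q f"
  using assms by (intro gdep_ptsI gdep_action_section act_closed[OF Y]) auto

lemma fin_gset_gdep: "fin_gset G (gdep A X Y q f)"
proof (rule fin_gsetI)
  \<comment> \<open>A point is determined by \<open>y\<close> and a graph, which is a subset of the
    finite set of pairs from \<open>X\<close> and \<open>A\<close>.\<close>
  have "gdep_pts A X Y q f
      \<subseteq> (\<lambda>(y, F). HPair y (HSet (Abs_fset F))) ` (pts Y \<times> Pow (case_prod HPair ` (pts X \<times> pts A)))"
    by (auto simp: gdep_pts_def hgraph_def image_iff intro!: bexI[of _ "(\<lambda>x. HPair x (_ x)) ` fib _"])
  then show "finite (pts (gdep A X Y q f))"
    using A X Y by (auto intro: finite_subset simp: fin_gset_finite)
  show "action (gdep A X Y q f) g \<in> extensional (pts (gdep A X Y q f))" for g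
    by (simp add: gdep_def)
next
  fix g p assume g: "g \<in> carrier G" and "p \<in> pts (gdep A X Y q f)"
  then have p: "p \<in> gdep_pts A X Y q f" by simp
  from p show "action (gdep A X Y q f) g p \<in> pts (gdep A X Y q f)"
  proof (cases rule: gdep_cases)
    case (1 y s)
    show ?thesis
      unfolding 1(1) gdep_action[OF g p[unfolded 1(1)]] pts_gdep
      by (rule gdep_action_mem[OF g 1(2-4)])
  qed
next
  fix p assume "p \<in> pts (gdep A X Y q f)"
  then have p: "p \<in> gdep_pts A X Y q f" by simp
  from p show "action (gdep A X Y q f) \<one> p = p"
  proof (cases rule: gdep_cases)
    case (1 y s)
    show ?thesis
      unfolding 1(1) gdep_action[OF one_closed p[unfolded 1(1)]]
      using 1(2-4) by (auto simp: act_one[OF Y] act_one[OF X] act_one[OF A] intro!: hgraph_cong)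
  qed
next
  fix g h p assume gh: "g \<in> carrier G" "h \<in> carrier G" and "p \<in> pts (gdep A X Y q f)"
  then have p: "p \<in> gdep_pts A X Y q f" by simp
  from p show "action (gdep A X Y q f) (g \<otimes> h) p
      = action (gdep A X Y q f) g (action (gdep A X Y q f) h p)"
  proof (cases rule: gdep_cases)
    case (1 y s)
    have hp: "HPair (action Y h y) (hgraph (fib (action Y h y)) (\<lambda>x. action A h (s (action X (inv h) x))))
        \<in> gdep_pts A X Y q f"
      by (rule gdep_action_mem[OF gh(2) 1(2-4)])
    have "action A (g \<otimes> h) (s (action X (inv (g \<otimes> h)) x))
        = action A g (action A h (s (action X (inv h) (action X (inv g) x))))"
      if "x \<in> fib (action Y g (action Y h y))" for x
    proof -
      have "action X (inv h) (action X (inv g) x) \<in> fib y"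
        using that gh 1(2) by (simp add: gmap_equiv[OF f] act_inv_left[OF Y] act_closed[OF X] act_closed[OF Y])
      then have "s (action X (inv h) (action X (inv g) x)) \<in> pts A" using 1 by simp
      then show ?thesis
        using gh that by (simp add: inv_mult_group act_mult[OF X] act_mult[OF A])
    qed
    then have "hgraph (fib (action Y g (action Y h y)))
          (\<lambda>x. action A (g \<otimes> h) (s (action X (inv (g \<otimes> h)) x)))
        = hgraph (fib (action Y g (action Y h y)))
          (\<lambda>x. action A g (action A h (s (action X (inv h) (action X (inv g) x)))))"
      by (rule hgraph_cong)
    then show ?thesis
      unfolding 1(1) gdep_action[OF m_closed[OF gh] p[unfolded 1(1)]]
        gdep_action[OF gh(2) p[unfolded 1(1)]] gdep_action[OF gh(1) hp]
      using gh 1(2) by (simp only: act_mult[OF Y])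
  qed
qed

lemma gdep_proj_apply [simp]: "HPair y s \<in> gdep_pts A X Y q f \<Longrightarrow> gdep_proj A X Y q f (HPair y s) = y"
  by (simp add: gdep_proj_def)

lemma gdep_proj_gmap: "gdep_proj A X Y q f \<in> gmap G (gdep A X Y q f) Y"
proof (rule gmapI)
  show "gdep_proj A X Y q f \<in> extensional (pts (gdep A X Y q f))" by (simp add: gdep_proj_def)
next
  fix p assume "p \<in> pts (gdep A X Y q f)"
  then show "gdep_proj A X Y q f p \<in> pts Y" by (auto elim!: gdep_cases simp: gdep_proj_def)
next
  fix g p assume g: "g \<in> carrier G" and p: "p \<in> pts (gdep A X Y q f)"
  from act_closed[OF fin_gset_gdep g p]
  have gp: "action (gdep A X Y q f) g p \<in> gdep_pts A X Y q f" by simp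
  from p have p: "p \<in> gdep_pts A X Y q f" by simp
  then show "gdep_proj A X Y q f (action (gdep A X Y q f) g p) = action Y g (gdep_proj A X Y q f p)"
  proof (cases rule: gdep_cases)
    case (1 y s)
    show ?thesis
      using gp p unfolding 1(1) gdep_action[OF g p[unfolded 1(1)]] by (simp only: gdep_proj_apply)
  qed
qed

lemma fin_gset_gdep_dom: "fin_gset G (gdep_dom A X Y q f)"
  unfolding gdep_dom_def by (rule fin_gset_gpb[OF X fin_gset_gdep f gdep_proj_gmap])

lemma gdep_snd_gmap: "gdep_snd A X Y q f \<in> gmap G (gdep_dom A X Y q f) (gdep A X Y q f)"
  unfolding gdep_dom_def gdep_snd_def by (rule gpb_snd_gmap[OF X fin_gset_gdep f gdep_proj_gmap])

lemma gdep_dom_cases: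
  assumes "z \<in> pts (gdep_dom A X Y q f)"
  obtains x s where "x \<in> pts X" "z = HPair x (HPair (f x) (hgraph (fib (f x)) s))"
    "HPair (f x) (hgraph (fib (f x)) s) \<in> gdep_pts A X Y q f"
    "\<And>x'. x' \<in> fib (f x) \<Longrightarrow> s x' \<in> pts A \<and> q (s x') = x'"
proof -
  from assms obtain x p where z: "z = HPair x p" "x \<in> pts X" "p \<in> gdep_pts A X Y q f"
    "f x = gdep_proj A X Y q f p"
    by (auto simp: gdep_dom_def elim!: gpb_cases)
  from z(3) show ?thesis
  proof (cases rule: gdep_cases)
    case (1 y s)
    then have "f x = y" using z by simp
    then show ?thesis using that[of x s] 1 z by simp
  qed
qed

lemma gdep_eval_gmap: "gdep_eval A X Y q f \<in> gmap G (gdep_dom A X Y q f) A"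
proof (rule gmapI)
  show "gdep_eval A X Y q f \<in> extensional (pts (gdep_dom A X Y q f))" by (simp add: gdep_eval_def)
next
  fix p assume "p \<in> pts (gdep_dom A X Y q f)"
  then show "gdep_eval A X Y q f p \<in> pts A"
    by (cases rule: gdep_dom_cases) (simp add: gdep_eval_apply fin_gset_finite[OF X])
next
  fix g z assume g: "g \<in> carrier G" and z: "z \<in> pts (gdep_dom A X Y q f)"
  from z show "gdep_eval A X Y q f (action (gdep_dom A X Y q f) g z) = action A g (gdep_eval A X Y q f z)"
  proof (cases rule: gdep_dom_cases)
    case (1 x s)
    let ?s' = "\<lambda>x. action A g (s (action X (inv g) x))"
    have eq: "action (gdep_dom A X Y q f) g z
        = HPair (action X g x) (HPair (f (action X g x)) (hgraph (fib (f (action X g x))) ?s'))"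
      unfolding 1(2) using 1 z g
      by (simp add: gdep_dom_def gdep_action gmap_equiv[OF f])
    from act_closed[OF fin_gset_gdep_dom g z, unfolded eq]
    have "HPair (f (action X g x)) (hgraph (fib (f (action X g x))) ?s') \<in> gdep_pts A X Y q f"
      by (simp add: gdep_dom_def)
    from gdep_eval_apply[OF fin_gset_finite[OF X] act_closed[OF X g 1(1)] this]
    show ?thesis
      unfolding eq using 1 g by (simp add: gdep_eval_apply fin_gset_finite[OF X] act_inv_left[OF X])
  qed
qed

end

section \<open>Orbits of a finite group, in particular the free orbit\<close>

locale finite_group = group G for G (structure) +
  assumes finite_carrier: "finite (carrier G)"
begin

lemma helems_hcoset [simp]: "C \<subseteq> carrier G \<Longrightarrow> helems (hcoset C) = C"
  using finite_subset[OF _ finite_carrier, of C] by (auto simp: helems_def hcoset_def)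

lemma pts_gorbit [simp]: "pts (gorbit G H) = orbit_pts G H"
  by (simp add: gorbit_def)

lemma orbit_ptsI: "a \<in> carrier G \<Longrightarrow> hcoset (a <# H) \<in> orbit_pts G H"
  by (simp add: orbit_pts_def)

lemma gorbit_action:
  "H \<subseteq> carrier G \<Longrightarrow> g \<in> carrier G \<Longrightarrow> a \<in> carrier G
    \<Longrightarrow> action (gorbit G H) g (hcoset (a <# H)) = hcoset ((g \<otimes> a) <# H)"
  by (simp add: gorbit_def orbit_ptsI l_coset_subset_G lcos_m_assoc)

lemma fin_gset_gorbit: assumes "subgroup H G" shows "fin_gset G (gorbit G H)"
proof (rule fin_gsetI)
  have H: "H \<subseteq> carrier G" using assms by (simp add: subgroup.subset)
  show "finite (pts (gorbit G H))" by (simp add: orbit_pts_def finite_carrier)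
  show "action (gorbit G H) g \<in> extensional (pts (gorbit G H))" for g by (simp add: gorbit_def)
qed (use assms in \<open>auto simp: gorbit_action orbit_pts_def subgroup.subset m_assoc\<close>)

lemma gtransitive_gorbit: assumes "subgroup H G" shows "gtransitive G (gorbit G H)"
proof -
  have H: "H \<subseteq> carrier G" using assms by (simp add: subgroup.subset)
  have "\<exists>g\<in>carrier G. action (gorbit G H) g (hcoset (a <# H)) = hcoset (b <# H)"
    if "a \<in> carrier G" "b \<in> carrier G" for a b
    by (rule bexI[of _ "b \<otimes> inv a"]) (use that H in \<open>simp_all add: gorbit_action m_assoc\<close>)
  then show ?thesis by (auto simp: gtransitive_def orbit_pts_def)
qed

lemma gorbit_map_apply:
  assumes X: "fin_gset G X" and x: "x \<in> pts X" and H: "subgroup H G"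
    and stab: "\<And>h. h \<in> H \<Longrightarrow> action X h x = x" and a: "a \<in> carrier G"
  shows "gorbit_map G X H x (hcoset (a <# H)) = action X a x"
proof -
  have sub: "H \<subseteq> carrier G" using H by (simp add: subgroup.subset)
  have aH: "helems (hcoset (a <# H)) = a <# H" using a sub by (simp add: l_coset_subset_G)
  define b where "b = (SOME b. b \<in> carrier G \<and> b \<in> a <# H)"
  have "a \<in> a <# H" using subgroup.one_closed[OF H] a by (force simp: l_coset_def)
  then have "b \<in> carrier G \<and> b \<in> a <# H" unfolding b_def using a by (rule_tac someI) blast
  then obtain h where h: "h \<in> H" "b = a \<otimes> h" by (auto simp: l_coset_def)
  then have "action X b x = action X a x"
    using stab[of h] a sub X x by (simp add: act_mult subset_iff)
  then show ?thesis using a by (simp add: gorbit_map_def orbit_ptsI aH b_def)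
qed

lemma gorbit_map_gmap:
  assumes X: "fin_gset G X" and x: "x \<in> pts X" and H: "subgroup H G"
    and stab: "\<And>h. h \<in> H \<Longrightarrow> action X h x = x"
  shows "gorbit_map G X H x \<in> gmap G (gorbit G H) X"
proof (rule gmapI)
  show "gorbit_map G X H x \<in> extensional (pts (gorbit G H))" by (simp add: gorbit_map_def)
next
  fix z assume "z \<in> pts (gorbit G H)"
  then show "gorbit_map G X H x z \<in> pts X"
    using X x by (auto simp: orbit_pts_def gorbit_map_apply[OF assms] act_closed)
next
  fix g z assume "g \<in> carrier G" "z \<in> pts (gorbit G H)"
  then show "gorbit_map G X H x (action (gorbit G H) g z) = action X g (gorbit_map G X H x z)"
    using X x H by (auto simp: orbit_pts_def gorbit_map_apply[OF assms] gorbit_action subgroup.subset act_mult)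
qed

text \<open>The orbit-stabilizer theorem as an isomorphism of G-sets: if \<open>a\<close> and
  \<open>b\<close> move \<open>x\<close> to the same point, then \<open>inv a \<otimes> b\<close>
  stabilizes \<open>x\<close> and the two cosets agree; transitivity gives surjectivity.\<close>

lemma gorbit_map_bij:
  assumes X: "fin_gset G X" and x: "x \<in> pts X" and trans: "gtransitive G X"
  defines "H \<equiv> stabilizer G (action X) x"
  shows "subgroup H G" "gorbit_map G X H x \<in> gmap G (gorbit G H) X"
    "bij_betw (gorbit_map G X H x) (pts (gorbit G H)) (pts X)"
proof -
  show H: "subgroup H G"
    unfolding H_def using X x by (auto simp: fin_gset_def intro: group_action.stabilizer_subgroup)
  have stab: "\<And>h. h \<in> H \<Longrightarrow> action X h x = x" by (simp add: H_def stabilizer_def)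
  note app = gorbit_map_apply[OF X x H stab]
  show m: "gorbit_map G X H x \<in> gmap G (gorbit G H) X" by (rule gorbit_map_gmap[OF X x H stab])
  have eq: "a <# H = b <# H"
    if ab: "a \<in> carrier G" "b \<in> carrier G" "action X a x = action X b x" for a b
  proof -
    have "action X (inv a \<otimes> b) x = x"
      using ab X x by (metis act_inv_left act_mult inv_closed)
    then have "inv a \<otimes> b \<in> H" using ab by (simp add: H_def stabilizer_def)
    then have "b \<in> a <# H" using ab
      by (auto simp: l_coset_def intro!: bexI[of _ "inv a \<otimes> b"] simp flip: m_assoc)
    then show ?thesis using H ab(1) by (metis l_repr_independence)
  qed
  have "inj_on (gorbit_map G X H x) (pts (gorbit G H))"
  proof (rule inj_onI)
    fix z w assume zw: "z \<in> pts (gorbit G H)" "w \<in> pts (gorbit G H)"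
      "gorbit_map G X H x z = gorbit_map G X H x w"
    then obtain a b where ab: "a \<in> carrier G" "b \<in> carrier G" "z = hcoset (a <# H)" "w = hcoset (b <# H)"
      by (auto simp: orbit_pts_def)
    then have "a <# H = b <# H" using zw(3) by (intro eq) (simp_all add: app)
    then show "z = w" using ab by simp
  qed
  moreover have "gorbit_map G X H x ` pts (gorbit G H) = pts X"
    by (rule gmap_surj[OF fin_gset_gorbit[OF H] _ trans m]) (auto simp: orbit_pts_def)
  ultimately show "bij_betw (gorbit_map G X H x) (pts (gorbit G H)) (pts X)"
    by (simp add: bij_betw_def)
qed

abbreviation gfree :: "'a gset" where "gfree \<equiv> gorbit G {\<one>}"

abbreviation gbase :: "'a hf" where "gbase \<equiv> hcoset (\<one> <# {\<one>})"

lemma fin_gset_gfree: "fin_gset G gfree"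
  by (rule fin_gset_gorbit[OF triv_subgroup])

lemma gtransitive_gfree: "gtransitive G gfree"
  by (rule gtransitive_gorbit[OF triv_subgroup])

lemma gbase_pts: "gbase \<in> orbit_pts G {\<one>}"
  by (simp add: orbit_ptsI)

text \<open>\<open>G/e\<close> represents the underlying set: a map out of it is the choice of a
  point, namely the image of the base coset. Conditions on restrictions to \<open>gfree\<close> are
  therefore conditions at the points of \<open>X\<close>.\<close>

lemma gfree_map:
  assumes "fin_gset G X" "x \<in> pts X"
  shows "gorbit_map G X {\<one>} x \<in> gmap G gfree X" "gorbit_map G X {\<one>} x gbase = x"
proof -
  show "gorbit_map G X {\<one>} x \<in> gmap G gfree X"
    by (rule gorbit_map_gmap[OF assms triv_subgroup]) (use assms in \<open>simp add: act_one\<close>)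
  show "gorbit_map G X {\<one>} x gbase = x"
    using assms by (subst gorbit_map_apply[OF assms triv_subgroup]) (simp_all add: act_one)
qed

lemma gfree_map_eqI:
  assumes "v \<in> gmap G gfree X" "w \<in> gmap G gfree X" "v gbase = w gbase"
  shows "v = w"
proof (rule gmap_eqI[OF assms(1,2)])
  fix z assume "z \<in> pts gfree"
  then obtain a where a: "a \<in> carrier G" "z = hcoset (a <# {\<one>})" by (auto simp: orbit_pts_def)
  then have "z = action gfree a gbase" by (simp add: gorbit_action)
  then show "v z = w z"
    using assms a gbase_pts by (simp add: gmap_equiv[OF assms(1)] gmap_equiv[OF assms(2)])
qed

text \<open>Transitivity provides a point of \<open>D\<close> over the base coset, and this point
  defines \<open>s\<close>. Its composite with \<open>k\<close> fixes the base coset, hence is the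
  identity.\<close>

lemma gfree_section:
  assumes D: "fin_gset G D" and ne: "pts D \<noteq> {}" and k: "k \<in> gmap G D gfree"
  obtains s where "s \<in> gmap G gfree D" "gcomp gfree k s = gid gfree" "inj_on s (pts gfree)"
proof -
  obtain d where d: "d \<in> pts D" "k d = gbase"
    using gmap_surj[OF D ne gtransitive_gfree k] gbase_pts by (metis imageE pts_gorbit)
  let ?s = "gorbit_map G D {\<one>} d"
  have s: "?s \<in> gmap G gfree D" "?s gbase = d" using gfree_map[OF D d(1)] by auto
  have id: "gcomp gfree k ?s = gid gfree"
    by (rule gfree_map_eqI[OF gcomp_gmap[OF s(1) k fin_gset_gfree] gid_gmap[OF fin_gset_gfree]])
      (use s d gbase_pts in simp)
  have "inj_on ?s (pts gfree)"
    by (rule inj_on_inverseI[of _ k]) (metis gcomp_apply gid_apply id)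
  then show ?thesis using that s id by blast
qed

lemma orbit_proj_gmap:
  assumes "subgroup K G" shows "orbit_proj G {\<one>} K \<in> gmap G gfree (gorbit G K)"
proof -
  have K: "K \<subseteq> carrier G" using assms by (simp add: subgroup.subset)
  have ap: "orbit_proj G {\<one>} K (hcoset (a <# {\<one>})) = hcoset (a <# K)" if a: "a \<in> carrier G" for a
  proof -
    have "a <# {\<one>} = {a}" using a by (auto simp: l_coset_def)
    then show ?thesis
      using a K orbit_ptsI[OF a, of "{\<one>}"] by (simp add: orbit_proj_def l_coset_eq_set_mult)
  qed
  show ?thesis
  proof (rule gmapI)
    show "orbit_proj G {\<one>} K \<in> extensional (pts gfree)" by (simp add: orbit_proj_def)
  qed (use K in \<open>auto simp: orbit_pts_def ap gorbit_action\<close>)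
qed

text \<open>The complement of an embedded copy of \<open>G/e\<close> is stable and strictly smaller,
  which drives the induction on \<open>card (pts D)\<close>.\<close>

lemma gcover_gfree:
  assumes D: "fin_gset G D" and s: "s \<in> gmap G gfree D" and inj: "inj_on s (pts gfree)"
  obtains C i where "gcover G gfree C D s i" "card (pts C) < card (pts D)"
proof
  have "gstable G D (s ` pts gfree)"
    unfolding gstable_def
  proof (intro conjI ballI)
    show "s ` pts gfree \<subseteq> pts D" using s by (auto intro: gmap_closed)
    fix g x assume "g \<in> carrier G" "x \<in> s ` pts gfree"
    then obtain z where z: "z \<in> pts gfree" "x = s z" by blast
    then have "action D g x = s (action gfree g z)"
      using \<open>g \<in> carrier G\<close> by (simp only: gmap_equiv[OF s])
    then show "action D g x \<in> s ` pts gfree"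
      using act_closed[OF fin_gset_gfree \<open>g \<in> carrier G\<close> z(1)] by blast
  qed
  from gstable_Diff[OF D this] have st: "gstable G D (pts D - s ` pts gfree)" .
  show "gcover G gfree (gsub D (pts D - s ` pts gfree)) D s (ginc (pts D - s ` pts gfree))"
    using assms st fin_gset_gfree fin_gset_gsub[OF D st] ginc_gmap[OF st]
    by (auto simp: gcover_def inj_on_def gmap_closed)
  have "s gbase \<in> pts D \<inter> s ` pts gfree" using gmap_closed[OF s] gbase_pts by auto
  then show "card (pts (gsub D (pts D - s ` pts gfree))) < card (pts D)"
    using fin_gset_finite[OF D] by (intro psubset_card_mono) auto
qed

end

section \<open>Functors with restrictions and transfers\<close>

text \<open>
  The axioms shared by Mackey functors and by the additive and the multiplicative halves of a
  Tambara functor: the values are only commutative monoids, and \<open>tr\<close> is a transfer or a norm.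
\<close>

locale semi_mackey = finite_group G for G :: "('g, 'b) monoid_scheme" (structure) +
  fixes V :: "'g gset \<Rightarrow> ('m, 'z) monoid_scheme"
    and res :: "'g gset \<Rightarrow> 'g gset \<Rightarrow> 'g hfmap \<Rightarrow> 'm \<Rightarrow> 'm"
    and tr :: "'g gset \<Rightarrow> 'g gset \<Rightarrow> 'g hfmap \<Rightarrow> 'm \<Rightarrow> 'm"
  assumes val: "fin_gset G X \<Longrightarrow> comm_monoid (V X)"
    and res_hom: "\<lbrakk>fin_gset G X; fin_gset G Y; f \<in> gmap G X Y\<rbrakk> \<Longrightarrow> res X Y f \<in> hom (V Y) (V X)"
    and tr_hom: "\<lbrakk>fin_gset G X; fin_gset G Y; f \<in> gmap G X Y\<rbrakk> \<Longrightarrow> tr X Y f \<in> hom (V X) (V Y)"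
    and res_one: "\<lbrakk>fin_gset G X; fin_gset G Y; f \<in> gmap G X Y\<rbrakk> \<Longrightarrow> res X Y f \<one>\<^bsub>V Y\<^esub> = \<one>\<^bsub>V X\<^esub>"
    and tr_one: "\<lbrakk>fin_gset G X; fin_gset G Y; f \<in> gmap G X Y\<rbrakk> \<Longrightarrow> tr X Y f \<one>\<^bsub>V X\<^esub> = \<one>\<^bsub>V Y\<^esub>"
    and res_id: "\<lbrakk>fin_gset G X; m \<in> carrier (V X)\<rbrakk> \<Longrightarrow> res X X (gid X) m = m"
    and tr_id: "\<lbrakk>fin_gset G X; m \<in> carrier (V X)\<rbrakk> \<Longrightarrow> tr X X (gid X) m = m"
    and res_comp: "\<lbrakk>fin_gset G X; fin_gset G Y; fin_gset G Z; f \<in> gmap G X Y; h \<in> gmap G Y Z;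
        m \<in> carrier (V Z)\<rbrakk> \<Longrightarrow> res X Z (gcomp X h f) m = res X Y f (res Y Z h m)"
    and tr_comp: "\<lbrakk>fin_gset G X; fin_gset G Y; fin_gset G Z; f \<in> gmap G X Y; h \<in> gmap G Y Z;
        m \<in> carrier (V X)\<rbrakk> \<Longrightarrow> tr X Z (gcomp X h f) m = tr Y Z h (tr X Y f m)"
    and sum: "\<lbrakk>fin_gset G X; fin_gset G Y\<rbrakk>
      \<Longrightarrow> bij_betw (\<lambda>m. (res X (gsum X Y) (ginl X) m, res Y (gsum X Y) (ginr Y) m))
            (carrier (V (gsum X Y))) (carrier (V X) \<times> carrier (V Y))"
    and empty: "\<lbrakk>fin_gset G X; pts X = {}\<rbrakk> \<Longrightarrow> carrier (V X) = {\<one>\<^bsub>V X\<^esub>}"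
    and base_change: "\<lbrakk>fin_gset G X; fin_gset G Y; fin_gset G Y'; f \<in> gmap G X Y;
        h \<in> gmap G Y' Y; m \<in> carrier (V X)\<rbrakk>
      \<Longrightarrow> res Y' Y h (tr X Y f m)
        = tr (gpb X f Y' h) Y' (gpb_snd X f Y' h) (res (gpb X f Y' h) X (gpb_fst X f Y' h) m)"
begin

lemma res_closed: "\<lbrakk>fin_gset G X; fin_gset G Y; f \<in> gmap G X Y; m \<in> carrier (V Y)\<rbrakk>
    \<Longrightarrow> res X Y f m \<in> carrier (V X)"
  using res_hom by (auto simp: hom_def)

lemma tr_closed: "\<lbrakk>fin_gset G X; fin_gset G Y; f \<in> gmap G X Y; m \<in> carrier (V X)\<rbrakk>
    \<Longrightarrow> tr X Y f m \<in> carrier (V Y)"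
  using tr_hom by (auto simp: hom_def)

lemma res_mult: "\<lbrakk>fin_gset G X; fin_gset G Y; f \<in> gmap G X Y; m \<in> carrier (V Y); n \<in> carrier (V Y)\<rbrakk>
    \<Longrightarrow> res X Y f (m \<otimes>\<^bsub>V Y\<^esub> n) = res X Y f m \<otimes>\<^bsub>V X\<^esub> res X Y f n"
  using res_hom by (auto simp: hom_def)

lemma tr_mult: "\<lbrakk>fin_gset G X; fin_gset G Y; f \<in> gmap G X Y; m \<in> carrier (V X); n \<in> carrier (V X)\<rbrakk>
    \<Longrightarrow> tr X Y f (m \<otimes>\<^bsub>V X\<^esub> n) = tr X Y f m \<otimes>\<^bsub>V Y\<^esub> tr X Y f n"
  using tr_hom by (auto simp: hom_def)

text \<open>For injective \<open>u\<close>, the fibre product of \<open>u\<close> with itself is the diagonal, as it is for \<open>gid X\<close>.\<close>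

lemma res_tr_inj:
  assumes X: "fin_gset G X" and Y: "fin_gset G Y" and u: "u \<in> gmap G X Y"
    and inj: "inj_on u (pts X)" and t: "t \<in> carrier (V X)"
  shows "res X Y u (tr X Y u t) = t"
proof -
  have p: "gpb_pts X u X u = gpb_pts X (gid X) X (gid X)"
    using inj by (auto simp: gpb_pts_def inj_on_def)
  have "res X Y u (tr X Y u t) = res X X (gid X) (tr X X (gid X) t)"
    unfolding base_change[OF X Y X u u t] base_change[OF X X X gid_gmap[OF X] gid_gmap[OF X] t]
    by (simp add: gpb_def gpb_fst_def gpb_snd_def p)
  then show ?thesis using X t by (simp add: res_id tr_id)
qed

text \<open>Restriction along a bijection is injective, because restriction along the inverse map
  undoes it. So both sides may be compared after restriction, where \<open>res_tr_inj\<close>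
  applies.\<close>

lemma tr_res_iso:
  assumes X: "fin_gset G X" and Y: "fin_gset G Y" and u: "u \<in> gmap G X Y"
    and bij: "bij_betw u (pts X) (pts Y)" and t: "t \<in> carrier (V Y)"
  shows "tr X Y u (res X Y u t) = t"
proof -
  obtain h where h: "h \<in> gmap G Y X" "gcomp Y u h = gid Y"
    using gmap_inverse[OF X u bij] by blast
  have inv: "res Y X h (res X Y u m) = m" if "m \<in> carrier (V Y)" for m
    using res_comp[OF Y X Y h(1) u that] h(2) res_id[OF Y that] by simp
  have c: "res X Y u t \<in> carrier (V X)" by (rule res_closed[OF X Y u t])
  have "res X Y u (tr X Y u (res X Y u t)) = res X Y u t"
    using bij by (intro res_tr_inj[OF X Y u _ c]) (simp add: bij_betw_def)
  then show ?thesis using inv[OF t] inv[OF tr_closed[OF X Y u c]] by simp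
qed

text \<open>The axioms give base change only for the literal fibre product \<open>gpb\<close>. The
  map \<open>?w\<close> identifies \<open>X'\<close> with it, and by \<open>tr_res_iso\<close> a
  transfer after a restriction along \<open>?w\<close> can be inserted.\<close>

lemma res_tr_pullback:
  assumes pb: "gpullback G X' X Y' Y f h f' g'" and m: "m \<in> carrier (V X)"
  shows "res Y' Y h (tr X Y f m) = tr X' Y' f' (res X' X g' m)"
proof -
  have *: "fin_gset G X'" "fin_gset G X" "fin_gset G Y'" "fin_gset G Y"
    "f \<in> gmap G X Y" "h \<in> gmap G Y' Y" "f' \<in> gmap G X' Y'" "g' \<in> gmap G X' X"
    and bij: "bij_betw (\<lambda>x. HPair (g' x) (f' x)) (pts X') (gpb_pts X f Y' h)"
    using pb by (auto simp: gpullback_def)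
  let ?P = "gpb X f Y' h" and ?w = "gpair X' g' f'"
  have P: "fin_gset G ?P" using fin_gset_gpb[OF *(2,3,5,6)] .
  have fst: "gpb_fst X f Y' h \<in> gmap G ?P X" and snd: "gpb_snd X f Y' h \<in> gmap G ?P Y'"
    using gpb_fst_gmap[OF *(2,3,5,6)] gpb_snd_gmap[OF *(2,3,5,6)] .
  have bw: "bij_betw ?w (pts X') (pts ?P)"
    unfolding pts_gpb using bij
    by (subst bij_betw_cong[of _ _ "\<lambda>x. HPair (g' x) (f' x)"]) simp_all
  have mem: "HPair (g' x) (f' x) \<in> gpb_pts X f Y' h" if "x \<in> pts X'" for x
    using bij_betw_imp_surj_on[OF bij] that by blast
  have w: "?w \<in> gmap G X' ?P"
  proof (rule gmapI)
    show "?w \<in> extensional (pts X')" by (simp add: gpair_def)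
  next
    fix x assume "x \<in> pts X'" then show "?w x \<in> pts ?P" using mem by (simp del: mem_gpb_pts)
  next
    fix g x assume g: "g \<in> carrier G" "x \<in> pts X'"
    then show "?w (action X' g x) = action ?P g (?w x)"
      using mem[OF g(2)] * by (simp add: act_closed gmap_equiv del: mem_gpb_pts)
  qed
  have fw: "gcomp X' (gpb_fst X f Y' h) ?w = g'"
    by (rule gmap_eqI[OF gcomp_gmap[OF w fst *(1)] *(8)]) (simp add: mem del: mem_gpb_pts)
  have sw: "gcomp X' (gpb_snd X f Y' h) ?w = f'"
    by (rule gmap_eqI[OF gcomp_gmap[OF w snd *(1)] *(7)]) (simp add: mem del: mem_gpb_pts)
  let ?n = "res ?P X (gpb_fst X f Y' h) m"
  have n: "?n \<in> carrier (V ?P)" by (rule res_closed[OF P *(2) fst m])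
  have "res Y' Y h (tr X Y f m) = tr ?P Y' (gpb_snd X f Y' h) (tr X' ?P ?w (res X' ?P ?w ?n))"
    unfolding base_change[OF *(2,4,3,5,6) m] tr_res_iso[OF *(1) P w bw n] ..
  also have "\<dots> = tr X' Y' f' (res X' ?P ?w ?n)"
    by (rule tr_comp[OF *(1) P *(3) w snd res_closed[OF *(1) P w n], symmetric, unfolded sw])
  also have "res X' ?P ?w ?n = res X' X g' m"
    by (rule res_comp[OF *(1) P *(2) w fst m, symmetric, unfolded fw])
  finally show ?thesis .
qed

text \<open>The fibre product is empty, so base change passes through a trivial group.\<close>

lemma res_tr_disjoint:
  assumes X: "fin_gset G X" and Y: "fin_gset G Y" and Z: "fin_gset G Z"
    and u: "u \<in> gmap G X Y" and v: "v \<in> gmap G Z Y"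
    and disj: "u ` pts X \<inter> v ` pts Z = {}" and t: "t \<in> carrier (V X)"
  shows "res Z Y v (tr X Y u t) = \<one>\<^bsub>V Z\<^esub>"
proof -
  let ?P = "gpb X u Z v"
  have P: "fin_gset G ?P" by (rule fin_gset_gpb[OF X Z u v])
  have "pts ?P = {}" using disj by (auto simp: gpb_pts_def)
  then have "res ?P X (gpb_fst X u Z v) t = \<one>\<^bsub>V ?P\<^esub>"
    using empty[OF P] res_closed[OF P X gpb_fst_gmap[OF X Z u v] t] by blast
  then show ?thesis
    using base_change[OF X Y Z u v t] tr_one[OF P Z gpb_snd_gmap[OF X Z u v]] by simp
qed

text \<open>The sum axiom speaks of \<open>gsum\<close> only. The copairing of
  \<open>u\<^sub>1\<close> and \<open>u\<^sub>2\<close> identifies \<open>gsum\<close> with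
  \<open>X\<close>, and by \<open>tr_res_iso\<close> no information is lost along this
  isomorphism.\<close>

lemma gcover_eqI:
  assumes c: "gcover G X\<^sub>1 X\<^sub>2 X u\<^sub>1 u\<^sub>2" and t: "t \<in> carrier (V X)" "s \<in> carrier (V X)"
    and eq: "res X\<^sub>1 X u\<^sub>1 t = res X\<^sub>1 X u\<^sub>1 s" "res X\<^sub>2 X u\<^sub>2 t = res X\<^sub>2 X u\<^sub>2 s"
  shows "t = s"
proof -
  have X: "fin_gset G X\<^sub>1" "fin_gset G X\<^sub>2" "fin_gset G X" "u\<^sub>1 \<in> gmap G X\<^sub>1 X" "u\<^sub>2 \<in> gmap G X\<^sub>2 X"
    using c by (auto simp: gcover_def)
  let ?S = "gsum X\<^sub>1 X\<^sub>2" and ?w = "gcopair X\<^sub>1 X\<^sub>2 u\<^sub>1 u\<^sub>2"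
  have S: "fin_gset G ?S" and w: "?w \<in> gmap G ?S X"
    using X by (auto simp: fin_gset_gsum gcopair_gmap)
  have bij: "bij_betw ?w (pts ?S) (pts X)"
    unfolding bij_betw_def
  proof
    have *: "inj_on u\<^sub>1 (pts X\<^sub>1)" "inj_on u\<^sub>2 (pts X\<^sub>2)" "u\<^sub>1 ` pts X\<^sub>1 \<inter> u\<^sub>2 ` pts X\<^sub>2 = {}"
      and un: "u\<^sub>1 ` pts X\<^sub>1 \<union> u\<^sub>2 ` pts X\<^sub>2 = pts X"
      using c by (simp_all add: gcover_def)
    show "inj_on ?w (pts ?S)"
    proof (rule inj_onI)
      fix z z' assume "z \<in> pts ?S" "z' \<in> pts ?S" and eq: "?w z = ?w z'"
      then consider x x' where "z = HInl x" "z' = HInl x'" "x \<in> pts X\<^sub>1" "x' \<in> pts X\<^sub>1"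
        | x y where "z = HInl x" "z' = HInr y" "x \<in> pts X\<^sub>1" "y \<in> pts X\<^sub>2"
        | y x where "z = HInr y" "z' = HInl x" "x \<in> pts X\<^sub>1" "y \<in> pts X\<^sub>2"
        | y y' where "z = HInr y" "z' = HInr y'" "y \<in> pts X\<^sub>2" "y' \<in> pts X\<^sub>2"
        unfolding pts_gsum by blast
      then show "z = z'"
      proof cases
        case (1 x x') then show ?thesis using eq inj_onD[OF *(1)] by simp
      next
        case (2 x y) then show ?thesis using eq *(3) by auto
      next
        case (3 y x) then show ?thesis using eq *(3) by auto
      next
        case (4 y y') then show ?thesis using eq inj_onD[OF *(2)] by simp
      qed
    qed
    have "?w ` pts ?S = u\<^sub>1 ` pts X\<^sub>1 \<union> u\<^sub>2 ` pts X\<^sub>2"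
      unfolding pts_gsum image_Un image_image by simp
    then show "?w ` pts ?S = pts X" using un by simp
  qed
  have l: "gcomp X\<^sub>1 ?w (ginl X\<^sub>1) = u\<^sub>1"
    by (rule gmap_eqI[OF gcomp_gmap[OF ginl_gmap[OF X(1)] w X(1)] X(4)]) simp
  have r: "gcomp X\<^sub>2 ?w (ginr X\<^sub>2) = u\<^sub>2"
    by (rule gmap_eqI[OF gcomp_gmap[OF ginr_gmap[OF X(2)] w X(2)] X(5)]) simp
  have "res X\<^sub>1 ?S (ginl X\<^sub>1) (res ?S X ?w m) = res X\<^sub>1 X u\<^sub>1 m"
    "res X\<^sub>2 ?S (ginr X\<^sub>2) (res ?S X ?w m) = res X\<^sub>2 X u\<^sub>2 m" if "m \<in> carrier (V X)" for m
    using res_comp[OF X(1) S X(3) ginl_gmap[OF X(1)] w that]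
      res_comp[OF X(2) S X(3) ginr_gmap[OF X(2)] w that] l r by simp_all
  then have "res ?S X ?w t = res ?S X ?w s"
    using eq t by (intro inj_onD[OF bij_betw_imp_inj_on[OF sum[OF X(1,2)]]])
      (simp_all add: res_closed[OF S X(3) w])
  then have "tr ?S X ?w (res ?S X ?w t) = tr ?S X ?w (res ?S X ?w s)" by simp
  then show ?thesis using t by (simp add: tr_res_iso[OF S X(3) w bij])
qed

text \<open>Both sides agree on each piece: the transfer from the piece itself restricts back to its
  argument, and the transfer from the other piece restricts to the identity element.\<close>

lemma gcover_decomp:
  assumes c: "gcover G X\<^sub>1 X\<^sub>2 X u\<^sub>1 u\<^sub>2" and t: "t \<in> carrier (V X)"
  shows "t = tr X\<^sub>1 X u\<^sub>1 (res X\<^sub>1 X u\<^sub>1 t) \<otimes>\<^bsub>V X\<^esub> tr X\<^sub>2 X u\<^sub>2 (res X\<^sub>2 X u\<^sub>2 t)"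
proof (rule gcover_eqI[OF c t])
  have X: "fin_gset G X\<^sub>1" "fin_gset G X\<^sub>2" "fin_gset G X" "u\<^sub>1 \<in> gmap G X\<^sub>1 X" "u\<^sub>2 \<in> gmap G X\<^sub>2 X"
    and inj: "inj_on u\<^sub>1 (pts X\<^sub>1)" "inj_on u\<^sub>2 (pts X\<^sub>2)"
    and disj: "u\<^sub>1 ` pts X\<^sub>1 \<inter> u\<^sub>2 ` pts X\<^sub>2 = {}" "u\<^sub>2 ` pts X\<^sub>2 \<inter> u\<^sub>1 ` pts X\<^sub>1 = {}"
    using c by (auto simp: gcover_def)
  let ?a = "res X\<^sub>1 X u\<^sub>1 t" and ?b = "res X\<^sub>2 X u\<^sub>2 t"
  have a: "?a \<in> carrier (V X\<^sub>1)" and b: "?b \<in> carrier (V X\<^sub>2)"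
    using X t by (simp_all add: res_closed)
  interpret X1: comm_monoid "V X\<^sub>1" by (rule val[OF X(1)])
  interpret X2: comm_monoid "V X\<^sub>2" by (rule val[OF X(2)])
  interpret X0: comm_monoid "V X" by (rule val[OF X(3)])
  have ta: "tr X\<^sub>1 X u\<^sub>1 ?a \<in> carrier (V X)" and tb: "tr X\<^sub>2 X u\<^sub>2 ?b \<in> carrier (V X)"
    using X a b by (simp_all add: tr_closed)
  then show "tr X\<^sub>1 X u\<^sub>1 ?a \<otimes>\<^bsub>V X\<^esub> tr X\<^sub>2 X u\<^sub>2 ?b \<in> carrier (V X)" by simp
  show "?a = res X\<^sub>1 X u\<^sub>1 (tr X\<^sub>1 X u\<^sub>1 ?a \<otimes>\<^bsub>V X\<^esub> tr X\<^sub>2 X u\<^sub>2 ?b)"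
    using a by (simp add: res_mult[OF X(1,3,4) ta tb] res_tr_inj[OF X(1,3,4) inj(1) a]
      res_tr_disjoint[OF X(2,3,1,5,4) disj(2) b])
  show "?b = res X\<^sub>2 X u\<^sub>2 (tr X\<^sub>1 X u\<^sub>1 ?a \<otimes>\<^bsub>V X\<^esub> tr X\<^sub>2 X u\<^sub>2 ?b)"
    using b by (simp add: res_mult[OF X(2,3,5) ta tb] res_tr_inj[OF X(2,3,5) inj(2) b]
      res_tr_disjoint[OF X(1,3,2,4,5) disj(1) a])
qed

text \<open>The preimage of a pair is the product of the two transfers, each of which is invisible
  on the other piece.\<close>

lemma gcover_bij:
  assumes c: "gcover G X\<^sub>1 X\<^sub>2 X u\<^sub>1 u\<^sub>2"
  shows "bij_betw (\<lambda>m. (res X\<^sub>1 X u\<^sub>1 m, res X\<^sub>2 X u\<^sub>2 m)) (carrier (V X)) (carrier (V X\<^sub>1) \<times> carrier (V X\<^sub>2))"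
  unfolding bij_betw_def
proof
  have X: "fin_gset G X\<^sub>1" "fin_gset G X\<^sub>2" "fin_gset G X" "u\<^sub>1 \<in> gmap G X\<^sub>1 X" "u\<^sub>2 \<in> gmap G X\<^sub>2 X"
    and inj: "inj_on u\<^sub>1 (pts X\<^sub>1)" "inj_on u\<^sub>2 (pts X\<^sub>2)"
    and disj: "u\<^sub>1 ` pts X\<^sub>1 \<inter> u\<^sub>2 ` pts X\<^sub>2 = {}" "u\<^sub>2 ` pts X\<^sub>2 \<inter> u\<^sub>1 ` pts X\<^sub>1 = {}"
    using c by (auto simp: gcover_def)
  let ?h = "\<lambda>m. (res X\<^sub>1 X u\<^sub>1 m, res X\<^sub>2 X u\<^sub>2 m)"
  show "inj_on ?h (carrier (V X))" by (rule inj_onI) (simp add: gcover_eqI[OF c])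
  interpret X1: comm_monoid "V X\<^sub>1" by (rule val[OF X(1)])
  interpret X2: comm_monoid "V X\<^sub>2" by (rule val[OF X(2)])
  interpret X0: comm_monoid "V X" by (rule val[OF X(3)])
  show "?h ` carrier (V X) = carrier (V X\<^sub>1) \<times> carrier (V X\<^sub>2)"
  proof
    show "?h ` carrier (V X) \<subseteq> carrier (V X\<^sub>1) \<times> carrier (V X\<^sub>2)"
      using X by (auto simp: res_closed)
    show "carrier (V X\<^sub>1) \<times> carrier (V X\<^sub>2) \<subseteq> ?h ` carrier (V X)"
    proof
      fix p assume "p \<in> carrier (V X\<^sub>1) \<times> carrier (V X\<^sub>2)"
      then obtain a b where p: "p = (a, b)" and a: "a \<in> carrier (V X\<^sub>1)" and b: "b \<in> carrier (V X\<^sub>2)"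
        by blast
      note ta = tr_closed[OF X(1,3,4) a] and tb = tr_closed[OF X(2,3,5) b]
      have "?h (tr X\<^sub>1 X u\<^sub>1 a \<otimes>\<^bsub>V X\<^esub> tr X\<^sub>2 X u\<^sub>2 b) = p"
        using a b p
        by (simp add: res_mult[OF X(1,3,4) ta tb] res_mult[OF X(2,3,5) ta tb]
            res_tr_inj[OF X(1,3,4) inj(1) a] res_tr_inj[OF X(2,3,5) inj(2) b]
            res_tr_disjoint[OF X(1,3,2,4,5) disj(1) a] res_tr_disjoint[OF X(2,3,1,5,4) disj(2) b])
      then show "p \<in> ?h ` carrier (V X)" by (rule image_eqI[OF sym]) (rule X0.m_closed[OF ta tb])
    qed
  qed
qed

text \<open>\<open>tr X Y f\<close> is applied to the decomposition of \<open>t\<close>. For the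
  multiplicative half of a Tambara functor this says that a norm is the product of the norms from
  the two pieces.\<close>

lemma tr_gcover:
  assumes c: "gcover G X\<^sub>1 X\<^sub>2 X u\<^sub>1 u\<^sub>2" and Y: "fin_gset G Y" and f: "f \<in> gmap G X Y"
    and t: "t \<in> carrier (V X)"
  shows "tr X Y f t = tr X\<^sub>1 Y (gcomp X\<^sub>1 f u\<^sub>1) (res X\<^sub>1 X u\<^sub>1 t)
    \<otimes>\<^bsub>V Y\<^esub> tr X\<^sub>2 Y (gcomp X\<^sub>2 f u\<^sub>2) (res X\<^sub>2 X u\<^sub>2 t)"
proof -
  have X: "fin_gset G X\<^sub>1" "fin_gset G X\<^sub>2" "fin_gset G X" "u\<^sub>1 \<in> gmap G X\<^sub>1 X" "u\<^sub>2 \<in> gmap G X\<^sub>2 X"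
    using c by (auto simp: gcover_def)
  have a: "res X\<^sub>1 X u\<^sub>1 t \<in> carrier (V X\<^sub>1)" and b: "res X\<^sub>2 X u\<^sub>2 t \<in> carrier (V X\<^sub>2)"
    using X t by (simp_all add: res_closed)
  show ?thesis
    unfolding tr_comp[OF X(1,3) Y X(4) f a] tr_comp[OF X(2,3) Y X(5) f b]
    using tr_mult[OF X(3) Y f tr_closed[OF X(1,3,4) a] tr_closed[OF X(2,3,5) b]]
      gcover_decomp[OF c t] by simp
qed

text \<open>
  Over the free orbit every map splits off copies of the orbit, so a congruence on its value is
  respected by transfers into it.
\<close>

lemma tr_gfree_cong:
  assumes R_one: "R \<one>\<^bsub>V gfree\<^esub> \<one>\<^bsub>V gfree\<^esub>"
    and R_mult: "\<And>a b c d. \<lbrakk>a \<in> carrier (V gfree); b \<in> carrier (V gfree); c \<in> carrier (V gfree);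
        d \<in> carrier (V gfree); R a b; R c d\<rbrakk> \<Longrightarrow> R (a \<otimes>\<^bsub>V gfree\<^esub> c) (b \<otimes>\<^bsub>V gfree\<^esub> d)"
    and D: "fin_gset G D" and k: "k \<in> gmap G D gfree"
    and ab: "a \<in> carrier (V D)" "b \<in> carrier (V D)"
    and R: "\<And>v. v \<in> gmap G gfree D \<Longrightarrow> R (res gfree D v a) (res gfree D v b)"
  shows "R (tr D gfree k a) (tr D gfree k b)"
  using D k ab R
proof (induction "card (pts D)" arbitrary: D k a b rule: less_induct)
  case (less D k a b)
  note D = less.prems(1) and k = less.prems(2) and a = less.prems(3) and b = less.prems(4)
  show ?case
  proof (cases "pts D = {}")
    case True
    then have "a = \<one>\<^bsub>V D\<^esub>" "b = \<one>\<^bsub>V D\<^esub>" using empty[OF D] a b by auto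
    then show ?thesis using tr_one[OF D fin_gset_gfree k] R_one by simp
  next
    case False
    then obtain s where s: "s \<in> gmap G gfree D" "gcomp gfree k s = gid gfree" "inj_on s (pts gfree)"
      by (rule gfree_section[OF D _ k]) (use False in auto)
    obtain C i where cov: "gcover G gfree C D s i" and card: "card (pts C) < card (pts D)"
      by (rule gcover_gfree[OF D s(1,3)])
    have C: "fin_gset G C" and i: "i \<in> gmap G C D"
      using cov by (auto simp: gcover_def)
    note card
    moreover have "R (res gfree C v (res C D i a)) (res gfree C v (res C D i b))"
      if v: "v \<in> gmap G gfree C" for v
      using less.prems(5)[OF gcomp_gmap[OF v i fin_gset_gfree]]
      by (simp only: res_comp[OF fin_gset_gfree C D v i a] res_comp[OF fin_gset_gfree C D v i b])
    ultimately have 1: "R (tr C gfree (gcomp C k i) (res C D i a)) (tr C gfree (gcomp C k i) (res C D i b))"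
      by (intro less.hyps gcomp_gmap[OF i k C] C res_closed[OF C D i] a b)
    have closed: "tr C gfree (gcomp C k i) (res C D i x) \<in> carrier (V gfree)"
      "res gfree D s x \<in> carrier (V gfree)" if "x \<in> carrier (V D)" for x
      using that by (auto intro!: tr_closed[OF C fin_gset_gfree gcomp_gmap[OF i k C]]
          res_closed[OF C D i] res_closed[OF fin_gset_gfree D s(1)])
    \<comment> \<open>On the copy of the orbit that was split off, the transfer runs along the
      composite of \<open>k\<close> and \<open>s\<close>, which is the identity; so this copy
      contributes the restriction along \<open>s\<close> itself.\<close>
    show ?thesis
      unfolding tr_gcover[OF cov fin_gset_gfree k a] tr_gcover[OF cov fin_gset_gfree k b] s(2)
      using closed a b 1 less.prems(5)[OF s(1)]
      by (intro R_mult) (simp_all add: tr_id[OF fin_gset_gfree])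
  qed
qed

end

section \<open>Tambara functors\<close>

locale finite_tambara = finite_group G + tambara_functor G T
  for G :: "('g, 'b) monoid_scheme" (structure) and T :: "('g, 'a) tambara"
begin

lemma add_semi_mackey:
  "semi_mackey G (\<lambda>X. \<lparr>carrier = carrier (tval T X), monoid.mult = add (tval T X), one = \<zero>\<^bsub>tval T X\<^esub>\<rparr>)
    (tres T) (ttr T)"
proof (intro semi_mackey.intro finite_group_axioms semi_mackey_axioms.intro, goal_cases)
  case (1 X)
  then interpret cring "tval T X" by (rule val)
  show ?case by (rule comm_monoidI) (auto simp: a_ac)
next
  case (2 X Y f) then show ?case using res_hom[of X Y f] by (auto simp: ring_hom_def hom_def)
next
  case (3 X Y f) then show ?case using tr_hom[of X Y f] by (auto simp: hom_def)
next
  case (4 X Y f)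
  then show ?case
    using ring_hom_zero[OF res_hom[of X Y f]] val[of X] val[of Y] by (simp add: cring.axioms(1))
next
  case (5 X Y f)
  then interpret X: cring "tval T X" by (simp add: val)
  interpret Y: cring "tval T Y" using 5 by (simp add: val)
  interpret group_hom "add_monoid (tval T X)" "add_monoid (tval T Y)" "ttr T X Y f"
    by (intro group_hom.intro group_hom_axioms.intro tr_hom[OF 5] X.a_group Y.a_group)
  show ?case using hom_one by simp
qed (simp_all add: res_id tr_id res_comp tr_comp sum empty tr_base_change)

lemma mult_semi_mackey: "semi_mackey G (tval T) (tres T) (tnm T)"
proof (intro semi_mackey.intro finite_group_axioms semi_mackey_axioms.intro, goal_cases)
  case (1 X)
  then interpret cring "tval T X" by (rule val)
  show ?case by (rule comm_monoid_axioms)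
next
  case (2 X Y f) then show ?case using res_hom[of X Y f] by (auto simp: ring_hom_def hom_def)
next
  case (4 X Y f) then show ?case using res_hom[of X Y f] by (rule_tac ring_hom_one)
next
  \<comment> \<open>The axiom makes the value at the empty set \<open>{0}\<close>, whereas the
    multiplicative half asks for \<open>{1}\<close>; the two agree because 1 is an element of this
    ring.\<close>
  case (11 X)
  then interpret cring "tval T X" by (simp add: val)
  show ?case using one_closed empty[OF 11] by auto
qed (simp_all add: nm_hom nm_one res_id nm_id res_comp nm_comp sum nm_base_change)

sublocale tradd: semi_mackey G
  "\<lambda>X. \<lparr>carrier = carrier (tval T X), monoid.mult = add (tval T X), one = \<zero>\<^bsub>tval T X\<^esub>\<rparr>" "tres T" "ttr T"
  by (rule add_semi_mackey)

sublocale trmul: semi_mackey G "tval T" "tres T" "tnm T"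
  by (rule mult_semi_mackey)

lemmas res_closed = trmul.res_closed
lemmas nm_closed = trmul.tr_closed
lemmas res_mult = trmul.res_mult
lemmas tr_closed = tradd.tr_closed[simplified]
lemmas res_add = tradd.res_mult[simplified]
lemmas tr_add = tradd.tr_mult[simplified]
lemmas res_zero = tradd.res_one[simplified]
lemmas tr_zero = tradd.tr_one[simplified]
lemmas res_one = trmul.res_one

lemma res_minus:
  assumes "fin_gset G X" "fin_gset G Y" "f \<in> gmap G X Y" "a \<in> carrier (tval T Y)" "b \<in> carrier (tval T Y)"
  shows "tres T X Y f (a \<ominus>\<^bsub>tval T Y\<^esub> b) = tres T X Y f a \<ominus>\<^bsub>tval T X\<^esub> tres T X Y f b"
proof -
  interpret X: cring "tval T X" using assms by (simp add: val)
  interpret Y: cring "tval T Y" using assms by (simp add: val)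
  interpret ring_hom_ring "tval T Y" "tval T X" "tres T X Y f"
    by (rule ring_hom_ringI2) (use res_hom[OF assms(1-3)] in \<open>auto intro: X.ring_axioms Y.ring_axioms\<close>)
  show ?thesis using assms by (simp add: a_minus_def)
qed

lemma tr_minus:
  assumes "fin_gset G X" "fin_gset G Y" "f \<in> gmap G X Y" "a \<in> carrier (tval T X)" "b \<in> carrier (tval T X)"
  shows "ttr T X Y f (a \<ominus>\<^bsub>tval T X\<^esub> b) = ttr T X Y f a \<ominus>\<^bsub>tval T Y\<^esub> ttr T X Y f b"
proof -
  interpret X: cring "tval T X" using assms by (simp add: val)
  interpret Y: cring "tval T Y" using assms by (simp add: val)
  have c: "ttr T X Y f (a \<ominus>\<^bsub>tval T X\<^esub> b) \<in> carrier (tval T Y)" "ttr T X Y f b \<in> carrier (tval T Y)"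
    using assms by (simp_all add: tr_closed)
  have "a \<ominus>\<^bsub>tval T X\<^esub> b \<oplus>\<^bsub>tval T X\<^esub> b = a"
    using assms by (simp add: a_minus_def X.a_assoc X.l_neg)
  then have "ttr T X Y f a = ttr T X Y f (a \<ominus>\<^bsub>tval T X\<^esub> b) \<oplus>\<^bsub>tval T Y\<^esub> ttr T X Y f b"
    using assms tr_add[OF assms(1-3), of "a \<ominus>\<^bsub>tval T X\<^esub> b" b] by simp
  then show ?thesis using c by (simp add: a_minus_def Y.a_assoc Y.r_neg)
qed

lemma sum_surj:
  assumes "fin_gset G X" "fin_gset G Y" "a \<in> carrier (tval T X)" "b \<in> carrier (tval T Y)"
  obtains t where "t \<in> carrier (tval T (gsum X Y))" "tres T X (gsum X Y) (ginl X) t = a"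
    "tres T Y (gsum X Y) (ginr Y) t = b"
proof -
  have "(a, b) \<in> (\<lambda>t. (tres T X (gsum X Y) (ginl X) t, tres T Y (gsum X Y) (ginr Y) t))
      ` carrier (tval T (gsum X Y))"
    using sum[OF assms(1,2)] assms(3,4) by (auto simp: bij_betw_def)
  then show ?thesis using that by auto
qed

text \<open>The fold map is the identity on each of the two copies of \<open>X\<close>, so the
  product formula \<open>trmul.tr_gcover\<close> applies.\<close>

lemma nm_fold:
  assumes X: "fin_gset G X" and t: "t \<in> carrier (tval T (gsum X X))"
  shows "tnm T (gsum X X) X (gcopair X X (gid X) (gid X)) t
    = tres T X (gsum X X) (ginl X) t \<otimes>\<^bsub>tval T X\<^esub> tres T X (gsum X X) (ginr X) t"
proof -
  let ?F = "gcopair X X (gid X) (gid X)"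
  have F: "?F \<in> gmap G (gsum X X) X" using X by (simp add: gcopair_gmap gid_gmap)
  have l: "gcomp X ?F (ginl X) = gid X"
    by (rule gmap_eqI[OF gcomp_gmap[OF ginl_gmap[OF X] F X] gid_gmap[OF X]]) simp
  have r: "gcomp X ?F (ginr X) = gid X"
    by (rule gmap_eqI[OF gcomp_gmap[OF ginr_gmap[OF X] F X] gid_gmap[OF X]]) simp
  have "tres T X (gsum X X) (ginl X) t \<in> carrier (tval T X)"
    "tres T X (gsum X X) (ginr X) t \<in> carrier (tval T X)"
    using t by (auto intro!: res_closed[OF X fin_gset_gsum[OF X X]] ginl_gmap[OF X] ginr_gmap[OF X])
  then show ?thesis
    using trmul.tr_gcover[OF gcover_gsum[OF X X] X F t] by (simp add: l r nm_id X)
qed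

text \<open>
  Frobenius reciprocity is the exponential law for the fold map of \<open>Y + Y\<close> and
  \<open>id + f: Y + X \<rightarrow> Y + Y\<close>: a section over the fibre \<open>{y, y}\<close> is a point of \<open>X\<close> above \<open>y\<close>.
\<close>

lemma frobenius:
  assumes X: "fin_gset G X" and Y: "fin_gset G Y" and f: "f \<in> gmap G X Y"
    and s: "s \<in> carrier (tval T Y)" and t: "t \<in> carrier (tval T X)"
  shows "ttr T X Y f (tres T X Y f s \<otimes>\<^bsub>tval T X\<^esub> t) = s \<otimes>\<^bsub>tval T Y\<^esub> ttr T X Y f t"
proof -
  define A B where "A = gsum Y X" and "B = gsum Y Y"
  define q where "q = gcopair Y X (ginl Y) (gcomp X (ginr Y) f)"
  define F where "F = gcopair Y Y (gid Y) (gid Y)"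
  have A: "fin_gset G A" and B: "fin_gset G B" using X Y
    by (simp_all add: A_def B_def fin_gset_gsum)
  have inl: "ginl Y \<in> gmap G Y A" "ginl Y \<in> gmap G Y B"
    and inr: "ginr X \<in> gmap G X A" "ginr Y \<in> gmap G Y B"
    using X Y by (simp_all add: A_def B_def ginl_gmap ginr_gmap)
  have q: "q \<in> gmap G A B"
    unfolding q_def A_def using gcomp_gmap[OF f inr(2) X] inl(2) X Y by (simp add: gcopair_gmap)
  have F: "F \<in> gmap G B Y" using Y by (simp add: F_def B_def gcopair_gmap gid_gmap)
  have q_l: "q (HInl y) = HInl y" if "y \<in> pts Y" for y using that by (simp add: q_def)
  have q_r: "q (HInr x) = HInr (f x)" if "x \<in> pts X" for x
    using that gmap_closed[OF f] by (simp add: q_def)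
  have F_l: "F (HInl y) = y" and F_r: "F (HInr y) = y" if "y \<in> pts Y" for y
    using that by (simp_all add: F_def)
  \<comment> \<open>The components of \<open>c\<close> are \<open>s\<close> and \<open>t\<close>.
    Its transfer along \<open>q\<close> has the components \<open>s\<close> and the transfer of
    \<open>t\<close>, and the norm along the fold map \<open>F\<close> multiplies them, which gives
    the right-hand side. The left-hand side will come from the exponential law.\<close>
  obtain c where c: "c \<in> carrier (tval T A)" "tres T Y A (ginl Y) c = s" "tres T X A (ginr X) c = t"
    using sum_surj[OF Y X s t] unfolding A_def by blast
  have "tres T Y B (ginl Y) (ttr T A B q c) = ttr T Y Y (gid Y) (tres T Y A (ginl Y) c)"
  proof (rule tradd.res_tr_pullback)
    show "gpullback G Y A Y B q (ginl Y) (gid Y) (ginl Y)"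
      by (rule gpullbackI[OF Y A Y B q inl(2) gid_gmap[OF Y] inl(1)])
        (auto simp: A_def pts_gsum q_l q_r)
  qed (use c in simp)
  then have L1: "tres T Y B (ginl Y) (ttr T A B q c) = s" using c s Y by (simp add: tr_id)
  have L2: "tres T Y B (ginr Y) (ttr T A B q c) = ttr T X Y f t"
    unfolding c(3)[symmetric]
  proof (rule tradd.res_tr_pullback)
    show "gpullback G X A Y B q (ginr Y) f (ginr X)"
      by (rule gpullbackI[OF X A Y B q inr(2) f inr(1)])
        (auto simp: A_def pts_gsum q_l q_r gmap_closed[OF f])
  qed (use c in simp)
  have L: "tnm T B Y F (ttr T A B q c) = s \<otimes>\<^bsub>tval T Y\<^esub> ttr T X Y f t"
    using nm_fold[OF Y, of "ttr T A B q c"] tr_closed[OF A B q c(1)] L1 L2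
    unfolding F_def B_def by simp
  interpret D: dep_data G A B Y q F
    by unfold_locales (fact A B Y q F)+
  let ?D = "gdep A B Y q F" and ?E = "gdep_dom A B Y q F"
  let ?p = "gdep_proj A B Y q F" and ?r = "gdep_snd A B Y q F" and ?e = "gdep_eval A B Y q F"
  \<comment> \<open>\<open>\<sigma> x\<close> is the section over the fibre of \<open>f x\<close>
    that is forced on the first copy of \<open>Y\<close> and takes the value \<open>x\<close> on the
    second. Every section has this form, so \<open>w\<close> below identifies \<open>X\<close> with
    the dependent product.\<close>
  define \<sigma> where "\<sigma> x = (\<lambda>z. case z of HInl y \<Rightarrow> HInl y | _ \<Rightarrow> HInr x)" for x :: "'g hf"
  have fib: "D.fib y = {HInl y, HInr y}" if "y \<in> pts Y" for y
    using that by (auto simp: B_def pts_gsum F_l F_r)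
  define w where "w = (\<lambda>x\<in>pts X. HPair (f x) (hgraph (D.fib (f x)) (\<sigma> x)))"
  have w_mem: "HPair (f x) (hgraph (D.fib (f x)) (\<sigma> x)) \<in> gdep_pts A B Y q F"
    if x: "x \<in> pts X" for x
    using x gmap_closed[OF f x]
    by (intro gdep_ptsI) (auto simp: B_def pts_gsum F_l F_r \<sigma>_def q_l q_r A_def)
  have w: "w \<in> gmap G X ?D"
  proof (rule gmapI)
    show "w \<in> extensional (pts X)" by (simp add: w_def)
  next
    fix x assume "x \<in> pts X" then show "w x \<in> pts ?D" using w_mem by (simp add: w_def)
  next
    fix g x assume g: "g \<in> carrier G" and x: "x \<in> pts X"
    note fx = gmap_closed[OF f x]
    have gfx: "action Y g (f x) \<in> pts Y" by (rule act_closed[OF Y g fx])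
    have "hgraph (D.fib (action Y g (f x))) (\<sigma> (action X g x))
        = hgraph (D.fib (action Y g (f x))) (\<lambda>z. action A g (\<sigma> x (action B (inv g) z)))"
      using g x fx gfx
      by (intro hgraph_cong, unfold fib[OF gfx]) (auto simp: \<sigma>_def A_def B_def act_inv_left[OF Y])
    then show "w (action X g x) = action ?D g (w x)"
      using g x act_closed[OF X g x]
      by (simp only: w_def restrict_apply if_True D.gdep_action[OF g w_mem[OF x]] gmap_equiv[OF f])
  qed
  have w_eval: "(HInr (f x), w x) \<in> {(a, b). HPair a b \<in> pts ?E}" "?e (HPair (HInr (f x)) (w x)) = HInr x"
    "HPair (HInl (f x)) (w x) \<in> pts ?E" "?e (HPair (HInl (f x)) (w x)) = HInl (f x)"
    if x: "x \<in> pts X" for x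
  proof -
    note fx = gmap_closed[OF f x]
    have wx: "w x = HPair (f x) (hgraph (D.fib (f x)) (\<sigma> x))" using x by (simp add: w_def)
    have B_l: "HInl (f x) \<in> pts B" and B_r: "HInr (f x) \<in> pts B" using fx
      by (auto simp: B_def pts_gsum)
    have p: "?p (w x) = f x" unfolding wx by (rule D.gdep_proj_apply[OF w_mem[OF x]])
    have wD: "w x \<in> gdep_pts A B Y q F" unfolding wx by (rule w_mem[OF x])
    show "(HInr (f x), w x) \<in> {(a, b). HPair a b \<in> pts ?E}" "HPair (HInl (f x)) (w x) \<in> pts ?E"
      using B_l B_r p fx wD by (simp_all add: gdep_dom_def F_l F_r)
    show "?e (HPair (HInr (f x)) (w x)) = HInr x"
      using gdep_eval_apply[OF fin_gset_finite[OF B] B_r, of F "\<sigma> x" A Y q] w_mem[OF x] fx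
      by (simp only: F_r wx) (simp add: \<sigma>_def)
    show "?e (HPair (HInl (f x)) (w x)) = HInl (f x)"
      using gdep_eval_apply[OF fin_gset_finite[OF B] B_l, of F "\<sigma> x" A Y q] w_mem[OF x] fx
      by (simp only: F_l wx) (simp add: \<sigma>_def)
  qed
  have w_fst: "?p (w x) = f x" if "x \<in> pts X" for x
    using D.gdep_proj_apply[OF w_mem[OF that]] that by (simp add: w_def)
  have w_inj: "x = x'" if "x \<in> pts X" "x' \<in> pts X" "w x = w x'" for x x'
    using w_eval(2)[OF that(1)] w_eval(2)[OF that(2)] w_fst[OF that(1)] w_fst[OF that(2)] that(3)
      by simp
  have bw: "bij_betw w (pts X) (pts ?D)"
    unfolding bij_betw_def
  proof
    show "inj_on w (pts X)" using w_inj by (auto intro: inj_onI)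
    show "w ` pts X = pts ?D"
    proof
      show "w ` pts X \<subseteq> pts ?D" using gmap_closed[OF w] by blast
      show "pts ?D \<subseteq> w ` pts X"
      proof
        fix p assume "p \<in> pts ?D"
        then have "p \<in> gdep_pts A B Y q F" by simp
        then show "p \<in> w ` pts X"
        proof (cases rule: gdep_cases)
          case (1 y s)
          have Bz: "HInl y \<in> pts B" "HInr y \<in> pts B" using 1(2) by (auto simp: B_def pts_gsum)
          have sl: "s (HInl y) \<in> pts A" "q (s (HInl y)) = HInl y"
            and sr: "s (HInr y) \<in> pts A" "q (s (HInr y)) = HInr y"
            using 1(3,4) Bz F_l[OF 1(2)] F_r[OF 1(2)] by auto
          have s_l: "s (HInl y) = HInl y" using sl by (auto simp: A_def pts_gsum q_l q_r)
          obtain x where x: "x \<in> pts X" "s (HInr y) = HInr x" "f x = y"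
            using sr by (auto simp: A_def pts_gsum q_l q_r)
          have "hgraph (D.fib y) s = hgraph (D.fib y) (\<sigma> x)"
            using x s_l by (intro hgraph_cong) (auto simp: fib[OF 1(2)] \<sigma>_def)
          then have "p = w x" using 1(1) x by (simp add: w_def)
          then show ?thesis using x by blast
        qed
      qed
    qed
  qed
  \<comment> \<open>The fibres of \<open>?r\<close> have two points, one for each copy of
    \<open>Y\<close>; \<open>k\<close> exhibits two copies of \<open>X\<close> as the fibre product
    of \<open>?r\<close> and \<open>w\<close>.\<close>
  define k where "k = gcopair X X (gpair X (gcomp X (ginl Y) f) w) (gpair X (gcomp X (ginr Y) f) w)"
  have k_l: "k (HInl x) = HPair (HInl (f x)) (w x)" and k_r: "k (HInr x) = HPair (HInr (f x)) (w x)"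
    if "x \<in> pts X" for x using that gmap_closed[OF f that] by (simp_all add: k_def)
  note XX = fin_gset_gsum[OF X X]
  have k: "k \<in> gmap G (gsum X X) ?E"
  proof (rule gmapI)
    show "k \<in> extensional (pts (gsum X X))" by (simp add: k_def gcopair_def)
  next
    fix z assume "z \<in> pts (gsum X X)"
    then show "k z \<in> pts ?E" using w_eval by (auto simp: pts_gsum k_l k_r)
  next
    fix g z assume g: "g \<in> carrier G" and z: "z \<in> pts (gsum X X)"
    have E_act: "action ?E g (HPair a (w x)) = HPair (action B g a) (action ?D g (w x))"
      if "HPair a (w x) \<in> pts ?E" for a x
      using that by (simp add: gdep_dom_def)
    from z show "k (action (gsum X X) g z) = action ?E g (k z)"
      using w_eval g
      by (auto simp: pts_gsum k_l k_r act_closed[OF X] E_act gmap_equiv[OF f] gmap_equiv[OF w])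
        (auto simp: B_def gmap_closed[OF f])
  qed
  define N where "N = gcopair X X (gid X) (gid X)"
  have N: "N \<in> gmap G (gsum X X) X" using X by (simp add: N_def gcopair_gmap gid_gmap)
  have pb: "gpullback G (gsum X X) ?E X ?D ?r w N k"
  proof (rule gpullbackI[OF XX D.fin_gset_gdep_dom X D.fin_gset_gdep D.gdep_snd_gmap w N k])
    have r_ap: "?r (HPair a b) = b" if "HPair a b \<in> pts ?E" for a b
      using that by (simp add: gdep_snd_def gdep_dom_def)
    show "?r (k z) = w (N z)" if "z \<in> pts (gsum X X)" for z
      using that w_eval by (auto simp: pts_gsum k_l k_r N_def r_ap)
    show "z = z'" if "z \<in> pts (gsum X X)" "z' \<in> pts (gsum X X)" "k z = k z'" "N z = N z'" for z z'
      using that by (auto simp: pts_gsum k_l k_r N_def)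
    show "\<exists>z\<in>pts (gsum X X). k z = u \<and> N z = x"
      if u: "u \<in> pts ?E" and x: "x \<in> pts X" and eq: "?r u = w x" for u x
    proof -
      obtain b d where bd: "u = HPair b d" "b \<in> pts B" "F b = ?p d"
        using u by (auto simp: gdep_dom_def elim!: gpb_cases)
      have "d = w x" using r_ap[of b d] u eq bd(1) by simp
      then have "F b = f x" using bd(3) w_fst[OF x] by simp
      then have "b = HInl (f x) \<or> b = HInr (f x)"
        using bd(2) fib[OF gmap_closed[OF f x]] by auto
      then show ?thesis
      proof
        assume "b = HInl (f x)"
        then show ?thesis
          using x bd \<open>d = w x\<close> by (intro bexI[of _ "HInl x"]) (auto simp: k_l N_def pts_gsum)
      next
        assume "b = HInr (f x)"
        then show ?thesis
          using x bd \<open>d = w x\<close> by (intro bexI[of _ "HInr x"]) (auto simp: k_r N_def pts_gsum)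
      qed
    qed
  qed
  let ?v = "tres T ?E A ?e c"
  have v: "?v \<in> carrier (tval T ?E)"
    by (rule res_closed[OF D.fin_gset_gdep_dom A D.gdep_eval_gmap c(1)])
  have nv: "tnm T ?E ?D ?r ?v \<in> carrier (tval T ?D)"
    by (rule nm_closed[OF D.fin_gset_gdep_dom D.fin_gset_gdep D.gdep_snd_gmap v])
  have pw: "gcomp X ?p w = f"
    by (rule gmap_eqI[OF gcomp_gmap[OF w D.gdep_proj_gmap X] f]) (simp add: w_fst)
  \<comment> \<open>Followed by \<open>?e\<close>, the map \<open>k\<close> is \<open>f\<close> into
    the summand \<open>Y\<close> on the first copy of \<open>X\<close>, and the inclusion of
    \<open>X\<close> on the second. So \<open>c\<close>, restricted along the composite, has as
    components the restriction of \<open>s\<close> and \<open>t\<close>, and the norm along the fold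
    map multiplies them.\<close>
  have ek_l: "gcomp X (gcomp (gsum X X) ?e k) (ginl X) = gcomp X (ginl Y) f"
    using w_eval gmap_closed[OF f]
    by (auto simp: gcomp_def compose_def fun_eq_iff pts_gsum k_l)
  have ek_r: "gcomp X (gcomp (gsum X X) ?e k) (ginr X) = ginr X"
    using w_eval gmap_closed[OF f]
    by (auto simp: gcomp_def compose_def fun_eq_iff pts_gsum k_r ginr_def)
  note ek = gcomp_gmap[OF k D.gdep_eval_gmap XX]
  have "tnm T B Y F (ttr T A B q c) = ttr T ?D Y ?p (tnm T ?E ?D ?r ?v)"
    by (rule exponential[OF A B Y q F c(1)])
  also have "\<dots> = ttr T ?D Y ?p (ttr T X ?D w (tres T X ?D w (tnm T ?E ?D ?r ?v)))"
    using tradd.tr_res_iso[OF X D.fin_gset_gdep w bw] nv by simp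
  also have "\<dots> = ttr T X Y f (tres T X ?D w (tnm T ?E ?D ?r ?v))"
    using tr_comp[OF X D.fin_gset_gdep Y w D.gdep_proj_gmap res_closed[OF X D.fin_gset_gdep w nv]] pw by simp
  also have "tres T X ?D w (tnm T ?E ?D ?r ?v) = tnm T (gsum X X) X N (tres T (gsum X X) ?E k ?v)"
    by (rule trmul.res_tr_pullback[OF pb v])
  also have "tres T (gsum X X) ?E k ?v = tres T (gsum X X) A (gcomp (gsum X X) ?e k) c"
    by (rule res_comp[OF XX D.fin_gset_gdep_dom A k D.gdep_eval_gmap c(1), symmetric])
  also have "tnm T (gsum X X) X N \<dots> = tres T X A (gcomp X (ginl Y) f) c \<otimes>\<^bsub>tval T X\<^esub> tres T X A (ginr X) c"
    using nm_fold[OF X res_closed[OF XX A ek c(1)]]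
      res_comp[OF X XX A ginl_gmap[OF X] ek c(1)] res_comp[OF X XX A ginr_gmap[OF X] ek c(1)]
    by (simp add: N_def ek_l ek_r)
  also have "tres T X A (gcomp X (ginl Y) f) c = tres T X Y f s"
    using res_comp[OF X Y A f inl(1) c(1)] c(2) by simp
  finally show ?thesis using L c(3) by simp
qed

text \<open>Zero is the transfer of zero from the empty G-set. In the exponential law there is no
  section into the empty set over the nonempty fibres of \<open>f\<close>, so the dependent product
  is empty and the result is a transfer from the zero ring.\<close>

lemma nm_zero:
  assumes X: "fin_gset G X" and Y: "fin_gset G Y" and f: "f \<in> gmap G X Y"
    and surj: "f ` pts X = pts Y"
  shows "tnm T X Y f \<zero>\<^bsub>tval T X\<^esub> = \<zero>\<^bsub>tval T Y\<^esub>"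
proof -
  have st: "gstable G X {}" by (simp add: gstable_def)
  let ?A = "gsub X {}" and ?q = "ginc {}"
  have A: "fin_gset G ?A" and q: "?q \<in> gmap G ?A X"
    using fin_gset_gsub[OF X st] ginc_gmap[OF st] .
  interpret D: dep_data G ?A X Y ?q f by unfold_locales (fact A X Y q f)+
  let ?D = "gdep ?A X Y ?q f"
  have "pts ?D = {}"
  proof (rule equals0I)
    fix p assume "p \<in> pts ?D"
    then have "p \<in> gdep_pts ?A X Y ?q f" by simp
    then show False
    proof (cases rule: gdep_cases)
      case (1 y s)
      obtain x where "x \<in> pts X" "f x = y" using 1(2) surj by (metis imageE)
      then show False using 1(3) by simp
    qed
  qed
  then have D: "carrier (tval T ?D) = {\<zero>\<^bsub>tval T ?D\<^esub>}" by (intro empty[OF D.fin_gset_gdep])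
  interpret A: cring "tval T ?A" by (rule val[OF A])
  have "tnm T (gdep_dom ?A X Y ?q f) ?D (gdep_snd ?A X Y ?q f)
      (tres T (gdep_dom ?A X Y ?q f) ?A (gdep_eval ?A X Y ?q f) \<zero>\<^bsub>tval T ?A\<^esub>) \<in> carrier (tval T ?D)"
    by (intro nm_closed[OF D.fin_gset_gdep_dom D.fin_gset_gdep D.gdep_snd_gmap]
        res_closed[OF D.fin_gset_gdep_dom A D.gdep_eval_gmap]) simp
  then have "tnm T X Y f (ttr T ?A X ?q \<zero>\<^bsub>tval T ?A\<^esub>) = \<zero>\<^bsub>tval T Y\<^esub>"
    using exponential[OF A X Y q f A.zero_closed] D tr_zero[OF D.fin_gset_gdep Y D.gdep_proj_gmap]
      by simp
  then show ?thesis using tr_zero[OF A X q] by simp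
qed

end

section \<open>Congruences and quotients of Tambara functors\<close>

lemma coset_Union:
  assumes I: "ideal I R" and J: "ideal J S" and t: "t \<in> carrier R"
    and closed: "\<And>a. a \<in> carrier R \<Longrightarrow> h a \<in> carrier S"
    and cong: "\<And>a b. a \<in> carrier R \<Longrightarrow> b \<in> carrier R \<Longrightarrow> a \<ominus>\<^bsub>R\<^esub> b \<in> I \<Longrightarrow> h a \<ominus>\<^bsub>S\<^esub> h b \<in> J"
  shows "(\<Union>c\<in>I +>\<^bsub>R\<^esub> t. J +>\<^bsub>S\<^esub> h c) = J +>\<^bsub>S\<^esub> h t"
proof -
  interpret I: ideal I R by fact
  interpret J: ideal J S by fact
  have "J +>\<^bsub>S\<^esub> h c = J +>\<^bsub>S\<^esub> h t" if c: "c \<in> I +>\<^bsub>R\<^esub> t" for c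
  proof -
    have c': "c \<in> carrier R" using c t I.a_elemrcos_carrier by blast
    have "I +>\<^bsub>R\<^esub> c = I +>\<^bsub>R\<^esub> t" using I.a_repr_independence' c t by simp
    then have "c \<ominus>\<^bsub>R\<^esub> t \<in> I" using I.quotient_eq_iff_same_a_r_cos[OF I c' t] by simp
    then show ?thesis
      using J.quotient_eq_iff_same_a_r_cos[OF J closed[OF c'] closed[OF t]] cong[OF c' t] by simp
  qed
  moreover have "t \<in> I +>\<^bsub>R\<^esub> t" by (rule I.a_rcos_self[OF t])
  ultimately show ?thesis by blast
qed

text \<open>The conditions that make the operations on cosets well defined. Norms are not additive,
  so \<open>I_nm\<close> speaks of differences. \<open>I_sum\<close> says that membership is tested
  on the summands of a disjoint union, which makes the quotient additive.\<close>

locale tambara_congruence = finite_tambara G T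
  for G :: "('g, 'b) monoid_scheme" (structure) and T :: "('g, 'a) tambara" +
  fixes I :: "'g gset \<Rightarrow> 'a set"
  assumes I_ideal: "fin_gset G X \<Longrightarrow> ideal (I X) (tval T X)"
    and I_res: "\<lbrakk>fin_gset G X; fin_gset G Y; f \<in> gmap G X Y; t \<in> I Y\<rbrakk> \<Longrightarrow> tres T X Y f t \<in> I X"
    and I_tr: "\<lbrakk>fin_gset G X; fin_gset G Y; f \<in> gmap G X Y; t \<in> I X\<rbrakk> \<Longrightarrow> ttr T X Y f t \<in> I Y"
    and I_nm: "\<lbrakk>fin_gset G X; fin_gset G Y; f \<in> gmap G X Y; a \<in> carrier (tval T X);
        b \<in> carrier (tval T X); a \<ominus>\<^bsub>tval T X\<^esub> b \<in> I X\<rbrakk>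
      \<Longrightarrow> tnm T X Y f a \<ominus>\<^bsub>tval T Y\<^esub> tnm T X Y f b \<in> I Y"
    and I_sum: "\<lbrakk>fin_gset G X; fin_gset G Y; t \<in> carrier (tval T (gsum X Y));
        tres T X (gsum X Y) (ginl X) t \<in> I X; tres T Y (gsum X Y) (ginr Y) t \<in> I Y\<rbrakk>
      \<Longrightarrow> t \<in> I (gsum X Y)"
begin

abbreviation cl :: "'g gset \<Rightarrow> 'a \<Rightarrow> 'a set" where "cl X t \<equiv> I X +>\<^bsub>tval T X\<^esub> t"

abbreviation Q where "Q \<equiv> tambara_quot T I"

lemma I_carrier: "fin_gset G X \<Longrightarrow> t \<in> I X \<Longrightarrow> t \<in> carrier (tval T X)"
  using ideal.Icarr[OF I_ideal] by simp

lemma tval_quot: "tval Q X = tval T X Quot I X"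
  by (simp add: tambara_quot_def)

lemma carrier_quot: "carrier (tval Q X) = cl X ` carrier (tval T X)"
  by (auto simp: tval_quot FactRing_def A_RCOSETS_def' a_r_coset_def')

lemma cl_closed: "t \<in> carrier (tval T X) \<Longrightarrow> cl X t \<in> carrier (tval Q X)"
  by (auto simp: carrier_quot)

lemma cl_ring_hom: "fin_gset G X \<Longrightarrow> cl X \<in> ring_hom (tval T X) (tval Q X)"
  unfolding tval_quot by (rule ideal.rcos_ring_hom[OF I_ideal])

lemma cl_eq_iff:
  "fin_gset G X \<Longrightarrow> s \<in> carrier (tval T X) \<Longrightarrow> t \<in> carrier (tval T X)
    \<Longrightarrow> cl X s = cl X t \<longleftrightarrow> s \<ominus>\<^bsub>tval T X\<^esub> t \<in> I X"
  using ring.quotient_eq_iff_same_a_r_cos[OF cring.axioms(1)[OF val] I_ideal] by simp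

lemma zero_quot: "\<zero>\<^bsub>tval Q X\<^esub> = I X"
  by (simp add: tval_quot FactRing_def)

lemma cl_zero_iff:
  assumes X: "fin_gset G X" and t: "t \<in> carrier (tval T X)"
  shows "cl X t = \<zero>\<^bsub>tval Q X\<^esub> \<longleftrightarrow> t \<in> I X"
  using ideal.rcos_const_imp_mem[OF I_ideal[OF X] t]
    ring.a_rcos_zero[OF cring.axioms(1)[OF val[OF X]] I_ideal[OF X]]
  by (auto simp: zero_quot)

lemma tres_quot:
  assumes X: "fin_gset G X" and Y: "fin_gset G Y" and f: "f \<in> gmap G X Y"
    and t: "t \<in> carrier (tval T Y)"
  shows "tres Q X Y f (cl Y t) = cl X (tres T X Y f t)"
  unfolding tambara_quot_def tambara.simps
  by (rule coset_Union[OF I_ideal[OF Y] I_ideal[OF X] t res_closed[OF X Y f]])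
    (use I_res[OF X Y f] in \<open>simp_all add: res_minus[OF X Y f, symmetric]\<close>)

lemma ttr_quot:
  assumes X: "fin_gset G X" and Y: "fin_gset G Y" and f: "f \<in> gmap G X Y"
    and t: "t \<in> carrier (tval T X)"
  shows "ttr Q X Y f (cl X t) = cl Y (ttr T X Y f t)"
  unfolding tambara_quot_def tambara.simps
  by (rule coset_Union[OF I_ideal[OF X] I_ideal[OF Y] t tr_closed[OF X Y f]])
    (use I_tr[OF X Y f] in \<open>simp_all add: tr_minus[OF X Y f, symmetric]\<close>)

lemma tnm_quot:
  assumes X: "fin_gset G X" and Y: "fin_gset G Y" and f: "f \<in> gmap G X Y"
    and t: "t \<in> carrier (tval T X)"
  shows "tnm Q X Y f (cl X t) = cl Y (tnm T X Y f t)"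
  unfolding tambara_quot_def tambara.simps
  by (rule coset_Union[OF I_ideal[OF X] I_ideal[OF Y] t nm_closed[OF X Y f]])
    (use I_nm[OF X Y f] in simp_all)

lemmas cl_simps = ring_hom_mult[OF cl_ring_hom, symmetric] ring_hom_add[OF cl_ring_hom, symmetric]
  ring_hom_one[OF cl_ring_hom, symmetric]

text \<open>All operations commute with the surjections \<open>cl X\<close>, so each axiom is the
  axiom of \<open>T\<close> for representatives. The injectivity half of additivity is where
  \<open>I_sum\<close> enters.\<close>

lemma tambara_functor_quot: "tambara_functor G Q"
proof (rule tambara_functor.intro, goal_cases)
  case (1 X)
  then show ?case unfolding tval_quot using ideal.quotient_is_cring[OF I_ideal[OF 1] val[OF 1]]
    by simp
next
  case (2 X Y f)
  interpret Y: cring "tval T Y" using 2 by (simp add: val)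
  show ?case
    by (rule ring_hom_memI)
      (use 2 in \<open>auto simp: carrier_quot tres_quot cl_simps res_mult res_add res_one res_closed\<close>)
next
  case (3 X Y f)
  interpret X: cring "tval T X" using 3 by (simp add: val)
  show ?case
    by (rule homI) (use 3 in \<open>auto simp: carrier_quot ttr_quot cl_simps tr_add tr_closed\<close>)
next
  case (4 X Y f)
  interpret X: cring "tval T X" using 4 by (simp add: val)
  show ?case
    by (rule homI) (use 4 in \<open>auto simp: carrier_quot tnm_quot cl_simps trmul.tr_mult nm_closed\<close>)
next
  case (5 X Y f)
  interpret X: cring "tval T X" using 5 by (simp add: val)
  show ?case
    using tnm_quot[OF 5 X.one_closed] nm_one[OF 5]
    by (simp add: ring_hom_one[OF cl_ring_hom[OF 5(1)]] ring_hom_one[OF cl_ring_hom[OF 5(2)]])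
next
  case (6 X t) then show ?case by (auto simp: carrier_quot tres_quot gid_gmap res_id)
next
  case (7 X t) then show ?case by (auto simp: carrier_quot ttr_quot gid_gmap tr_id)
next
  case (8 X t) then show ?case by (auto simp: carrier_quot tnm_quot gid_gmap nm_id)
next
  case (9 X Y Z f h t)
  then show ?case by (auto simp: carrier_quot tres_quot gcomp_gmap[of f X Y h Z] res_comp res_closed)
next
  case (10 X Y Z f h t)
  then show ?case by (auto simp: carrier_quot ttr_quot gcomp_gmap[of f X Y h Z] tr_comp tr_closed)
next
  case (11 X Y Z f h t)
  then show ?case by (auto simp: carrier_quot tnm_quot gcomp_gmap[of f X Y h Z] nm_comp nm_closed)
next
  case (12 X Y)
  note S = fin_gset_gsum[OF 12] and l = ginl_gmap[OF 12(1), of Y] and r = ginr_gmap[OF 12(2), of X]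
  note q = tres_quot[OF 12(1) S l] tres_quot[OF 12(2) S r]
  interpret S: cring "tval T (gsum X Y)" by (rule val[OF S])
  show ?case
    unfolding bij_betw_def
  proof
    show "inj_on (\<lambda>t. (tres Q X (gsum X Y) (ginl X) t, tres Q Y (gsum X Y) (ginr Y) t))
        (carrier (tval Q (gsum X Y)))"
    proof (rule inj_onI)
      fix c d
      assume cd: "c \<in> carrier (tval Q (gsum X Y))" "d \<in> carrier (tval Q (gsum X Y))"
        and eq: "(tres Q X (gsum X Y) (ginl X) c, tres Q Y (gsum X Y) (ginr Y) c)
          = (tres Q X (gsum X Y) (ginl X) d, tres Q Y (gsum X Y) (ginr Y) d)"
      from cd obtain s t where st: "s \<in> carrier (tval T (gsum X Y))" "t \<in> carrier (tval T (gsum X Y))"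
        "c = cl (gsum X Y) s" "d = cl (gsum X Y) t"
        unfolding carrier_quot by blast
      have "s \<ominus>\<^bsub>tval T (gsum X Y)\<^esub> t \<in> I (gsum X Y)"
        using eq st 12
        by (intro I_sum[OF 12])
          (simp_all add: q cl_eq_iff res_minus[OF 12(1) S l] res_minus[OF 12(2) S r]
            res_closed[OF 12(1) S l] res_closed[OF 12(2) S r])
      then show "c = d" using st by (simp add: cl_eq_iff[OF S])
    qed
    show "(\<lambda>t. (tres Q X (gsum X Y) (ginl X) t, tres Q Y (gsum X Y) (ginr Y) t))
        ` carrier (tval Q (gsum X Y)) = carrier (tval Q X) \<times> carrier (tval Q Y)" (is "?h ` _ = _")
    proof
      show "?h ` carrier (tval Q (gsum X Y)) \<subseteq> carrier (tval Q X) \<times> carrier (tval Q Y)"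
        by (auto simp: carrier_quot q res_closed[OF 12(1) S l] res_closed[OF 12(2) S r])
      show "carrier (tval Q X) \<times> carrier (tval Q Y) \<subseteq> ?h ` carrier (tval Q (gsum X Y))"
      proof
        fix p assume "p \<in> carrier (tval Q X) \<times> carrier (tval Q Y)"
        then obtain a b where ab: "a \<in> carrier (tval T X)" "b \<in> carrier (tval T Y)" "p = (cl X a, cl Y b)"
          by (auto simp: carrier_quot)
        obtain t where "t \<in> carrier (tval T (gsum X Y))" "tres T X (gsum X Y) (ginl X) t = a"
          "tres T Y (gsum X Y) (ginr Y) t = b"
          using sum_surj[OF 12 ab(1,2)] by blast
        then show "p \<in> ?h ` carrier (tval Q (gsum X Y))"
          by (intro image_eqI[of _ _ "cl (gsum X Y) t"]) (simp_all add: q ab cl_closed)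
      qed
    qed
  qed
next
  case (13 X)
  then have "cl X \<zero>\<^bsub>tval T X\<^esub> = \<zero>\<^bsub>tval Q X\<^esub>"
    using ring_hom_zero[OF cl_ring_hom[OF 13(1)]] ideal.quotient_is_ring[OF I_ideal[OF 13(1)]]
      val[OF 13(1)] by (simp add: cring.axioms(1) tval_quot)
  then show ?case by (simp add: carrier_quot empty[OF 13])
next
  case (14 X Y Y' f h t)
  note g = fin_gset_gpb[OF 14(1,3,4,5)] gpb_fst_gmap[OF 14(1,3,4,5)] gpb_snd_gmap[OF 14(1,3,4,5)]
  from 14 show ?case
    by (auto simp: carrier_quot ttr_quot tres_quot tr_closed res_closed g tr_base_change
        tres_quot[OF g(1) 14(1) g(2)] ttr_quot[OF g(1) 14(3) g(3)] res_closed[OF g(1) 14(1) g(2)])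
next
  case (15 X Y Y' f h t)
  note g = fin_gset_gpb[OF 15(1,3,4,5)] gpb_fst_gmap[OF 15(1,3,4,5)] gpb_snd_gmap[OF 15(1,3,4,5)]
  from 15 show ?case
    by (auto simp: carrier_quot tnm_quot tres_quot nm_closed res_closed g nm_base_change
        tres_quot[OF g(1) 15(1) g(2)] tnm_quot[OF g(1) 15(3) g(3)] res_closed[OF g(1) 15(1) g(2)])
next
  case (16 A X Y q f t)
  interpret D: dep_data G A X Y q f by unfold_locales (use 16 in auto)
  from 16(6) obtain s where s: "s \<in> carrier (tval T A)" "t = cl A s" by (auto simp: carrier_quot)
  note c1 = tr_closed[OF 16(1,2,4) s(1)]
    and c2 = res_closed[OF D.fin_gset_gdep_dom 16(1) D.gdep_eval_gmap s(1)]
  note c3 = nm_closed[OF D.fin_gset_gdep_dom D.fin_gset_gdep D.gdep_snd_gmap c2]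
  show ?case
    unfolding s(2) ttr_quot[OF 16(1,2,4) s(1)] tnm_quot[OF 16(2,3,5) c1]
      tres_quot[OF D.fin_gset_gdep_dom 16(1) D.gdep_eval_gmap s(1)]
      tnm_quot[OF D.fin_gset_gdep_dom D.fin_gset_gdep D.gdep_snd_gmap c2]
      ttr_quot[OF D.fin_gset_gdep 16(3) D.gdep_proj_gmap c3]
      exponential[OF 16(1-5) s(1)] ..
qed

lemma tambara_map_quot: "tambara_map G T Q cl"
  by (simp add: tambara_map_def cl_ring_hom tres_quot ttr_quot tnm_quot)

text \<open>\<open>I\<close> is the kernel of the projection to \<open>Q\<close>, whose values
  consist of cosets and so have the type over which \<open>tambara_ideal\<close> lets the target
  range.\<close>

lemma tambara_ideal_congruence:
  assumes "I \<in> extensional {X. fin_gset G X}" shows "tambara_ideal G T I"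
  unfolding tambara_ideal_def
proof (intro conjI assms exI allI impI)
  show "tambara_functor G Q" by (rule tambara_functor_quot)
  show "tambara_map G T Q cl" by (rule tambara_map_quot)
  show "I X = a_kernel (tval T X) (tval Q X) (cl X)" if X: "fin_gset G X" for X
    using cl_zero_iff[OF X] I_carrier[OF X] by (auto simp: a_kernel_def')
qed

text \<open>Norms along surjections preserve zero, so an ideal that contains 1 somewhere over free orbits is everything.\<close>

lemma proper_at_gfree:
  assumes "proper_family G T I" shows "\<one>\<^bsub>tval T gfree\<^esub> \<notin> I gfree"
proof
  assume one: "\<one>\<^bsub>tval T gfree\<^esub> \<in> I gfree"
  have "I X = carrier (tval T X)" if X: "fin_gset G X" for X
  proof -
    let ?P = "gprod X gfree"
    note P = fin_gset_gprod[OF X fin_gset_gfree]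
    note fst = gfst_gmap[OF X fin_gset_gfree] and snd = gsnd_gmap[OF X fin_gset_gfree]
    interpret P: cring "tval T ?P" by (rule val[OF P])
    interpret X: cring "tval T X" by (rule val[OF X])
    have "\<one>\<^bsub>tval T ?P\<^esub> \<in> I ?P"
      using I_res[OF P fin_gset_gfree snd one] res_one[OF P fin_gset_gfree snd] by simp
    then have "\<one>\<^bsub>tval T ?P\<^esub> \<ominus>\<^bsub>tval T ?P\<^esub> \<zero>\<^bsub>tval T ?P\<^esub> \<in> I ?P" by (simp add: a_minus_def)
    then have "tnm T ?P X (gfst X gfree) \<one>\<^bsub>tval T ?P\<^esub>
        \<ominus>\<^bsub>tval T X\<^esub> tnm T ?P X (gfst X gfree) \<zero>\<^bsub>tval T ?P\<^esub> \<in> I X"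
      by (intro I_nm[OF P X fst]) simp_all
    moreover have "gfst X gfree ` pts ?P = pts X"
    proof
      show "gfst X gfree ` pts ?P \<subseteq> pts X" using gmap_closed[OF fst] by blast
      show "pts X \<subseteq> gfst X gfree ` pts ?P"
      proof
        fix x assume "x \<in> pts X"
        then show "x \<in> gfst X gfree ` pts ?P"
          using gbase_pts by (intro image_eqI[of _ _ "HPair x gbase"]) simp_all
      qed
    qed
    ultimately have "\<one>\<^bsub>tval T X\<^esub> \<in> I X"
      using nm_one[OF P X fst] nm_zero[OF P X fst] by (simp add: a_minus_def)
    then show ?thesis using ideal.one_imp_carrier[OF I_ideal[OF X]] by simp
  qed
  then show False using assms by (auto simp: proper_family_def)
qed

end

section \<open>From invariant ideals over the free orbit to maximal Tambara ideals\<close>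

context finite_tambara
begin

text \<open>If a difference lies in the kernel, then the two elements have the same image, and so
  have their norms. \<open>I_sum\<close> is the additivity of the target.\<close>

lemma tambara_ideal_imp_congruence:
  assumes "tambara_ideal G T I" shows "tambara_congruence G T I"
proof -
  obtain S :: "('g, 'a set) tambara" and \<phi> where S: "tambara_functor G S"
    and \<phi>: "tambara_map G T S \<phi>"
    and I: "\<And>X. fin_gset G X \<Longrightarrow> I X = a_kernel (tval T X) (tval S X) (\<phi> X)"
    using assms by (auto simp: tambara_ideal_def)
  interpret S: finite_tambara G S using S finite_group_axioms by (simp add: finite_tambara_def)
  have hom: "ring_hom_ring (tval T X) (tval S X) (\<phi> X)" if "fin_gset G X" for X
    using \<phi> val[OF that] S.val[OF that] that
    by (intro ring_hom_ringI2) (auto simp: tambara_map_def cring.axioms(1))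
  have mem: "t \<in> I X \<longleftrightarrow> t \<in> carrier (tval T X) \<and> \<phi> X t = \<zero>\<^bsub>tval S X\<^esub>" if "fin_gset G X" for X t
    using I[OF that] by (auto simp: a_kernel_def')
  note \<phi>_ops = \<phi>[unfolded tambara_map_def, THEN conjunct2, rule_format]
  show ?thesis
  proof (intro tambara_congruence.intro finite_tambara_axioms tambara_congruence_axioms.intro, goal_cases)
    case (1 X) then show ?case using ring_hom_ring.kernel_is_ideal[OF hom] I by simp
  next
    case (2 X Y f t)
    then show ?case using \<phi>_ops[of X Y f] by (simp add: mem res_closed S.res_zero)
  next
    case (3 X Y f t)
    then show ?case using \<phi>_ops[of X Y f] by (simp add: mem tr_closed S.tr_zero)
  next
    case (4 X Y f a b)
    interpret X: ring_hom_ring "tval T X" "tval S X" "\<phi> X" by (rule hom[OF 4(1)])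
    interpret Y: ring_hom_ring "tval T Y" "tval S Y" "\<phi> Y" by (rule hom[OF 4(2)])
    have c: "tnm T X Y f a \<in> carrier (tval T Y)" "tnm T X Y f b \<in> carrier (tval T Y)"
      using 4 by (simp_all add: nm_closed)
    have "\<phi> X a \<oplus>\<^bsub>tval S X\<^esub> (\<ominus>\<^bsub>tval S X\<^esub> \<phi> X b) = \<zero>\<^bsub>tval S X\<^esub>"
      using 4 by (simp add: mem a_minus_def)
    then have "\<phi> X a = \<phi> X b"
      using 4 by (metis X.S.minus_equality X.S.minus_minus X.hom_closed X.S.a_inv_closed)
    then have "\<phi> Y (tnm T X Y f a) = \<phi> Y (tnm T X Y f b)" using 4 \<phi>_ops[of X Y f] by simp
    then show ?case using 4 c by (simp add: mem a_minus_def Y.S.r_neg)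
  next
    case (5 X Y t)
    note S' = fin_gset_gsum[OF 5(1,2)]
    note l = ginl_gmap[OF 5(1), of Y] and r = ginr_gmap[OF 5(2), of X]
    have "\<phi> (gsum X Y) t = \<zero>\<^bsub>tval S (gsum X Y)\<^esub>"
    proof (rule inj_onD[OF bij_betw_imp_inj_on[OF S.sum[OF 5(1,2)]]])
      interpret S': cring "tval S (gsum X Y)" by (rule S.val[OF S'])
      show "\<zero>\<^bsub>tval S (gsum X Y)\<^esub> \<in> carrier (tval S (gsum X Y))" by simp
      show "\<phi> (gsum X Y) t \<in> carrier (tval S (gsum X Y))"
        using ring_hom_closed[OF ring_hom_ring.homh[OF hom[OF S']] 5(3)] .
    qed (use 5 S' l r \<phi>_ops[OF conjI[OF 5(1) conjI[OF S' l]]] \<phi>_ops[OF conjI[OF 5(2) conjI[OF S' r]]]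
      in \<open>simp add: mem S.res_zero\<close>)
    then show ?case using 5 by (simp add: mem[OF S'])
  qed
qed

text \<open>The G-maps from \<open>gfree\<close> to itself are the translations, so this is
  stability under the action of \<open>G\<close> on \<open>T(G/e)\<close>.\<close>

definition invariant_ideal :: "'a set \<Rightarrow> bool" where
  "invariant_ideal \<aa> \<longleftrightarrow> ideal \<aa> (tval T gfree) \<and>
    (\<forall>v\<in>gmap G gfree gfree. \<forall>t\<in>\<aa>. tres T gfree gfree v t \<in> \<aa>)"

text \<open>The coinduced family: among the families closed under restriction whose value at
  \<open>gfree\<close> lies in \<open>\<aa>\<close>, it is the largest.\<close>

definition gideal :: "'a set \<Rightarrow> 'g gset \<Rightarrow> 'a set" where
  "gideal \<aa> = (\<lambda>X\<in>{X. fin_gset G X}.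
    {t \<in> carrier (tval T X). \<forall>v\<in>gmap G gfree X. tres T gfree X v t \<in> \<aa>})"

lemma mem_gideal:
  "fin_gset G X \<Longrightarrow> t \<in> gideal \<aa> X \<longleftrightarrow>
    t \<in> carrier (tval T X) \<and> (\<forall>v\<in>gmap G gfree X. tres T gfree X v t \<in> \<aa>)"
  by (simp add: gideal_def)

text \<open>Restricted along a map from \<open>gfree\<close> to \<open>Y\<close>, a transfer or norm
  into \<open>Y\<close> becomes, by base change, one along a map into \<open>gfree\<close>, and
  there \<open>tr_gfree_cong\<close> applies. For transfers the comparison is with zero, for norms
  it is between the two given elements.\<close>

lemma gideal_congruence:
  assumes "invariant_ideal \<aa>" shows "tambara_congruence G T (gideal \<aa>)"
proof -
  interpret A: ideal \<aa> "tval T gfree" using assms by (simp add: invariant_ideal_def)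
  interpret E: cring "tval T gfree" by (rule val[OF fin_gset_gfree])
  note E = fin_gset_gfree
  have diff: "x \<ominus>\<^bsub>tval T gfree\<^esub> y \<in> \<aa>" if "x \<in> \<aa>" "y \<in> \<aa>" for x y
    using that by (simp add: a_minus_def)
  \<comment> \<open>Congruence modulo \<open>\<aa>\<close> respects both ring operations, so the
    same lemma on maps into \<open>gfree\<close> serves transfers and norms.\<close>
  define R where "R x y \<longleftrightarrow> x \<ominus>\<^bsub>tval T gfree\<^esub> y \<in> \<aa>" for x y
  have R_iff: "R x y \<longleftrightarrow> \<aa> +>\<^bsub>tval T gfree\<^esub> x = \<aa> +>\<^bsub>tval T gfree\<^esub> y"
    if "x \<in> carrier (tval T gfree)" "y \<in> carrier (tval T gfree)" for x y
    unfolding R_def by (rule A.quotient_eq_iff_same_a_r_cos[OF A.ideal_axioms that])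
  note hom = A.rcos_ring_hom
  have R_add: "R (a \<oplus>\<^bsub>tval T gfree\<^esub> c) (b \<oplus>\<^bsub>tval T gfree\<^esub> d)"
    and R_mult: "R (a \<otimes>\<^bsub>tval T gfree\<^esub> c) (b \<otimes>\<^bsub>tval T gfree\<^esub> d)"
    if "a \<in> carrier (tval T gfree)" "b \<in> carrier (tval T gfree)" "c \<in> carrier (tval T gfree)"
      "d \<in> carrier (tval T gfree)" "R a b" "R c d" for a b c d
    using that by (simp_all add: R_iff ring_hom_add[OF hom] ring_hom_mult[OF hom])
  have R_refl: "R x x" if "x \<in> carrier (tval T gfree)" for x
    using that by (simp add: R_iff)
  have R_mem: "R (tres T gfree X v a) (tres T gfree X v b)"
    if "fin_gset G X" "a \<in> carrier (tval T X)" "b \<in> carrier (tval T X)"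
      "a \<ominus>\<^bsub>tval T X\<^esub> b \<in> gideal \<aa> X" "v \<in> gmap G gfree X" for X a b v
    using that by (simp add: R_def mem_gideal res_minus[OF E, symmetric])
  have nm: "R (tnm T D gfree k a) (tnm T D gfree k b)"
    if "fin_gset G D" "k \<in> gmap G D gfree" "a \<in> carrier (tval T D)" "b \<in> carrier (tval T D)"
      "\<And>v. v \<in> gmap G gfree D \<Longrightarrow> R (tres T gfree D v a) (tres T gfree D v b)" for D k a b
    by (rule trmul.tr_gfree_cong) (use that R_mult R_refl in auto)
  have tr: "R (ttr T D gfree k a) (ttr T D gfree k b)"
    if "fin_gset G D" "k \<in> gmap G D gfree" "a \<in> carrier (tval T D)" "b \<in> carrier (tval T D)"
      "\<And>v. v \<in> gmap G gfree D \<Longrightarrow> R (tres T gfree D v a) (tres T gfree D v b)" for D k a b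
    by (rule tradd.tr_gfree_cong) (use that R_add R_refl in auto)
  show ?thesis
  proof (intro tambara_congruence.intro finite_tambara_axioms tambara_congruence_axioms.intro, goal_cases)
    case (1 X)
    interpret X: cring "tval T X" by (rule val[OF 1])
    have [simp]: "tres T gfree X v (\<ominus>\<^bsub>tval T X\<^esub> a) = \<ominus>\<^bsub>tval T gfree\<^esub> tres T gfree X v a"
      if "a \<in> carrier (tval T X)" "v \<in> gmap G gfree X" for a v
      using res_minus[OF E 1 that(2) X.zero_closed that(1)] that res_zero[OF E 1 that(2)]
        res_closed[OF E 1 that(2,1)] by (simp add: a_minus_def)
    show ?case
    proof (rule idealI[OF X.ring_axioms])
      show "subgroup (gideal \<aa> X) (add_monoid (tval T X))"
      proof (rule subgroup.intro)
        fix a assume "a \<in> gideal \<aa> X"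
        then have "\<ominus>\<^bsub>tval T X\<^esub> a \<in> gideal \<aa> X" by (simp add: mem_gideal 1)
        then show "inv\<^bsub>add_monoid (tval T X)\<^esub> a \<in> gideal \<aa> X" unfolding a_inv_def .
      qed (auto simp: mem_gideal 1 res_add[OF E 1] res_zero[OF E 1])
    qed (auto simp: mem_gideal 1 res_mult[OF E 1] A.I_l_closed A.I_r_closed res_closed[OF E 1])
  next
    case (2 X Y f t)
    then show ?case
      by (auto simp: mem_gideal res_closed res_comp[OF E 2(1,2) _ 2(3), symmetric] gcomp_gmap[OF _ 2(3) E])
  next
    case (3 X Y f t)
    have "tres T gfree Y v (ttr T X Y f t) \<in> \<aa>" if v: "v \<in> gmap G gfree Y" for v
    proof -
      let ?D = "gpb X f gfree v"
      note D = fin_gset_gpb[OF 3(1) E 3(3) v] and fst = gpb_fst_gmap[OF 3(1) E 3(3) v]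
        and snd = gpb_snd_gmap[OF 3(1) E 3(3) v]
      have t: "t \<in> carrier (tval T X)" using 3 by (simp add: mem_gideal)
      interpret D: cring "tval T ?D" by (rule val[OF D])
      let ?s = "tres T ?D X (gpb_fst X f gfree v) t"
      have s: "?s \<in> carrier (tval T ?D)" by (rule res_closed[OF D 3(1) fst t])
      have "R (ttr T ?D gfree (gpb_snd X f gfree v) ?s) (ttr T ?D gfree (gpb_snd X f gfree v) \<zero>\<^bsub>tval T ?D\<^esub>)"
      proof (rule tr[OF D snd s D.zero_closed])
        fix w assume w: "w \<in> gmap G gfree ?D"
        have "tres T gfree ?D w ?s \<in> \<aa>"
          using 3(4) gcomp_gmap[OF w fst E]
          by (simp only: mem_gideal[OF 3(1)] res_comp[OF E D 3(1) w fst t, symmetric])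
        then show "R (tres T gfree ?D w ?s) (tres T gfree ?D w \<zero>\<^bsub>tval T ?D\<^esub>)"
          by (simp add: R_def res_zero[OF E D w] a_minus_def)
      qed
      moreover have "ttr T ?D gfree (gpb_snd X f gfree v) ?s \<in> carrier (tval T gfree)"
        by (rule tr_closed[OF D E snd s])
      ultimately show ?thesis
        by (simp add: tr_base_change[OF 3(1,2) E 3(3) v t] R_def tr_zero[OF D E snd] a_minus_def)
    qed
    then show ?case using 3 by (simp add: mem_gideal tr_closed)
  next
    case (4 X Y f a b)
    interpret Y: cring "tval T Y" by (rule val[OF 4(2)])
    have "R (tres T gfree Y v (tnm T X Y f a)) (tres T gfree Y v (tnm T X Y f b))"
      if v: "v \<in> gmap G gfree Y" for v
    proof -
      let ?D = "gpb X f gfree v"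
      note D = fin_gset_gpb[OF 4(1) E 4(3) v] and fst = gpb_fst_gmap[OF 4(1) E 4(3) v]
        and snd = gpb_snd_gmap[OF 4(1) E 4(3) v]
      show ?thesis
        unfolding nm_base_change[OF 4(1,2) E 4(3) v 4(4)] nm_base_change[OF 4(1,2) E 4(3) v 4(5)]
      proof (rule nm[OF D snd res_closed[OF D 4(1) fst 4(4)] res_closed[OF D 4(1) fst 4(5)]])
        fix w assume w: "w \<in> gmap G gfree ?D"
        show "R (tres T gfree ?D w (tres T ?D X (gpb_fst X f gfree v) a))
            (tres T gfree ?D w (tres T ?D X (gpb_fst X f gfree v) b))"
          using R_mem[OF 4(1,4,5,6) gcomp_gmap[OF w fst E]]
          by (simp only: res_comp[OF E D 4(1) w fst 4(4)] res_comp[OF E D 4(1) w fst 4(5)])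
      qed
    qed
    then show ?case
      using 4 by (simp add: mem_gideal[OF 4(2)] R_def res_minus[OF E 4(2)] nm_closed[OF 4(1-3)])
  next
    case (5 X Y t)
    have "tres T gfree (gsum X Y) v t \<in> \<aa>" if v: "v \<in> gmap G gfree (gsum X Y)" for v
    proof -
      \<comment> \<open>A map from \<open>gfree\<close> into a sum is determined by the image of the
        base coset, hence factors through one of the summands.\<close>
      have "v gbase \<in> pts (gsum X Y)" using gmap_closed[OF v] gbase_pts by simp
      then consider x where "x \<in> pts X" "v gbase = HInl x" | y where "y \<in> pts Y" "v gbase = HInr y"
        by (auto simp: pts_gsum)
      then show ?thesis
      proof cases
        case (1 x)
        note w = gfree_map[OF 5(1) 1(1)] and l = ginl_gmap[OF 5(1), of Y]
        have "v = gcomp gfree (ginl X) (gorbit_map G X {\<one>} x)"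
          using 1 w(2) gbase_pts by (intro gfree_map_eqI[OF v gcomp_gmap[OF w(1) l E]]) simp
        then show ?thesis
          using 5 w by (simp add: res_comp[OF E 5(1) fin_gset_gsum[OF 5(1,2)] w(1) l 5(3)] mem_gideal[OF 5(1)])
      next
        case (2 y)
        note w = gfree_map[OF 5(2) 2(1)] and r = ginr_gmap[OF 5(2), of X]
        have "v = gcomp gfree (ginr Y) (gorbit_map G Y {\<one>} y)"
          using 2 w(2) gbase_pts by (intro gfree_map_eqI[OF v gcomp_gmap[OF w(1) r E]]) simp
        then show ?thesis
          using 5 w by (simp add: res_comp[OF E 5(2) fin_gset_gsum[OF 5(1,2)] w(1) r 5(3)] mem_gideal[OF 5(2)])
      qed
    qed
    then show ?case using 5 by (simp add: mem_gideal fin_gset_gsum)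
  qed
qed

text \<open>One inclusion is the invariance of \<open>\<aa>\<close>; the other is the condition for
  the identity map of \<open>gfree\<close>.\<close>

lemma gideal_gfree:
  assumes "invariant_ideal \<aa>" shows "gideal \<aa> gfree = \<aa>"
proof -
  interpret A: ideal \<aa> "tval T gfree" using assms by (simp add: invariant_ideal_def)
  show ?thesis
    using assms gid_gmap[OF fin_gset_gfree] res_id[OF fin_gset_gfree]
    by (auto simp: mem_gideal fin_gset_gfree invariant_ideal_def A.Icarr) metis
qed

text \<open>The value at \<open>gfree\<close> of a proper Tambara ideal \<open>J\<close> above
  \<open>gideal \<bb>\<close> is invariant, contains \<open>\<bb>\<close> and, by
  \<open>proper_at_gfree\<close>, omits 1; so it equals \<open>\<bb>\<close>. As
  \<open>gideal \<bb>\<close> is the largest family with this value, \<open>J\<close> cannot exceed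
  it.\<close>

lemma gideal_maximal:
  assumes inv: "invariant_ideal \<bb>" and one: "\<one>\<^bsub>tval T gfree\<^esub> \<notin> \<bb>"
    and max: "\<And>\<cc>. invariant_ideal \<cc> \<Longrightarrow> \<one>\<^bsub>tval T gfree\<^esub> \<notin> \<cc> \<Longrightarrow> \<bb> \<subseteq> \<cc> \<Longrightarrow> \<cc> = \<bb>"
  shows "maximal_tambara_ideal G T (gideal \<bb>)"
  unfolding maximal_tambara_ideal_def
proof (intro conjI allI impI)
  interpret B: tambara_congruence G T "gideal \<bb>" by (rule gideal_congruence[OF inv])
  interpret E: cring "tval T gfree" by (rule val[OF fin_gset_gfree])
  show "tambara_ideal G T (gideal \<bb>)"
    by (rule B.tambara_ideal_congruence) (simp add: gideal_def)
  show "proper_family G T (gideal \<bb>)"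
    using one gideal_gfree[OF inv] fin_gset_gfree E.one_closed unfolding proper_family_def by metis
  fix J assume J: "tambara_ideal G T J \<and> proper_family G T J \<and> (\<forall>X. fin_gset G X \<longrightarrow> gideal \<bb> X \<subseteq> J X)"
  then interpret J: tambara_congruence G T J by (simp add: tambara_ideal_imp_congruence)
  have "J gfree = \<bb>"
  proof (rule max)
    show "invariant_ideal (J gfree)"
      using J.I_ideal[OF fin_gset_gfree] J.I_res[OF fin_gset_gfree fin_gset_gfree]
      by (simp add: invariant_ideal_def)
    show "\<one>\<^bsub>tval T gfree\<^esub> \<notin> J gfree" using J J.proper_at_gfree by simp
    show "\<bb> \<subseteq> J gfree" using J fin_gset_gfree gideal_gfree[OF inv] by auto
  qed
  then have "J X = gideal \<bb> X" if X: "fin_gset G X" for X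
    using J J.I_res[OF fin_gset_gfree X] J.I_carrier[OF X] X by (auto simp: mem_gideal)
  then show "J = gideal \<bb>"
    using J by (intro extensionalityI[of _ "{X. fin_gset G X}"]) (auto simp: tambara_ideal_def gideal_def)
qed

text \<open>Zorn's lemma: invariance and the absence of 1 both pass to unions of chains.\<close>

lemma invariant_ideal_extend:
  assumes "invariant_ideal \<aa>" and "\<one>\<^bsub>tval T gfree\<^esub> \<notin> \<aa>"
  obtains \<bb> where "invariant_ideal \<bb>" "\<one>\<^bsub>tval T gfree\<^esub> \<notin> \<bb>" "\<aa> \<subseteq> \<bb>"
    "\<And>\<cc>. invariant_ideal \<cc> \<Longrightarrow> \<one>\<^bsub>tval T gfree\<^esub> \<notin> \<cc> \<Longrightarrow> \<bb> \<subseteq> \<cc> \<Longrightarrow> \<cc> = \<bb>"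
proof -
  interpret E: cring "tval T gfree" by (rule val[OF fin_gset_gfree])
  let ?F = "{\<bb>. invariant_ideal \<bb> \<and> \<one>\<^bsub>tval T gfree\<^esub> \<notin> \<bb> \<and> \<aa> \<subseteq> \<bb>}"
  have "\<exists>M\<in>?F. \<forall>X\<in>?F. M \<subseteq> X \<longrightarrow> X = M"
  proof (rule subset_Zorn_nonempty)
    show "?F \<noteq> {}" using assms by blast
    fix C assume C: "C \<noteq> {}" "subset.chain ?F C"
    then have "subset.chain {I. ideal I (tval T gfree)} C"
      by (auto simp: subset.chain_def invariant_ideal_def)
    from E.chain_Union_is_ideal[OF this] C(1) have "ideal (\<Union>C) (tval T gfree)" by simp
    moreover have "\<forall>B\<in>C. B \<in> ?F" using C(2) by (auto simp: subset.chain_def)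
    ultimately show "\<Union>C \<in> ?F" using C(1) unfolding invariant_ideal_def by blast
  qed
  then obtain M where M: "M \<in> ?F" and max: "\<forall>X\<in>?F. M \<subseteq> X \<longrightarrow> X = M" by (rule bexE)
  show ?thesis
  proof (rule that[of M])
    fix \<cc> assume c: "invariant_ideal \<cc>" "\<one>\<^bsub>tval T gfree\<^esub> \<notin> \<cc>" "M \<subseteq> \<cc>"
    then have "\<cc> \<in> ?F" using M by blast
    then show "\<cc> = M" using max c(3) by blast
  qed (use M in simp_all)
qed

end

section \<open>Local Tambara functors\<close>

lemma (in cring) UnitsI: "a \<in> carrier R \<Longrightarrow> b \<in> carrier R \<Longrightarrow> a \<otimes> b = \<one> \<Longrightarrow> a \<in> Units R"
  using m_comm[of a b] by (auto simp: Units_def)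

locale local_cohomological = finite_tambara G T
  for G :: "('g, 'b) monoid_scheme" (structure) and T :: "('g, 'a) tambara" +
  fixes \<mm> :: "'g gset \<Rightarrow> 'a set"
  assumes local: "local_tambara G T"
    and maximal: "maximal_tambara_ideal G T \<mm>"
    and cohomological: "mult_cohomological G T"

sublocale local_cohomological \<subseteq> tambara_congruence G T \<mm>
  using maximal by (simp add: maximal_tambara_ideal_def tambara_ideal_imp_congruence)

context local_cohomological
begin

lemma one_notin_gfree: "\<one>\<^bsub>tval T gfree\<^esub> \<notin> \<mm> gfree"
  using maximal by (simp add: maximal_tambara_ideal_def proper_at_gfree)

text \<open>\<open>\<aa>\<close> is enlarged to an ideal \<open>\<bb>\<close> that is maximal among
  the proper invariant ones. The Tambara ideal \<open>gideal \<bb>\<close> is then maximal, and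
  locality identifies it with \<open>\<mm>\<close>.\<close>

lemma invariant_ideal_subset:
  assumes "invariant_ideal \<aa>" "\<one>\<^bsub>tval T gfree\<^esub> \<notin> \<aa>"
  shows "\<aa> \<subseteq> \<mm> gfree"
proof -
  obtain \<bb> where b: "invariant_ideal \<bb>" "\<one>\<^bsub>tval T gfree\<^esub> \<notin> \<bb>" "\<aa> \<subseteq> \<bb>"
    "\<And>\<cc>. invariant_ideal \<cc> \<Longrightarrow> \<one>\<^bsub>tval T gfree\<^esub> \<notin> \<cc> \<Longrightarrow> \<bb> \<subseteq> \<cc> \<Longrightarrow> \<cc> = \<bb>"
    by (rule invariant_ideal_extend[OF assms]) blast
  have "gideal \<bb> = \<mm>"
    using gideal_maximal[OF b(1,2,4)] maximal local unfolding local_tambara_def by blast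
  then show ?thesis using gideal_gfree[OF b(1)] b(3) by simp
qed

text \<open>Base change turns the left-hand side into a norm from the fibre product of
  \<open>gfree\<close> with itself. The diagonal is a copy of \<open>gfree\<close> in it and
  contributes the factor \<open>u\<close>; the complement of the diagonal contributes
  \<open>y\<close>.\<close>

lemma res_nm_gfree:
  assumes Y: "fin_gset G Y" and p: "p \<in> gmap G gfree Y" and u: "u \<in> carrier (tval T gfree)"
  obtains y where "y \<in> carrier (tval T gfree)"
    "tres T gfree Y p (tnm T gfree Y p u) = u \<otimes>\<^bsub>tval T gfree\<^esub> y"
proof -
  note E = fin_gset_gfree
  let ?D = "gpb gfree p gfree p"
  note D = fin_gset_gpb[OF E E p p] and fst = gpb_fst_gmap[OF E E p p]
    and snd = gpb_snd_gmap[OF E E p p]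
  define s where "s = gpair gfree (gid gfree) (gid gfree)"
  have s: "s \<in> gmap G gfree ?D"
    by (rule gmapI) (auto simp: s_def act_closed[OF E, unfolded pts_gorbit] gpair_def)
  have inj: "inj_on s (pts gfree)" by (auto simp: s_def inj_on_def)
  have fs: "gcomp gfree (gpb_fst gfree p gfree p) s = gid gfree"
    by (rule gmap_eqI[OF gcomp_gmap[OF s fst E] gid_gmap[OF E]]) (simp add: s_def)
  have ss: "gcomp gfree (gpb_snd gfree p gfree p) s = gid gfree"
    by (rule gmap_eqI[OF gcomp_gmap[OF s snd E] gid_gmap[OF E]]) (simp add: s_def)
  obtain C i where cov: "gcover G gfree C ?D s i" by (rule gcover_gfree[OF D s inj])
  then have C: "fin_gset G C" and i: "i \<in> gmap G C ?D" by (auto simp: gcover_def)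
  let ?w = "tres T ?D gfree (gpb_fst gfree p gfree p) u"
  have w: "?w \<in> carrier (tval T ?D)" by (rule res_closed[OF D E fst u])
  have "tres T gfree ?D s ?w = u"
    using res_comp[OF E D E s fst u] by (simp add: fs res_id[OF E u])
  then have "tnm T ?D gfree (gpb_snd gfree p gfree p) ?w
      = u \<otimes>\<^bsub>tval T gfree\<^esub> tnm T C gfree (gcomp C (gpb_snd gfree p gfree p) i) (tres T C ?D i ?w)"
    using trmul.tr_gcover[OF cov E snd w] by (simp add: ss nm_id[OF E u])
  moreover have "tnm T C gfree (gcomp C (gpb_snd gfree p gfree p) i) (tres T C ?D i ?w) \<in> carrier (tval T gfree)"
    by (rule nm_closed[OF C E gcomp_gmap[OF i snd C] res_closed[OF C D i w]])
  ultimately show ?thesis using that nm_base_change[OF E Y E p p u] by simp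
qed

text \<open>
  The restriction of the norm of \<open>1 - a\<close> to the trivial group is invariant, hence generates an
  invariant ideal. If this were proper, it would be contained in \<open>\<mm>\<close>, although the norm is
  congruent to 1.
\<close>

lemma one_minus_unit_gfree:
  assumes a: "a \<in> \<mm> gfree"
  shows "\<one>\<^bsub>tval T gfree\<^esub> \<ominus>\<^bsub>tval T gfree\<^esub> a \<in> Units (tval T gfree)"
proof -
  note E = fin_gset_gfree
  interpret E: cring "tval T gfree" by (rule val[OF E])
  let ?u = "\<one>\<^bsub>tval T gfree\<^esub> \<ominus>\<^bsub>tval T gfree\<^esub> a"
  have ac: "a \<in> carrier (tval T gfree)" by (rule I_carrier[OF E a])
  then have u: "?u \<in> carrier (tval T gfree)" by simp
  \<comment> \<open>The one-point G-set. Translations of \<open>gfree\<close> do not change the map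
    \<open>p\<close> to it, which makes the restricted norm \<open>N\<close> invariant.\<close>
  define P :: "'g gset" where "P = \<lparr>pts = {HSet fempty}, action = \<lambda>g. \<lambda>x\<in>{HSet fempty}. x\<rparr>"
  define p :: "'g hfmap" where "p = (\<lambda>x\<in>pts gfree. HSet fempty)"
  have P: "fin_gset G P" by (rule fin_gsetI) (auto simp: P_def)
  have p: "p \<in> gmap G gfree P"
    by (rule gmapI) (auto simp: p_def P_def act_closed[OF E, unfolded pts_gorbit])
  define N where "N = tres T gfree P p (tnm T gfree P p ?u)"
  have nu: "tnm T gfree P p ?u \<in> carrier (tval T P)" by (rule nm_closed[OF E P p u])
  have N: "N \<in> carrier (tval T gfree)" unfolding N_def by (rule res_closed[OF E P p nu])
  have N_inv: "tres T gfree gfree v N = N" if v: "v \<in> gmap G gfree gfree" for v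
  proof -
    have "gcomp gfree p v = p"
      by (rule gmap_eqI[OF gcomp_gmap[OF v p E] p]) (use gmap_closed[OF v] in \<open>simp add: p_def\<close>)
    then show ?thesis using res_comp[OF E E P v p nu] by (simp add: N_def)
  qed
  have inv: "invariant_ideal (PIdl\<^bsub>tval T gfree\<^esub> N)"
    unfolding invariant_ideal_def
  proof (intro conjI ballI)
    show "ideal (PIdl\<^bsub>tval T gfree\<^esub> N) (tval T gfree)" by (rule E.cgenideal_ideal[OF N])
    fix v t assume v: "v \<in> gmap G gfree gfree" and "t \<in> PIdl\<^bsub>tval T gfree\<^esub> N"
    then obtain r where r: "r \<in> carrier (tval T gfree)" "t = r \<otimes>\<^bsub>tval T gfree\<^esub> N"
      by (auto simp: cgenideal_def)
    then show "tres T gfree gfree v t \<in> PIdl\<^bsub>tval T gfree\<^esub> N"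
      using res_mult[OF E E v r(1) N] N_inv[OF v] res_closed[OF E E v r(1)]
      by (auto simp: cgenideal_def)
  qed
  interpret m: ideal "\<mm> gfree" "tval T gfree" by (rule I_ideal[OF E])
  interpret P: cring "tval T P" by (rule val[OF P])
  have "\<one>\<^bsub>tval T gfree\<^esub> \<ominus>\<^bsub>tval T gfree\<^esub> ?u = a"
    using ac by (simp add: a_minus_def E.minus_add E.a_assoc[symmetric] E.r_neg)
  then have "tnm T gfree P p \<one>\<^bsub>tval T gfree\<^esub> \<ominus>\<^bsub>tval T P\<^esub> tnm T gfree P p ?u \<in> \<mm> P"
    using a by (intro I_nm[OF E P p]) (simp_all add: ac)
  from I_res[OF E P p this] have 1: "\<one>\<^bsub>tval T gfree\<^esub> \<ominus>\<^bsub>tval T gfree\<^esub> N \<in> \<mm> gfree"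
    using nu by (simp add: N_def res_minus[OF E P p] nm_one[OF E P p] res_one[OF E P p])
  have "\<one>\<^bsub>tval T gfree\<^esub> \<in> PIdl\<^bsub>tval T gfree\<^esub> N"
  proof (rule ccontr)
    assume "\<one>\<^bsub>tval T gfree\<^esub> \<notin> PIdl\<^bsub>tval T gfree\<^esub> N"
    then have "N \<in> \<mm> gfree" using invariant_ideal_subset[OF inv] E.cgenideal_self[OF N] by blast
    then have "(\<one>\<^bsub>tval T gfree\<^esub> \<ominus>\<^bsub>tval T gfree\<^esub> N) \<oplus>\<^bsub>tval T gfree\<^esub> N \<in> \<mm> gfree" using 1 by simp
    moreover have "(\<one>\<^bsub>tval T gfree\<^esub> \<ominus>\<^bsub>tval T gfree\<^esub> N) \<oplus>\<^bsub>tval T gfree\<^esub> N = \<one>\<^bsub>tval T gfree\<^esub>"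
      using N by (simp add: a_minus_def E.a_assoc E.l_neg)
    ultimately show False using one_notin_gfree by simp
  qed
  then obtain r where r: "r \<in> carrier (tval T gfree)" "\<one>\<^bsub>tval T gfree\<^esub> = r \<otimes>\<^bsub>tval T gfree\<^esub> N"
    by (auto simp: cgenideal_def)
  \<comment> \<open>\<open>N\<close> is a unit and a multiple of \<open>?u\<close>, so
    \<open>?u\<close> is a unit as well.\<close>
  obtain y where y: "y \<in> carrier (tval T gfree)" "N = ?u \<otimes>\<^bsub>tval T gfree\<^esub> y"
    unfolding N_def by (rule res_nm_gfree[OF P p u])
  have "?u \<otimes>\<^bsub>tval T gfree\<^esub> (y \<otimes>\<^bsub>tval T gfree\<^esub> r) = N \<otimes>\<^bsub>tval T gfree\<^esub> r"
    unfolding y(2) by (rule E.m_assoc[OF u y(1) r(1), symmetric])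
  also have "\<dots> = \<one>\<^bsub>tval T gfree\<^esub>" using r N by (simp add: E.m_comm)
  finally show ?thesis by (rule E.UnitsI[OF u E.m_closed[OF y(1) r(1)]])
qed

text \<open>The norm of the restriction of \<open>b\<close> is a power of \<open>b\<close>; multiplicative cohomologicality enters only here.\<close>

lemma unit_orbit:
  assumes K: "subgroup K G" and b: "b \<in> carrier (tval T (gorbit G K))"
    and unit: "tres T gfree (gorbit G K) (orbit_proj G {\<one>} K) b \<in> Units (tval T gfree)"
  shows "b \<in> Units (tval T (gorbit G K))"
proof -
  let ?O = "gorbit G K" and ?p = "orbit_proj G {\<one>} K"
  note O = fin_gset_gorbit[OF K] and p = orbit_proj_gmap[OF K] and E = fin_gset_gfree
  interpret E: cring "tval T gfree" by (rule val[OF E])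
  interpret O: cring "tval T ?O" by (rule val[OF O])
  let ?r = "tres T gfree ?O ?p b"
  have r: "?r \<in> carrier (tval T gfree)" by (rule res_closed[OF E O p b])
  obtain v where v: "v \<in> carrier (tval T gfree)" "?r \<otimes>\<^bsub>tval T gfree\<^esub> v = \<one>\<^bsub>tval T gfree\<^esub>"
    using unit by (auto simp: Units_def)
  define n where "n = card ((\<lambda>k. k <# {\<one>}) ` K)"
  have "\<one> \<in> K" "K \<subseteq> carrier G" using K by (simp_all add: subgroup.one_closed subgroup.subset)
  \<comment> \<open>The exponent is positive, so \<open>b\<close> divides its power with exponent
    \<open>n\<close>, which is a unit.\<close>
  then have "n \<noteq> 0" using finite_subset[OF _ finite_carrier] by (auto simp: n_def)
  then obtain k where k: "n = Suc k" using not0_implies_Suc by blast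
  have "tnm T gfree ?O ?p ?r = b [^]\<^bsub>tval T ?O\<^esub> n"
    using cohomological triv_subgroup K \<open>\<one> \<in> K\<close> b unfolding mult_cohomological_def n_def by blast
  then have "(b [^]\<^bsub>tval T ?O\<^esub> n) \<otimes>\<^bsub>tval T ?O\<^esub> tnm T gfree ?O ?p v = \<one>\<^bsub>tval T ?O\<^esub>"
    using trmul.tr_mult[OF E O p r v(1)] v(2) nm_one[OF E O p] by simp
  then have "b \<otimes>\<^bsub>tval T ?O\<^esub> ((b [^]\<^bsub>tval T ?O\<^esub> k) \<otimes>\<^bsub>tval T ?O\<^esub> tnm T gfree ?O ?p v) = \<one>\<^bsub>tval T ?O\<^esub>"
    using b nm_closed[OF E O p v(1)] by (simp add: k O.m_assoc O.m_lcomm)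
  then show ?thesis
    by (rule O.UnitsI[OF b, rotated]) (use b nm_closed[OF E O p v(1)] in simp)
qed

text \<open>\<open>Y\<close> is isomorphic to \<open>G/H\<close> for the stabilizer \<open>H\<close>
  of a point. The claim is known over \<open>G/e\<close>, is lifted to \<open>G/H\<close> by
  \<open>unit_orbit\<close>, and is carried to \<open>Y\<close> by the norm along the isomorphism,
  which inverts the restriction.\<close>

lemma one_minus_unit:
  assumes Y: "fin_gset G Y" and trans: "gtransitive G Y" and a: "a \<in> \<mm> Y"
  shows "\<one>\<^bsub>tval T Y\<^esub> \<ominus>\<^bsub>tval T Y\<^esub> a \<in> Units (tval T Y)"
proof -
  obtain y where y: "y \<in> pts Y" using trans by (auto simp: gtransitive_def)
  define H where "H = stabilizer G (action Y) y"
  let ?k = "gorbit_map G Y H y" and ?O = "gorbit G H"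
  have H: "subgroup H G" and k: "?k \<in> gmap G ?O Y" and bij: "bij_betw ?k (pts ?O) (pts Y)"
    unfolding H_def by (rule gorbit_map_bij[OF Y y trans])+
  note O = fin_gset_gorbit[OF H] and p = orbit_proj_gmap[OF H] and E = fin_gset_gfree
  interpret Y: cring "tval T Y" by (rule val[OF Y])
  interpret O: cring "tval T ?O" by (rule val[OF O])
  let ?u = "\<one>\<^bsub>tval T Y\<^esub> \<ominus>\<^bsub>tval T Y\<^esub> a" and ?b = "tres T ?O Y ?k a"
  have ac: "a \<in> carrier (tval T Y)" by (rule I_carrier[OF Y a])
  then have u: "?u \<in> carrier (tval T Y)" by simp
  have b: "?b \<in> \<mm> ?O" by (rule I_res[OF O Y k a])
  have bc: "?b \<in> carrier (tval T ?O)" by (rule I_carrier[OF O b])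
  have ku: "tres T ?O Y ?k ?u = \<one>\<^bsub>tval T ?O\<^esub> \<ominus>\<^bsub>tval T ?O\<^esub> ?b"
    using ac by (simp add: res_minus[OF O Y k] res_one[OF O Y k])
  have "\<one>\<^bsub>tval T ?O\<^esub> \<ominus>\<^bsub>tval T ?O\<^esub> ?b \<in> Units (tval T ?O)"
  proof (rule unit_orbit[OF H])
    show "tres T gfree ?O (orbit_proj G {\<one>} H) (\<one>\<^bsub>tval T ?O\<^esub> \<ominus>\<^bsub>tval T ?O\<^esub> ?b) \<in> Units (tval T gfree)"
      using one_minus_unit_gfree[OF I_res[OF E O p b]] bc
      by (simp add: res_minus[OF E O p] res_one[OF E O p])
  qed (use bc in simp)
  then obtain c where c: "c \<in> carrier (tval T ?O)" "tres T ?O Y ?k ?u \<otimes>\<^bsub>tval T ?O\<^esub> c = \<one>\<^bsub>tval T ?O\<^esub>"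
    unfolding ku by (auto simp: Units_def)
  note nc = nm_closed[OF O Y k c(1)]
  have "tnm T ?O Y ?k (tres T ?O Y ?k ?u) = ?u" by (rule trmul.tr_res_iso[OF O Y k bij u])
  then have "?u \<otimes>\<^bsub>tval T Y\<^esub> tnm T ?O Y ?k c = \<one>\<^bsub>tval T Y\<^esub>"
    using trmul.tr_mult[OF O Y k res_closed[OF O Y k u] c(1)] c(2) nm_one[OF O Y k] by simp
  then show ?thesis by (rule Y.UnitsI[OF u nc])
qed

end

section \<open>A model for the free modules\<close>

lemma (in finite_group) semi_mackey_mackey:
  assumes "mackey_functor G M" shows "semi_mackey G (mval M) (mres M) (mtr M)"
proof -
  interpret M: mackey_functor G M by fact
  have grp: "group_hom (mval M X) (mval M Y) h"
    if "fin_gset G X" "fin_gset G Y" "h \<in> hom (mval M X) (mval M Y)" for X Y h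
    using that M.val by (simp add: group_hom_def group_hom_axioms_def comm_group.axioms(2))
  show ?thesis
  proof (intro semi_mackey.intro finite_group_axioms semi_mackey_axioms.intro, goal_cases)
    case (1 X) then show ?case using M.val comm_group.axioms(1) by blast
  next
    case (4 X Y f) show ?case by (rule group_hom.hom_one[OF grp[OF 4(2,1) M.res_hom[OF 4]]])
  next
    case (5 X Y f) show ?case by (rule group_hom.hom_one[OF grp[OF 5(1,2) M.tr_hom[OF 5]]])
  qed (simp_all add: M.res_hom M.tr_hom M.res_id M.tr_id M.res_comp M.tr_comp M.sum M.empty M.base_change)
qed

section \<open>Compatibility of fibre products and coverings with products by
  \<open>W\<close>\<close>

context group
begin

lemma gtimes_gid: "gtimes X W (gid X) = gid (gprod X W)"
  by (auto simp: gtimes_def gid_def pts_gprod fun_eq_iff)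

lemma gtimes_gcomp:
  "f \<in> gmap G X Y \<Longrightarrow> gtimes X W (gcomp X h f) = gcomp (gprod X W) (gtimes Y W h) (gtimes X W f)"
  by (auto simp: gtimes_def gcomp_def compose_def pts_gprod fun_eq_iff gmap_closed)

lemma gfst_gtimes:
  "f \<in> gmap G X Y \<Longrightarrow> gcomp (gprod X W) (gfst Y W) (gtimes X W f) = gcomp (gprod X W) f (gfst X W)"
  by (auto simp: gtimes_def gfst_def gcomp_def compose_def pts_gprod fun_eq_iff gmap_closed)

lemma gsnd_gtimes:
  "f \<in> gmap G X Y \<Longrightarrow> gcomp (gprod X W) (gsnd Y W) (gtimes X W f) = gsnd X W"
  by (auto simp: gtimes_def gsnd_def gcomp_def compose_def pts_gprod fun_eq_iff gmap_closed)

lemma gfst_gpair: "a \<in> gmap G Z X \<Longrightarrow> b \<in> gmap G Z Y \<Longrightarrow> gcomp Z (gfst X Y) (gpair Z a b) = a"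
  by (rule extensionalityI[of _ "pts Z"])
    (simp_all add: gcomp_def compose_def gmap_closed, simp add: gmap_def PiE_def)

lemma gsnd_gpair: "a \<in> gmap G Z X \<Longrightarrow> b \<in> gmap G Z Y \<Longrightarrow> gcomp Z (gsnd X Y) (gpair Z a b) = b"
  by (rule extensionalityI[of _ "pts Z"])
    (simp_all add: gcomp_def compose_def gmap_closed, simp add: gmap_def PiE_def)

lemma gtimes_gpair: "a \<in> gmap G Z X \<Longrightarrow> b \<in> gmap G Z W \<Longrightarrow> f \<in> gmap G X Y
    \<Longrightarrow> gcomp Z (gtimes X W f) (gpair Z a b) = gpair Z (gcomp Z f a) b"
  by (auto simp: gcomp_def compose_def gpair_def fun_eq_iff gmap_closed)

lemma gpair_eta:
  "v \<in> gmap G Z (gprod X W) \<Longrightarrow> gpair Z (gcomp Z (gfst X W) v) (gcomp Z (gsnd X W) v) = v"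
proof (rule extensionalityI[of _ "pts Z"])
  assume v: "v \<in> gmap G Z (gprod X W)"
  then show "v \<in> extensional (pts Z)" by (simp add: gmap_def PiE_def)
  fix z assume z: "z \<in> pts Z"
  show "gpair Z (gcomp Z (gfst X W) v) (gcomp Z (gsnd X W) v) z = v z"
    using gmap_closed[OF v z] z by (auto elim: gprod_cases)
qed (simp add: gpair_def)

lemma gpullback_gtimes:
  assumes pb: "gpullback G X' X Y' Y f h f' g'" and W: "fin_gset G W"
  shows "gpullback G (gprod X' W) (gprod X W) (gprod Y' W) (gprod Y W)
    (gtimes X W f) (gtimes Y' W h) (gtimes X' W f') (gtimes X' W g')"
proof -
  have *: "fin_gset G X'" "fin_gset G X" "fin_gset G Y'" "fin_gset G Y"
    "f \<in> gmap G X Y" "h \<in> gmap G Y' Y" "f' \<in> gmap G X' Y'" "g' \<in> gmap G X' X"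
    and bij: "bij_betw (\<lambda>x. HPair (g' x) (f' x)) (pts X') (gpb_pts X f Y' h)"
    using pb by (auto simp: gpullback_def)
  have img: "(\<lambda>x. HPair (g' x) (f' x)) ` pts X' = gpb_pts X f Y' h"
    and inj: "inj_on (\<lambda>x. HPair (g' x) (f' x)) (pts X')"
    using bij by (simp_all add: bij_betw_def)
  have comm: "f (g' x) = h (f' x)" if "x \<in> pts X'" for x
  proof -
    have "HPair (g' x) (f' x) \<in> gpb_pts X f Y' h" using img that by blast
    then show ?thesis by simp
  qed
  show ?thesis
  proof (rule gpullbackI)
    show "\<exists>z\<in>pts (gprod X' W). gtimes X' W g' z = p \<and> gtimes X' W f' z = q"
      if "p \<in> pts (gprod X W)" "q \<in> pts (gprod Y' W)" "gtimes X W f p = gtimes Y' W h q" for p q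
    proof -
      note mem = that
      obtain x w where p: "p = HPair x w" "x \<in> pts X" "w \<in> pts W" by (rule gprod_cases[OF mem(1)])
      obtain y w' where q: "q = HPair y w'" "y \<in> pts Y'" "w' \<in> pts W"
        by (rule gprod_cases[OF mem(2)])
      have pq: "p = HPair x w" "q = HPair y w" "x \<in> pts X" "y \<in> pts Y'" "w \<in> pts W" "f x = h y"
        using p q mem(3) by simp_all
      then have "HPair x y \<in> gpb_pts X f Y' h" by simp
      then obtain z where "z \<in> pts X'" "x = g' z" "y = f' z" unfolding img[symmetric] by blast
      then show ?thesis using pq by (intro bexI[of _ "HPair z w"]) simp_all
    qed
    show "z = z'" if "z \<in> pts (gprod X' W)" "z' \<in> pts (gprod X' W)"
      "gtimes X' W g' z = gtimes X' W g' z'" "gtimes X' W f' z = gtimes X' W f' z'" for z z'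
    proof -
      note mem = that
      obtain x w where p: "z = HPair x w" "x \<in> pts X'" "w \<in> pts W" by (rule gprod_cases[OF mem(1)])
      obtain x' w' where q: "z' = HPair x' w'" "x' \<in> pts X'" "w' \<in> pts W"
        by (rule gprod_cases[OF mem(2)])
      have "x = x'" by (rule inj_onD[OF inj]) (use mem(3,4) p q in simp_all)
      moreover have "w = w'" using mem(3) p q by simp
      ultimately show ?thesis using p q by simp
    qed
    show "gtimes X W f (gtimes X' W g' z) = gtimes Y' W h (gtimes X' W f' z)"
      if z: "z \<in> pts (gprod X' W)" for z
    proof -
      obtain x w where "z = HPair x w" "x \<in> pts X'" "w \<in> pts W" by (rule gprod_cases[OF z])
      then show ?thesis using comm gmap_closed[OF *(7)] gmap_closed[OF *(8)] by simp
    qed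
  qed (simp_all add: * W fin_gset_gprod gtimes_gmap)
qed

text \<open>One square in both orientations: base change of \<open>f\<close> along the projection
  computes the action of a transferred scalar, and base change of the projection along
  \<open>f\<close> gives the naturality of \<open>yoneda_map\<close>.\<close>

lemma gpullback_gfst:
  assumes "fin_gset G X" "fin_gset G Y" "fin_gset G W" "f \<in> gmap G X Y"
  shows "gpullback G (gprod X W) X (gprod Y W) Y f (gfst Y W) (gtimes X W f) (gfst X W)"
    "gpullback G (gprod X W) (gprod Y W) X Y (gfst Y W) f (gfst X W) (gtimes X W f)"
proof -
  have surj: "\<exists>z\<in>pts (gprod X W). gfst X W z = x \<and> gtimes X W f z = p"
    if "x \<in> pts X" "p \<in> pts (gprod Y W)" "f x = gfst Y W p" for x p
  proof -
    note mem = that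
    obtain y w where p: "p = HPair y w" "y \<in> pts Y" "w \<in> pts W" by (rule gprod_cases[OF mem(2)])
    then show ?thesis using mem by (intro bexI[of _ "HPair x w"]) simp_all
  qed
  note G = fin_gset_gprod[OF assms(1,3)] fin_gset_gprod[OF assms(2,3)] gtimes_gmap[OF assms(1,3,4)]
    gfst_gmap[OF assms(1,3)] gfst_gmap[OF assms(2,3)]
  show "gpullback G (gprod X W) X (gprod Y W) Y f (gfst Y W) (gtimes X W f) (gfst X W)"
    by (rule gpullbackI[OF G(1) assms(1) G(2) assms(2,4) G(5,3,4)])
      (use surj gmap_closed[OF assms(4)] in \<open>auto elim!: gprod_cases\<close>)
  have "\<exists>z\<in>pts (gprod X W). gtimes X W f z = p \<and> gfst X W z = x"
    if "p \<in> pts (gprod Y W)" "x \<in> pts X" "gfst Y W p = f x" for x p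
    using surj[OF that(2,1)] that(3) by auto
  then show "gpullback G (gprod X W) (gprod Y W) X Y (gfst Y W) f (gfst X W) (gtimes X W f)"
    by (intro gpullbackI[OF G(1,2) assms(1,2) G(5) assms(4) G(4,3)])
      (use gmap_closed[OF assms(4)] in \<open>auto elim!: gprod_cases\<close>)
qed

lemma gcover_gtimes:
  assumes c: "gcover G X\<^sub>1 X\<^sub>2 X u\<^sub>1 u\<^sub>2" and W: "fin_gset G W"
  shows "gcover G (gprod X\<^sub>1 W) (gprod X\<^sub>2 W) (gprod X W) (gtimes X\<^sub>1 W u\<^sub>1) (gtimes X\<^sub>2 W u\<^sub>2)"
proof -
  have *: "fin_gset G X\<^sub>1" "fin_gset G X\<^sub>2" "fin_gset G X" "u\<^sub>1 \<in> gmap G X\<^sub>1 X" "u\<^sub>2 \<in> gmap G X\<^sub>2 X"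
    and inj: "inj_on u\<^sub>1 (pts X\<^sub>1)" "inj_on u\<^sub>2 (pts X\<^sub>2)"
    and disj: "u\<^sub>1 ` pts X\<^sub>1 \<inter> u\<^sub>2 ` pts X\<^sub>2 = {}" and un: "u\<^sub>1 ` pts X\<^sub>1 \<union> u\<^sub>2 ` pts X\<^sub>2 = pts X"
    using c by (simp_all add: gcover_def)
  have img: "gtimes Z W u ` pts (gprod Z W) = {HPair x w | x w. x \<in> u ` pts Z \<and> w \<in> pts W}" for Z u
  proof
    show "gtimes Z W u ` pts (gprod Z W) \<subseteq> {HPair x w | x w. x \<in> u ` pts Z \<and> w \<in> pts W}"
      by (auto elim!: gprod_cases)
    show "{HPair x w | x w. x \<in> u ` pts Z \<and> w \<in> pts W} \<subseteq> gtimes Z W u ` pts (gprod Z W)"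
    proof
      fix p assume "p \<in> {HPair x w | x w. x \<in> u ` pts Z \<and> w \<in> pts W}"
      then obtain z w where "p = HPair (u z) w" "z \<in> pts Z" "w \<in> pts W" by blast
      then show "p \<in> gtimes Z W u ` pts (gprod Z W)"
        by (intro image_eqI[of _ _ "HPair z w"]) simp_all
    qed
  qed
  have "inj_on (gtimes Z W u) (pts (gprod Z W))" if "inj_on u (pts Z)" for Z u
    using inj_onD[OF that] by (intro inj_onI) (auto elim!: gprod_cases)
  moreover have "gtimes X\<^sub>1 W u\<^sub>1 ` pts (gprod X\<^sub>1 W) \<inter> gtimes X\<^sub>2 W u\<^sub>2 ` pts (gprod X\<^sub>2 W) = {}"
    unfolding img using disj by blast
  moreover have "gtimes X\<^sub>1 W u\<^sub>1 ` pts (gprod X\<^sub>1 W) \<union> gtimes X\<^sub>2 W u\<^sub>2 ` pts (gprod X\<^sub>2 W) = pts (gprod X W)"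
    unfolding img unfolding pts_gprod un[symmetric] by blast
  ultimately show ?thesis
    using * W inj by (simp add: gcover_def fin_gset_gprod gtimes_gmap)
qed

end

text \<open>By Frobenius reciprocity, \<open>(T \<box> A\<^sub>W)(Y) = T(Y \<times> W)\<close>.\<close>

definition free_model :: "('g, 'a) tambara \<Rightarrow> 'g gset \<Rightarrow> ('g, 'a, 'a) tmodule" where
  "free_model T W =
    \<lparr>mval = \<lambda>Y. add_monoid (tval T (gprod Y W)),
     mres = \<lambda>X Y f. tres T (gprod X W) (gprod Y W) (gtimes X W f),
     mtr = \<lambda>X Y f. ttr T (gprod X W) (gprod Y W) (gtimes X W f),
     mact = \<lambda>Y t m. tres T (gprod Y W) Y (gfst Y W) t \<otimes>\<^bsub>tval T (gprod Y W)\<^esub> m\<rparr>"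

text \<open>The module map \<open>t \<mapsto> pr\<^sub>1\<^sub>+(t \<cdot> pr\<^sub>2\<^sup>* w)\<close> classified by \<open>w \<in> M(W)\<close>.\<close>

definition yoneda_map :: "('g, 'a, 'm) tmodule \<Rightarrow> 'g gset \<Rightarrow> 'm \<Rightarrow> 'g gset \<Rightarrow> 'a \<Rightarrow> 'm" where
  "yoneda_map M W w Y t = mtr M (gprod Y W) Y (gfst Y W)
    (mact M (gprod Y W) t (mres M (gprod Y W) W (gsnd Y W) w))"

text \<open>The transfer of 1 along the diagonal is the universal element of
  \<open>T\<^sub>W(W)\<close>, the one that corresponds to the identity of
  \<open>T\<^sub>W\<close>.\<close>

definition free_gen :: "('g, 'a) tambara \<Rightarrow> 'g gset \<Rightarrow> 'a" where
  "free_gen T W = ttr T W (gprod W W) (gpair W (gid W) (gid W)) \<one>\<^bsub>tval T W\<^esub>"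

section \<open>The model is a module and satisfies the Yoneda lemma\<close>

context finite_tambara
begin

text \<open>Taking the product with \<open>W\<close> preserves fibre products and disjoint unions,
  so each Mackey axiom is one of \<open>T\<close>. The compatibilities of the action with transfers
  are Frobenius reciprocity.\<close>

lemma tambara_module_free_model:
  assumes W: "fin_gset G W" shows "tambara_module G T (free_model T W)"
proof -
  note P = fin_gset_gprod[OF _ W]
  note times = gtimes_gmap[OF _ W]
  have R: "cring (tval T (gprod X W))" if "fin_gset G X" for X by (rule val[OF P[OF that]])
  have mackey: "mackey_functor G (free_model T W)"
  proof (rule mackey_functor.intro, goal_cases)
    case (1 X)
    then interpret R: cring "tval T (gprod X W)" by (rule R)
    show ?case using R.a_comm_group by (simp add: free_model_def)
  next
    case (2 X Y f)
    then show ?case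
      using res_hom[OF P[OF 2(1)] P[OF 2(2)] times[OF 2(1,3)]]
        by (simp add: free_model_def ring_hom_def hom_def)
  next
    case (3 X Y f)
    then show ?case using tr_hom[OF P[OF 3(1)] P[OF 3(2)] times[OF 3(1,3)]]
      by (simp add: free_model_def)
  next
    case (4 X m) then show ?case by (simp add: free_model_def gtimes_gid res_id P)
  next
    case (5 X m) then show ?case by (simp add: free_model_def gtimes_gid tr_id P)
  next
    case (6 X Y Z f h m)
    then show ?case
      using res_comp[OF P[OF 6(1)] P[OF 6(2)] P[OF 6(3)] times[OF 6(1,4)] times[OF 6(2,5)], of m]
      by (simp add: free_model_def gtimes_gcomp[OF 6(4)])
  next
    case (7 X Y Z f h m)
    then show ?case
      using tr_comp[OF P[OF 7(1)] P[OF 7(2)] P[OF 7(3)] times[OF 7(1,4)] times[OF 7(2,5)], of m]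
      by (simp add: free_model_def gtimes_gcomp[OF 7(4)])
  next
    case (8 X Y)
    let ?S = "gprod (gsum X Y) W" and ?l = "gtimes X W (ginl X)" and ?r = "gtimes Y W (ginr Y)"
    note S = P[OF fin_gset_gsum[OF 8]]
    note l = times[OF 8(1) ginl_gmap[OF 8(1), of Y]] and r = times[OF 8(2) ginr_gmap[OF 8(2), of X]]
    note cov = gcover_gtimes[OF gcover_gsum[OF 8] W]
    have "bij_betw (\<lambda>m. (tres T (gprod X W) ?S ?l m, tres T (gprod Y W) ?S ?r m))
        (carrier (tval T ?S)) (carrier (tval T (gprod X W)) \<times> carrier (tval T (gprod Y W)))"
      by (rule trmul.gcover_bij[OF cov])
    then show ?case by (simp add: free_model_def)
  next
    case (9 X)
    then have "pts (gprod X W) = {}" by (auto simp: pts_gprod)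
    then show ?case using empty[OF P[OF 9(1)]] by (simp add: free_model_def)
  next
    case (10 X Y Y' f h m)
    note pb = gpullback_gtimes[OF gpullback_gpb[OF 10(1,3,2,4,5)] W]
    show ?case
      using tradd.res_tr_pullback[OF pb] 10(6) by (simp add: free_model_def)
  qed
  show ?thesis
  proof (intro tambara_module.intro mackey tambara_module_axioms.intro, goal_cases)
    case (1 X t m)
    then interpret R: cring "tval T (gprod X W)" by (intro R)
    show ?case using 1 by (simp add: free_model_def res_closed[OF P _ gfst_gmap[OF _ W]])
  next
    case (2 X s t m)
    then interpret R: cring "tval T (gprod X W)" by (intro R)
    show ?case
      using 2 by (simp add: free_model_def res_add[OF P _ gfst_gmap[OF _ W]] R.l_distr
          res_closed[OF P _ gfst_gmap[OF _ W]])
  next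
    case (3 X t m n)
    then interpret R: cring "tval T (gprod X W)" by (intro R)
    show ?case using 3 by (simp add: free_model_def R.r_distr res_closed[OF P _ gfst_gmap[OF _ W]])
  next
    case (4 X Y f t m)
    note fX = gfst_gmap[OF 4(1) W] and fY = gfst_gmap[OF 4(2) W]
    show ?case
      using 4 res_comp[OF P[OF 4(1)] P[OF 4(2)] 4(2) times[OF 4(1,3)] fY 4(4)]
        res_comp[OF P[OF 4(1)] 4(1,2) fX 4(3,4)]
      by (simp add: free_model_def res_mult[OF P[OF 4(1)] P[OF 4(2)] times[OF 4(1,3)]]
          res_closed[OF P[OF 4(2)] 4(2) fY] gfst_gtimes[OF 4(3)])
  next
    case (5 X Y f t m)
    interpret R: cring "tval T (gprod Y W)" by (rule R[OF 5(2)])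
    interpret RX: cring "tval T (gprod X W)" by (rule R[OF 5(1)])
    note fX = gfst_gmap[OF 5(1) W] and fY = gfst_gmap[OF 5(2) W] and f = times[OF 5(1,3)]
    let ?t = "tres T (gprod X W) X (gfst X W) t"
    have t: "?t \<in> carrier (tval T (gprod X W))" by (rule res_closed[OF P[OF 5(1)] 5(1) fX 5(4)])
    have m: "m \<in> carrier (tval T (gprod Y W))" using 5(5) by (simp add: free_model_def)
    note rm = res_closed[OF P[OF 5(1)] P[OF 5(2)] f m]
      and tt = tr_closed[OF P[OF 5(1)] P[OF 5(2)] f t]
    have "ttr T (gprod X W) (gprod Y W) (gtimes X W f) (?t \<otimes>\<^bsub>tval T (gprod X W)\<^esub>
        tres T (gprod X W) (gprod Y W) (gtimes X W f) m)
      = ttr T (gprod X W) (gprod Y W) (gtimes X W f) ?t \<otimes>\<^bsub>tval T (gprod Y W)\<^esub> m"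
      using frobenius[OF P[OF 5(1)] P[OF 5(2)] f m t] t rm m tt by (simp add: RX.m_comm R.m_comm)
    moreover have "tres T (gprod Y W) Y (gfst Y W) (ttr T X Y f t) = ttr T (gprod X W) (gprod Y W) (gtimes X W f) ?t"
      using tradd.res_tr_pullback[OF gpullback_gfst(1)[OF 5(1,2) W 5(3)]] 5(4) by simp
    ultimately show ?case by (simp add: free_model_def)
  next
    case (6 X Y f t m)
    note fX = gfst_gmap[OF 6(1) W] and fY = gfst_gmap[OF 6(2) W] and f = times[OF 6(1,3)]
    have "tres T (gprod X W) X (gfst X W) (tres T X Y f t)
        = tres T (gprod X W) (gprod Y W) (gtimes X W f) (tres T (gprod Y W) Y (gfst Y W) t)"
      using res_comp[OF P[OF 6(1)] P[OF 6(2)] 6(2) f fY 6(4)] res_comp[OF P[OF 6(1)] 6(1,2) fX 6(3,4)]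
      by (simp add: gfst_gtimes[OF 6(3)])
    then show ?case
      using 6 frobenius[OF P[OF 6(1)] P[OF 6(2)] f res_closed[OF P[OF 6(2)] 6(2) fY 6(4)]]
      by (simp add: free_model_def)
  next
    case (7 X m)
    then interpret R: cring "tval T (gprod X W)" by (intro R)
    show ?case using 7 by (simp add: free_model_def res_one[OF P _ gfst_gmap[OF _ W]])
  next
    case (8 X s t m)
    then interpret R: cring "tval T (gprod X W)" by (intro R)
    show ?case
      using 8 by (simp add: free_model_def res_mult[OF P _ gfst_gmap[OF _ W]] R.m_assoc
          res_closed[OF P _ gfst_gmap[OF _ W]])
  qed
qed

lemma free_gen_closed: assumes W: "fin_gset G W" shows "free_gen T W \<in> carrier (tval T (gprod W W))"
proof -
  interpret W: cring "tval T W" by (rule val[OF W])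
  show ?thesis
    unfolding free_gen_def
    by (rule tr_closed[OF W fin_gset_gprod[OF W W] gpair_gmap[OF W gid_gmap[OF W] gid_gmap[OF W]] W.one_closed])
qed

text \<open>Pulled back along the second projection of \<open>Y \<times> W\<close>, the diagonal of
  \<open>W\<close> becomes the graph of that projection.\<close>

lemma free_gen_res:
  assumes W: "fin_gset G W" and Y: "fin_gset G Y"
  shows "tres T (gprod (gprod Y W) W) (gprod W W) (gtimes (gprod Y W) W (gsnd Y W)) (free_gen T W)
    = ttr T (gprod Y W) (gprod (gprod Y W) W) (gpair (gprod Y W) (gid (gprod Y W)) (gsnd Y W)) \<one>\<^bsub>tval T (gprod Y W)\<^esub>"
proof -
  note YW = fin_gset_gprod[OF Y W] and WW = fin_gset_gprod[OF W W]
  note YWW = fin_gset_gprod[OF YW W] and f2 = gsnd_gmap[OF Y W]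
  define d where "d = gpair (gprod Y W) (gid (gprod Y W)) (gsnd Y W)"
  define e where "e = gpair W (gid W) (gid W)"
  have d: "d \<in> gmap G (gprod Y W) (gprod (gprod Y W) W)"
    unfolding d_def by (rule gpair_gmap[OF YW gid_gmap[OF YW] f2])
  have e: "e \<in> gmap G W (gprod W W)" unfolding e_def
    by (rule gpair_gmap[OF W gid_gmap[OF W] gid_gmap[OF W]])
  note s = gtimes_gmap[OF YW W f2]
  interpret W: cring "tval T W" by (rule val[OF W])
  have pb: "gpullback G (gprod Y W) W (gprod (gprod Y W) W) (gprod W W) e (gtimes (gprod Y W) W (gsnd Y W)) d (gsnd Y W)"
    by (rule gpullbackI[OF YW W YWW WW e s d f2]) (auto simp: d_def e_def elim!: gprod_cases)
  show ?thesis
    unfolding free_gen_def e_def[symmetric] d_def[symmetric]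
    using tradd.res_tr_pullback[OF pb] by (simp add: res_one[OF YW W f2])
qed

text \<open>By Frobenius reciprocity the pullback of \<open>t\<close> times the transfer of 1 along
  the graph \<open>d\<close> is the transfer of \<open>t\<close> along \<open>d\<close>, and the
  projection undoes \<open>d\<close>. So every element of the model is built from the
  generator.\<close>

lemma free_gen_yoneda:
  assumes W: "fin_gset G W" and Y: "fin_gset G Y" and t: "t \<in> carrier (tval T (gprod Y W))"
  shows "yoneda_map (free_model T W) W (free_gen T W) Y t = t"
proof -
  note YW = fin_gset_gprod[OF Y W]
  note YWW = fin_gset_gprod[OF YW W]
  note f1 = gfst_gmap[OF Y W] and f2 = gsnd_gmap[OF Y W] and g1 = gfst_gmap[OF YW W]
  define d where "d = gpair (gprod Y W) (gid (gprod Y W)) (gsnd Y W)"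
  have d: "d \<in> gmap G (gprod Y W) (gprod (gprod Y W) W)"
    unfolding d_def by (rule gpair_gmap[OF YW gid_gmap[OF YW] f2])
  note p = gtimes_gmap[OF YW W f1]
  interpret YW: cring "tval T (gprod Y W)" by (rule val[OF YW])
  interpret YWW: cring "tval T (gprod (gprod Y W) W)" by (rule val[OF YWW])
  note 1 = free_gen_res[OF W Y, folded d_def]
  let ?t = "tres T (gprod (gprod Y W) W) (gprod Y W) (gfst (gprod Y W) W) t"
  have tc: "?t \<in> carrier (tval T (gprod (gprod Y W) W))" by (rule res_closed[OF YWW YW g1 t])
  have "tres T (gprod Y W) (gprod (gprod Y W) W) d ?t = t"
    using res_comp[OF YW YWW YW d g1 t] gfst_gpair[OF gid_gmap[OF YW] f2]
    by (simp add: d_def res_id[OF YW t])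
  then have 2: "?t \<otimes>\<^bsub>tval T (gprod (gprod Y W) W)\<^esub> ttr T (gprod Y W) (gprod (gprod Y W) W) d \<one>\<^bsub>tval T (gprod Y W)\<^esub>
      = ttr T (gprod Y W) (gprod (gprod Y W) W) d t"
    using frobenius[OF YW YWW d tc YW.one_closed] t by simp
  have "gcomp (gprod Y W) (gtimes (gprod Y W) W (gfst Y W)) d = gid (gprod Y W)"
    by (rule gmap_eqI[OF gcomp_gmap[OF d p YW] gid_gmap[OF YW]]) (auto simp: d_def elim!: gprod_cases)
  then have "ttr T (gprod (gprod Y W) W) (gprod Y W) (gtimes (gprod Y W) W (gfst Y W))
      (ttr T (gprod Y W) (gprod (gprod Y W) W) d t) = t"
    using tr_comp[OF YW YWW YW d p t] by (simp add: tr_id[OF YW t])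
  then show ?thesis using 1 2 by (simp add: yoneda_map_def free_model_def)
qed

text \<open>A module map commutes with the restriction, the action and the transfer by which
  \<open>free_gen_yoneda\<close> builds \<open>t\<close> from the generator. This is uniqueness in
  the Yoneda lemma.\<close>

lemma tmodule_map_free_model:
  assumes W: "fin_gset G W" and \<psi>: "tmodule_map G T (free_model T W) M \<psi>"
    and Y: "fin_gset G Y" and t: "t \<in> carrier (tval T (gprod Y W))"
  shows "\<psi> Y t = yoneda_map M W (\<psi> W (free_gen T W)) Y t"
proof -
  interpret F: tambara_module G T "free_model T W" by (rule tambara_module_free_model[OF W])
  interpret F: semi_mackey G "mval (free_model T W)" "mres (free_model T W)" "mtr (free_model T W)"
    by (rule semi_mackey_mackey[OF F.mackey_functor_axioms])
  note YW = fin_gset_gprod[OF Y W]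
  note f1 = gfst_gmap[OF Y W] and f2 = gsnd_gmap[OF Y W]
  have g: "free_gen T W \<in> carrier (mval (free_model T W) W)"
    using free_gen_closed[OF W] by (simp add: free_model_def)
  note rg = F.res_closed[OF YW W f2 g]
  note ag = F.act_closed[OF YW t rg]
  have res: "\<psi> X (mres (free_model T W) X Y f m) = mres M X Y f (\<psi> Y m)"
    if "fin_gset G X" "fin_gset G Y" "f \<in> gmap G X Y" "m \<in> carrier (mval (free_model T W) Y)" for X Y f m
    using \<psi> that unfolding tmodule_map_def by blast
  have tr: "\<psi> Y (mtr (free_model T W) X Y f m) = mtr M X Y f (\<psi> X m)"
    if "fin_gset G X" "fin_gset G Y" "f \<in> gmap G X Y" "m \<in> carrier (mval (free_model T W) X)" for X Y f m
    using \<psi> that unfolding tmodule_map_def by blast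
  have act: "\<psi> X (mact (free_model T W) X t m) = mact M X t (\<psi> X m)"
    if "fin_gset G X" "t \<in> carrier (tval T X)" "m \<in> carrier (mval (free_model T W) X)" for X t m
    using \<psi> that unfolding tmodule_map_def by blast
  have "\<psi> Y t = \<psi> Y (yoneda_map (free_model T W) W (free_gen T W) Y t)"
    by (simp add: free_gen_yoneda[OF W Y t])
  also have "\<dots> = yoneda_map M W (\<psi> W (free_gen T W)) Y t"
    unfolding yoneda_map_def using tr[OF YW Y f1 ag] act[OF YW t rg] res[OF YW W f2 g] by simp
  finally show ?thesis .
qed

text \<open>Existence in the Yoneda lemma. Compatibility with restrictions is base change, with
  transfers \<open>act_tr_left\<close>, with scalars \<open>act_assoc\<close> and
  \<open>act_tr_right\<close>.\<close>

lemma yoneda_tmodule_map: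
  assumes M: "tambara_module G T M" and W: "fin_gset G W" and w: "w \<in> carrier (mval M W)"
  shows "tmodule_map G T (free_model T W) M (yoneda_map M W w)"
proof -
  interpret M: tambara_module G T M by fact
  interpret sM: semi_mackey G "mval M" "mres M" "mtr M"
    by (rule semi_mackey_mackey[OF M.mackey_functor_axioms])
  note P = fin_gset_gprod[OF _ W]
  have wc: "mres M (gprod X W) W (gsnd X W) w \<in> carrier (mval M (gprod X W))"
    if "fin_gset G X" for X
    using that by (simp add: sM.res_closed[OF P[OF that] W gsnd_gmap[OF that W] w])
  have ac: "mact M (gprod X W) t (mres M (gprod X W) W (gsnd X W) w) \<in> carrier (mval M (gprod X W))"
    if "fin_gset G X" "t \<in> carrier (tval T (gprod X W))" for X t
    by (rule M.act_closed[OF P[OF that(1)] that(2) wc[OF that(1)]])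
  \<comment> \<open>The second projection is unchanged by \<open>f\<close> on the first factor, so
    the pullbacks of \<open>w\<close> to the various products with \<open>W\<close> are
    compatible.\<close>
  have w_res: "mres M (gprod X W) (gprod Y W) (gtimes X W f) (mres M (gprod Y W) W (gsnd Y W) w)
      = mres M (gprod X W) W (gsnd X W) w"
    if X: "fin_gset G X" and Y: "fin_gset G Y" and f: "f \<in> gmap G X Y" for X Y f
    using sM.res_comp[OF P[OF X] P[OF Y] W gtimes_gmap[OF X W f] gsnd_gmap[OF Y W] w]
    by (simp add: gsnd_gtimes[OF f])
  show ?thesis
    unfolding tmodule_map_def
  proof (intro conjI allI impI ballI)
    fix X assume X: "fin_gset G X"
    show "yoneda_map M W w X \<in> hom (mval (free_model T W) X) (mval M X)"
    proof (rule homI)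
      show "yoneda_map M W w X t \<in> carrier (mval M X)"
        if "t \<in> carrier (mval (free_model T W) X)" for t
        unfolding yoneda_map_def using that
        by (intro sM.tr_closed[OF P[OF X] X gfst_gmap[OF X W]] ac[OF X]) (simp add: free_model_def)
      show "yoneda_map M W w X (s \<otimes>\<^bsub>mval (free_model T W) X\<^esub> t)
          = yoneda_map M W w X s \<otimes>\<^bsub>mval M X\<^esub> yoneda_map M W w X t"
        if "s \<in> carrier (mval (free_model T W) X)" "t \<in> carrier (mval (free_model T W) X)" for s t
        using that by (simp add: free_model_def yoneda_map_def M.act_add_left[OF P[OF X] _ _ wc[OF X]]
            sM.tr_mult[OF P[OF X] X gfst_gmap[OF X W]] ac[OF X])
    qed
  next
    fix X Y f m assume "fin_gset G X \<and> fin_gset G Y \<and> f \<in> gmap G X Y"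
      and m: "m \<in> carrier (mval (free_model T W) Y)"
    then have X: "fin_gset G X" and Y: "fin_gset G Y" and f: "f \<in> gmap G X Y" by auto
    have m': "m \<in> carrier (tval T (gprod Y W))" using m by (simp add: free_model_def)
    show "yoneda_map M W w X (mres (free_model T W) X Y f m) = mres M X Y f (yoneda_map M W w Y m)"
      unfolding yoneda_map_def sM.res_tr_pullback[OF gpullback_gfst(2)[OF X Y W f] ac[OF Y m']]
        M.act_res[OF P[OF X] P[OF Y] gtimes_gmap[OF X W f] m' wc[OF Y]] w_res[OF X Y f]
      by (simp add: free_model_def)
  next
    fix X Y f m assume "fin_gset G X \<and> fin_gset G Y \<and> f \<in> gmap G X Y"
      and m: "m \<in> carrier (mval (free_model T W) X)"
    then have X: "fin_gset G X" and Y: "fin_gset G Y" and f: "f \<in> gmap G X Y" by auto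
    have m': "m \<in> carrier (tval T (gprod X W))" using m by (simp add: free_model_def)
    note f' = gtimes_gmap[OF X W f]
    have "mact M (gprod Y W) (ttr T (gprod X W) (gprod Y W) (gtimes X W f) m) (mres M (gprod Y W) W (gsnd Y W) w)
        = mtr M (gprod X W) (gprod Y W) (gtimes X W f) (mact M (gprod X W) m (mres M (gprod X W) W (gsnd X W) w))"
      using M.act_tr_left[OF P[OF X] P[OF Y] f' m' wc[OF Y]] w_res[OF X Y f] by simp
    then show "yoneda_map M W w Y (mtr (free_model T W) X Y f m) = mtr M X Y f (yoneda_map M W w X m)"
      using sM.tr_comp[OF P[OF X] P[OF Y] Y f' gfst_gmap[OF Y W] ac[OF X m']]
        sM.tr_comp[OF P[OF X] X Y gfst_gmap[OF X W] f ac[OF X m']]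
      by (simp add: yoneda_map_def free_model_def gfst_gtimes[OF f])
  next
    fix X t m assume X: "fin_gset G X" and t: "t \<in> carrier (tval T X)"
      and m: "m \<in> carrier (mval (free_model T W) X)"
    have m': "m \<in> carrier (tval T (gprod X W))" using m by (simp add: free_model_def)
    note f = gfst_gmap[OF X W]
    show "yoneda_map M W w X (mact (free_model T W) X t m) = mact M X t (yoneda_map M W w X m)"
      using M.act_assoc[OF P[OF X] res_closed[OF P[OF X] X f t] m' wc[OF X]]
        M.act_tr_right[OF P[OF X] X f t ac[OF X m']]
      by (simp add: yoneda_map_def free_model_def)
  qed
qed

end

section \<open>Nakayama's lemma\<close>

text \<open>Here \<open>S\<close> is a module over \<open>R\<close> via \<open>\<rho>\<close>; \<open>hspan\<close> is \<open>N + J x\<^sub>1 + \<dots> + J x\<^sub>n\<close>.\<close>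

primrec hspan ::
    "('s, 'y) ring_scheme \<Rightarrow> ('r \<Rightarrow> 's) \<Rightarrow> 'r set \<Rightarrow> 's set \<Rightarrow> 's list \<Rightarrow> 's set" where
  "hspan S \<rho> J N [] = N"
| "hspan S \<rho> J N (x # xs) = {\<rho> a \<otimes>\<^bsub>S\<^esub> x \<oplus>\<^bsub>S\<^esub> l | a l. a \<in> J \<and> l \<in> hspan S \<rho> J N xs}"

text \<open>In the intended instance \<open>R\<close> is \<open>T(Y)\<close>, \<open>S\<close> is
  \<open>T(Y \<times> W)\<close>, \<open>\<rho>\<close> is restriction along the projection,
  \<open>J\<close> is \<open>\<mm> Y\<close>, and \<open>N\<close> is the value of a submodule at
  \<open>Y\<close>.\<close>

locale ring_nakayama = R: cring R + S: cring S
  for R :: "('r, 'x) ring_scheme" and S :: "('s, 'y) ring_scheme" +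
  fixes \<rho> :: "'r \<Rightarrow> 's" and J :: "'r set" and N :: "'s set"
  assumes hom: "\<rho> \<in> ring_hom R S"
    and J: "ideal J R"
    and N_sub: "N \<subseteq> carrier S" and N_zero: "\<zero>\<^bsub>S\<^esub> \<in> N"
    and N_add: "m \<in> N \<Longrightarrow> n \<in> N \<Longrightarrow> m \<oplus>\<^bsub>S\<^esub> n \<in> N"
    and N_act: "r \<in> carrier R \<Longrightarrow> n \<in> N \<Longrightarrow> \<rho> r \<otimes>\<^bsub>S\<^esub> n \<in> N"
begin

interpretation J: ideal J R by (rule J)

lemma rho_closed: "a \<in> carrier R \<Longrightarrow> \<rho> a \<in> carrier S"
  using hom by (rule ring_hom_closed)

lemma rho_zero: "\<rho> \<zero>\<^bsub>R\<^esub> = \<zero>\<^bsub>S\<^esub>"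
  using ring_hom_zero[OF hom R.ring_axioms S.ring_axioms] .

lemma J_zero: "\<zero>\<^bsub>R\<^esub> \<in> J"
  by (rule additive_subgroup.zero_closed[OF ideal.axioms(1)[OF J]])

lemma hspan_ConsI:
  "a \<in> J \<Longrightarrow> l \<in> hspan S \<rho> J N xs \<Longrightarrow> n = \<rho> a \<otimes>\<^bsub>S\<^esub> x \<oplus>\<^bsub>S\<^esub> l \<Longrightarrow> n \<in> hspan S \<rho> J N (x # xs)"
  by auto

lemma hspan_carrier: "set xs \<subseteq> carrier S \<Longrightarrow> hspan S \<rho> J N xs \<subseteq> carrier S"
  by (induction xs) (use N_sub J.Icarr in \<open>auto simp: subset_iff rho_closed\<close>)

lemma hspan_base: "set xs \<subseteq> carrier S \<Longrightarrow> N \<subseteq> hspan S \<rho> J N xs"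
proof (induction xs)
  case (Cons x xs)
  show ?case
  proof
    fix n assume n: "n \<in> N"
    then have "n = \<rho> \<zero>\<^bsub>R\<^esub> \<otimes>\<^bsub>S\<^esub> x \<oplus>\<^bsub>S\<^esub> n" using Cons.prems N_sub by (auto simp: rho_zero)
    then show "n \<in> hspan S \<rho> J N (x # xs)"
      by (rule hspan_ConsI[OF J_zero, rotated]) (use Cons n in auto)
  qed
qed simp

lemma hspan_zero: "set xs \<subseteq> carrier S \<Longrightarrow> \<zero>\<^bsub>S\<^esub> \<in> hspan S \<rho> J N xs"
  using hspan_base N_zero by blast

lemma hspan_add:
  "set xs \<subseteq> carrier S \<Longrightarrow> m \<in> hspan S \<rho> J N xs \<Longrightarrow> n \<in> hspan S \<rho> J N xs
    \<Longrightarrow> m \<oplus>\<^bsub>S\<^esub> n \<in> hspan S \<rho> J N xs"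
proof (induction xs arbitrary: m n)
  case Nil then show ?case using N_add by simp
next
  case (Cons x xs)
  obtain a k where m: "a \<in> J" "k \<in> hspan S \<rho> J N xs" "m = \<rho> a \<otimes>\<^bsub>S\<^esub> x \<oplus>\<^bsub>S\<^esub> k" using Cons.prems by auto
  obtain b l where n: "b \<in> J" "l \<in> hspan S \<rho> J N xs" "n = \<rho> b \<otimes>\<^bsub>S\<^esub> x \<oplus>\<^bsub>S\<^esub> l" using Cons.prems by auto
  have c: "x \<in> carrier S" "k \<in> carrier S" "l \<in> carrier S" "a \<in> carrier R" "b \<in> carrier R"
    using Cons.prems hspan_carrier[of xs] m n J.Icarr by auto
  then have "m \<oplus>\<^bsub>S\<^esub> n = \<rho> (a \<oplus>\<^bsub>R\<^esub> b) \<otimes>\<^bsub>S\<^esub> x \<oplus>\<^bsub>S\<^esub> (k \<oplus>\<^bsub>S\<^esub> l)"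
    by (simp add: m n ring_hom_add[OF hom] rho_closed S.l_distr S.a_ac)
  moreover have "k \<oplus>\<^bsub>S\<^esub> l \<in> hspan S \<rho> J N xs" using Cons m n by auto
  ultimately show ?case using J.a_closed[OF m(1) n(1)] by auto
qed

lemma hspan_act:
  "set xs \<subseteq> carrier S \<Longrightarrow> r \<in> carrier R \<Longrightarrow> n \<in> hspan S \<rho> J N xs \<Longrightarrow> \<rho> r \<otimes>\<^bsub>S\<^esub> n \<in> hspan S \<rho> J N xs"
proof (induction xs arbitrary: n)
  case Nil then show ?case using N_act by simp
next
  case (Cons x xs)
  obtain b l where n: "b \<in> J" "l \<in> hspan S \<rho> J N xs" "n = \<rho> b \<otimes>\<^bsub>S\<^esub> x \<oplus>\<^bsub>S\<^esub> l" using Cons.prems by auto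
  have c: "x \<in> carrier S" "l \<in> carrier S" "b \<in> carrier R"
    using Cons.prems hspan_carrier[of xs] n J.Icarr by auto
  then have "\<rho> r \<otimes>\<^bsub>S\<^esub> n = \<rho> (r \<otimes>\<^bsub>R\<^esub> b) \<otimes>\<^bsub>S\<^esub> x \<oplus>\<^bsub>S\<^esub> \<rho> r \<otimes>\<^bsub>S\<^esub> l"
    using Cons.prems by (simp add: n ring_hom_mult[OF hom] rho_closed S.r_distr S.m_assoc)
  moreover have "\<rho> r \<otimes>\<^bsub>S\<^esub> l \<in> hspan S \<rho> J N xs" using Cons n by auto
  ultimately show ?case using J.I_l_closed[OF n(1)] Cons.prems(2) by auto
qed

lemma hspan_gen:
  "set xs \<subseteq> carrier S \<Longrightarrow> x \<in> set xs \<Longrightarrow> a \<in> J \<Longrightarrow> \<rho> a \<otimes>\<^bsub>S\<^esub> x \<in> hspan S \<rho> J N xs"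
proof (induction xs)
  case (Cons y xs)
  show ?case
  proof (cases "x = y")
    case True
    have "\<rho> a \<otimes>\<^bsub>S\<^esub> x = \<rho> a \<otimes>\<^bsub>S\<^esub> y \<oplus>\<^bsub>S\<^esub> \<zero>\<^bsub>S\<^esub>"
      using Cons.prems True J.Icarr by (simp add: rho_closed)
    then show ?thesis using Cons.prems hspan_zero[of xs] by auto
  next
    case False
    have l: "\<rho> a \<otimes>\<^bsub>S\<^esub> x \<in> hspan S \<rho> J N xs" using Cons False by simp
    then have "\<rho> a \<otimes>\<^bsub>S\<^esub> x = \<rho> \<zero>\<^bsub>R\<^esub> \<otimes>\<^bsub>S\<^esub> y \<oplus>\<^bsub>S\<^esub> \<rho> a \<otimes>\<^bsub>S\<^esub> x"
      using Cons.prems hspan_carrier[of xs] by (auto simp: rho_zero)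
    then show ?thesis by (rule hspan_ConsI[OF J_zero l])
  qed
qed simp

text \<open>One generator is eliminated at a time. From \<open>x = a x + l\<close> follows
  \<open>(1 - a) x = l\<close>, so \<open>x\<close> lies in the span of the other generators. After
  substitution the hypothesis holds for the shorter list; once its members are in \<open>N\<close>,
  so is \<open>x\<close>.\<close>

lemma nakayama:
  assumes units: "\<And>a. a \<in> J \<Longrightarrow> \<one>\<^bsub>R\<^esub> \<ominus>\<^bsub>R\<^esub> a \<in> Units R"
  shows "set xs \<subseteq> carrier S \<Longrightarrow> set xs \<subseteq> hspan S \<rho> J N xs \<Longrightarrow> set xs \<subseteq> N"
proof (induction xs)
  case (Cons x xs)
  have xs: "set xs \<subseteq> carrier S" and x: "x \<in> carrier S" using Cons.prems by auto
  note L = hspan_carrier[OF xs]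
  obtain a l where a: "a \<in> J" and l: "l \<in> hspan S \<rho> J N xs" and xe: "x = \<rho> a \<otimes>\<^bsub>S\<^esub> x \<oplus>\<^bsub>S\<^esub> l"
    using Cons.prems(2) by auto
  have ac: "a \<in> carrier R" and lc: "l \<in> carrier S" using J.Icarr[OF a] L l by auto
  have "\<rho> (\<one>\<^bsub>R\<^esub> \<ominus>\<^bsub>R\<^esub> a) \<oplus>\<^bsub>S\<^esub> \<rho> a = \<one>\<^bsub>S\<^esub>"
    using ac by (simp add: ring_hom_add[OF hom, symmetric] ring_hom_one[OF hom] a_minus_def R.a_assoc R.l_neg)
  then have "x = \<rho> (\<one>\<^bsub>R\<^esub> \<ominus>\<^bsub>R\<^esub> a) \<otimes>\<^bsub>S\<^esub> x \<oplus>\<^bsub>S\<^esub> \<rho> a \<otimes>\<^bsub>S\<^esub> x"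
    using x ac by (metis S.l_distr S.l_one rho_closed R.minus_closed R.one_closed)
  then have "\<rho> a \<otimes>\<^bsub>S\<^esub> x \<oplus>\<^bsub>S\<^esub> \<rho> (\<one>\<^bsub>R\<^esub> \<ominus>\<^bsub>R\<^esub> a) \<otimes>\<^bsub>S\<^esub> x = \<rho> a \<otimes>\<^bsub>S\<^esub> x \<oplus>\<^bsub>S\<^esub> l"
    using xe x ac lc by (simp add: S.a_comm rho_closed)
  then have ul: "\<rho> (\<one>\<^bsub>R\<^esub> \<ominus>\<^bsub>R\<^esub> a) \<otimes>\<^bsub>S\<^esub> x = l"
    using x ac lc S.add.l_cancel[of "\<rho> a \<otimes>\<^bsub>S\<^esub> x" "\<rho> (\<one>\<^bsub>R\<^esub> \<ominus>\<^bsub>R\<^esub> a) \<otimes>\<^bsub>S\<^esub> x" l]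
    by (simp add: rho_closed)
  obtain b where b: "b \<in> carrier R" "b \<otimes>\<^bsub>R\<^esub> (\<one>\<^bsub>R\<^esub> \<ominus>\<^bsub>R\<^esub> a) = \<one>\<^bsub>R\<^esub>"
    using units[OF a] by (auto simp: Units_def)
  have "\<rho> b \<otimes>\<^bsub>S\<^esub> l = \<rho> (b \<otimes>\<^bsub>R\<^esub> (\<one>\<^bsub>R\<^esub> \<ominus>\<^bsub>R\<^esub> a)) \<otimes>\<^bsub>S\<^esub> x"
    using b(1) ac x by (simp add: ul[symmetric] ring_hom_mult[OF hom] rho_closed S.m_assoc)
  then have "\<rho> b \<otimes>\<^bsub>S\<^esub> l = x" using b x by (simp add: ring_hom_one[OF hom])
  then have xL: "x \<in> hspan S \<rho> J N xs" using hspan_act[OF xs b(1) l] by simp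
  have "set xs \<subseteq> hspan S \<rho> J N xs"
  proof
    fix y assume "y \<in> set xs"
    then obtain c k where "c \<in> J" "k \<in> hspan S \<rho> J N xs" "y = \<rho> c \<otimes>\<^bsub>S\<^esub> x \<oplus>\<^bsub>S\<^esub> k"
      using Cons.prems(2) by auto
    then show "y \<in> hspan S \<rho> J N xs"
      using hspan_add[OF xs hspan_act[OF xs _ xL]] J.Icarr by auto
  qed
  from Cons.IH[OF xs this] have xsN: "set xs \<subseteq> N" .
  have "hspan S \<rho> J N ys \<subseteq> N" if "set ys \<subseteq> N" for ys
    using that by (induction ys) (auto intro!: N_add N_act J.Icarr)
  from this[OF xsN] xL xsN show ?case by auto
qed simp

end

section \<open>Transitive G-sets compared by size, and transfers decomposed into orbits\<close>

lemma (in group) gtransitive_bijI: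
  assumes "fin_gset G O'" "gtransitive G O'" "fin_gset G Y" "gtransitive G Y" "f \<in> gmap G O' Y"
    and "card (pts O') \<le> card (pts Y)"
  shows "bij_betw f (pts O') (pts Y)"
proof -
  have surj: "f ` pts O' = pts Y"
    by (rule gmap_surj[OF assms(1) _ assms(4,5)]) (use assms in \<open>simp add: gtransitive_def\<close>)
  moreover have "inj_on f (pts O')"
    using assms(6) card_image_le[OF fin_gset_finite[OF assms(1)], of f] fin_gset_finite[OF assms(1)]
    by (intro eq_card_imp_inj_on) (simp_all add: surj)
  ultimately show ?thesis by (simp add: bij_betw_def)
qed

text \<open>A transitive G-set is the set of translates of one point. The bound makes the measure
  \<open>card (carrier G) - card (pts Y)\<close> drop strictly when a transitive \<open>Y\<close> is
  replaced by a larger orbit.\<close>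

lemma (in finite_group) gtransitive_card_le:
  assumes "gtransitive G Y" shows "card (pts Y) \<le> card (carrier G)"
proof -
  obtain y where y: "y \<in> pts Y" using assms by (auto simp: gtransitive_def)
  have "pts Y \<subseteq> (\<lambda>g. action Y g y) ` carrier G"
  proof
    fix z assume "z \<in> pts Y"
    then obtain g where "g \<in> carrier G" "action Y g y = z" using assms y unfolding gtransitive_def
      by blast
    then show "z \<in> (\<lambda>g. action Y g y) ` carrier G" by blast
  qed
  then show ?thesis using finite_carrier card_image_le[OF finite_carrier]
    by (meson card_mono finite_imageI le_trans)
qed

context finite_tambara
begin

text \<open>\<open>gcover_gsub\<close> splits off one orbit of \<open>D\<close> at a time, so a
  transfer is a sum of transfers from transitive G-sets. Two families \<open>J\<close> occur below:
  the ideal \<open>\<mm>\<close>, and all of \<open>T\<close>.\<close>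

lemma tr_orbits:
  assumes Z: "fin_gset G Z" and zero: "\<zero>\<^bsub>tval T Z\<^esub> \<in> A"
    and add: "\<And>a b. a \<in> A \<Longrightarrow> b \<in> A \<Longrightarrow> a \<oplus>\<^bsub>tval T Z\<^esub> b \<in> A"
    and J: "\<And>X. fin_gset G X \<Longrightarrow> J X \<subseteq> carrier (tval T X)"
    and J_res: "\<And>X Y f t. fin_gset G X \<Longrightarrow> fin_gset G Y \<Longrightarrow> f \<in> gmap G X Y \<Longrightarrow> t \<in> J Y
      \<Longrightarrow> tres T X Y f t \<in> J X"
    and orb: "\<And>O' v c. fin_gset G O' \<Longrightarrow> gtransitive G O' \<Longrightarrow> v \<in> gmap G O' Z \<Longrightarrow> c \<in> J O'
      \<Longrightarrow> ttr T O' Z v c \<in> A"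
    and "fin_gset G D" "u \<in> gmap G D Z" "c \<in> J D"
  shows "ttr T D Z u c \<in> A"
  using assms(7-)
proof (induction "card (pts D)" arbitrary: D u c rule: less_induct)
  case (less D u c)
  note D = less.prems(1) and u = less.prems(2) and c = less.prems(3)
  have cc: "c \<in> carrier (tval T D)" using J[OF D] c by blast
  show ?case
  proof (cases "pts D = {}")
    case True
    then have "c = \<zero>\<^bsub>tval T D\<^esub>" using empty[OF D] cc by simp
    then show ?thesis using tr_zero[OF D Z u] zero by simp
  next
    case False
    then obtain d where d: "d \<in> pts D" by blast
    define S where "S = orbit G (action D) d"
    have st: "gstable G D S" unfolding S_def by (rule gstable_orbit[OF D d])
    have tr: "gtransitive G (gsub D S)" unfolding S_def by (rule gtransitive_orbit[OF D d])
    have dS: "d \<in> S" unfolding S_def by (rule orbit_self[OF D d])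
    note cov = gcover_gsub[OF D st]
    note O' = fin_gset_gsub[OF D st] and C = fin_gset_gsub[OF D gstable_Diff[OF D st]]
    note iO = ginc_gmap[OF st] and iC = ginc_gmap[OF gstable_Diff[OF D st]]
    have "card (pts (gsub D (pts D - S))) < card (pts D)"
      using fin_gset_finite[OF D] d dS by (intro psubset_card_mono) auto
    then have "ttr T (gsub D (pts D - S)) Z (gcomp (gsub D (pts D - S)) u (ginc (pts D - S)))
        (tres T (gsub D (pts D - S)) D (ginc (pts D - S)) c) \<in> A"
      by (intro less.hyps C gcomp_gmap[OF iC u C] J_res[OF C D iC c])
    moreover have "ttr T (gsub D S) Z (gcomp (gsub D S) u (ginc S)) (tres T (gsub D S) D (ginc S) c) \<in> A"
      by (intro orb O' tr gcomp_gmap[OF iO u O'] J_res[OF O' D iO c])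
    ultimately show ?thesis using tradd.tr_gcover[OF cov Z u] cc add by simp
  qed
qed

end

context local_cohomological
begin

text \<open>The value of \<open>\<mm> T\<^sub>W\<close> at \<open>Y\<close> is
  \<open>\<mm>(Y \<times> W)\<close>, so \<open>cover\<close> says that \<open>T\<^sub>W\<close> is
  the sum of \<open>N\<close> and \<open>\<mm> T\<^sub>W\<close>. Transitive \<open>Y\<close> are
  settled by induction, larger orbits before smaller ones, and general \<open>Y\<close> by
  decomposition into orbits.\<close>

lemma nakayama:
  assumes W: "fin_gset G W"
    and N_sub: "\<And>Y. fin_gset G Y \<Longrightarrow> N Y \<subseteq> carrier (tval T (gprod Y W))"
    and N_zero: "\<And>Y. fin_gset G Y \<Longrightarrow> \<zero>\<^bsub>tval T (gprod Y W)\<^esub> \<in> N Y"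
    and N_add: "\<And>Y m n. fin_gset G Y \<Longrightarrow> m \<in> N Y \<Longrightarrow> n \<in> N Y \<Longrightarrow> m \<oplus>\<^bsub>tval T (gprod Y W)\<^esub> n \<in> N Y"
    and N_act: "\<And>Y r n. fin_gset G Y \<Longrightarrow> r \<in> carrier (tval T Y) \<Longrightarrow> n \<in> N Y
      \<Longrightarrow> tres T (gprod Y W) Y (gfst Y W) r \<otimes>\<^bsub>tval T (gprod Y W)\<^esub> n \<in> N Y"
    and N_tr: "\<And>X Y f n. fin_gset G X \<Longrightarrow> fin_gset G Y \<Longrightarrow> f \<in> gmap G X Y \<Longrightarrow> n \<in> N X
      \<Longrightarrow> ttr T (gprod X W) (gprod Y W) (gtimes X W f) n \<in> N Y"
    and cover: "\<And>Y t. fin_gset G Y \<Longrightarrow> t \<in> carrier (tval T (gprod Y W))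
      \<Longrightarrow> \<exists>c\<in>\<mm> (gprod Y W). t \<ominus>\<^bsub>tval T (gprod Y W)\<^esub> c \<in> N Y"
    and Y: "fin_gset G Y" and t: "t \<in> carrier (tval T (gprod Y W))"
  shows "t \<in> N Y"
proof -
  note P = fin_gset_gprod[OF _ W]
  \<comment> \<open>A map into \<open>Y \<times> W\<close> is the graph of its second component
    followed by its first component times \<open>W\<close>. Its transfer thus passes through
    \<open>T(O' \<times> W)\<close>; if \<open>N\<close> is everything at \<open>O'\<close>, closure
    of \<open>N\<close> under transfers gives the claim.\<close>
  have factor: "ttr T O' (gprod Y W) v c \<in> N Y"
    if O': "fin_gset G O'" and full: "carrier (tval T (gprod O' W)) \<subseteq> N O'" and Y: "fin_gset G Y"
      and v: "v \<in> gmap G O' (gprod Y W)" and c: "c \<in> carrier (tval T O')" for O' Y v c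
  proof -
    note f = gcomp_gmap[OF v gfst_gmap[OF Y W] O'] and b = gcomp_gmap[OF v gsnd_gmap[OF Y W] O']
    let ?f = "gcomp O' (gfst Y W) v" and ?b = "gcomp O' (gsnd Y W) v"
    note p = gpair_gmap[OF O' gid_gmap[OF O'] b]
    have fid: "gcomp O' ?f (gid O') = ?f"
      by (rule gmap_eqI[OF gcomp_gmap[OF gid_gmap[OF O'] f O'] f]) simp
    have "gcomp O' (gtimes O' W ?f) (gpair O' (gid O') ?b) = v"
      unfolding gtimes_gpair[OF gid_gmap[OF O'] b f] fid by (rule gpair_eta[OF v])
    then have "ttr T O' (gprod Y W) v c = ttr T (gprod O' W) (gprod Y W) (gtimes O' W ?f)
        (ttr T O' (gprod O' W) (gpair O' (gid O') ?b) c)"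
      using tr_comp[OF O' P[OF O'] P[OF Y] p gtimes_gmap[OF O' W f] c] by simp
    then show ?thesis
      using N_tr[OF O' Y f] full tr_closed[OF O' P[OF O'] p c] by auto
  qed
  have transitive: "carrier (tval T (gprod Y W)) \<subseteq> N Y" if "fin_gset G Y" "gtransitive G Y" for Y
    using that
  \<comment> \<open>Descending induction on the size of \<open>Y\<close>: the claim for
    \<open>Y\<close> uses the larger orbits that map to it.\<close>
  proof (induction "card (carrier G) - card (pts Y)" arbitrary: Y rule: less_induct)
    case (less Y)
    note Y = less.prems(1) and trans = less.prems(2)
    note YW = P[OF Y]
    interpret R: cring "tval T Y" by (rule val[OF Y])
    interpret S: cring "tval T (gprod Y W)" by (rule val[OF YW])
    let ?\<rho> = "tres T (gprod Y W) Y (gfst Y W)"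
    note f1 = gfst_gmap[OF Y W]
    interpret K: ring_nakayama "tval T Y" "tval T (gprod Y W)" ?\<rho> "\<mm> Y" "N Y"
      by (intro ring_nakayama.intro ring_nakayama_axioms.intro R.is_cring S.is_cring res_hom[OF YW Y f1]
          I_ideal[OF Y] N_sub[OF Y] N_zero[OF Y] N_add[OF Y] N_act[OF Y])
    \<comment> \<open>The transfers of 1 along graphs are the generators at \<open>Y\<close>; they
      are finitely many because there are only finitely many maps from \<open>Y\<close> to
      \<open>W\<close>.\<close>
    define \<gamma> where "\<gamma> b = ttr T Y (gprod Y W) (gpair Y (gid Y) b) \<one>\<^bsub>tval T Y\<^esub>" for b
    have \<gamma>_map: "gpair Y (gid Y) b \<in> gmap G Y (gprod Y W)" if "b \<in> gmap G Y W" for b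
      by (rule gpair_gmap[OF Y gid_gmap[OF Y] that])
    have \<gamma>_closed: "\<gamma> b \<in> carrier (tval T (gprod Y W))" if "b \<in> gmap G Y W" for b
      unfolding \<gamma>_def by (rule tr_closed[OF Y YW \<gamma>_map[OF that]]) simp
    \<comment> \<open>A larger orbit contributes to \<open>N\<close> by induction. Otherwise the
      first component \<open>?f\<close> of \<open>v\<close> is an isomorphism, so \<open>v\<close>
      is \<open>?f\<close> followed by the graph of some \<open>b\<close>, and Frobenius reciprocity
      extracts the transfer of \<open>c\<close> along \<open>?f\<close> as a coefficient of
      \<open>\<gamma> b\<close>.\<close>
    have orbit_case: "ttr T O' (gprod Y W) v c \<in> N Y \<or>
        (\<exists>b f. b \<in> gmap G Y W \<and> f \<in> gmap G O' Y \<and>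
          ttr T O' (gprod Y W) v c = ?\<rho> (ttr T O' Y f c) \<otimes>\<^bsub>tval T (gprod Y W)\<^esub> \<gamma> b)"
      if O': "fin_gset G O'" and tO: "gtransitive G O'" and v: "v \<in> gmap G O' (gprod Y W)"
        and c: "c \<in> carrier (tval T O')" for O' v c
    proof (cases "card (pts O') \<le> card (pts Y)")
      case False
      then have "card (carrier G) - card (pts O') < card (carrier G) - card (pts Y)"
        using gtransitive_card_le[OF tO] by simp
      from factor[OF O' less.hyps[OF this O' tO] Y v c] show ?thesis ..
    next
      case True
      let ?f = "gcomp O' (gfst Y W) v" and ?b' = "gcomp O' (gsnd Y W) v"
      note f = gcomp_gmap[OF v gfst_gmap[OF Y W] O'] and b' = gcomp_gmap[OF v gsnd_gmap[OF Y W] O']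
      obtain h where h: "h \<in> gmap G Y O'" "gcomp O' h ?f = gid O'"
        using gmap_inverse[OF O' f gtransitive_bijI[OF O' tO Y trans f True]] by blast
      define b where "b = gcomp Y ?b' h"
      have b: "b \<in> gmap G Y W" unfolding b_def by (rule gcomp_gmap[OF h(1) b' Y])
      have hf: "h (?f x) = x" if "x \<in> pts O'" for x
        using fun_cong[OF h(2), of x] that by simp
      have "gcomp O' (gpair Y (gid Y) b) ?f = v"
      proof (rule gmap_eqI[OF gcomp_gmap[OF f \<gamma>_map[OF b] O'] v])
        fix x assume x: "x \<in> pts O'"
        obtain y w where yw: "v x = HPair y w" "y \<in> pts Y" "w \<in> pts W"
          by (rule gprod_cases[OF gmap_closed[OF v x]])
        then have fx: "?f x = y" using x by simp
        have "b y = w" using hf[OF x] yw x by (simp add: b_def fx)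
        then show "gcomp O' (gpair Y (gid Y) b) ?f x = v x" using x yw by (simp add: fx)
      qed
      then have "ttr T O' (gprod Y W) v c = ttr T Y (gprod Y W) (gpair Y (gid Y) b) (ttr T O' Y ?f c)"
        using tr_comp[OF O' Y YW f \<gamma>_map[OF b] c] by simp
      moreover have r: "ttr T O' Y ?f c \<in> carrier (tval T Y)" by (rule tr_closed[OF O' Y f c])
      moreover have "tres T Y (gprod Y W) (gpair Y (gid Y) b) (?\<rho> (ttr T O' Y ?f c)) = ttr T O' Y ?f c"
        using res_comp[OF Y YW Y \<gamma>_map[OF b] f1 r] gfst_gpair[OF gid_gmap[OF Y] b]
          by (simp add: res_id[OF Y r])
      ultimately have "ttr T O' (gprod Y W) v c = ?\<rho> (ttr T O' Y ?f c) \<otimes>\<^bsub>tval T (gprod Y W)\<^esub> \<gamma> b"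
        using frobenius[OF Y YW \<gamma>_map[OF b] K.rho_closed[OF r] R.one_closed] by (simp add: \<gamma>_def)
      then show ?thesis using b f by blast
    qed
    obtain bs where bs: "set bs = gmap G Y W" using finite_list[OF finite_gmap[OF Y W]] by blast
    let ?xs = "map \<gamma> bs"
    have xs: "set ?xs \<subseteq> carrier (tval T (gprod Y W))" using bs \<gamma>_closed by auto
    \<comment> \<open>\<open>c\<close> is its own transfer along the identity. Decomposed into
      orbits, it yields elements of \<open>N\<close> and multiples of the \<open>\<gamma> b\<close>
      whose coefficients stay in \<open>\<mm> Y\<close>, as \<open>\<mm>\<close> is closed under
      transfers.\<close>
    have m_hspan: "c \<in> hspan (tval T (gprod Y W)) ?\<rho> (\<mm> Y) (N Y) ?xs"
      if c: "c \<in> \<mm> (gprod Y W)" for c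
    proof -
      have "ttr T (gprod Y W) (gprod Y W) (gid (gprod Y W)) c \<in> hspan (tval T (gprod Y W)) ?\<rho> (\<mm> Y) (N Y) ?xs"
      proof (rule tr_orbits[where J = \<mm>, OF YW K.hspan_zero[OF xs] K.hspan_add[OF xs] _ _ _ YW gid_gmap[OF YW] c])
        fix O' v c
        assume O': "fin_gset G O'" "gtransitive G O'" and v: "v \<in> gmap G O' (gprod Y W)"
          and c: "c \<in> \<mm> O'"
        from orbit_case[OF O' v I_carrier[OF O'(1) c]]
        show "ttr T O' (gprod Y W) v c \<in> hspan (tval T (gprod Y W)) ?\<rho> (\<mm> Y) (N Y) ?xs"
        proof (elim disjE exE conjE)
          assume "ttr T O' (gprod Y W) v c \<in> N Y" then show ?thesis using K.hspan_base[OF xs]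
            by blast
        next
          fix b f
          assume b: "b \<in> gmap G Y W" and f: "f \<in> gmap G O' Y"
            and "ttr T O' (gprod Y W) v c = ?\<rho> (ttr T O' Y f c) \<otimes>\<^bsub>tval T (gprod Y W)\<^esub> \<gamma> b"
          then show ?thesis using K.hspan_gen[OF xs _ I_tr[OF O'(1) Y f c], of "\<gamma> b"] bs by simp
        qed
      qed (use I_carrier I_res in auto)
      then show ?thesis by (simp add: tr_id[OF YW I_carrier[OF YW c]])
    qed
    \<comment> \<open>By \<open>cover\<close> each \<open>\<gamma> b\<close> is a sum of elements of
      \<open>N Y\<close> and \<open>\<mm>(Y \<times> W)\<close>, hence lies in the span; this is the
      hypothesis of the ring-theoretic lemma.\<close>
    have "set ?xs \<subseteq> N Y"
    proof (rule K.nakayama[OF one_minus_unit[OF Y trans] xs])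
      show "set ?xs \<subseteq> hspan (tval T (gprod Y W)) ?\<rho> (\<mm> Y) (N Y) ?xs"
      proof
        fix x assume "x \<in> set ?xs"
        then have x: "x \<in> carrier (tval T (gprod Y W))" using xs by blast
        then obtain c where c: "c \<in> \<mm> (gprod Y W)" "x \<ominus>\<^bsub>tval T (gprod Y W)\<^esub> c \<in> N Y"
          using cover[OF Y] by blast
        have "(x \<ominus>\<^bsub>tval T (gprod Y W)\<^esub> c) \<oplus>\<^bsub>tval T (gprod Y W)\<^esub> c = x"
          using x I_carrier[OF YW c(1)] by (simp add: a_minus_def S.a_assoc S.l_neg)
        then show "x \<in> hspan (tval T (gprod Y W)) ?\<rho> (\<mm> Y) (N Y) ?xs"
          using K.hspan_add[OF xs _ m_hspan[OF c(1)]] c(2) K.hspan_base[OF xs] by (metis subsetD)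
      qed
    qed
    then have \<gamma>_N: "\<gamma> b \<in> N Y" if "b \<in> gmap G Y W" for b using that bs by auto
    \<comment> \<open>The same decomposition with arbitrary coefficients: now that every
      \<open>\<gamma> b\<close> is in \<open>N Y\<close>, so is each transfer from an orbit.\<close>
    show ?case
    proof
      fix t assume t: "t \<in> carrier (tval T (gprod Y W))"
      have "ttr T (gprod Y W) (gprod Y W) (gid (gprod Y W)) t \<in> N Y"
      proof (rule tr_orbits[where J = "\<lambda>X. carrier (tval T X)" and A = "N Y", OF YW N_zero[OF Y] N_add[OF Y] _ _ _ YW gid_gmap[OF YW] t])
        fix O' v c
        assume O': "fin_gset G O'" "gtransitive G O'" and v: "v \<in> gmap G O' (gprod Y W)"
          and c: "c \<in> carrier (tval T O')"
        from orbit_case[OF O' v c] show "ttr T O' (gprod Y W) v c \<in> N Y"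
        proof (elim disjE exE conjE)
          fix b f
          assume b: "b \<in> gmap G Y W" and f: "f \<in> gmap G O' Y"
            and "ttr T O' (gprod Y W) v c = ?\<rho> (ttr T O' Y f c) \<otimes>\<^bsub>tval T (gprod Y W)\<^esub> \<gamma> b"
          then show ?thesis using N_act[OF Y tr_closed[OF O'(1) Y f c] \<gamma>_N[OF b]] by simp
        qed
      qed (auto simp: res_closed)
      then show "t \<in> N Y" by (simp add: tr_id[OF YW t])
    qed
  qed
  \<comment> \<open>For general \<open>Y\<close>, the element is decomposed over the orbits of
    \<open>Y \<times> W\<close>, and \<open>factor\<close> reduces each of them to the transitive
    case.\<close>
  have "ttr T (gprod Y W) (gprod Y W) (gid (gprod Y W)) t \<in> N Y"
    by (rule tr_orbits[where J = "\<lambda>X. carrier (tval T X)" and A = "N Y", OF P[OF Y] N_zero[OF Y] N_add[OF Y] _ _ _ P[OF Y] gid_gmap[OF P[OF Y]] t])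
      (auto simp: res_closed intro!: factor[OF _ transitive Y])
  then show ?thesis by (simp add: tr_id[OF P[OF Y] t])
qed

end

section \<open>Generators and relations\<close>

lemma free_hom_diff:
  assumes h: "h \<in> hom (free_Abelian_group S) A" and A: "group A"
    and "Poly_Mapping.keys c \<subseteq> S" "Poly_Mapping.keys d \<subseteq> S"
  shows "h (c - d) = h c \<otimes>\<^bsub>A\<^esub> inv\<^bsub>A\<^esub> h d"
proof -
  interpret group_hom "free_Abelian_group S" A h
    using h A by (simp add: group_hom_def group_hom_axioms_def)
  have "c - d = c \<otimes>\<^bsub>free_Abelian_group S\<^esub> inv\<^bsub>free_Abelian_group S\<^esub> d" using assms by simp
  then show ?thesis
    using assms(3,4) by (metis carrier_free_Abelian_group_iff hom_inv hom_mult group.inv_closed group_free_Abelian_group h)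
qed

lemma free_hom_eqI:
  assumes h: "h \<in> hom (free_Abelian_group S) A" and k: "k \<in> hom (free_Abelian_group S) A"
    and A: "group A"
    and gens: "\<And>x. x \<in> S \<Longrightarrow> h (frag_of x) = k (frag_of x)" and c: "Poly_Mapping.keys c \<subseteq> S"
  shows "h c = k c"
proof (rule free_Abelian_group_induct[OF c])
  have "h \<one>\<^bsub>free_Abelian_group S\<^esub> = \<one>\<^bsub>A\<^esub>" "k \<one>\<^bsub>free_Abelian_group S\<^esub> = \<one>\<^bsub>A\<^esub>"
    by (rule hom_one[OF h group_free_Abelian_group A], rule hom_one[OF k group_free_Abelian_group A])
  then show "h 0 = k 0" by simp
qed (simp_all add: free_hom_diff[OF h A] free_hom_diff[OF k A] gens)

lemma keys_frag2: "x \<in> S \<Longrightarrow> y \<in> S \<Longrightarrow> Poly_Mapping.keys (frag_of x - frag_of y) \<subseteq> S"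
  using keys_diff[of "frag_of x" "frag_of y"] by auto

lemma keys_frag3:
  "x \<in> S \<Longrightarrow> y \<in> S \<Longrightarrow> z \<in> S \<Longrightarrow> Poly_Mapping.keys (frag_of x - frag_of y - frag_of z) \<subseteq> S"
  using keys_diff[of "frag_of x - frag_of y" "frag_of z"] keys_frag2[of x S y] by auto

lemma frag_extend_hom:
  assumes "\<phi> ` S \<subseteq> S'"
  shows "frag_extend (\<lambda>x. frag_of (\<phi> x)) \<in> hom (free_Abelian_group S) (free_Abelian_group S')"
proof (rule homI)
  fix c assume "c \<in> carrier (free_Abelian_group S)"
  then have "(\<Union>x\<in>Poly_Mapping.keys c. Poly_Mapping.keys (frag_of (\<phi> x))) \<subseteq> S'" using assms by auto
  then show "frag_extend (\<lambda>x. frag_of (\<phi> x)) c \<in> carrier (free_Abelian_group S')"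
    using keys_frag_extend[of "\<lambda>x. frag_of (\<phi> x)" c] unfolding carrier_free_Abelian_group_iff
      by blast
qed (simp add: frag_extend_add)

abbreviation pcl :: "'s set \<Rightarrow> ('s \<Rightarrow>\<^sub>0 int) set \<Rightarrow> ('s \<Rightarrow>\<^sub>0 int) \<Rightarrow> ('s \<Rightarrow>\<^sub>0 int) set" where
  "pcl S R c \<equiv> relations S R #>\<^bsub>free_Abelian_group S\<^esub> c"

locale presentation =
  fixes S :: "'s set" and R :: "('s \<Rightarrow>\<^sub>0 int) set"
  assumes R_carrier: "R \<subseteq> carrier (free_Abelian_group S)"
begin

sublocale F: comm_group "free_Abelian_group S"
  by (rule abelian_free_Abelian_group)

lemma R_keys: "r \<in> R \<Longrightarrow> Poly_Mapping.keys r \<subseteq> S"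
  using subsetD[OF R_carrier] by simp

lemma relations_subgroup: "subgroup (relations S R) (free_Abelian_group S)"
  unfolding relations_def by (rule F.generate_is_subgroup[OF R_carrier])

lemma relations_keys: "r \<in> relations S R \<Longrightarrow> Poly_Mapping.keys r \<subseteq> S"
  using subsetD[OF subgroup.subset[OF relations_subgroup]] by simp

lemma relations_normal: "relations S R \<lhd> free_Abelian_group S"
  by (rule F.subgroup_imp_normal[OF relations_subgroup])

lemma comm_group_presented: "comm_group (presented S R)"
  unfolding presented_def by (rule F.abelian_FactGroup[OF relations_subgroup])

lemma carrier_presented: "carrier (presented S R) = pcl S R ` {c. Poly_Mapping.keys c \<subseteq> S}"
proof -
  have "carrier (free_Abelian_group S) = {c. Poly_Mapping.keys c \<subseteq> S}" by auto
  then show ?thesis by (simp add: presented_def carrier_FactGroup)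
qed

lemma pcl_closed: "Poly_Mapping.keys c \<subseteq> S \<Longrightarrow> pcl S R c \<in> carrier (presented S R)"
  by (auto simp: carrier_presented)

lemma pcl_hom: "pcl S R \<in> hom (free_Abelian_group S) (presented S R)"
  unfolding presented_def by (rule normal.r_coset_hom_Mod[OF relations_normal])

lemma pcl_add: "Poly_Mapping.keys c \<subseteq> S \<Longrightarrow> Poly_Mapping.keys d \<subseteq> S
    \<Longrightarrow> pcl S R (c + d) = pcl S R c \<otimes>\<^bsub>presented S R\<^esub> pcl S R d"
  using hom_mult[OF pcl_hom, of c d] by simp

lemma pcl_zero: "pcl S R 0 = \<one>\<^bsub>presented S R\<^esub>"
  using hom_one[OF pcl_hom F.is_group comm_group.axioms(2)[OF comm_group_presented]] by simp

lemma one_presented: "\<one>\<^bsub>presented S R\<^esub> = relations S R"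
  by (simp add: presented_def)

lemma pcl_one_iff: "Poly_Mapping.keys c \<subseteq> S \<Longrightarrow> pcl S R c = \<one>\<^bsub>presented S R\<^esub> \<longleftrightarrow> c \<in> relations S R"
  using F.coset_join1[OF _ _ relations_subgroup, of c] F.coset_join2[OF _ relations_subgroup, of c]
    subgroup.subset[OF relations_subgroup]
  by (auto simp: one_presented)

lemma pcl_diff: "Poly_Mapping.keys c \<subseteq> S \<Longrightarrow> Poly_Mapping.keys d \<subseteq> S
    \<Longrightarrow> pcl S R (c - d) = pcl S R c \<otimes>\<^bsub>presented S R\<^esub> inv\<^bsub>presented S R\<^esub> pcl S R d"
  by (rule free_hom_diff[OF pcl_hom comm_group.axioms(2)[OF comm_group_presented]])

lemma pcl_eqI:
  assumes "c - d \<in> relations S R" "Poly_Mapping.keys c \<subseteq> S" "Poly_Mapping.keys d \<subseteq> S"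
  shows "pcl S R c = pcl S R d"
proof -
  interpret Q: comm_group "presented S R" by (rule comm_group_presented)
  have "Poly_Mapping.keys (c - d) \<subseteq> S" using assms keys_diff[of c d] by blast
  then have "pcl S R c \<otimes>\<^bsub>presented S R\<^esub> inv\<^bsub>presented S R\<^esub> pcl S R d = \<one>\<^bsub>presented S R\<^esub>"
    using assms pcl_one_iff[of "c - d"] pcl_diff[of c d] by simp
  then show ?thesis using assms pcl_closed by (metis Q.inv_equality Q.inv_inv Q.inv_closed)
qed

lemma rel: "r \<in> R \<Longrightarrow> r \<in> relations S R"
  by (simp add: relations_def generate.incl)

lemma pcl_rel_eq: "frag_of x - frag_of y \<in> R \<Longrightarrow> x \<in> S \<Longrightarrow> y \<in> S \<Longrightarrow> pcl S R (frag_of x) = pcl S R (frag_of y)"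
  by (rule pcl_eqI) (simp_all add: rel)

lemma pcl_rel_add:
  assumes "frag_of z - frag_of x - frag_of y \<in> R" "x \<in> S" "y \<in> S" "z \<in> S"
  shows "pcl S R (frag_of z) = pcl S R (frag_of x) \<otimes>\<^bsub>presented S R\<^esub> pcl S R (frag_of y)"
proof -
  have "frag_of z - (frag_of x + frag_of y) \<in> relations S R" using rel[OF assms(1)]
    by (simp add: algebra_simps)
  then have "pcl S R (frag_of z) = pcl S R (frag_of x + frag_of y)"
    by (rule pcl_eqI) (use assms keys_add[of "frag_of x" "frag_of y"] in auto)
  then show ?thesis using assms by (simp add: pcl_add)
qed

lemma hom_relations:
  assumes h: "h \<in> hom (free_Abelian_group S) A" and A: "group A" and R: "\<And>r. r \<in> R \<Longrightarrow> h r = \<one>\<^bsub>A\<^esub>"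
    and r: "r \<in> relations S R"
  shows "h r = \<one>\<^bsub>A\<^esub>"
proof -
  interpret group_hom "free_Abelian_group S" A h
    using h A F.is_group by (simp add: group_hom_def group_hom_axioms_def)
  have "relations S R \<subseteq> kernel (free_Abelian_group S) A h"
    unfolding relations_def
    by (rule F.generate_subgroup_incl[OF _ subgroup_kernel]) (use R R_keys in \<open>simp add: kernel_def subset_iff\<close>)
  then show ?thesis using r by (auto simp: kernel_def)
qed

text \<open>A homomorphism that kills the relators kills the subgroup generated by them, and so is
  constant on cosets. This is the form in which maps out of presented groups are evaluated on an
  arbitrary representative.\<close>

lemma hom_pcl_cong:
  assumes h: "h \<in> hom (free_Abelian_group S) A" and A: "group A" and R: "\<And>r. r \<in> R \<Longrightarrow> h r = \<one>\<^bsub>A\<^esub>"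
    and c: "Poly_Mapping.keys c \<subseteq> S" and d: "d \<in> pcl S R c"
  shows "h d = h c" "Poly_Mapping.keys d \<subseteq> S"
proof -
  obtain r where r: "r \<in> relations S R" "d = r + c" using d by (auto simp: r_coset_def)
  have rS: "Poly_Mapping.keys r \<subseteq> S" by (rule relations_keys[OF r(1)])
  then show "Poly_Mapping.keys d \<subseteq> S" using r c keys_add[of r c] by blast
  have "h d = h r \<otimes>\<^bsub>A\<^esub> h c" using hom_mult[OF h, of r c] rS c r by simp
  then show "h d = h c"
    using hom_relations[OF h A R r(1)] hom_in_carrier[OF h, of c] c A by (simp add: group.is_monoid)
qed

lemma pcl_self: "Poly_Mapping.keys c \<subseteq> S \<Longrightarrow> c \<in> pcl S R c"
  using F.rcos_self[OF _ relations_subgroup] by simp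

end

text \<open>\<open>presented_map\<close> is a union over all representatives. It is a single coset
  because the composite into the target presentation is constant on the given coset.\<close>

lemma presented_map_pcl:
  assumes P: "presentation S R" and P': "presentation S' R'" and \<phi>: "\<phi> ` S \<subseteq> S'"
    and R: "\<And>r. r \<in> R \<Longrightarrow> frag_extend (\<lambda>x. frag_of (\<phi> x)) r \<in> relations S' R'"
    and c: "Poly_Mapping.keys c \<subseteq> S"
  shows "presented_map S' R' \<phi> (pcl S R c) = pcl S' R' (frag_extend (\<lambda>x. frag_of (\<phi> x)) c)"
proof -
  interpret P: presentation S R by fact
  interpret P': presentation S' R' by fact
  let ?e = "frag_extend (\<lambda>x. frag_of (\<phi> x))"
  have e: "Poly_Mapping.keys (?e d) \<subseteq> S'" if "Poly_Mapping.keys d \<subseteq> S" for d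
    using hom_in_carrier[OF frag_extend_hom[OF \<phi>], of d] that by simp
  have hom: "(\<lambda>c. pcl S' R' (?e c)) \<in> hom (free_Abelian_group S) (presented S' R')"
    using hom_compose[OF frag_extend_hom[OF \<phi>] P'.pcl_hom] by (simp add: comp_def)
  have eq: "pcl S' R' (?e d) = pcl S' R' (?e c)" if "d \<in> pcl S R c" for d
  proof (rule P.hom_pcl_cong(1)[OF hom comm_group.axioms(2)[OF P'.comm_group_presented] _ c that])
    fix r assume r: "r \<in> R"
    then have "Poly_Mapping.keys r \<subseteq> S" by (rule P.R_keys)
    then show "pcl S' R' (?e r) = \<one>\<^bsub>presented S' R'\<^esub>" using P'.pcl_one_iff[OF e] R[OF r] by simp
  qed
  show ?thesis
    unfolding presented_map_def
  proof
    show "(\<Union>d\<in>pcl S R c. pcl S' R' (?e d)) \<subseteq> pcl S' R' (?e c)"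
      by (rule UN_least) (simp only: eq subset_refl)
    show "pcl S' R' (?e c) \<subseteq> (\<Union>d\<in>pcl S R c. pcl S' R' (?e d))"
      by (rule UN_upper[OF P.pcl_self[OF c]])
  qed
qed

section \<open>Representable Mackey functors\<close>

context group
begin

lemma mem_spans [simp]: "(Z, a, b) \<in> spans G Y X \<longleftrightarrow> fin_gset G Z \<and> a \<in> gmap G Z Y \<and> b \<in> gmap G Z X"
  by (simp add: spans_def)

lemma gcomp_assoc: "f \<in> gmap G X Y \<Longrightarrow> gcomp X k (gcomp X h f) = gcomp X (gcomp Y k h) f"
  by (auto simp: gcomp_def compose_def fun_eq_iff gmap_closed)

lemma gcomp_gid: "f \<in> gmap G X Y \<Longrightarrow> gcomp X (gid Y) f = f"
  by (rule extensionalityI[of _ "pts X"]) (simp_all add: gcomp_def compose_def gmap_closed, simp add: gmap_def PiE_def)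

lemma gcomp_gcopair:
  "a \<in> gmap G X Z \<Longrightarrow> b \<in> gmap G Y Z \<Longrightarrow>
    gcomp (gsum X Y) f (gcopair X Y a b) = gcopair X Y (gcomp X f a) (gcomp Y f b)"
  by (rule extensionalityI[of _ "pts (gsum X Y)"])
    (auto simp: gcomp_def compose_def gcopair_def pts_gsum)

lemma span_presentation: "presentation (spans G Y X) (span_rels G Y X)"
proof
  show "span_rels G Y X \<subseteq> carrier (free_Abelian_group (spans G Y X))"
  proof
    fix r assume "r \<in> span_rels G Y X"
    then show "r \<in> carrier (free_Abelian_group (spans G Y X))"
    proof cases
      case (iso Z' a b Z h)
      then have "(Z, gcomp Z a h, gcomp Z b h) \<in> spans G Y X" by (auto intro: gcomp_gmap)
      then show ?thesis using keys_frag2[OF _ iso(2)] by (simp add: iso(1) del: mem_spans)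
    next
      case (sum Z a b Z' a' b')
      then have "(gsum Z Z', gcopair Z Z' a a', gcopair Z Z' b b') \<in> spans G Y X"
        by (simp add: fin_gset_gsum gcopair_gmap)
      then show ?thesis using keys_frag3[OF _ sum(2,3)] by (simp add: sum(1) del: mem_spans)
    qed
  qed
qed

abbreviation scl :: "'a gset \<Rightarrow> 'a gset \<Rightarrow> ('a span \<Rightarrow>\<^sub>0 int) \<Rightarrow> ('a span \<Rightarrow>\<^sub>0 int) set" where
  "scl Y X \<equiv> pcl (spans G Y X) (span_rels G Y X)"

lemma mval_representable: "mval (representable G X) Y = presented (spans G Y X) (span_rels G Y X)"
  by (simp add: representable_def)

lemma scl_iso:
  assumes s: "(Z', a, b) \<in> spans G Y X" and Z: "fin_gset G Z" and h: "h \<in> gmap G Z Z'"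
    and bij: "bij_betw h (pts Z) (pts Z')"
  shows "scl Y X (frag_of (Z, gcomp Z a h, gcomp Z b h)) = scl Y X (frag_of (Z', a, b))"
proof (rule presentation.pcl_rel_eq[OF span_presentation span_rels.iso[OF assms] _ s])
  have "a \<in> gmap G Z' Y" "b \<in> gmap G Z' X" using s by simp_all
  then show "(Z, gcomp Z a h, gcomp Z b h) \<in> spans G Y X"
    using Z gcomp_gmap[OF h _ Z] by simp
qed

lemma scl_sum:
  assumes s: "(Z, a, b) \<in> spans G Y X" and s': "(Z', a', b') \<in> spans G Y X"
  shows "scl Y X (frag_of (gsum Z Z', gcopair Z Z' a a', gcopair Z Z' b b'))
    = scl Y X (frag_of (Z, a, b)) \<otimes>\<^bsub>presented (spans G Y X) (span_rels G Y X)\<^esub> scl Y X (frag_of (Z', a', b'))"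
proof (rule presentation.pcl_rel_add[OF span_presentation span_rels.sum[OF assms] s s'])
  show "(gsum Z Z', gcopair Z Z' a a', gcopair Z Z' b b') \<in> spans G Y X"
    using s s' by (simp add: fin_gset_gsum gcopair_gmap)
qed

text \<open>The effect of the transfers of \<open>representable\<close> on generators;
  \<open>span_pull\<close> below is the effect of the restrictions.\<close>

definition span_push :: "'a hfmap \<Rightarrow> 'a span \<Rightarrow> 'a span" where
  "span_push f = (\<lambda>(Z, a, b). (Z, gcomp Z f a, b))"

definition span_pull :: "'a gset \<Rightarrow> 'a hfmap \<Rightarrow> 'a span \<Rightarrow> 'a span" where
  "span_pull Y f = (\<lambda>(Z, a, b). (gpb Z a Y f, gpb_snd Z a Y f, gcomp (gpb Z a Y f) b (gpb_fst Z a Y f)))"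

lemma span_push_mem: "f \<in> gmap G Y Y' \<Longrightarrow> s \<in> spans G Y X \<Longrightarrow> span_push f s \<in> spans G Y' X"
proof (cases s)
  assume f: "f \<in> gmap G Y Y'" and s: "s \<in> spans G Y X"
  case (fields Z a b)
  then have Z: "fin_gset G Z" and a: "a \<in> gmap G Z Y" and b: "b \<in> gmap G Z X" using s by auto
  show ?thesis using Z b gcomp_gmap[OF a f Z] by (simp add: fields span_push_def)
qed

lemma span_pull_mem: "fin_gset G Y \<Longrightarrow> f \<in> gmap G Y Y' \<Longrightarrow> s \<in> spans G Y' X \<Longrightarrow> span_pull Y f s \<in> spans G Y X"
proof (cases s)
  assume Y: "fin_gset G Y" and f: "f \<in> gmap G Y Y'" and s: "s \<in> spans G Y' X"
  case (fields Z a b)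
  then have Z: "fin_gset G Z" and a: "a \<in> gmap G Z Y'" and b: "b \<in> gmap G Z X" using s by auto
  note P = fin_gset_gpb[OF Z Y a f]
  show ?thesis
    using P gpb_snd_gmap[OF Z Y a f] gcomp_gmap[OF gpb_fst_gmap[OF Z Y a f] b P]
    by (simp add: fields span_pull_def)
qed

lemma rel_of_scl:
  assumes "scl Y X (frag_of s) = scl Y X (frag_of t)" "s \<in> spans G Y X" "t \<in> spans G Y X"
  shows "frag_of s - frag_of t \<in> relations (spans G Y X) (span_rels G Y X)"
proof -
  interpret P: presentation "spans G Y X" "span_rels G Y X" by (rule span_presentation)
  interpret Q: comm_group "presented (spans G Y X) (span_rels G Y X)"
    by (rule P.comm_group_presented)
  have k: "Poly_Mapping.keys (frag_of s) \<subseteq> spans G Y X" "Poly_Mapping.keys (frag_of t) \<subseteq> spans G Y X"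
    using assms by simp_all
  have "Poly_Mapping.keys (frag_of s - frag_of t) \<subseteq> spans G Y X" by (rule keys_frag2[OF assms(2,3)])
  then show ?thesis using assms(1) P.pcl_diff[OF k] P.pcl_closed[OF k(2)] P.pcl_one_iff by simp
qed

text \<open>Composition with \<open>f\<close> commutes with precomposition by an isomorphism and
  with copairing, so it sends every relator to a relator.\<close>

lemma mtr_representable:
  assumes f: "f \<in> gmap G Y Y'" and c: "Poly_Mapping.keys c \<subseteq> spans G Y X"
  shows "mtr (representable G X) Y Y' f (scl Y X c) = scl Y' X (frag_extend (\<lambda>s. frag_of (span_push f s)) c)"
proof -
  have *: "mtr (representable G X) Y Y' f = presented_map (spans G Y' X) (span_rels G Y' X) (span_push f)"
    by (simp add: representable_def span_push_def)
  show ?thesis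
    unfolding *
  proof (rule presented_map_pcl[OF span_presentation span_presentation _ _ c])
    show "span_push f ` spans G Y X \<subseteq> spans G Y' X" using span_push_mem[OF f] by blast
    fix r assume "r \<in> span_rels G Y X"
    then have "frag_extend (\<lambda>s. frag_of (span_push f s)) r \<in> span_rels G Y' X"
    proof cases
      case (iso Z' a b Z h)
      have "gcomp Z f (gcomp Z a h) = gcomp Z (gcomp Z' f a) h" by (rule gcomp_assoc[OF iso(4)])
      then have "frag_extend (\<lambda>s. frag_of (span_push f s)) r
          = frag_of (Z, gcomp Z (gcomp Z' f a) h, gcomp Z b h) - frag_of (Z', gcomp Z' f a, b)"
        by (simp add: iso(1) frag_extend_diff span_push_def)
      also have "\<dots> \<in> span_rels G Y' X"
        using iso f by (intro span_rels.iso) (auto intro: gcomp_gmap)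
      finally show ?thesis .
    next
      case (sum Z a b Z' a' b')
      then have "gcomp (gsum Z Z') f (gcopair Z Z' a a') = gcopair Z Z' (gcomp Z f a) (gcomp Z' f a')"
        by (intro gcomp_gcopair) auto
      then have "frag_extend (\<lambda>s. frag_of (span_push f s)) r
          = frag_of (gsum Z Z', gcopair Z Z' (gcomp Z f a) (gcomp Z' f a'), gcopair Z Z' b b')
            - frag_of (Z, gcomp Z f a, b) - frag_of (Z', gcomp Z' f a', b')"
        by (simp add: sum(1) frag_extend_diff span_push_def)
      also have "\<dots> \<in> span_rels G Y' X"
        using sum f by (intro span_rels.sum) (auto intro: gcomp_gmap)
      finally show ?thesis .
    qed
    then show "frag_extend (\<lambda>s. frag_of (span_push f s)) r \<in> relations (spans G Y' X) (span_rels G Y' X)"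
      by (rule presentation.rel[OF span_presentation])
  qed
qed

text \<open>Isomorphic spans have isomorphic fibre products with \<open>Y\<close>; the isomorphism
  \<open>k\<close> is \<open>h\<close> on the first component and the identity on the
  second.\<close>

lemma span_pull_iso:
  assumes Y: "fin_gset G Y" and f: "f \<in> gmap G Y Y'"
    and s: "(Z', a, b) \<in> spans G Y' X" and Z: "fin_gset G Z" and h: "h \<in> gmap G Z Z'"
    and bij: "bij_betw h (pts Z) (pts Z')"
  shows "scl Y X (frag_of (span_pull Y f (Z, gcomp Z a h, gcomp Z b h)))
    = scl Y X (frag_of (span_pull Y f (Z', a, b)))"
proof -
  have Z': "fin_gset G Z'" and a: "a \<in> gmap G Z' Y'" and b: "b \<in> gmap G Z' X" using s by auto
  note ah = gcomp_gmap[OF h a Z]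
  let ?P = "gpb Z (gcomp Z a h) Y f" and ?P' = "gpb Z' a Y f"
  note P = fin_gset_gpb[OF Z Y ah f] and P' = fin_gset_gpb[OF Z' Y a f]
  define k where "k = gpair ?P (gcomp ?P h (gpb_fst Z (gcomp Z a h) Y f)) (gpb_snd Z (gcomp Z a h) Y f)"
  have k_ap: "k (HPair z y) = HPair (h z) y" if "HPair z y \<in> gpb_pts Z (gcomp Z a h) Y f" for z y
    using that by (simp add: k_def)
  have k: "k \<in> gmap G ?P ?P'"
  proof (rule gmapI)
    show "k \<in> extensional (pts ?P)" by (simp add: k_def gpair_def)
  next
    fix p assume "p \<in> pts ?P"
    then show "k p \<in> pts ?P'" by (auto elim!: gpb_cases simp: k_ap gmap_closed[OF h])
  next
    fix g p assume g: "g \<in> carrier G" and p: "p \<in> pts ?P"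
    then have "p \<in> gpb_pts Z (gcomp Z a h) Y f" by simp
    then obtain z y where zy: "p = HPair z y" "z \<in> pts Z" "y \<in> pts Y" "gcomp Z a h z = f y"
      by (rule gpb_cases)
    have "HPair (action Z g z) (action Y g y) \<in> gpb_pts Z (gcomp Z a h) Y f"
      using act_closed[OF P g p] zy by simp
    then show "k (action ?P g p) = action ?P' g (k p)"
      using zy g by (simp add: k_ap gmap_closed[OF h] gmap_equiv[OF h])
  qed
  have kb: "bij_betw k (pts ?P) (pts ?P')"
    unfolding bij_betw_def
  proof
    show "inj_on k (pts ?P)"
    proof (rule inj_onI)
      fix p q assume pq: "p \<in> pts ?P" "q \<in> pts ?P" "k p = k q"
      obtain z y where p: "p = HPair z y" "z \<in> pts Z" "y \<in> pts Y" "gcomp Z a h z = f y"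
        using pq(1) unfolding pts_gpb by (rule gpb_cases)
      obtain z' y' where q: "q = HPair z' y'" "z' \<in> pts Z" "y' \<in> pts Y" "gcomp Z a h z' = f y'"
        using pq(2) unfolding pts_gpb by (rule gpb_cases)
      have e: "h z = h z'" "y = y'" using pq(3) p q by (simp_all add: k_ap)
      have "z = z'" by (rule inj_onD[OF bij_betw_imp_inj_on[OF bij] e(1) p(2) q(2)])
      then show "p = q" using p q e by simp
    qed
    show "k ` pts ?P = pts ?P'"
    proof
      show "k ` pts ?P \<subseteq> pts ?P'" using gmap_closed[OF k] by blast
      show "pts ?P' \<subseteq> k ` pts ?P"
      proof
        fix p assume "p \<in> pts ?P'"
        then obtain z' y where p: "p = HPair z' y" "z' \<in> pts Z'" "y \<in> pts Y" "a z' = f y"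
          unfolding pts_gpb by (rule gpb_cases)
        obtain z where z: "z \<in> pts Z" "z' = h z" using p(2) bij by (auto simp: bij_betw_def)
        show "p \<in> k ` pts ?P"
          by (rule image_eqI[of _ _ "HPair z y"]) (use p z in \<open>simp_all add: k_ap\<close>)
      qed
    qed
  qed
  have 1: "gcomp ?P (gpb_snd Z' a Y f) k = gpb_snd Z (gcomp Z a h) Y f"
    by (rule gmap_eqI[OF gcomp_gmap[OF k gpb_snd_gmap[OF Z' Y a f] P] gpb_snd_gmap[OF Z Y ah f]])
      (auto elim!: gpb_cases simp: k_ap gmap_closed[OF h])
  have 2: "gcomp ?P (gcomp ?P' b (gpb_fst Z' a Y f)) k = gcomp ?P (gcomp Z b h) (gpb_fst Z (gcomp Z a h) Y f)"
    by (rule gmap_eqI[OF gcomp_gmap[OF k gcomp_gmap[OF gpb_fst_gmap[OF Z' Y a f] b P'] P]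
          gcomp_gmap[OF gpb_fst_gmap[OF Z Y ah f] gcomp_gmap[OF h b Z] P]])
      (auto elim!: gpb_cases simp: k_ap gmap_closed[OF h])
  have "(?P', gpb_snd Z' a Y f, gcomp ?P' b (gpb_fst Z' a Y f)) \<in> spans G Y X"
    using span_pull_mem[OF Y f s] by (simp add: span_pull_def)
  from scl_iso[OF this P k kb] show ?thesis by (simp add: span_pull_def 1 2)
qed

text \<open>Fibre products distribute over disjoint unions, but only up to the isomorphism
  \<open>k\<close>; so the sum relation is combined with \<open>scl_iso\<close>.\<close>

lemma span_pull_sum:
  assumes Y: "fin_gset G Y" and f: "f \<in> gmap G Y Y'"
    and s: "(Z, a, b) \<in> spans G Y' X" and s': "(Z', a', b') \<in> spans G Y' X"
  shows "scl Y X (frag_of (span_pull Y f (gsum Z Z', gcopair Z Z' a a', gcopair Z Z' b b')))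
    = scl Y X (frag_of (span_pull Y f (Z, a, b)))
      \<otimes>\<^bsub>presented (spans G Y X) (span_rels G Y X)\<^esub> scl Y X (frag_of (span_pull Y f (Z', a', b')))"
proof -
  have Z: "fin_gset G Z" and a: "a \<in> gmap G Z Y'" and b: "b \<in> gmap G Z X"
    and Z': "fin_gset G Z'" and a': "a' \<in> gmap G Z' Y'" and b': "b' \<in> gmap G Z' X" using s s'
      by auto
  let ?S = "gsum Z Z'" and ?a = "gcopair Z Z' a a'" and ?b = "gcopair Z Z' b b'"
  note S = fin_gset_gsum[OF Z Z'] and aa = gcopair_gmap[OF Z Z' a a']
    and bb = gcopair_gmap[OF Z Z' b b']
  let ?P = "gpb ?S ?a Y f" and ?Q = "gpb Z a Y f" and ?Q' = "gpb Z' a' Y f"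
  note P = fin_gset_gpb[OF S Y aa f] and Q = fin_gset_gpb[OF Z Y a f]
    and Q' = fin_gset_gpb[OF Z' Y a' f]
  note QQ = fin_gset_gsum[OF Q Q']
  define k where "k = gcopair ?Q ?Q' (gpair ?Q (gcomp ?Q (ginl Z) (gpb_fst Z a Y f)) (gpb_snd Z a Y f))
    (gpair ?Q' (gcomp ?Q' (ginr Z') (gpb_fst Z' a' Y f)) (gpb_snd Z' a' Y f))"
  have kl: "k (HInl (HPair z y)) = HPair (HInl z) y" if "HPair z y \<in> gpb_pts Z a Y f" for z y
    using that by (simp add: k_def)
  have kr: "k (HInr (HPair z y)) = HPair (HInr z) y" if "HPair z y \<in> gpb_pts Z' a' Y f" for z y
    using that by (simp add: k_def)
  have cases: thesis if "p \<in> pts (gsum ?Q ?Q')"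
    "\<And>z y. p = HInl (HPair z y) \<Longrightarrow> z \<in> pts Z \<Longrightarrow> y \<in> pts Y \<Longrightarrow> a z = f y \<Longrightarrow> thesis"
    "\<And>z y. p = HInr (HPair z y) \<Longrightarrow> z \<in> pts Z' \<Longrightarrow> y \<in> pts Y \<Longrightarrow> a' z = f y \<Longrightarrow> thesis" for p thesis
    using that by (auto simp: pts_gsum elim!: gpb_cases)
  have k: "k \<in> gmap G (gsum ?Q ?Q') ?P"
  proof (rule gmapI)
    show "k \<in> extensional (pts (gsum ?Q ?Q'))" by (simp add: k_def gcopair_def)
  next
    fix p assume "p \<in> pts (gsum ?Q ?Q')"
    then show "k p \<in> pts ?P" by (rule cases) (simp_all add: kl kr pts_gsum)
  next
    fix g p assume g: "g \<in> carrier G" and p: "p \<in> pts (gsum ?Q ?Q')"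
    then have gp: "action (gsum ?Q ?Q') g p \<in> pts (gsum ?Q ?Q')" by (rule act_closed[OF QQ])
    from p show "k (action (gsum ?Q ?Q') g p) = action ?P g (k p)"
    proof (rule cases)
      fix z y assume zy: "p = HInl (HPair z y)" "z \<in> pts Z" "y \<in> pts Y" "a z = f y"
      then have "HPair (action Z g z) (action Y g y) \<in> gpb_pts Z a Y f" using gp
        by (auto simp: pts_gsum)
      then show ?thesis using zy by (simp add: kl pts_gsum)
    next
      fix z y assume zy: "p = HInr (HPair z y)" "z \<in> pts Z'" "y \<in> pts Y" "a' z = f y"
      then have "HPair (action Z' g z) (action Y g y) \<in> gpb_pts Z' a' Y f" using gp
        by (auto simp: pts_gsum)
      then show ?thesis using zy by (simp add: kr pts_gsum)
    qed
  qed
  have kb: "bij_betw k (pts (gsum ?Q ?Q')) (pts ?P)"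
    unfolding bij_betw_def
  proof
    show "inj_on k (pts (gsum ?Q ?Q'))"
    proof (rule inj_onI)
      fix p q assume p: "p \<in> pts (gsum ?Q ?Q')" and q: "q \<in> pts (gsum ?Q ?Q')" and eq: "k p = k q"
      show "p = q"
        by (rule cases[OF p]; rule cases[OF q]) (use eq in \<open>simp_all add: kl kr\<close>)
    qed
    show "k ` pts (gsum ?Q ?Q') = pts ?P"
    proof
      show "k ` pts (gsum ?Q ?Q') \<subseteq> pts ?P" using gmap_closed[OF k] by blast
      show "pts ?P \<subseteq> k ` pts (gsum ?Q ?Q')"
      proof
        fix p assume "p \<in> pts ?P"
        then obtain u y where p: "p = HPair u y" "u \<in> pts ?S" "y \<in> pts Y" "?a u = f y"
          unfolding pts_gpb by (rule gpb_cases)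
        from p(2) consider z where "u = HInl z" "z \<in> pts Z" | z where "u = HInr z" "z \<in> pts Z'"
          by (auto simp: pts_gsum)
        then show "p \<in> k ` pts (gsum ?Q ?Q')"
        proof cases
          case (1 z)
          then show ?thesis
            using p by (intro image_eqI[of _ _ "HInl (HPair z y)"]) (simp_all add: kl pts_gsum)
        next
          case (2 z)
          then show ?thesis
            using p by (intro image_eqI[of _ _ "HInr (HPair z y)"]) (simp_all add: kr pts_gsum)
        qed
      qed
    qed
  qed
  note fs = gpb_fst_gmap[OF S Y aa f] and sn = gpb_snd_gmap[OF S Y aa f]
  let ?s1 = "gpb_snd Z a Y f" and ?s2 = "gpb_snd Z' a' Y f"
  let ?b1 = "gcomp ?Q b (gpb_fst Z a Y f)" and ?b2 = "gcomp ?Q' b' (gpb_fst Z' a' Y f)"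
  note s1 = gpb_snd_gmap[OF Z Y a f] and s2 = gpb_snd_gmap[OF Z' Y a' f]
  note b1 = gcomp_gmap[OF gpb_fst_gmap[OF Z Y a f] b Q]
    and b2 = gcomp_gmap[OF gpb_fst_gmap[OF Z' Y a' f] b' Q']
  have 1: "gcomp (gsum ?Q ?Q') (gpb_snd ?S ?a Y f) k = gcopair ?Q ?Q' ?s1 ?s2"
  proof (rule gmap_eqI[OF gcomp_gmap[OF k sn QQ] gcopair_gmap[OF Q Q' s1 s2]])
    fix p assume p: "p \<in> pts (gsum ?Q ?Q')"
    then show "gcomp (gsum ?Q ?Q') (gpb_snd ?S ?a Y f) k p = gcopair ?Q ?Q' ?s1 ?s2 p"
      by (rule cases) (use p in \<open>simp_all add: kl kr pts_gsum\<close>)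
  qed
  have 2: "gcomp (gsum ?Q ?Q') (gcomp ?P ?b (gpb_fst ?S ?a Y f)) k = gcopair ?Q ?Q' ?b1 ?b2"
  proof (rule gmap_eqI[OF gcomp_gmap[OF k gcomp_gmap[OF fs bb P] QQ] gcopair_gmap[OF Q Q' b1 b2]])
    fix p assume p: "p \<in> pts (gsum ?Q ?Q')"
    then show "gcomp (gsum ?Q ?Q') (gcomp ?P ?b (gpb_fst ?S ?a Y f)) k p = gcopair ?Q ?Q' ?b1 ?b2 p"
      by (rule cases) (use p in \<open>simp_all add: kl kr pts_gsum\<close>)
  qed
  have mem: "(?P, gpb_snd ?S ?a Y f, gcomp ?P ?b (gpb_fst ?S ?a Y f)) \<in> spans G Y X"
    using P sn gcomp_gmap[OF fs bb P] by simp
  have m1: "(?Q, ?s1, ?b1) \<in> spans G Y X" and m2: "(?Q', ?s2, ?b2) \<in> spans G Y X"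
    using Q s1 b1 Q' s2 b2 by simp_all
  show ?thesis
    using scl_iso[OF mem QQ k kb] scl_sum[OF m1 m2] by (simp add: span_pull_def 1 2)
qed

text \<open>The fibre product of a relator is a relator only up to isomorphism of spans. Membership
  in \<open>relations\<close> is therefore verified in the presented group, where
  \<open>span_pull_iso\<close> and \<open>span_pull_sum\<close> are equations.\<close>

lemma mres_representable:
  assumes Y: "fin_gset G Y" and f: "f \<in> gmap G Y Y'" and c: "Poly_Mapping.keys c \<subseteq> spans G Y' X"
  shows "mres (representable G X) Y Y' f (scl Y' X c) = scl Y X (frag_extend (\<lambda>s. frag_of (span_pull Y f s)) c)"
proof -
  interpret P: presentation "spans G Y X" "span_rels G Y X" by (rule span_presentation)
  interpret Q: comm_group "presented (spans G Y X) (span_rels G Y X)"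
    by (rule P.comm_group_presented)
  have *: "mres (representable G X) Y Y' f = presented_map (spans G Y X) (span_rels G Y X) (span_pull Y f)"
    by (simp add: representable_def span_pull_def)
  note mem = span_pull_mem[OF Y f]
  show ?thesis
    unfolding *
  proof (rule presented_map_pcl[OF span_presentation span_presentation _ _ c])
    show "span_pull Y f ` spans G Y' X \<subseteq> spans G Y X" using mem by blast
    fix r assume "r \<in> span_rels G Y' X"
    then show "frag_extend (\<lambda>s. frag_of (span_pull Y f s)) r \<in> relations (spans G Y X) (span_rels G Y X)"
    proof cases
      case (iso Z' a b Z h)
      have "(Z, gcomp Z a h, gcomp Z b h) \<in> spans G Y' X" using iso by (auto intro: gcomp_gmap)
      from rel_of_scl[OF span_pull_iso[OF Y f iso(2-5)] mem[OF this] mem[OF iso(2)]]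
      show ?thesis by (simp add: iso(1) frag_extend_diff)
    next
      case (sum Z a b Z' a' b')
      let ?s = "(gsum Z Z', gcopair Z Z' a a', gcopair Z Z' b b')"
      have s: "?s \<in> spans G Y' X" using sum by (auto simp: fin_gset_gsum gcopair_gmap)
      let ?p = "span_pull Y f ?s" and ?q = "span_pull Y f (Z, a, b)"
        and ?r = "span_pull Y f (Z', a', b')"
      note m = mem[OF s] mem[OF sum(2)] mem[OF sum(3)]
      note k1 = keys_frag2[OF m(1,2)] and k2 = keys_frag3[OF m]
      have cl: "scl Y X (frag_of ?q) \<in> carrier (presented (spans G Y X) (span_rels G Y X))"
        "scl Y X (frag_of ?r) \<in> carrier (presented (spans G Y X) (span_rels G Y X))"
        using m by (simp_all add: P.pcl_closed)
      have "scl Y X (frag_of ?p - frag_of ?q - frag_of ?r) = \<one>\<^bsub>presented (spans G Y X) (span_rels G Y X)\<^esub>"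
        using k1 m cl by (simp add: P.pcl_diff span_pull_sum[OF Y f sum(2,3)] Q.m_ac Q.inv_solve_right')
      then show ?thesis using P.pcl_one_iff[OF k2] by (simp add: sum(1) frag_extend_diff)
    qed
  qed
qed

end

section \<open>Free modules\<close>

text \<open>The closure properties under which the relators of a box product are combinations of its
  generators; \<open>representable\<close> enters the box product through them.\<close>

locale mackey_closed =
  fixes G :: "('g, 'b) monoid_scheme" and M :: "('g, 'm, 'z) mackey_scheme"
  assumes mult_closed: "\<lbrakk>fin_gset G X; m \<in> carrier (mval M X); n \<in> carrier (mval M X)\<rbrakk>
      \<Longrightarrow> m \<otimes>\<^bsub>mval M X\<^esub> n \<in> carrier (mval M X)"
    and mres_closed: "\<lbrakk>fin_gset G X; fin_gset G Y; f \<in> gmap G X Y; m \<in> carrier (mval M Y)\<rbrakk>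
      \<Longrightarrow> mres M X Y f m \<in> carrier (mval M X)"
    and mtr_closed: "\<lbrakk>fin_gset G X; fin_gset G Y; f \<in> gmap G X Y; m \<in> carrier (mval M X)\<rbrakk>
      \<Longrightarrow> mtr M X Y f m \<in> carrier (mval M Y)"

lemma mem_box_gens [simp]: "(Y, f, m, n) \<in> box_gens G M N X \<longleftrightarrow>
    fin_gset G Y \<and> f \<in> gmap G Y X \<and> m \<in> carrier (mval M Y) \<and> n \<in> carrier (mval N Y)"
  by (simp add: box_gens_def)

lemma (in group) box_presentation:
  assumes "mackey_closed G M" "mackey_closed G N"
  shows "presentation (box_gens G M N X) (box_rels G M N X)"
proof
  interpret M: mackey_closed G M by fact
  interpret N: mackey_closed G N by fact
  show "box_rels G M N X \<subseteq> carrier (free_Abelian_group (box_gens G M N X))"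
  proof
    fix r assume "r \<in> box_rels G M N X"
    then have "Poly_Mapping.keys r \<subseteq> box_gens G M N X"
    proof cases
      case (add_left Y f m n m')
      then show ?thesis
        unfolding add_left(1) by (intro keys_frag3) (simp_all add: M.mult_closed)
    next
      case (add_right Y f m n n')
      then show ?thesis
        unfolding add_right(1) by (intro keys_frag3) (simp_all add: N.mult_closed)
    next
      case (frobenius_left Y Y' h f m n)
      then show ?thesis
        using gcomp_gmap[OF frobenius_left(4,5,2)] unfolding frobenius_left(1)
        by (intro keys_frag2) (simp_all add: M.mtr_closed N.mres_closed)
    next
      case (frobenius_right Y Y' h f m n)
      then show ?thesis
        using gcomp_gmap[OF frobenius_right(4,5,2)] unfolding frobenius_right(1)
        by (intro keys_frag2) (simp_all add: N.mtr_closed M.mres_closed)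
    qed
    then show "r \<in> carrier (free_Abelian_group (box_gens G M N X))" by simp
  qed
qed

lemma (in comm_group) inv_both: "a \<in> carrier G \<Longrightarrow> b \<in> carrier G \<Longrightarrow> a \<otimes> b \<otimes> inv a \<otimes> inv b = \<one>"
proof -
  assume ab: "a \<in> carrier G" "b \<in> carrier G"
  have "a \<otimes> b \<otimes> inv a \<otimes> inv b = (a \<otimes> b) \<otimes> inv (a \<otimes> b)" using ab by (simp add: m_assoc inv_mult)
  then show ?thesis using ab by simp
qed

lemma free_hom_rel2:
  assumes h: "h \<in> hom (free_Abelian_group S) A" and A: "comm_group A" and m: "x \<in> S" "y \<in> S"
    and eq: "h (frag_of x) = h (frag_of y)"
  shows "h (frag_of x - frag_of y) = \<one>\<^bsub>A\<^esub>"
proof -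
  interpret A: comm_group A by (rule A)
  have "h (frag_of y) \<in> carrier A" using hom_in_carrier[OF h, of "frag_of y"] m by simp
  then show ?thesis using m eq by (simp add: free_hom_diff[OF h A.is_group])
qed

lemma free_hom_rel3:
  assumes h: "h \<in> hom (free_Abelian_group S) A" and A: "comm_group A" and m: "x \<in> S" "y \<in> S" "z \<in> S"
    and eq: "h (frag_of x) = h (frag_of y) \<otimes>\<^bsub>A\<^esub> h (frag_of z)"
  shows "h (frag_of x - frag_of y - frag_of z) = \<one>\<^bsub>A\<^esub>"
proof -
  interpret A: comm_group A by (rule A)
  have c: "h (frag_of y) \<in> carrier A" "h (frag_of z) \<in> carrier A"
    using hom_in_carrier[OF h, of "frag_of y"] hom_in_carrier[OF h, of "frag_of z"] m by simp_all
  have "h (frag_of x - frag_of y - frag_of z)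
    = h (frag_of y) \<otimes>\<^bsub>A\<^esub> h (frag_of z) \<otimes>\<^bsub>A\<^esub> inv\<^bsub>A\<^esub> h (frag_of y) \<otimes>\<^bsub>A\<^esub> inv\<^bsub>A\<^esub> h (frag_of z)"
    using m keys_frag2[OF m(1,2)] eq by (simp add: free_hom_diff[OF h A.is_group])
  then show ?thesis using A.inv_both[OF c] by simp
qed

text \<open>The data of a map from the box product to \<open>P\<close>. It occurs twice: in the
  comparison of free modules with their model, and in the product of an ideal and a module.\<close>

locale box_pairing = semi_mackey G "mval P" "mres P" "mtr P" + M: mackey_closed G M + N: mackey_closed G N
  for G :: "('g, 'b) monoid_scheme" (structure) and M :: "('g, 'm, 'x) mackey_scheme"
    and N :: "('g, 'n, 'y) mackey_scheme" and P :: "('g, 'p, 'z) mackey_scheme" +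
  fixes \<mu> :: "'g gset \<Rightarrow> 'm \<Rightarrow> 'n \<Rightarrow> 'p"
  assumes val_group: "fin_gset G X \<Longrightarrow> comm_group (mval P X)"
    and pair_closed: "\<lbrakk>fin_gset G X; m \<in> carrier (mval M X); n \<in> carrier (mval N X)\<rbrakk>
      \<Longrightarrow> \<mu> X m n \<in> carrier (mval P X)"
    and pair_add_left: "\<lbrakk>fin_gset G X; m \<in> carrier (mval M X); m' \<in> carrier (mval M X); n \<in> carrier (mval N X)\<rbrakk>
      \<Longrightarrow> \<mu> X (m \<otimes>\<^bsub>mval M X\<^esub> m') n = \<mu> X m n \<otimes>\<^bsub>mval P X\<^esub> \<mu> X m' n"
    and pair_add_right: "\<lbrakk>fin_gset G X; m \<in> carrier (mval M X); n \<in> carrier (mval N X); n' \<in> carrier (mval N X)\<rbrakk>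
      \<Longrightarrow> \<mu> X m (n \<otimes>\<^bsub>mval N X\<^esub> n') = \<mu> X m n \<otimes>\<^bsub>mval P X\<^esub> \<mu> X m n'"
    and pair_tr_left: "\<lbrakk>fin_gset G X; fin_gset G Y; f \<in> gmap G X Y; m \<in> carrier (mval M X); n \<in> carrier (mval N Y)\<rbrakk>
      \<Longrightarrow> mtr P X Y f (\<mu> X m (mres N X Y f n)) = \<mu> Y (mtr M X Y f m) n"
    and pair_tr_right: "\<lbrakk>fin_gset G X; fin_gset G Y; f \<in> gmap G X Y; m \<in> carrier (mval M Y); n \<in> carrier (mval N X)\<rbrakk>
      \<Longrightarrow> mtr P X Y f (\<mu> X (mres M X Y f m) n) = \<mu> Y m (mtr N X Y f n)"
begin

definition pair_val :: "'g gset \<Rightarrow> ('g, 'm, 'n) box_gen \<Rightarrow> 'p" where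
  "pair_val Y = (\<lambda>(Z, f, m, n). mtr P Z Y f (\<mu> Z m n))"

lemma pair_val_closed:
  assumes "fin_gset G Y" "g \<in> box_gens G M N Y" shows "pair_val Y g \<in> carrier (mval P Y)"
  using assms by (cases g) (auto simp: pair_val_def intro!: tr_closed pair_closed)

text \<open>Each kind of relator is one axiom of the pairing. The homomorphism \<open>h\<close> is
  arbitrary because one application extends \<open>pair_val\<close> by choice and the other by the
  finite products in \<open>presented_lift\<close>.\<close>

lemma pair_rels:
  assumes Y: "fin_gset G Y" and h: "h \<in> hom (free_Abelian_group (box_gens G M N Y)) (mval P Y)"
    and gens: "\<And>g. g \<in> box_gens G M N Y \<Longrightarrow> h (frag_of g) = pair_val Y g"
    and r: "r \<in> box_rels G M N Y"
  shows "h r = \<one>\<^bsub>mval P Y\<^esub>"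
  using r
proof cases
  note rel2 = free_hom_rel2[OF h val_group[OF Y]] and rel3 = free_hom_rel3[OF h val_group[OF Y]]
  {
    case (add_left Z f m n m')
    then have *: "fin_gset G Z" "f \<in> gmap G Z Y" "m \<in> carrier (mval M Z)" "m' \<in> carrier (mval M Z)"
      "n \<in> carrier (mval N Z)" by auto
    show ?thesis
      unfolding add_left(1) using *
      by (intro rel3) (simp_all add: gens pair_val_def pair_add_left pair_closed M.mult_closed tr_mult[OF *(1) Y])
  next
    case (add_right Z f m n n')
    then have *: "fin_gset G Z" "f \<in> gmap G Z Y" "m \<in> carrier (mval M Z)" "n \<in> carrier (mval N Z)"
      "n' \<in> carrier (mval N Z)" by auto
    show ?thesis
      unfolding add_right(1) using *
      by (intro rel3) (simp_all add: gens pair_val_def pair_add_right pair_closed N.mult_closed tr_mult[OF *(1) Y])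
  next
    case (frobenius_left Z Z' k f m n)
    note Z = frobenius_left(2) and Z' = frobenius_left(3) and k = frobenius_left(4)
      and f = frobenius_left(5)
      and m = frobenius_left(6) and n = frobenius_left(7)
    note rn = N.mres_closed[OF Z Z' k n]
    have mem: "(Z, gcomp Z f k, m, mres N Z Z' k n) \<in> box_gens G M N Y"
      "(Z', f, mtr M Z Z' k m, n) \<in> box_gens G M N Y"
      using Z Z' k f m n gcomp_gmap[OF k f Z] rn M.mtr_closed[OF Z Z' k m] by simp_all
    show ?thesis
      unfolding frobenius_left(1)
      using tr_comp[OF Z Z' Y k f pair_closed[OF Z m rn]] pair_tr_left[OF Z Z' k m n]
      by (intro rel2 mem) (simp add: gens[OF mem(1)] gens[OF mem(2)] pair_val_def)
  next
    case (frobenius_right Z Z' k f m n)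
    note Z = frobenius_right(2) and Z' = frobenius_right(3) and k = frobenius_right(4)
      and f = frobenius_right(5)
      and m = frobenius_right(6) and n = frobenius_right(7)
    note rm = M.mres_closed[OF Z Z' k m]
    have mem: "(Z, gcomp Z f k, mres M Z Z' k m, n) \<in> box_gens G M N Y"
      "(Z', f, m, mtr N Z Z' k n) \<in> box_gens G M N Y"
      using Z Z' k f m n gcomp_gmap[OF k f Z] rm N.mtr_closed[OF Z Z' k n] by simp_all
    show ?thesis
      unfolding frobenius_right(1)
      using tr_comp[OF Z Z' Y k f pair_closed[OF Z rm n]] pair_tr_right[OF Z Z' k m n]
      by (intro rel2 mem) (simp add: gens[OF mem(1)] gens[OF mem(2)] pair_val_def)
  }
qed

end

lemma (in finite_tambara) mackey_closed_tambara: "mackey_closed G (tambara_mackey T)"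
proof
  fix X m n assume X: "fin_gset G X"
    and mn: "m \<in> carrier (mval (tambara_mackey T) X)" "n \<in> carrier (mval (tambara_mackey T) X)"
  interpret X: cring "tval T X" by (rule val[OF X])
  show "m \<otimes>\<^bsub>mval (tambara_mackey T) X\<^esub> n \<in> carrier (mval (tambara_mackey T) X)"
    using mn by (simp add: tambara_mackey_def)
qed (simp_all add: tambara_mackey_def res_closed tr_closed)

lemma (in group) mackey_closed_representable: "mackey_closed G (representable G W)"
proof
  fix X m n
  assume X: "fin_gset G X"
    and mn: "m \<in> carrier (mval (representable G W) X)" "n \<in> carrier (mval (representable G W) X)"
  interpret P: presentation "spans G X W" "span_rels G X W" by (rule span_presentation)
  interpret Q: comm_group "presented (spans G X W) (span_rels G X W)"
    by (rule P.comm_group_presented)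
  show "m \<otimes>\<^bsub>mval (representable G W) X\<^esub> n \<in> carrier (mval (representable G W) X)"
    using mn by (simp add: mval_representable)
next
  fix X Y f m
  assume X: "fin_gset G X" and f: "f \<in> gmap G X Y" and m: "m \<in> carrier (mval (representable G W) Y)"
  interpret P: presentation "spans G X W" "span_rels G X W" by (rule span_presentation)
  interpret P': presentation "spans G Y W" "span_rels G Y W" by (rule span_presentation)
  obtain c where c: "m = scl Y W c" "Poly_Mapping.keys c \<subseteq> spans G Y W"
    using m by (auto simp: mval_representable P'.carrier_presented)
  have "span_pull X f ` spans G Y W \<subseteq> spans G X W" using span_pull_mem[OF X f] by blast
  from hom_in_carrier[OF frag_extend_hom[OF this], of c] c(2)
  show "mres (representable G W) X Y f m \<in> carrier (mval (representable G W) X)"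
    by (simp add: c(1) mres_representable[OF X f c(2)] mval_representable P.pcl_closed)
next
  fix X Y f m
  assume Y: "fin_gset G Y" and f: "f \<in> gmap G X Y" and m: "m \<in> carrier (mval (representable G W) X)"
  interpret P: presentation "spans G X W" "span_rels G X W" by (rule span_presentation)
  interpret P': presentation "spans G Y W" "span_rels G Y W" by (rule span_presentation)
  obtain c where c: "m = scl X W c" "Poly_Mapping.keys c \<subseteq> spans G X W"
    using m by (auto simp: mval_representable P.carrier_presented)
  have "span_push f ` spans G X W \<subseteq> spans G Y W" using span_push_mem[OF f] by blast
  from hom_in_carrier[OF frag_extend_hom[OF this], of c] c(2)
  show "mtr (representable G W) X Y f m \<in> carrier (mval (representable G W) Y)"
    by (simp add: c(1) mtr_representable[OF f c(2)] mval_representable P'.pcl_closed)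
qed

section \<open>The map from a representable functor to the model\<close>

locale free_comparison = finite_tambara G T
  for G :: "('g, 'b) monoid_scheme" (structure) and T :: "('g, 'a) tambara" +
  fixes W :: "'g gset"
  assumes W: "fin_gset G W"
begin

abbreviation A where "A \<equiv> representable G W"

abbreviation F where "F \<equiv> free_model T W"

sublocale F: tambara_module G T F
  by (rule tambara_module_free_model[OF W])

sublocale sF: semi_mackey G "mval F" "mres F" "mtr F"
  by (rule semi_mackey_mackey[OF F.mackey_functor_axioms])

lemma group_F: "fin_gset G Z \<Longrightarrow> group (mval F Z)"
  using F.val by (simp add: comm_group.axioms(2))

lemma carrier_F: "carrier (mval F Z) = carrier (tval T (gprod Z W))"
  by (simp add: free_model_def)

text \<open>A span stands for restriction along \<open>b\<close> followed by transfer along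
  \<open>a\<close>; applied to \<open>free_gen\<close>, this gives the transfer of 1 along the pair
  of \<open>a\<close> and \<open>b\<close>.\<close>

definition span_val :: "'g gset \<Rightarrow> 'g span \<Rightarrow> 'a" where
  "span_val Z = (\<lambda>(V, a, b). ttr T V (gprod Z W) (gpair V a b) \<one>\<^bsub>tval T V\<^esub>)"

lemma span_val_closed:
  assumes "fin_gset G Z" "s \<in> spans G Z W" shows "span_val Z s \<in> carrier (mval F Z)"
proof (cases s)
  case (fields V a b)
  then have V: "fin_gset G V" and a: "a \<in> gmap G V Z" and b: "b \<in> gmap G V W" using assms by auto
  interpret V: cring "tval T V" by (rule val[OF V])
  show ?thesis
    using tr_closed[OF V fin_gset_gprod[OF assms(1) W] gpair_gmap[OF V a b] V.one_closed]
    by (simp add: fields span_val_def carrier_F)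
qed

definition span_ext :: "'g gset \<Rightarrow> ('g span \<Rightarrow>\<^sub>0 int) \<Rightarrow> 'a" where
  "span_ext Z = (SOME h. h \<in> hom (free_Abelian_group (spans G Z W)) (mval F Z) \<and>
    (\<forall>s\<in>spans G Z W. h (frag_of s) = span_val Z s))"

lemma span_ext:
  assumes Z: "fin_gset G Z"
  shows "span_ext Z \<in> hom (free_Abelian_group (spans G Z W)) (mval F Z)"
    "s \<in> spans G Z W \<Longrightarrow> span_ext Z (frag_of s) = span_val Z s"
proof -
  have "span_val Z ` spans G Z W \<subseteq> carrier (mval F Z)" using span_val_closed[OF Z] by blast
  then obtain h where "h \<in> hom (free_Abelian_group (spans G Z W)) (mval F Z)"
    "\<And>s. s \<in> spans G Z W \<Longrightarrow> h (frag_of s) = span_val Z s"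
    using comm_group.free_Abelian_group_universal[OF F.val[OF Z]] by blast
  then have "\<exists>h. h \<in> hom (free_Abelian_group (spans G Z W)) (mval F Z) \<and>
    (\<forall>s\<in>spans G Z W. h (frag_of s) = span_val Z s)" by blast
  then have "span_ext Z \<in> hom (free_Abelian_group (spans G Z W)) (mval F Z) \<and>
    (\<forall>s\<in>spans G Z W. span_ext Z (frag_of s) = span_val Z s)"
    unfolding span_ext_def by (rule someI_ex)
  then show "span_ext Z \<in> hom (free_Abelian_group (spans G Z W)) (mval F Z)"
    "s \<in> spans G Z W \<Longrightarrow> span_ext Z (frag_of s) = span_val Z s" by auto
qed

text \<open>An isomorphism transfers 1 to 1, and a transfer from a disjoint union is the sum of the
  transfers from its parts.\<close>

lemma span_ext_rels:
  assumes Z: "fin_gset G Z" and r: "r \<in> span_rels G Z W"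
  shows "span_ext Z r = \<one>\<^bsub>mval F Z\<^esub>"
  using r
proof cases
  note ZW = fin_gset_gprod[OF Z W]
  {
    case (iso V' a b V h)
    have V': "fin_gset G V'" and a: "a \<in> gmap G V' Z" and b: "b \<in> gmap G V' W" using iso(2) by auto
    note V = iso(3) and h = iso(4) and bij = iso(5)
    have s: "(V, gcomp V a h, gcomp V b h) \<in> spans G Z W"
      using V gcomp_gmap[OF h a V] gcomp_gmap[OF h b V] by simp
    note p = gpair_gmap[OF V' a b]
    interpret V: cring "tval T V" by (rule val[OF V])
    interpret V': cring "tval T V'" by (rule val[OF V'])
    have "gcomp V (gpair V' a b) h = gpair V (gcomp V a h) (gcomp V b h)"
      by (auto simp: gcomp_def compose_def gpair_def fun_eq_iff gmap_closed[OF h])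
    moreover have "ttr T V V' h \<one>\<^bsub>tval T V\<^esub> = \<one>\<^bsub>tval T V'\<^esub>"
      using tradd.tr_res_iso[OF V V' h bij, of "\<one>\<^bsub>tval T V'\<^esub>"] by (simp add: res_one[OF V V' h])
    ultimately have "span_val Z (V, gcomp V a h, gcomp V b h) = span_val Z (V', a, b)"
      using tr_comp[OF V V' ZW h p V.one_closed] by (simp add: span_val_def)
    then show ?thesis
      unfolding iso(1) by (intro free_hom_rel2[OF span_ext(1)[OF Z] F.val[OF Z] s iso(2)])
        (simp only: span_ext(2)[OF Z s] span_ext(2)[OF Z iso(2)])
  next
    case (sum V a b V' a' b')
    have V: "fin_gset G V" and a: "a \<in> gmap G V Z" and b: "b \<in> gmap G V W"
      and V': "fin_gset G V'" and a': "a' \<in> gmap G V' Z" and b': "b' \<in> gmap G V' W" using sum(2,3)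
        by auto
    let ?S = "gsum V V'" and ?a = "gcopair V V' a a'" and ?b = "gcopair V V' b b'"
    note S = fin_gset_gsum[OF V V'] and aa = gcopair_gmap[OF V V' a a']
      and bb = gcopair_gmap[OF V V' b b']
    interpret S: cring "tval T ?S" by (rule val[OF S])
    have s: "(?S, ?a, ?b) \<in> spans G Z W" using S aa bb by simp
    note p = gpair_gmap[OF S aa bb]
    have l: "gcomp V (gpair ?S ?a ?b) (ginl V) = gpair V a b"
      by (auto simp: gcomp_def compose_def gpair_def fun_eq_iff pts_gsum)
    have r: "gcomp V' (gpair ?S ?a ?b) (ginr V') = gpair V' a' b'"
      by (auto simp: gcomp_def compose_def gpair_def fun_eq_iff pts_gsum)
    have "span_val Z (?S, ?a, ?b) = span_val Z (V, a, b) \<otimes>\<^bsub>mval F Z\<^esub> span_val Z (V', a', b')"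
      using tradd.tr_gcover[OF gcover_gsum[OF V V'] ZW p, of "\<one>\<^bsub>tval T ?S\<^esub>"]
      by (simp add: span_val_def l r res_one[OF V S ginl_gmap[OF V]] res_one[OF V' S ginr_gmap[OF V']] free_model_def)
    then show ?thesis
      unfolding sum(1) by (intro free_hom_rel3[OF span_ext(1)[OF Z] F.val[OF Z] s sum(2,3)])
        (simp only: span_ext(2)[OF Z s] span_ext(2)[OF Z sum(2)] span_ext(2)[OF Z sum(3)])
  }
qed

text \<open>The map from \<open>A\<close> to \<open>F\<close> induced by \<open>span_val\<close>; by
  \<open>ev_scl\<close> the choice of the representative is harmless.\<close>

definition ev :: "'g gset \<Rightarrow> ('g span \<Rightarrow>\<^sub>0 int) set \<Rightarrow> 'a" where
  "ev Z \<alpha> = span_ext Z (SOME c. c \<in> \<alpha>)"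

lemma ev_scl:
  assumes Z: "fin_gset G Z" and c: "Poly_Mapping.keys c \<subseteq> spans G Z W"
  shows "ev Z (scl Z W c) = span_ext Z c"
proof -
  interpret P: presentation "spans G Z W" "span_rels G Z W" by (rule span_presentation)
  have s: "(SOME d. d \<in> scl Z W c) \<in> scl Z W c" by (rule someI[of _ c]) (rule P.pcl_self[OF c])
  show ?thesis
    unfolding ev_def
    by (rule P.hom_pcl_cong(1)[OF span_ext(1)[OF Z] group_F[OF Z] _ c s]) (rule span_ext_rels[OF Z])
qed

lemma scl_cases:
  assumes "\<alpha> \<in> carrier (mval A Z)"
  obtains c where "\<alpha> = scl Z W c" "Poly_Mapping.keys c \<subseteq> spans G Z W"
  using assms presentation.carrier_presented[OF span_presentation]
    by (auto simp: mval_representable)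

lemma ev_closed:
  assumes Z: "fin_gset G Z" and \<alpha>: "\<alpha> \<in> carrier (mval A Z)" shows "ev Z \<alpha> \<in> carrier (mval F Z)"
proof -
  obtain c where c: "\<alpha> = scl Z W c" "Poly_Mapping.keys c \<subseteq> spans G Z W" by (rule scl_cases[OF \<alpha>])
  show ?thesis using hom_in_carrier[OF span_ext(1)[OF Z], of c] c by (simp add: ev_scl[OF Z])
qed

lemma ev_mult:
  assumes Z: "fin_gset G Z" and \<alpha>: "\<alpha> \<in> carrier (mval A Z)" and \<beta>: "\<beta> \<in> carrier (mval A Z)"
  shows "ev Z (\<alpha> \<otimes>\<^bsub>mval A Z\<^esub> \<beta>) = ev Z \<alpha> \<otimes>\<^bsub>mval F Z\<^esub> ev Z \<beta>"
proof -
  interpret P: presentation "spans G Z W" "span_rels G Z W" by (rule span_presentation)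
  obtain c where c: "\<alpha> = scl Z W c" "Poly_Mapping.keys c \<subseteq> spans G Z W" by (rule scl_cases[OF \<alpha>])
  obtain d where d: "\<beta> = scl Z W d" "Poly_Mapping.keys d \<subseteq> spans G Z W" by (rule scl_cases[OF \<beta>])
  have "Poly_Mapping.keys (c + d) \<subseteq> spans G Z W" using keys_add[of c d] c d by blast
  then have "ev Z (scl Z W (c + d)) = span_ext Z (c + d)" by (rule ev_scl[OF Z])
  then show ?thesis
    using hom_mult[OF span_ext(1)[OF Z], of c d] c d
    by (simp add: mval_representable P.pcl_add ev_scl[OF Z])
qed

text \<open>Base change: the apex of the pulled back span is the fibre product of the pair of
  \<open>a\<close> and \<open>b\<close> with \<open>f\<close> times the identity of
  \<open>W\<close>.\<close>

lemma span_val_pull: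
  assumes Z: "fin_gset G Z" and Z': "fin_gset G Z'" and f: "f \<in> gmap G Z' Z"
    and s: "s \<in> spans G Z W"
  shows "span_val Z' (span_pull Z' f s) = mres F Z' Z f (span_val Z s)"
proof (cases s)
  case (fields V a b)
  then have V: "fin_gset G V" and a: "a \<in> gmap G V Z" and b: "b \<in> gmap G V W" using s by auto
  interpret V: cring "tval T V" by (rule val[OF V])
  note P = fin_gset_gpb[OF V Z' a f] and fs = gpb_fst_gmap[OF V Z' a f]
    and sn = gpb_snd_gmap[OF V Z' a f]
  let ?P = "gpb V a Z' f" and ?f = "gpb_fst V a Z' f" and ?s = "gpb_snd V a Z' f"
  note bf = gcomp_gmap[OF fs b P]
  note ZW = fin_gset_gprod[OF Z W] and ZW' = fin_gset_gprod[OF Z' W]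
  have pb: "gpullback G ?P V (gprod Z' W) (gprod Z W) (gpair V a b) (gtimes Z' W f) (gpair ?P ?s (gcomp ?P b ?f)) ?f"
  proof (rule gpullbackI[OF P V ZW' ZW gpair_gmap[OF V a b] gtimes_gmap[OF Z' W f] gpair_gmap[OF P sn bf] fs])
    fix p assume "p \<in> pts ?P"
    then obtain v z where "p = HPair v z" "v \<in> pts V" "z \<in> pts Z'" "a v = f z"
      unfolding pts_gpb by (rule gpb_cases)
    then show "gpair V a b (?f p) = gtimes Z' W f (gpair ?P ?s (gcomp ?P b ?f) p)"
      by (simp add: gmap_closed[OF b])
  next
    fix p q assume "p \<in> pts ?P" "q \<in> pts ?P" and eq: "?f p = ?f q"
      "gpair ?P ?s (gcomp ?P b ?f) p = gpair ?P ?s (gcomp ?P b ?f) q"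
    then obtain v z v' z' where "p = HPair v z" "v \<in> pts V" "z \<in> pts Z'" "a v = f z"
      "q = HPair v' z'" "v' \<in> pts V" "z' \<in> pts Z'" "a v' = f z'"
      unfolding pts_gpb by (auto elim!: gpb_cases)
    then show "p = q" using eq by simp
  next
    fix v y assume v: "v \<in> pts V" and y: "y \<in> pts (gprod Z' W)"
      and eq: "gpair V a b v = gtimes Z' W f y"
    obtain z w where zw: "y = HPair z w" "z \<in> pts Z'" "w \<in> pts W" by (rule gprod_cases[OF y])
    then have "a v = f z" "b v = w" using eq v by simp_all
    then show "\<exists>p\<in>pts ?P. ?f p = v \<and> gpair ?P ?s (gcomp ?P b ?f) p = y"
      using v zw by (intro bexI[of _ "HPair v z"]) simp_all
  qed
  show ?thesis
    using tradd.res_tr_pullback[OF pb, of "\<one>\<^bsub>tval T V\<^esub>"]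
    by (simp add: fields span_val_def span_pull_def free_model_def res_one[OF P V fs])
qed

lemma span_val_push:
  assumes Z: "fin_gset G Z" and Z': "fin_gset G Z'" and f: "f \<in> gmap G Z Z'"
    and s: "s \<in> spans G Z W"
  shows "span_val Z' (span_push f s) = mtr F Z Z' f (span_val Z s)"
proof (cases s)
  case (fields V a b)
  then have V: "fin_gset G V" and a: "a \<in> gmap G V Z" and b: "b \<in> gmap G V W" using s by auto
  interpret V: cring "tval T V" by (rule val[OF V])
  show ?thesis
    using tr_comp[OF V fin_gset_gprod[OF Z W] fin_gset_gprod[OF Z' W] gpair_gmap[OF V a b] gtimes_gmap[OF Z W f] V.one_closed]
    by (simp add: fields span_val_def span_push_def free_model_def gtimes_gpair[OF a b f])
qed

lemma ev_res:
  assumes Z: "fin_gset G Z" and Z': "fin_gset G Z'" and f: "f \<in> gmap G Z' Z"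
    and \<alpha>: "\<alpha> \<in> carrier (mval A Z)"
  shows "ev Z' (mres A Z' Z f \<alpha>) = mres F Z' Z f (ev Z \<alpha>)"
proof -
  obtain c where c: "\<alpha> = scl Z W c" "Poly_Mapping.keys c \<subseteq> spans G Z W" by (rule scl_cases[OF \<alpha>])
  have sub: "span_pull Z' f ` spans G Z W \<subseteq> spans G Z' W" using span_pull_mem[OF Z' f] by blast
  let ?e = "frag_extend (\<lambda>s. frag_of (span_pull Z' f s))"
  have ec: "Poly_Mapping.keys (?e c) \<subseteq> spans G Z' W"
    using hom_in_carrier[OF frag_extend_hom[OF sub], of c] c by simp
  have "(span_ext Z' \<circ> ?e) c = (mres F Z' Z f \<circ> span_ext Z) c"
  proof (rule free_hom_eqI[OF Group.hom_compose[OF frag_extend_hom[OF sub] span_ext(1)[OF Z']]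
        Group.hom_compose[OF span_ext(1)[OF Z] F.res_hom[OF Z' Z f]] group_F[OF Z'] _ c(2)])
    fix s assume s: "s \<in> spans G Z W"
    show "(span_ext Z' \<circ> ?e) (frag_of s) = (mres F Z' Z f \<circ> span_ext Z) (frag_of s)"
      using span_val_pull[OF Z Z' f s] span_ext(2)[OF Z s] span_ext(2)[OF Z' span_pull_mem[OF Z' f s]] by simp
  qed
  then show ?thesis by (simp add: c(1) mres_representable[OF Z' f c(2)] ev_scl[OF Z c(2)] ev_scl[OF Z' ec])
qed

lemma ev_tr:
  assumes Z: "fin_gset G Z" and Z': "fin_gset G Z'" and f: "f \<in> gmap G Z Z'"
    and \<alpha>: "\<alpha> \<in> carrier (mval A Z)"
  shows "ev Z' (mtr A Z Z' f \<alpha>) = mtr F Z Z' f (ev Z \<alpha>)"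
proof -
  obtain c where c: "\<alpha> = scl Z W c" "Poly_Mapping.keys c \<subseteq> spans G Z W" by (rule scl_cases[OF \<alpha>])
  have sub: "span_push f ` spans G Z W \<subseteq> spans G Z' W" using span_push_mem[OF f] by blast
  let ?e = "frag_extend (\<lambda>s. frag_of (span_push f s))"
  have ec: "Poly_Mapping.keys (?e c) \<subseteq> spans G Z' W"
    using hom_in_carrier[OF frag_extend_hom[OF sub], of c] c by simp
  have "(span_ext Z' \<circ> ?e) c = (mtr F Z Z' f \<circ> span_ext Z) c"
  proof (rule free_hom_eqI[OF Group.hom_compose[OF frag_extend_hom[OF sub] span_ext(1)[OF Z']]
        Group.hom_compose[OF span_ext(1)[OF Z] F.tr_hom[OF Z Z' f]] group_F[OF Z'] _ c(2)])
    fix s assume s: "s \<in> spans G Z W"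
    show "(span_ext Z' \<circ> ?e) (frag_of s) = (mtr F Z Z' f \<circ> span_ext Z) (frag_of s)"
      using span_val_push[OF Z Z' f s] span_ext(2)[OF Z s] span_ext(2)[OF Z' span_push_mem[OF f s]]
        by simp
  qed
  then show ?thesis by (simp add: c(1) mtr_representable[OF f c(2)] ev_scl[OF Z c(2)] ev_scl[OF Z' ec])
qed

end

section \<open>Normal forms in the box product and the comparison isomorphism\<close>

context free_comparison
begin

abbreviation M\<^sub>T where "M\<^sub>T \<equiv> tambara_mackey T"

abbreviation gens where "gens Y \<equiv> box_gens G M\<^sub>T A Y"

abbreviation rels where "rels Y \<equiv> box_rels G M\<^sub>T A Y"

abbreviation bcl where "bcl Y \<equiv> pcl (gens Y) (rels Y)"

abbreviation B where "B Y \<equiv> presented (gens Y) (rels Y)"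

lemma mackey_tambara_simps [simp]:
  "carrier (mval M\<^sub>T Y) = carrier (tval T Y)"
  "x \<otimes>\<^bsub>mval M\<^sub>T Y\<^esub> y = x \<oplus>\<^bsub>tval T Y\<^esub> y"
  "mres M\<^sub>T = tres T" "mtr M\<^sub>T = ttr T"
  by (simp_all add: tambara_mackey_def)

lemma gens_presentation: "presentation (gens Y) (rels Y)"
  by (rule box_presentation[OF mackey_closed_tambara mackey_closed_representable])

text \<open>This pairing, a scalar acting on the image of a class under \<open>ev\<close>, induces
  the comparison map. Its Frobenius laws combine those of the action on \<open>F\<close> with the
  naturality of \<open>ev\<close>.\<close>

sublocale pair: box_pairing G M\<^sub>T A F "\<lambda>Z s \<alpha>. mact F Z s (ev Z \<alpha>)"
proof (intro box_pairing.intro box_pairing_axioms.intro sF.semi_mackey_axioms mackey_closed_tambara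
    mackey_closed_representable F.val)
  fix X m n assume X: "fin_gset G X" and "m \<in> carrier (mval M\<^sub>T X)" and n: "n \<in> carrier (mval A X)"
  then show "mact F X m (ev X n) \<in> carrier (mval F X)" by (simp add: F.act_closed ev_closed)
next
  fix X m m' n assume "fin_gset G X" "m \<in> carrier (mval M\<^sub>T X)" "m' \<in> carrier (mval M\<^sub>T X)" "n \<in> carrier (mval A X)"
  then show "mact F X (m \<otimes>\<^bsub>mval M\<^sub>T X\<^esub> m') (ev X n) = mact F X m (ev X n) \<otimes>\<^bsub>mval F X\<^esub> mact F X m' (ev X n)"
    by (simp add: F.act_add_left ev_closed)
next
  fix X m n n' assume "fin_gset G X" "m \<in> carrier (mval M\<^sub>T X)" "n \<in> carrier (mval A X)" "n' \<in> carrier (mval A X)"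
  then show "mact F X m (ev X (n \<otimes>\<^bsub>mval A X\<^esub> n')) = mact F X m (ev X n) \<otimes>\<^bsub>mval F X\<^esub> mact F X m (ev X n')"
    by (simp add: F.act_add_right ev_closed ev_mult)
next
  fix X Y f m n assume "fin_gset G X" "fin_gset G Y" "f \<in> gmap G X Y" "m \<in> carrier (mval M\<^sub>T X)" "n \<in> carrier (mval A Y)"
  then show "mtr F X Y f (mact F X m (ev X (mres A X Y f n))) = mact F Y (mtr M\<^sub>T X Y f m) (ev Y n)"
    by (simp add: ev_res F.act_tr_left ev_closed)
next
  fix X Y f m n assume "fin_gset G X" "fin_gset G Y" "f \<in> gmap G X Y" "m \<in> carrier (mval M\<^sub>T Y)" "n \<in> carrier (mval A X)"
  then show "mtr F X Y f (mact F X (mres M\<^sub>T X Y f m) (ev X n)) = mact F Y m (ev Y (mtr A X Y f n))"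
    by (simp add: ev_tr F.act_tr_right ev_closed)
qed

lemmas gen_val_def = pair.pair_val_def and gen_val_closed = pair.pair_val_closed

abbreviation gen_val where "gen_val \<equiv> pair.pair_val"

definition gen_ext :: "'g gset \<Rightarrow> (('g, 'a, ('g span \<Rightarrow>\<^sub>0 int) set) box_gen \<Rightarrow>\<^sub>0 int) \<Rightarrow> 'a" where
  "gen_ext Y = (SOME h. h \<in> hom (free_Abelian_group (gens Y)) (mval F Y) \<and>
    (\<forall>g\<in>gens Y. h (frag_of g) = gen_val Y g))"

lemma gen_ext:
  assumes Y: "fin_gset G Y"
  shows "gen_ext Y \<in> hom (free_Abelian_group (gens Y)) (mval F Y)"
    "g \<in> gens Y \<Longrightarrow> gen_ext Y (frag_of g) = gen_val Y g"
proof -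
  have "gen_val Y ` gens Y \<subseteq> carrier (mval F Y)" using gen_val_closed[OF Y] by blast
  then obtain h where "h \<in> hom (free_Abelian_group (gens Y)) (mval F Y)"
    "\<And>g. g \<in> gens Y \<Longrightarrow> h (frag_of g) = gen_val Y g"
    using comm_group.free_Abelian_group_universal[OF F.val[OF Y]] by blast
  then have "\<exists>h. h \<in> hom (free_Abelian_group (gens Y)) (mval F Y) \<and>
    (\<forall>g\<in>gens Y. h (frag_of g) = gen_val Y g)" by blast
  then have "gen_ext Y \<in> hom (free_Abelian_group (gens Y)) (mval F Y) \<and>
    (\<forall>g\<in>gens Y. gen_ext Y (frag_of g) = gen_val Y g)"
    unfolding gen_ext_def by (rule someI_ex)
  then show "gen_ext Y \<in> hom (free_Abelian_group (gens Y)) (mval F Y)"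
    "g \<in> gens Y \<Longrightarrow> gen_ext Y (frag_of g) = gen_val Y g" by auto
qed

lemma gen_ext_rels: "fin_gset G Y \<Longrightarrow> r \<in> rels Y \<Longrightarrow> gen_ext Y r = \<one>\<^bsub>mval F Y\<^esub>"
  by (rule pair.pair_rels[OF _ gen_ext(1) gen_ext(2)])

definition base_span :: "'g gset \<Rightarrow> 'g span" where
  "base_span Y = (gprod Y W, gid (gprod Y W), gsnd Y W)"

text \<open>The normal form: the transfer, along the first projection, of \<open>t\<close> times the
  class of the second projection. Every element of the box product turns out to have this form for
  exactly one \<open>t\<close>.\<close>

definition std_gen :: "'g gset \<Rightarrow> 'a \<Rightarrow> ('g, 'a, ('g span \<Rightarrow>\<^sub>0 int) set) box_gen" where
  "std_gen Y t = (gprod Y W, gfst Y W, t, scl (gprod Y W) W (frag_of (base_span Y)))"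

lemma base_span_mem: "fin_gset G Y \<Longrightarrow> base_span Y \<in> spans G (gprod Y W) W"
  by (simp add: base_span_def fin_gset_gprod W gid_gmap gsnd_gmap)

lemma scl_closed: "s \<in> spans G Z W \<Longrightarrow> scl Z W (frag_of s) \<in> carrier (mval A Z)"
  by (simp add: mval_representable presentation.pcl_closed[OF span_presentation] del: mem_spans)

lemma std_gen_mem: "fin_gset G Y \<Longrightarrow> t \<in> carrier (tval T (gprod Y W)) \<Longrightarrow> std_gen Y t \<in> gens Y"
  by (simp add: std_gen_def fin_gset_gprod W gfst_gmap scl_closed[OF base_span_mem])

text \<open>\<open>ev\<close> sends the class of \<open>base_span\<close> to a restriction of
  \<open>free_gen\<close>, so the value is given by the Yoneda formula, which returns
  \<open>t\<close>.\<close>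

lemma gen_val_std:
  assumes Y: "fin_gset G Y" and t: "t \<in> carrier (tval T (gprod Y W))"
  shows "gen_val Y (std_gen Y t) = t"
proof -
  note YW = fin_gset_gprod[OF Y W]
  have "ev (gprod Y W) (scl (gprod Y W) W (frag_of (base_span Y))) = span_val (gprod Y W) (base_span Y)"
    using ev_scl[OF YW, of "frag_of (base_span Y)"] span_ext(2)[OF YW base_span_mem[OF Y]] base_span_mem[OF Y]
    by simp
  also have "\<dots> = mres F (gprod Y W) W (gsnd Y W) (free_gen T W)"
    using free_gen_res[OF W Y] by (simp add: span_val_def base_span_def free_model_def)
  finally show ?thesis
    using free_gen_yoneda[OF W Y t] by (simp add: gen_val_def std_gen_def yoneda_map_def)
qed

lemma std_hom:
  assumes Y: "fin_gset G Y" shows "(\<lambda>t. bcl Y (frag_of (std_gen Y t))) \<in> hom (mval F Y) (B Y)"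
proof (rule homI)
  interpret P: presentation "gens Y" "rels Y" by (rule gens_presentation)
  interpret R: cring "tval T (gprod Y W)" by (rule val[OF fin_gset_gprod[OF Y W]])
  show "bcl Y (frag_of (std_gen Y t)) \<in> carrier (B Y)" if "t \<in> carrier (mval F Y)" for t
    using that std_gen_mem[OF Y] by (simp add: P.pcl_closed carrier_F del: mem_box_gens)
  fix s t assume st: "s \<in> carrier (mval F Y)" "t \<in> carrier (mval F Y)"
  then have st': "s \<in> carrier (tval T (gprod Y W))" "t \<in> carrier (tval T (gprod Y W))"
    by (simp_all add: carrier_F)
  have mult: "s \<otimes>\<^bsub>mval F Y\<^esub> t = s \<oplus>\<^bsub>tval T (gprod Y W)\<^esub> t" by (simp add: free_model_def)
  have "frag_of (std_gen Y (s \<oplus>\<^bsub>tval T (gprod Y W)\<^esub> t)) - frag_of (std_gen Y s) - frag_of (std_gen Y t) \<in> rels Y"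
    using box_rels.add_left[of "gprod Y W" "gfst Y W" s "scl (gprod Y W) W (frag_of (base_span Y))" G M\<^sub>T A Y t]
      std_gen_mem[OF Y st'(1)] st' by (simp add: std_gen_def del: mem_box_gens)
  then show "bcl Y (frag_of (std_gen Y (s \<otimes>\<^bsub>mval F Y\<^esub> t)))
      = bcl Y (frag_of (std_gen Y s)) \<otimes>\<^bsub>B Y\<^esub> bcl Y (frag_of (std_gen Y t))"
    unfolding mult using st' by (intro P.pcl_rel_add std_gen_mem[OF Y]) simp_all
qed

text \<open>\<open>f\<^sub>+(s \<cdot> a\<^sub>+ b\<^sup>* \<omega>) = pr\<^sub>1\<^sub>+(k\<^sub>+ a\<^sup>* s \<cdot> pr\<^sub>2\<^sup>* \<omega>)\<close> with \<open>k = (f a, b)\<close>, by two applications of Frobenius.\<close>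

lemma gen_standard_span:
  assumes Y: "fin_gset G Y" and Z: "fin_gset G Z" and f: "f \<in> gmap G Z Y"
    and s: "s \<in> carrier (tval T Z)"
    and sp: "(V, a, b) \<in> spans G Z W"
  shows "\<exists>t\<in>carrier (mval F Y). bcl Y (frag_of (Z, f, s, scl Z W (frag_of (V, a, b)))) = bcl Y (frag_of (std_gen Y t))"
proof -
  interpret P: presentation "gens Y" "rels Y" by (rule gens_presentation)
  have V: "fin_gset G V" and a: "a \<in> gmap G V Z" and b: "b \<in> gmap G V W" using sp by auto
  note YW = fin_gset_gprod[OF Y W] and fa = gcomp_gmap[OF a f V]
  define k where "k = gpair V (gcomp V f a) b"
  have k: "k \<in> gmap G V (gprod Y W)" unfolding k_def by (rule gpair_gmap[OF V fa b])
  have fk: "gcomp V (gfst Y W) k = gcomp V f a" unfolding k_def by (rule gfst_gpair[OF fa b])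
  have sk: "gcomp V (gsnd Y W) k = b" unfolding k_def by (rule gsnd_gpair[OF fa b])
  let ?\<beta> = "scl V W (frag_of (V, gid V, b))" and ?\<omega> = "scl (gprod Y W) W (frag_of (base_span Y))"
  let ?r = "tres T V Z a s" and ?t = "ttr T V (gprod Y W) k (tres T V Z a s)"
  have \<beta>s: "(V, gid V, b) \<in> spans G V W" using V b by (simp add: gid_gmap)
  note \<beta> = scl_closed[OF \<beta>s] and \<omega> = scl_closed[OF base_span_mem[OF Y]]
  note r = res_closed[OF V Z a s] and t = tr_closed[OF V YW k res_closed[OF V Z a s]]
  have tr_\<beta>: "mtr A V Z a ?\<beta> = scl Z W (frag_of (V, a, b))"
  proof -
    have "gcomp V a (gid V) = a"
      by (rule gmap_eqI[OF gcomp_gmap[OF gid_gmap[OF V] a V] a]) simp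
    then show ?thesis
      using mtr_representable[OF a, of "frag_of (V, gid V, b)"] \<beta>s by (simp add: span_push_def)
  qed
  \<comment> \<open>The pullback of \<open>base_span\<close> along \<open>k\<close> is a fibre
    product with an identity map, so its second projection to \<open>V\<close> is an
    isomorphism.\<close>
  have res_\<omega>: "mres A V (gprod Y W) k ?\<omega> = ?\<beta>"
  proof -
    let ?P = "gpb (gprod Y W) (gid (gprod Y W)) V k"
    let ?s = "gpb_snd (gprod Y W) (gid (gprod Y W)) V k"
      and ?f = "gpb_fst (gprod Y W) (gid (gprod Y W)) V k"
    note P = fin_gset_gpb[OF YW V gid_gmap[OF YW] k]
    note sn = gpb_snd_gmap[OF YW V gid_gmap[OF YW] k]
      and fs = gpb_fst_gmap[OF YW V gid_gmap[OF YW] k]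
    have bij: "bij_betw ?s (pts ?P) (pts V)"
      by (rule bij_betw_byWitness[of _ "\<lambda>v. HPair (k v) v"])
        (auto elim!: gpb_cases simp: gmap_closed[OF k])
    have 1: "gcomp ?P (gid V) ?s = ?s" by (rule gcomp_gid[OF sn])
    have 2: "gcomp ?P b ?s = gcomp ?P (gsnd Y W) ?f"
    proof (rule gmap_eqI[OF gcomp_gmap[OF sn b P] gcomp_gmap[OF fs gsnd_gmap[OF Y W] P]])
      fix p assume "p \<in> pts ?P"
      then obtain q v where "p = HPair q v" "q \<in> pts (gprod Y W)" "v \<in> pts V" "gid (gprod Y W) q = k v"
        unfolding pts_gpb by (rule gpb_cases)
      then show "gcomp ?P b ?s p = gcomp ?P (gsnd Y W) ?f p"
        using fun_cong[OF sk, of v] gmap_closed[OF k] by simp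
    qed
    have "mres A V (gprod Y W) k ?\<omega> = scl V W (frag_of (span_pull V k (base_span Y)))"
      using mres_representable[OF V k, of "frag_of (base_span Y)"] base_span_mem[OF Y] by simp
    also have "span_pull V k (base_span Y) = (?P, gcomp ?P (gid V) ?s, gcomp ?P b ?s)"
      by (simp only: span_pull_def base_span_def prod.case 1 2)
    also have "scl V W (frag_of \<dots>) = ?\<beta>" by (rule scl_iso[OF \<beta>s P sn bij])
    finally show ?thesis .
  qed
  have m1: "(Z, f, s, scl Z W (frag_of (V, a, b))) \<in> gens Y" using Z f s scl_closed[OF sp] by simp
  have m2: "(V, gcomp V f a, ?r, ?\<beta>) \<in> gens Y" using V fa r \<beta> by simp
  have "frag_of (V, gcomp V f a, mres M\<^sub>T V Z a s, ?\<beta>) - frag_of (Z, f, s, mtr A V Z a ?\<beta>) \<in> rels Y"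
    using s by (intro box_rels.frobenius_right[OF V Z a f _ \<beta>]) simp
  then have e1: "bcl Y (frag_of (V, gcomp V f a, ?r, ?\<beta>)) = bcl Y (frag_of (Z, f, s, scl Z W (frag_of (V, a, b))))"
    by (intro P.pcl_rel_eq[OF _ m2 m1]) (simp add: tr_\<beta>)
  have "frag_of (V, gcomp V (gfst Y W) k, ?r, mres A V (gprod Y W) k ?\<omega>)
      - frag_of (gprod Y W, gfst Y W, mtr M\<^sub>T V (gprod Y W) k ?r, ?\<omega>) \<in> rels Y"
    using r by (intro box_rels.frobenius_left[OF V YW k gfst_gmap[OF Y W] _ \<omega>]) simp
  then have e2: "bcl Y (frag_of (V, gcomp V f a, ?r, ?\<beta>)) = bcl Y (frag_of (std_gen Y ?t))"
    by (intro P.pcl_rel_eq[OF _ m2 std_gen_mem[OF Y t]]) (simp add: fk res_\<omega> std_gen_def)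
  show ?thesis using e1 e2 t by (intro bexI[of _ ?t]) (simp_all add: carrier_F)
qed

lemma std_diff:
  assumes Y: "fin_gset G Y"
    and "\<exists>t\<in>carrier (mval F Y). x = bcl Y (frag_of (std_gen Y t))"
    and "\<exists>t\<in>carrier (mval F Y). y = bcl Y (frag_of (std_gen Y t))"
  shows "\<exists>t\<in>carrier (mval F Y). x \<otimes>\<^bsub>B Y\<^esub> inv\<^bsub>B Y\<^esub> y = bcl Y (frag_of (std_gen Y t))"
proof -
  interpret P: presentation "gens Y" "rels Y" by (rule gens_presentation)
  interpret h: group_hom "mval F Y" "B Y" "\<lambda>t. bcl Y (frag_of (std_gen Y t))"
    using std_hom[OF Y] group_F[OF Y] comm_group.axioms(2)[OF P.comm_group_presented]
    by (simp add: group_hom_def group_hom_axioms_def)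
  obtain s t where st: "s \<in> carrier (mval F Y)" "t \<in> carrier (mval F Y)"
    "x = bcl Y (frag_of (std_gen Y s))" "y = bcl Y (frag_of (std_gen Y t))" using assms by blast
  then show ?thesis by (intro bexI[of _ "s \<otimes>\<^bsub>mval F Y\<^esub> inv\<^bsub>mval F Y\<^esub> t"]) simp_all
qed

lemma std_one:
  assumes Y: "fin_gset G Y" shows "\<one>\<^bsub>B Y\<^esub> = bcl Y (frag_of (std_gen Y \<one>\<^bsub>mval F Y\<^esub>))"
proof -
  interpret P: presentation "gens Y" "rels Y" by (rule gens_presentation)
  show ?thesis
    using hom_one[OF std_hom[OF Y] group_F[OF Y] comm_group.axioms(2)[OF P.comm_group_presented]]
      by simp
qed

text \<open>By \<open>add_right\<close> a generator is additive in its last entry, and normal forms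
  are closed under differences; this reduces the claim to a single span.\<close>

lemma gen_standard:
  assumes Y: "fin_gset G Y" and g: "g \<in> gens Y"
  shows "\<exists>t\<in>carrier (mval F Y). bcl Y (frag_of g) = bcl Y (frag_of (std_gen Y t))"
proof (cases g)
  case (fields Z f s \<alpha>)
  then have Z: "fin_gset G Z" and f: "f \<in> gmap G Z Y" and s: "s \<in> carrier (tval T Z)"
    and \<alpha>: "\<alpha> \<in> carrier (mval A Z)" using g by auto
  interpret P: presentation "gens Y" "rels Y" by (rule gens_presentation)
  interpret S: presentation "spans G Z W" "span_rels G Z W" by (rule span_presentation)
  interpret BY: comm_group "B Y" by (rule P.comm_group_presented)
  obtain c where c: "\<alpha> = scl Z W c" "Poly_Mapping.keys c \<subseteq> spans G Z W" by (rule scl_cases[OF \<alpha>])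
  have scl: "scl Z W d \<in> carrier (mval A Z)" if "Poly_Mapping.keys d \<subseteq> spans G Z W" for d
    using S.pcl_closed[OF that] by (simp add: mval_representable)
  define \<kappa> where "\<kappa> d = bcl Y (frag_of (Z, f, s, scl Z W d))" for d
  have \<kappa>: "\<kappa> \<in> hom (free_Abelian_group (spans G Z W)) (B Y)"
  proof (rule homI)
    fix d assume "d \<in> carrier (free_Abelian_group (spans G Z W))"
    then show "\<kappa> d \<in> carrier (B Y)"
      unfolding \<kappa>_def using Z f s scl by (intro P.pcl_closed) simp
  next
    fix d e assume "d \<in> carrier (free_Abelian_group (spans G Z W))" "e \<in> carrier (free_Abelian_group (spans G Z W))"
    then have de: "Poly_Mapping.keys d \<subseteq> spans G Z W" "Poly_Mapping.keys e \<subseteq> spans G Z W"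
      by simp_all
    have m: "(Z, f, s, scl Z W d) \<in> gens Y" "(Z, f, s, scl Z W e) \<in> gens Y" "(Z, f, s, scl Z W (d + e)) \<in> gens Y"
      using Z f s scl de keys_add[of d e] by (auto intro!: scl)
    have "frag_of (Z, f, s, scl Z W (d + e)) - frag_of (Z, f, s, scl Z W d) - frag_of (Z, f, s, scl Z W e) \<in> rels Y"
      using box_rels.add_right[OF m(1) scl[OF de(2)]] de by (simp add: mval_representable S.pcl_add)
    then show "\<kappa> (d \<otimes>\<^bsub>free_Abelian_group (spans G Z W)\<^esub> e) = \<kappa> d \<otimes>\<^bsub>B Y\<^esub> \<kappa> e"
      using P.pcl_rel_add[OF _ m(1,2,3)] by (simp add: \<kappa>_def)
  qed
  have "\<exists>t\<in>carrier (mval F Y). \<kappa> c = bcl Y (frag_of (std_gen Y t))"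
  proof (rule free_Abelian_group_induct[OF c(2)])
    have "\<kappa> \<one>\<^bsub>free_Abelian_group (spans G Z W)\<^esub> = \<one>\<^bsub>B Y\<^esub>"
      by (rule hom_one[OF \<kappa> group_free_Abelian_group BY.is_group])
    then show "\<exists>t\<in>carrier (mval F Y). \<kappa> 0 = bcl Y (frag_of (std_gen Y t))"
      using std_one[OF Y] group.is_monoid[OF group_F[OF Y]] by (auto intro: monoid.one_closed)
  next
    fix x y
    assume xy: "Poly_Mapping.keys x \<subseteq> spans G Z W" "Poly_Mapping.keys y \<subseteq> spans G Z W"
      and ex: "\<exists>t\<in>carrier (mval F Y). \<kappa> x = bcl Y (frag_of (std_gen Y t))"
        "\<exists>t\<in>carrier (mval F Y). \<kappa> y = bcl Y (frag_of (std_gen Y t))"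
    show "\<exists>t\<in>carrier (mval F Y). \<kappa> (x - y) = bcl Y (frag_of (std_gen Y t))"
      unfolding free_hom_diff[OF \<kappa> BY.is_group xy] by (rule std_diff[OF Y ex])
  next
    fix sp assume sp: "sp \<in> spans G Z W"
    show "\<exists>t\<in>carrier (mval F Y). \<kappa> (frag_of sp) = bcl Y (frag_of (std_gen Y t))"
      unfolding \<kappa>_def using gen_standard_span[OF Y Z f s] sp by (cases sp) blast
  qed
  then show ?thesis by (simp add: \<kappa>_def fields c(1))
qed

lemma standard:
  assumes Y: "fin_gset G Y" and c: "Poly_Mapping.keys c \<subseteq> gens Y"
  shows "\<exists>t\<in>carrier (mval F Y). bcl Y c = bcl Y (frag_of (std_gen Y t))"
proof (rule free_Abelian_group_induct[OF c])
  interpret P: presentation "gens Y" "rels Y" by (rule gens_presentation)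
  show "\<exists>t\<in>carrier (mval F Y). bcl Y 0 = bcl Y (frag_of (std_gen Y t))"
    unfolding P.pcl_zero
    using std_one[OF Y] group.is_monoid[OF group_F[OF Y]] by (auto intro: monoid.one_closed)
  fix x y
  assume xy: "Poly_Mapping.keys x \<subseteq> gens Y" "Poly_Mapping.keys y \<subseteq> gens Y"
    and ex: "\<exists>t\<in>carrier (mval F Y). bcl Y x = bcl Y (frag_of (std_gen Y t))"
      "\<exists>t\<in>carrier (mval F Y). bcl Y y = bcl Y (frag_of (std_gen Y t))"
  show "\<exists>t\<in>carrier (mval F Y). bcl Y (x - y) = bcl Y (frag_of (std_gen Y t))"
    unfolding P.pcl_diff[OF xy] by (rule std_diff[OF Y ex])
qed (rule gen_standard[OF Y])

lemma gen_ext_cong: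
  assumes Y: "fin_gset G Y" and c: "Poly_Mapping.keys c \<subseteq> gens Y" and d: "d \<in> bcl Y c"
  shows "gen_ext Y d = gen_ext Y c"
  by (rule presentation.hom_pcl_cong(1)[OF gens_presentation gen_ext(1)[OF Y] group_F[OF Y] _ c d])
    (rule gen_ext_rels[OF Y])

text \<open>Some normal form exists by \<open>standard\<close>; evaluating \<open>gen_ext\<close> on
  both representatives shows that its parameter is \<open>gen_ext Y c\<close>.\<close>

lemma bcl_standard:
  assumes Y: "fin_gset G Y" and c: "Poly_Mapping.keys c \<subseteq> gens Y"
  shows "bcl Y c = bcl Y (frag_of (std_gen Y (gen_ext Y c)))"
proof -
  interpret P: presentation "gens Y" "rels Y" by (rule gens_presentation)
  obtain t where t: "t \<in> carrier (mval F Y)" "bcl Y c = bcl Y (frag_of (std_gen Y t))"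
    using standard[OF Y c] by blast
  have t': "t \<in> carrier (tval T (gprod Y W))" using t by (simp add: carrier_F)
  note m = std_gen_mem[OF Y t']
  have "c \<in> bcl Y (frag_of (std_gen Y t))" using P.pcl_self[OF c] t(2) by simp
  then have "gen_ext Y c = gen_ext Y (frag_of (std_gen Y t))"
    using m by (intro gen_ext_cong[OF Y]) simp_all
  then show ?thesis using t(2) gen_ext(2)[OF Y m] gen_val_std[OF Y t'] by simp
qed

text \<open>This is injectivity of the comparison. It also replaces a check of the relators for each
  operation of the box product separately.\<close>

lemma gen_ext_kernel:
  assumes Y: "fin_gset G Y" and c: "Poly_Mapping.keys c \<subseteq> gens Y" and "gen_ext Y c = \<one>\<^bsub>mval F Y\<^esub>"
  shows "c \<in> relations (gens Y) (rels Y)"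
  using bcl_standard[OF Y c] std_one[OF Y] assms(3) presentation.pcl_one_iff[OF gens_presentation c]
    by simp

definition comparison :: "'g gset \<Rightarrow> (('g, 'a, ('g span \<Rightarrow>\<^sub>0 int) set) box_gen \<Rightarrow>\<^sub>0 int) set \<Rightarrow> 'a" where
  "comparison Y C = gen_ext Y (SOME c. c \<in> C)"

lemma comparison_bcl:
  assumes Y: "fin_gset G Y" and c: "Poly_Mapping.keys c \<subseteq> gens Y"
  shows "comparison Y (bcl Y c) = gen_ext Y c"
proof -
  have "(SOME d. d \<in> bcl Y c) \<in> bcl Y c"
    by (rule someI[of _ c]) (rule presentation.pcl_self[OF gens_presentation c])
  then show ?thesis unfolding comparison_def by (rule gen_ext_cong[OF Y c])
qed

lemma mval_free: "mval (free_tmodule G T W) Y = B Y"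
  by (simp add: free_tmodule_def box_def Let_def)

text \<open>The image of a relator under \<open>\<phi>\<close> has the value \<open>h\<close> of the
  identity, so it is a relation by \<open>gen_ext_kernel\<close>. Hence the operation is well
  defined on classes and corresponds to \<open>h\<close>.\<close>

lemma comparison_op:
  assumes Y: "fin_gset G Y" and Y': "fin_gset G Y'" and \<phi>: "\<phi> ` gens Y \<subseteq> gens Y'"
    and op: "h \<in> hom (mval F Y) (mval F Y')"
    and val: "\<And>g. g \<in> gens Y \<Longrightarrow> gen_val Y' (\<phi> g) = h (gen_val Y g)"
    and C: "C \<in> carrier (B Y)"
  shows "comparison Y' (presented_map (gens Y') (rels Y') \<phi> C) = h (comparison Y C)"
    "presented_map (gens Y') (rels Y') \<phi> C \<in> carrier (B Y')"
proof -
  let ?e = "frag_extend (\<lambda>x. frag_of (\<phi> x))"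
  interpret P: presentation "gens Y" "rels Y" by (rule gens_presentation)
  obtain c where c: "C = bcl Y c" "Poly_Mapping.keys c \<subseteq> gens Y" using C
    by (auto simp: P.carrier_presented)
  have e: "gen_ext Y' (?e d) = h (gen_ext Y d)" if d: "Poly_Mapping.keys d \<subseteq> gens Y" for d
  proof -
    have "(gen_ext Y' \<circ> ?e) d = (h \<circ> gen_ext Y) d"
    proof (rule free_hom_eqI[OF Group.hom_compose[OF frag_extend_hom[OF \<phi>] gen_ext(1)[OF Y']]
          Group.hom_compose[OF gen_ext(1)[OF Y] op] group_F[OF Y'] _ d])
      fix g assume g: "g \<in> gens Y"
      then have "\<phi> g \<in> gens Y'" using \<phi> by blast
      then show "(gen_ext Y' \<circ> ?e) (frag_of g) = (h \<circ> gen_ext Y) (frag_of g)"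
        using g val gen_ext(2)[OF Y] gen_ext(2)[OF Y'] by simp
    qed
    then show ?thesis by simp
  qed
  have k: "Poly_Mapping.keys (?e d) \<subseteq> gens Y'" if "Poly_Mapping.keys d \<subseteq> gens Y" for d
    using hom_in_carrier[OF frag_extend_hom[OF \<phi>], of d] that by simp
  have "?e r \<in> relations (gens Y') (rels Y')" if r: "r \<in> rels Y" for r
    using e[OF P.R_keys[OF r]] gen_ext_rels[OF Y r] hom_one[OF op group_F[OF Y] group_F[OF Y']]
    by (intro gen_ext_kernel[OF Y' k[OF P.R_keys[OF r]]]) simp
  from presented_map_pcl[OF gens_presentation gens_presentation \<phi> this c(2)]
  have eq: "presented_map (gens Y') (rels Y') \<phi> C = bcl Y' (?e c)" by (simp only: c(1))
  show "comparison Y' (presented_map (gens Y') (rels Y') \<phi> C) = h (comparison Y C)"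
    unfolding eq by (simp add: c(1) comparison_bcl[OF Y c(2)] comparison_bcl[OF Y' k[OF c(2)]] e[OF c(2)])
  show "presented_map (gens Y') (rels Y') \<phi> C \<in> carrier (B Y')"
    unfolding eq by (rule presentation.pcl_closed[OF gens_presentation k[OF c(2)]])
qed

lemma comparison_res:
  assumes Y: "fin_gset G Y" and Y': "fin_gset G Y'" and f: "f \<in> gmap G Y Y'"
    and C: "C \<in> carrier (B Y')"
  shows "comparison Y (mres (free_tmodule G T W) Y Y' f C) = mres F Y Y' f (comparison Y' C)"
    "mres (free_tmodule G T W) Y Y' f C \<in> carrier (B Y)"
proof -
  let ?\<phi> = "\<lambda>(Z, h, m, n). (gpb Z h Y f, gpb_snd Z h Y f, mres M\<^sub>T (gpb Z h Y f) Z (gpb_fst Z h Y f) m,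
    mres A (gpb Z h Y f) Z (gpb_fst Z h Y f) n)"
  have eq: "mres (free_tmodule G T W) Y Y' f = presented_map (gens Y) (rels Y) ?\<phi>"
    by (simp add: free_tmodule_def box_def Let_def)
  have "?\<phi> g \<in> gens Y \<and> gen_val Y (?\<phi> g) = mres F Y Y' f (gen_val Y' g)" if g: "g \<in> gens Y'" for g
  proof (cases g)
    case (fields Z h s \<alpha>)
    then have Z: "fin_gset G Z" and h: "h \<in> gmap G Z Y'" and s: "s \<in> carrier (tval T Z)"
      and \<alpha>: "\<alpha> \<in> carrier (mval A Z)" using g by auto
    note P = fin_gset_gpb[OF Z Y h f] and fs = gpb_fst_gmap[OF Z Y h f]
      and sn = gpb_snd_gmap[OF Z Y h f]
    note e = ev_closed[OF Z \<alpha>]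
    have "?\<phi> g \<in> gens Y"
      using P sn res_closed[OF P Z fs s] pair.N.mres_closed[OF P Z fs \<alpha>] by (simp add: fields)
    moreover have "gen_val Y (?\<phi> g) = mres F Y Y' f (gen_val Y' g)"
      using F.base_change[OF Z Y' Y h f F.act_closed[OF Z s e]] F.act_res[OF P Z fs s e] ev_res[OF Z P fs \<alpha>]
      by (simp add: fields gen_val_def)
    ultimately show ?thesis by blast
  qed
  then have *: "?\<phi> ` gens Y' \<subseteq> gens Y" "\<And>g. g \<in> gens Y' \<Longrightarrow> gen_val Y (?\<phi> g) = mres F Y Y' f (gen_val Y' g)"
    by blast+
  show "comparison Y (mres (free_tmodule G T W) Y Y' f C) = mres F Y Y' f (comparison Y' C)"
    unfolding eq by (rule comparison_op(1)[OF Y' Y *(1) F.res_hom[OF Y Y' f] *(2) C])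
  show "mres (free_tmodule G T W) Y Y' f C \<in> carrier (B Y)"
    unfolding eq by (rule comparison_op(2)[OF Y' Y *(1) F.res_hom[OF Y Y' f] *(2) C])
qed

lemma comparison_tr:
  assumes Y: "fin_gset G Y" and Y': "fin_gset G Y'" and f: "f \<in> gmap G Y Y'"
    and C: "C \<in> carrier (B Y)"
  shows "comparison Y' (mtr (free_tmodule G T W) Y Y' f C) = mtr F Y Y' f (comparison Y C)"
    "mtr (free_tmodule G T W) Y Y' f C \<in> carrier (B Y')"
proof -
  let ?\<phi> = "\<lambda>(Z, h, m, n). (Z, gcomp Z f h, m, n)"
  have eq: "mtr (free_tmodule G T W) Y Y' f = presented_map (gens Y') (rels Y') ?\<phi>"
    by (simp add: free_tmodule_def box_def Let_def)
  have "?\<phi> g \<in> gens Y' \<and> gen_val Y' (?\<phi> g) = mtr F Y Y' f (gen_val Y g)" if g: "g \<in> gens Y" for g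
  proof (cases g)
    case (fields Z h s \<alpha>)
    then have Z: "fin_gset G Z" and h: "h \<in> gmap G Z Y" and s: "s \<in> carrier (tval T Z)"
      and \<alpha>: "\<alpha> \<in> carrier (mval A Z)" using g by auto
    show ?thesis
      using Z s \<alpha> gcomp_gmap[OF h f Z] sF.tr_comp[OF Z Y Y' h f F.act_closed[OF Z s ev_closed[OF Z \<alpha>]]]
      by (simp add: fields gen_val_def)
  qed
  then have *: "?\<phi> ` gens Y \<subseteq> gens Y'" "\<And>g. g \<in> gens Y \<Longrightarrow> gen_val Y' (?\<phi> g) = mtr F Y Y' f (gen_val Y g)"
    by blast+
  show "comparison Y' (mtr (free_tmodule G T W) Y Y' f C) = mtr F Y Y' f (comparison Y C)"
    unfolding eq by (rule comparison_op(1)[OF Y Y' *(1) F.tr_hom[OF Y Y' f] *(2) C])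
  show "mtr (free_tmodule G T W) Y Y' f C \<in> carrier (B Y')"
    unfolding eq by (rule comparison_op(2)[OF Y Y' *(1) F.tr_hom[OF Y Y' f] *(2) C])
qed

lemma comparison_act:
  assumes Y: "fin_gset G Y" and t: "t \<in> carrier (tval T Y)" and C: "C \<in> carrier (B Y)"
  shows "comparison Y (mact (free_tmodule G T W) Y t C) = mact F Y t (comparison Y C)"
    "mact (free_tmodule G T W) Y t C \<in> carrier (B Y)"
proof -
  let ?\<phi> = "\<lambda>(Z, f, s, a). (Z, f, tres T Z Y f t \<otimes>\<^bsub>tval T Z\<^esub> s, a)"
  have eq: "mact (free_tmodule G T W) Y t = presented_map (gens Y) (rels Y) ?\<phi>"
    by (simp add: free_tmodule_def Let_def)
  have hom: "mact F Y t \<in> hom (mval F Y) (mval F Y)"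
    by (rule homI) (simp_all add: F.act_closed[OF Y t] F.act_add_right[OF Y t])
  have "?\<phi> g \<in> gens Y \<and> gen_val Y (?\<phi> g) = mact F Y t (gen_val Y g)" if g: "g \<in> gens Y" for g
  proof (cases g)
    case (fields Z h s \<alpha>)
    then have Z: "fin_gset G Z" and h: "h \<in> gmap G Z Y" and s: "s \<in> carrier (tval T Z)"
      and \<alpha>: "\<alpha> \<in> carrier (mval A Z)" using g by auto
    interpret Z: cring "tval T Z" by (rule val[OF Z])
    note r = res_closed[OF Z Y h t] and e = ev_closed[OF Z \<alpha>]
    show ?thesis
      using Z h s \<alpha> r F.act_assoc[OF Z r s e] F.act_tr_right[OF Z Y h t F.act_closed[OF Z s e]]
      by (simp add: fields gen_val_def)
  qed
  then have *: "?\<phi> ` gens Y \<subseteq> gens Y" "\<And>g. g \<in> gens Y \<Longrightarrow> gen_val Y (?\<phi> g) = mact F Y t (gen_val Y g)"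
    by blast+
  show "comparison Y (mact (free_tmodule G T W) Y t C) = mact F Y t (comparison Y C)"
    unfolding eq by (rule comparison_op(1)[OF Y Y *(1) hom *(2) C])
  show "mact (free_tmodule G T W) Y t C \<in> carrier (B Y)"
    unfolding eq by (rule comparison_op(2)[OF Y Y *(1) hom *(2) C])
qed

text \<open>The inverse takes \<open>t\<close> to the class of the normal form
  \<open>std_gen Y t\<close>.\<close>

lemma comparison_iso: "tmodule_iso G T (free_tmodule G T W) F comparison"
  unfolding tmodule_iso_def tmodule_map_def mval_free
proof (intro conjI allI impI ballI)
  fix Y assume Y: "fin_gset G Y"
  interpret P: presentation "gens Y" "rels Y" by (rule gens_presentation)
  show "comparison Y \<in> hom (B Y) (mval F Y)"
  proof (rule homI)
    fix C assume "C \<in> carrier (B Y)"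
    then obtain c where c: "C = bcl Y c" "Poly_Mapping.keys c \<subseteq> gens Y"
      by (auto simp: P.carrier_presented)
    then show "comparison Y C \<in> carrier (mval F Y)"
      using hom_in_carrier[OF gen_ext(1)[OF Y], of c] by (simp add: comparison_bcl[OF Y c(2)])
  next
    fix C D assume "C \<in> carrier (B Y)" "D \<in> carrier (B Y)"
    then obtain c d where c: "C = bcl Y c" "Poly_Mapping.keys c \<subseteq> gens Y"
      and d: "D = bcl Y d" "Poly_Mapping.keys d \<subseteq> gens Y" by (auto simp: P.carrier_presented)
    have cd: "Poly_Mapping.keys (c + d) \<subseteq> gens Y" using keys_add[of c d] c d by blast
    show "comparison Y (C \<otimes>\<^bsub>B Y\<^esub> D) = comparison Y C \<otimes>\<^bsub>mval F Y\<^esub> comparison Y D"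
      using hom_mult[OF gen_ext(1)[OF Y], of c d] c d
      by (simp add: P.pcl_add[symmetric] comparison_bcl[OF Y c(2)] comparison_bcl[OF Y d(2)] comparison_bcl[OF Y cd])
  qed
  show "bij_betw (comparison Y) (carrier (B Y)) (carrier (mval F Y))"
  proof (rule bij_betw_byWitness[of _ "\<lambda>t. bcl Y (frag_of (std_gen Y t))"])
    show "\<forall>C\<in>carrier (B Y). bcl Y (frag_of (std_gen Y (comparison Y C))) = C"
    proof
      fix C assume "C \<in> carrier (B Y)"
      then obtain c where c: "C = bcl Y c" "Poly_Mapping.keys c \<subseteq> gens Y"
        by (auto simp: P.carrier_presented)
      show "bcl Y (frag_of (std_gen Y (comparison Y C))) = C"
        by (simp only: c(1) comparison_bcl[OF Y c(2)] bcl_standard[OF Y c(2), symmetric])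
    qed
    show "\<forall>t\<in>carrier (mval F Y). comparison Y (bcl Y (frag_of (std_gen Y t))) = t"
    proof
      fix t assume "t \<in> carrier (mval F Y)"
      then have t: "t \<in> carrier (tval T (gprod Y W))" by (simp add: carrier_F)
      have k: "Poly_Mapping.keys (frag_of (std_gen Y t)) \<subseteq> gens Y" using std_gen_mem[OF Y t] by simp
      show "comparison Y (bcl Y (frag_of (std_gen Y t))) = t"
        by (simp only: comparison_bcl[OF Y k] gen_ext(2)[OF Y std_gen_mem[OF Y t]] gen_val_std[OF Y t])
    qed
    show "comparison Y ` carrier (B Y) \<subseteq> carrier (mval F Y)"
    proof
      fix t assume "t \<in> comparison Y ` carrier (B Y)"
      then obtain c where c: "t = comparison Y (bcl Y c)" "Poly_Mapping.keys c \<subseteq> gens Y"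
        by (auto simp: P.carrier_presented)
      then show "t \<in> carrier (mval F Y)"
        using hom_in_carrier[OF gen_ext(1)[OF Y], of c] by (simp add: comparison_bcl[OF Y c(2)])
    qed
    show "(\<lambda>t. bcl Y (frag_of (std_gen Y t))) ` carrier (mval F Y) \<subseteq> carrier (B Y)"
      using std_hom[OF Y] by (auto simp: hom_def)
  qed
qed (auto simp: comparison_res comparison_tr comparison_act)

end

section \<open>Composition and inversion of module maps\<close>

lemma tmodule_map_comp:
  assumes \<phi>: "tmodule_map G T M N \<phi>" and \<psi>: "tmodule_map G T N P \<psi>"
  shows "tmodule_map G T M P (\<lambda>X m. \<psi> X (\<phi> X m))"
proof -
  have c: "\<phi> X m \<in> carrier (mval N X)" if "fin_gset G X" "m \<in> carrier (mval M X)" for X m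
    using \<phi> that by (auto simp: tmodule_map_def hom_def)
  have "(\<lambda>m. \<psi> X (\<phi> X m)) \<in> hom (mval M X) (mval P X)" if "fin_gset G X" for X
    using Group.hom_compose[of "\<phi> X" "mval M X" "mval N X" "\<psi> X" "mval P X"] \<phi> \<psi> that
    by (simp add: tmodule_map_def comp_def)
  then show ?thesis using \<phi> \<psi> c by (simp add: tmodule_map_def)
qed

lemma tmodule_mapD:
  assumes "tmodule_map G T M N \<phi>"
  shows "fin_gset G X \<Longrightarrow> \<phi> X \<in> hom (mval M X) (mval N X)"
    "\<lbrakk>fin_gset G X; fin_gset G Y; f \<in> gmap G X Y; m \<in> carrier (mval M Y)\<rbrakk>
      \<Longrightarrow> \<phi> X (mres M X Y f m) = mres N X Y f (\<phi> Y m)"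
    "\<lbrakk>fin_gset G X; fin_gset G Y; f \<in> gmap G X Y; m \<in> carrier (mval M X)\<rbrakk>
      \<Longrightarrow> \<phi> Y (mtr M X Y f m) = mtr N X Y f (\<phi> X m)"
    "\<lbrakk>fin_gset G X; t \<in> carrier (tval T X); m \<in> carrier (mval M X)\<rbrakk>
      \<Longrightarrow> \<phi> X (mact M X t m) = mact N X t (\<phi> X m)"
  using assms unfolding tmodule_map_def by blast+

lemma tmodule_map_closed:
  "tmodule_map G T M N \<phi> \<Longrightarrow> fin_gset G X \<Longrightarrow> m \<in> carrier (mval M X) \<Longrightarrow> \<phi> X m \<in> carrier (mval N X)"
  by (rule hom_in_carrier[OF tmodule_mapD(1)])

lemma tmodule_iso_inverse:
  assumes iso: "tmodule_iso G T M N \<phi>" and M: "mackey_closed G M"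
    and act: "\<And>X t m. fin_gset G X \<Longrightarrow> t \<in> carrier (tval T X) \<Longrightarrow> m \<in> carrier (mval M X)
      \<Longrightarrow> mact M X t m \<in> carrier (mval M X)"
  shows "tmodule_iso G T N M (\<lambda>X. inv_into (carrier (mval M X)) (\<phi> X))"
proof -
  interpret M: mackey_closed G M by fact
  have map: "tmodule_map G T M N \<phi>"
    and bij: "\<And>X. fin_gset G X \<Longrightarrow> bij_betw (\<phi> X) (carrier (mval M X)) (carrier (mval N X))"
    using iso by (auto simp: tmodule_iso_def)
  let ?\<psi> = "\<lambda>X. inv_into (carrier (mval M X)) (\<phi> X)"
  have c: "?\<psi> X n \<in> carrier (mval M X)" and r: "\<phi> X (?\<psi> X n) = n"
    if "fin_gset G X" "n \<in> carrier (mval N X)" for X n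
    using bij[OF that(1)] that(2) by (auto simp: bij_betw_def inv_into_into f_inv_into_f)
  have l: "?\<psi> X n = m" if "fin_gset G X" "m \<in> carrier (mval M X)" "\<phi> X m = n" for X m n
    using bij[OF that(1)] that(2,3) by (auto simp: bij_betw_def)
  note D = tmodule_mapD[OF map]
  show ?thesis
    unfolding tmodule_iso_def tmodule_map_def
  proof (intro conjI allI impI ballI)
    fix X assume X: "fin_gset G X"
    show "?\<psi> X \<in> hom (mval N X) (mval M X)"
    proof (rule homI)
      fix m n assume "m \<in> carrier (mval N X)" "n \<in> carrier (mval N X)"
      then show "?\<psi> X (m \<otimes>\<^bsub>mval N X\<^esub> n) = ?\<psi> X m \<otimes>\<^bsub>mval M X\<^esub> ?\<psi> X n"
        using X hom_mult[OF D(1)[OF X]] by (intro l) (simp_all add: c r M.mult_closed)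
    qed (rule c[OF X])
    show "bij_betw (?\<psi> X) (carrier (mval N X)) (carrier (mval M X))"
      by (rule bij_betw_inv_into[OF bij[OF X]])
  next
    fix X Y f m assume "fin_gset G X \<and> fin_gset G Y \<and> f \<in> gmap G X Y" and "m \<in> carrier (mval N Y)"
    then show "?\<psi> X (mres N X Y f m) = mres M X Y f (?\<psi> Y m)"
      by (intro l) (simp_all add: c r D M.mres_closed)
  next
    fix X Y f m assume "fin_gset G X \<and> fin_gset G Y \<and> f \<in> gmap G X Y" and "m \<in> carrier (mval N X)"
    then show "?\<psi> Y (mtr N X Y f m) = mtr M X Y f (?\<psi> X m)"
      by (intro l) (simp_all add: c r D M.mtr_closed)
  next
    fix X t m assume "fin_gset G X" "t \<in> carrier (tval T X)" "m \<in> carrier (mval N X)"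
    then show "?\<psi> X (mact N X t m) = mact M X t (?\<psi> X m)"
      by (intro l) (simp_all add: c r D act)
  qed
qed

lemma tmodule_iso_comp:
  assumes "tmodule_iso G T M N \<phi>" "tmodule_iso G T N P \<psi>"
  shows "tmodule_iso G T M P (\<lambda>X m. \<psi> X (\<phi> X m))"
  using assms tmodule_map_comp[of G T M N \<phi> P \<psi>]
    bij_betw_trans[of "\<phi> X" "carrier (mval M X)" "carrier (mval N X)" "\<psi> X" "carrier (mval P X)" for X]
  by (simp add: tmodule_iso_def comp_def)

context free_comparison
begin

lemma comparison_inverse:
  "tmodule_iso G T F (free_tmodule G T W) (\<lambda>X. inv_into (carrier (B X)) (comparison X))"
proof -
  have "mackey_closed G (free_tmodule G T W)"
  proof
    fix X m n assume "m \<in> carrier (mval (free_tmodule G T W) X)" "n \<in> carrier (mval (free_tmodule G T W) X)"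
    then show "m \<otimes>\<^bsub>mval (free_tmodule G T W) X\<^esub> n \<in> carrier (mval (free_tmodule G T W) X)"
      using monoid.m_closed[OF comm_monoid.axioms(1)[OF comm_group.axioms(1)[OF
            presentation.comm_group_presented[OF gens_presentation]]]]
      by (simp add: mval_free)
  qed (simp_all add: mval_free comparison_res comparison_tr)
  from tmodule_iso_inverse[OF comparison_iso this]
  show ?thesis by (simp add: mval_free comparison_act)
qed

end

section \<open>Freeness and finite generation in terms of the model\<close>

context finite_tambara
begin

lemma free_comparison: "fin_gset G W \<Longrightarrow> free_comparison G T W"
  by (simp add: free_comparison_def free_comparison_axioms_def finite_tambara_axioms)

lemma is_free_iff: "is_free G T M \<longleftrightarrow> (\<exists>W \<phi>. fin_gset G W \<and> tmodule_iso G T (free_model T W) M \<phi>)"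
proof
  assume "is_free G T M"
  then obtain W \<phi> where W: "fin_gset G W" and \<phi>: "tmodule_iso G T (free_tmodule G T W) M \<phi>"
    by (auto simp: is_free_def)
  from tmodule_iso_comp[OF free_comparison.comparison_inverse[OF free_comparison[OF W]] \<phi>] W
  show "\<exists>W \<phi>. fin_gset G W \<and> tmodule_iso G T (free_model T W) M \<phi>" by blast
next
  assume "\<exists>W \<phi>. fin_gset G W \<and> tmodule_iso G T (free_model T W) M \<phi>"
  then obtain W \<phi> where W: "fin_gset G W" and \<phi>: "tmodule_iso G T (free_model T W) M \<phi>" by blast
  from tmodule_iso_comp[OF free_comparison.comparison_iso[OF free_comparison[OF W]] \<phi>] W
  show "is_free G T M" unfolding is_free_def by blast
qed

lemma is_fin_gen_imp_free_model:
  assumes "is_fin_gen G T M"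
  obtains W \<phi> where "fin_gset G W" "tmodule_epi G T (free_model T W) M \<phi>"
proof -
  obtain W \<phi> where W: "fin_gset G W" and \<phi>: "tmodule_epi G T (free_tmodule G T W) M \<phi>"
    using assms by (auto simp: is_fin_gen_def)
  interpret C: free_comparison G T W by (rule free_comparison[OF W])
  let ?\<psi> = "\<lambda>X. inv_into (carrier (C.B X)) (C.comparison X)"
  have \<psi>: "tmodule_map G T (free_model T W) (free_tmodule G T W) ?\<psi>"
    and bij: "\<And>X. fin_gset G X \<Longrightarrow> bij_betw (?\<psi> X) (carrier (mval (free_model T W) X)) (carrier (mval (free_tmodule G T W) X))"
    using C.comparison_inverse by (auto simp: tmodule_iso_def)
  have \<phi>m: "tmodule_map G T (free_tmodule G T W) M \<phi>"
    and surj: "\<And>X. fin_gset G X \<Longrightarrow> \<phi> X ` carrier (mval (free_tmodule G T W) X) = carrier (mval M X)"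
    using \<phi> by (auto simp: tmodule_epi_def)
  have "(\<lambda>m. \<phi> X (?\<psi> X m)) ` carrier (mval (free_model T W) X) = carrier (mval M X)"
    if X: "fin_gset G X" for X
    unfolding surj[OF X, symmetric] bij_betw_imp_surj_on[OF bij[OF X], symmetric] image_image ..
  then have "tmodule_epi G T (free_model T W) M (\<lambda>X m. \<phi> X (?\<psi> X m))"
    using tmodule_map_comp[OF \<psi> \<phi>m] by (simp add: tmodule_epi_def)
  then show ?thesis using that W by blast
qed

end

section \<open>Module maps out of the model in terms of the rings
  \<open>T(Y \<times> W)\<close>\<close>

context finite_tambara
begin

context
  fixes M :: "('g, 'a, 'm) tmodule" and W \<xi>
  assumes M: "tambara_module G T M" and W: "fin_gset G W"
    and \<xi>: "tmodule_map G T (free_model T W) M \<xi>"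
begin

lemma free_map_closed: "fin_gset G Y \<Longrightarrow> t \<in> carrier (tval T (gprod Y W)) \<Longrightarrow> \<xi> Y t \<in> carrier (mval M Y)"
  using tmodule_map_closed[OF \<xi>, of Y t] by (simp add: free_model_def)

lemma free_map_hom:
  assumes Y: "fin_gset G Y" shows "group_hom (add_monoid (tval T (gprod Y W))) (mval M Y) (\<xi> Y)"
proof -
  interpret M: tambara_module G T M by (rule M)
  interpret MY: comm_group "mval M Y" by (rule M.val[OF Y])
  interpret R: cring "tval T (gprod Y W)" by (rule val[OF fin_gset_gprod[OF Y W]])
  show ?thesis
    using tmodule_mapD(1)[OF \<xi> Y] MY.is_group R.a_group
    by (simp add: group_hom_def group_hom_axioms_def free_model_def)
qed

lemma free_map_zero: "fin_gset G Y \<Longrightarrow> \<xi> Y \<zero>\<^bsub>tval T (gprod Y W)\<^esub> = \<one>\<^bsub>mval M Y\<^esub>"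
  using group_hom.hom_one[OF free_map_hom, of Y] by simp

lemma free_map_add:
  "fin_gset G Y \<Longrightarrow> s \<in> carrier (tval T (gprod Y W)) \<Longrightarrow> t \<in> carrier (tval T (gprod Y W))
    \<Longrightarrow> \<xi> Y (s \<oplus>\<^bsub>tval T (gprod Y W)\<^esub> t) = \<xi> Y s \<otimes>\<^bsub>mval M Y\<^esub> \<xi> Y t"
  using group_hom.hom_mult[OF free_map_hom, of Y s t] by simp

lemma free_map_minus:
  assumes Y: "fin_gset G Y" and st: "s \<in> carrier (tval T (gprod Y W))" "t \<in> carrier (tval T (gprod Y W))"
  shows "\<xi> Y (s \<ominus>\<^bsub>tval T (gprod Y W)\<^esub> t) = \<xi> Y s \<otimes>\<^bsub>mval M Y\<^esub> inv\<^bsub>mval M Y\<^esub> \<xi> Y t"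
proof -
  interpret R: cring "tval T (gprod Y W)" by (rule val[OF fin_gset_gprod[OF Y W]])
  have "\<xi> Y (\<ominus>\<^bsub>tval T (gprod Y W)\<^esub> t) = inv\<^bsub>mval M Y\<^esub> \<xi> Y t"
    using group_hom.hom_inv[OF free_map_hom[OF Y], of t] st by (simp add: a_inv_def)
  then show ?thesis using st Y by (simp add: R.minus_eq free_map_add)
qed

lemma free_map_tr:
  "fin_gset G X \<Longrightarrow> fin_gset G Y \<Longrightarrow> f \<in> gmap G X Y \<Longrightarrow> t \<in> carrier (tval T (gprod X W))
    \<Longrightarrow> \<xi> Y (ttr T (gprod X W) (gprod Y W) (gtimes X W f) t) = mtr M X Y f (\<xi> X t)"
  using tmodule_mapD(3)[OF \<xi>, of X Y f t] by (simp add: free_model_def)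

lemma free_map_res:
  "fin_gset G X \<Longrightarrow> fin_gset G Y \<Longrightarrow> f \<in> gmap G X Y \<Longrightarrow> t \<in> carrier (tval T (gprod Y W))
    \<Longrightarrow> \<xi> X (tres T (gprod X W) (gprod Y W) (gtimes X W f) t) = mres M X Y f (\<xi> Y t)"
  using tmodule_mapD(2)[OF \<xi>, of X Y f t] by (simp add: free_model_def)

lemma free_map_act:
  "fin_gset G Y \<Longrightarrow> r \<in> carrier (tval T Y) \<Longrightarrow> t \<in> carrier (tval T (gprod Y W))
    \<Longrightarrow> \<xi> Y (tres T (gprod Y W) Y (gfst Y W) r \<otimes>\<^bsub>tval T (gprod Y W)\<^esub> t) = mact M Y r (\<xi> Y t)"
  using tmodule_mapD(4)[OF \<xi>, of Y r t] by (simp add: free_model_def)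

end

end

section \<open>Transport of structure and projectivity\<close>

text \<open>A copy of \<open>M\<close> along an injection \<open>\<iota>\<close>. Projectivity
  quantifies over modules with values in a single type, into which the modules at hand have to be
  moved.\<close>

definition transport_tmodule :: "('m \<Rightarrow> 'n) \<Rightarrow> ('g, 't, 'm) tmodule \<Rightarrow> ('g, 't, 'n) tmodule" where
  "transport_tmodule \<iota> M =
    \<lparr>mval = \<lambda>X. \<lparr>carrier = \<iota> ` carrier (mval M X), monoid.mult = \<lambda>x y. \<iota> (inv_into UNIV \<iota> x \<otimes>\<^bsub>mval M X\<^esub> inv_into UNIV \<iota> y),
        one = \<iota> \<one>\<^bsub>mval M X\<^esub>\<rparr>,
     mres = \<lambda>X Y f x. \<iota> (mres M X Y f (inv_into UNIV \<iota> x)),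
     mtr = \<lambda>X Y f x. \<iota> (mtr M X Y f (inv_into UNIV \<iota> x)),
     mact = \<lambda>X t x. \<iota> (mact M X t (inv_into UNIV \<iota> x))\<rparr>"

lemma transport_simps:
  assumes "inj \<iota>"
  shows "carrier (mval (transport_tmodule \<iota> M) X) = \<iota> ` carrier (mval M X)"
    "\<iota> x \<otimes>\<^bsub>mval (transport_tmodule \<iota> M) X\<^esub> \<iota> y = \<iota> (x \<otimes>\<^bsub>mval M X\<^esub> y)"
    "\<one>\<^bsub>mval (transport_tmodule \<iota> M) X\<^esub> = \<iota> \<one>\<^bsub>mval M X\<^esub>"
    "mres (transport_tmodule \<iota> M) X Y f (\<iota> x) = \<iota> (mres M X Y f x)"
    "mtr (transport_tmodule \<iota> M) X Y f (\<iota> x) = \<iota> (mtr M X Y f x)"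
    "mact (transport_tmodule \<iota> M) X t (\<iota> x) = \<iota> (mact M X t x)"
  using assms by (simp_all add: transport_tmodule_def inv_f_f)

lemma transport_map:
  assumes "inj \<iota>" shows "tmodule_map G T M (transport_tmodule \<iota> M) (\<lambda>X. \<iota>)"
  using assms by (auto simp: tmodule_map_def transport_simps hom_def)

lemma (in finite_tambara) tambara_module_transport:
  assumes \<iota>: "inj \<iota>" and M: "tambara_module G T M"
  shows "tambara_module G T (transport_tmodule \<iota> M)"
proof -
  interpret M: tambara_module G T M by fact
  interpret sM: semi_mackey G "mval M" "mres M" "mtr M"
    by (rule semi_mackey_mackey[OF M.mackey_functor_axioms])
  note S = transport_simps[OF \<iota>, of M]
  let ?M = "transport_tmodule \<iota> M"
  note cl = sM.res_closed sM.tr_closed M.act_closed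
  have "mackey_functor G ?M"
  proof (rule mackey_functor.intro, goal_cases)
    case (1 X)
    interpret X: comm_group "mval M X" by (rule M.val[OF 1])
    show ?case
    proof (rule comm_groupI)
      fix x assume "x \<in> carrier (mval ?M X)"
      then obtain m where "x = \<iota> m" "m \<in> carrier (mval M X)" by (auto simp: S)
      then show "\<exists>y\<in>carrier (mval ?M X). y \<otimes>\<^bsub>mval ?M X\<^esub> x = \<one>\<^bsub>mval ?M X\<^esub>"
        by (intro bexI[of _ "\<iota> (inv\<^bsub>mval M X\<^esub> m)"]) (simp_all add: S)
    qed (auto simp: S X.m_ac)
  next
    case (2 X Y f) then show ?case by (intro homI) (auto simp: S sM.res_closed sM.res_mult)
  next
    case (3 X Y f) then show ?case by (intro homI) (auto simp: S sM.tr_closed sM.tr_mult)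
  next
    case (8 X Y)
    let ?i = "\<lambda>(a, b). (\<iota> a, \<iota> b)"
      and ?r = "\<lambda>m. (mres M X (gsum X Y) (ginl X) m, mres M Y (gsum X Y) (ginr Y) m)"
    let ?t = "\<lambda>m. (mres ?M X (gsum X Y) (ginl X) m, mres ?M Y (gsum X Y) (ginr Y) m)"
    have r: "bij_betw ?r (carrier (mval M (gsum X Y))) (carrier (mval M X) \<times> carrier (mval M Y))"
      by (rule M.sum[OF 8])
    have t: "?t (\<iota> m) = ?i (?r m)" for m by (simp add: S)
    show ?case
      unfolding bij_betw_def
    proof
      show "inj_on ?t (carrier (mval ?M (gsum X Y)))"
      proof (rule inj_onI)
        fix x y assume "x \<in> carrier (mval ?M (gsum X Y))" "y \<in> carrier (mval ?M (gsum X Y))"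
          and eq: "?t x = ?t y"
        then obtain m n where mn: "x = \<iota> m" "y = \<iota> n" "m \<in> carrier (mval M (gsum X Y))" "n \<in> carrier (mval M (gsum X Y))"
          by (auto simp: S)
        have "?r m = ?r n" using eq \<iota> unfolding mn t by (simp add: inj_eq)
        then have "m = n" by (rule inj_onD[OF bij_betw_imp_inj_on[OF r] _ mn(3,4)])
        then show "x = y" using mn by simp
      qed
      have "?t ` carrier (mval ?M (gsum X Y)) = ?i ` ?r ` carrier (mval M (gsum X Y))"
        by (simp add: image_image S split_def)
      also have "\<dots> = carrier (mval ?M X) \<times> carrier (mval ?M Y)"
        unfolding bij_betw_imp_surj_on[OF r] S by force
      finally show "?t ` carrier (mval ?M (gsum X Y)) = carrier (mval ?M X) \<times> carrier (mval ?M Y)" .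
    qed
  next
    case (10 X Y Y' f h m)
    then obtain n where n: "m = \<iota> n" "n \<in> carrier (mval M X)" by (auto simp: S)
    show ?case using M.base_change[OF 10(1-5) n(2)] by (simp add: n S)
  next
    case (6 X Y Z f h m)
    then obtain n where n: "m = \<iota> n" "n \<in> carrier (mval M Z)" by (auto simp: S)
    show ?case using M.res_comp[OF 6(1-5) n(2)] by (simp add: n S)
  next
    case (7 X Y Z f h m)
    then obtain n where n: "m = \<iota> n" "n \<in> carrier (mval M X)" by (auto simp: S)
    show ?case using M.tr_comp[OF 7(1-5) n(2)] by (simp add: n S)
  qed (auto simp: S M.res_id M.tr_id M.empty)
  then show ?thesis
  proof (intro tambara_module.intro tambara_module_axioms.intro, goal_cases)
    case 1 then show ?case .
  next
    case 2 then show ?case by (auto simp: S M.act_closed)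
  next
    case 3 then show ?case by (auto simp: S M.act_add_left)
  next
    case 4 then show ?case by (auto simp: S M.act_add_right)
  next
    case 5 then show ?case by (auto simp: S M.act_res)
  next
    case 6 then show ?case by (auto simp: S M.act_tr_left)
  next
    case 7 then show ?case by (auto simp: S M.act_tr_right)
  next
    case 8 then show ?case by (auto simp: S M.act_one)
  next
    case 9 then show ?case by (auto simp: S M.act_assoc)
  qed
qed

text \<open>The lifting problem is that of the identity of \<open>P\<close> through
  \<open>\<phi>\<close>, after \<open>P\<close> and the model have been copied into the type of test
  modules.\<close>

lemma (in finite_tambara) projective_section:
  fixes P :: "('g, 'a, 'p) tmodule"
  assumes P: "tambara_module G T P" and proj: "is_projective G T P" and W: "fin_gset G W"
    and epi: "tmodule_epi G T (free_model T W) P \<phi>"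
  obtains \<sigma> where "tmodule_map G T P (free_model T W) \<sigma>"
    "\<And>X p. fin_gset G X \<Longrightarrow> p \<in> carrier (mval P X) \<Longrightarrow> \<phi> X (\<sigma> X p) = p"
proof -
  define \<iota> :: "'p \<Rightarrow> ('g, 'a, 'p) test_elem" where "\<iota> p = [(p, undefined)]" for p
  \<comment> \<open>The scalar entry of a box generator stores \<open>t\<close>, and the other
    entries are padding; the encoding is injective since \<open>frag_of\<close> is.\<close>
  define \<kappa> :: "'a \<Rightarrow> ('g, 'a, 'p) test_elem"
    where "\<kappa> t = [(undefined, {frag_of (undefined, undefined, t, undefined)})]" for t
  have \<iota>: "inj \<iota>" by (rule injI) (simp add: \<iota>_def)
  have \<kappa>: "inj \<kappa>" by (rule injI) (simp add: \<kappa>_def frag_of_eq)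
  let ?F = "free_model T W"
  let ?M = "transport_tmodule \<kappa> ?F" and ?N = "transport_tmodule \<iota> P"
  have F: "tambara_module G T ?F" by (rule tambara_module_free_model[OF W])
  note SM = transport_simps[OF \<kappa>, of ?F] and SN = transport_simps[OF \<iota>, of P]
  have \<phi>: "tmodule_map G T ?F P \<phi>"
    and surj: "\<And>X. fin_gset G X \<Longrightarrow> \<phi> X ` carrier (mval ?F X) = carrier (mval P X)"
    using epi by (auto simp: tmodule_epi_def)
  have from_M: "tmodule_map G T ?M ?F (\<lambda>X. inv_into UNIV \<kappa>)"
    using \<kappa> by (auto simp: tmodule_map_def hom_def SM)
  have e_map: "tmodule_map G T ?M ?N (\<lambda>X x. \<iota> (\<phi> X (inv_into UNIV \<kappa> x)))"
    by (rule tmodule_map_comp[OF from_M tmodule_map_comp[OF \<phi> transport_map[OF \<iota>]]])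
  have "(\<lambda>x. \<iota> (\<phi> X (inv_into UNIV \<kappa> x))) ` carrier (mval ?M X) = carrier (mval ?N X)"
    if X: "fin_gset G X" for X
    unfolding SM SN surj[OF X, symmetric] image_image using \<kappa> by simp
  then have "tmodule_epi G T ?M ?N (\<lambda>X x. \<iota> (\<phi> X (inv_into UNIV \<kappa> x)))"
    using e_map by (simp add: tmodule_epi_def)
  then obtain \<psi> where \<psi>: "tmodule_map G T P ?M \<psi>"
    and eq: "\<And>X p. fin_gset G X \<Longrightarrow> p \<in> carrier (mval P X) \<Longrightarrow> \<iota> (\<phi> X (inv_into UNIV \<kappa> (\<psi> X p))) = \<iota> p"
    using proj tambara_module_transport[OF \<kappa> F] tambara_module_transport[OF \<iota> P] transport_map[OF \<iota>, of G T P]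
    unfolding is_projective_def by blast
  show ?thesis
  proof (rule that[of "\<lambda>X p. inv_into UNIV \<kappa> (\<psi> X p)"])
    show "tmodule_map G T P ?F (\<lambda>X p. inv_into UNIV \<kappa> (\<psi> X p))"
      by (rule tmodule_map_comp[OF \<psi> from_M])
  qed (use eq \<iota> in \<open>simp add: inj_eq\<close>)
qed

section \<open>The submodule \<open>\<mm> P\<close>\<close>

text \<open>The value that \<open>presented_lift\<close> assigns to a representative
  \<open>c\<close>; the group is written multiplicatively.\<close>

definition lin :: "('a, 'z) monoid_scheme \<Rightarrow> ('r \<Rightarrow> 'a) \<Rightarrow> ('r \<Rightarrow>\<^sub>0 int) \<Rightarrow> 'a" where
  "lin A \<phi> c = finprod A (\<lambda>x. \<phi> x [^]\<^bsub>A\<^esub> Poly_Mapping.lookup c x) (Poly_Mapping.keys c)"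

section \<open>Homomorphisms out of presented groups into a given abelian group\<close>

context comm_group
begin

text \<open>The product over the keys of \<open>c\<close> becomes one of finite support over the
  fixed set \<open>S\<close>, so that the products for different \<open>c\<close> can be multiplied
  factor by factor.\<close>

lemma lin_gfinprod:
  assumes \<phi>: "\<phi> ` S \<subseteq> carrier G" and c: "Poly_Mapping.keys c \<subseteq> S"
  shows "lin G \<phi> c = gfinprod G (\<lambda>x. \<phi> x [^] Poly_Mapping.lookup c x) S"
proof -
  let ?f = "\<lambda>x. \<phi> x [^] Poly_Mapping.lookup c x"
  have sub: "{x \<in> S. ?f x \<noteq> \<one>} \<subseteq> Poly_Mapping.keys c" by (auto simp: in_keys_iff)
  then have fin: "finite {x \<in> S. ?f x \<noteq> \<one>}" by (rule finite_subset) simp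
  have "finprod G ?f {x \<in> S. ?f x \<noteq> \<one>} = finprod G ?f (Poly_Mapping.keys c)"
    by (rule finprod_mono_neutral_cong_left) (use sub c \<phi> in \<open>auto simp: subset_iff image_subset_iff\<close>)
  then show ?thesis using fin by (simp add: lin_def gfinprod_def)
qed

lemma lin_hom:
  assumes \<phi>: "\<phi> ` S \<subseteq> carrier G" shows "lin G \<phi> \<in> hom (free_Abelian_group S) G"
proof (rule homI)
  have fin: "finite {x \<in> S. \<phi> x [^] Poly_Mapping.lookup u x \<noteq> \<one>}" for u :: "_ \<Rightarrow>\<^sub>0 int"
    by (rule finite_subset[OF _ finite_keys[of u]]) (auto simp: in_keys_iff)
  have closed: "\<phi> x [^] (n::int) \<in> carrier G" if "x \<in> S" for x n using \<phi> that by auto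
  fix c assume c: "c \<in> carrier (free_Abelian_group S)"
  then show "lin G \<phi> c \<in> carrier G"
    using closed by (simp add: lin_gfinprod[OF \<phi>])
  fix d assume d: "d \<in> carrier (free_Abelian_group S)"
  have cd: "Poly_Mapping.keys c \<subseteq> S" "Poly_Mapping.keys d \<subseteq> S" using c d by simp_all
  then have k: "Poly_Mapping.keys (c + d) \<subseteq> S" using keys_add[of c d] by blast
  have "gfinprod G (\<lambda>x. \<phi> x [^] Poly_Mapping.lookup (c + d) x) S
    = gfinprod G (\<lambda>x. \<phi> x [^] Poly_Mapping.lookup c x \<otimes> \<phi> x [^] Poly_Mapping.lookup d x) S"
    using \<phi> closed by (intro gfinprod_cong) (auto simp: Poly_Mapping.lookup_add int_pow_mult image_subset_iff simp_implies_def)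
  also have "\<dots> = gfinprod G (\<lambda>x. \<phi> x [^] Poly_Mapping.lookup c x) S \<otimes> gfinprod G (\<lambda>x. \<phi> x [^] Poly_Mapping.lookup d x) S"
    using fin[of c] fin[of d] closed by (intro gfinprod_distrib) auto
  finally show "lin G \<phi> (c \<otimes>\<^bsub>free_Abelian_group S\<^esub> d) = lin G \<phi> c \<otimes> lin G \<phi> d"
    by (simp add: lin_gfinprod[OF \<phi> cd(1)] lin_gfinprod[OF \<phi> cd(2)] lin_gfinprod[OF \<phi> k])
qed

lemma lin_frag_of: "\<phi> x \<in> carrier G \<Longrightarrow> lin G \<phi> (frag_of x) = \<phi> x"
  by (simp add: lin_def)

lemma presented_lift_pcl:
  assumes P: "presentation S R" and \<phi>: "\<phi> ` S \<subseteq> carrier G" and R: "\<And>r. r \<in> R \<Longrightarrow> lin G \<phi> r = \<one>"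
    and c: "Poly_Mapping.keys c \<subseteq> S"
  shows "presented_lift G \<phi> (pcl S R c) = lin G \<phi> c"
proof -
  interpret P: presentation S R by fact
  have eq: "lin G \<phi> d = lin G \<phi> c" if "d \<in> pcl S R c" for d
    by (rule P.hom_pcl_cong(1)[OF lin_hom[OF \<phi>] is_group _ c that]) (rule R)
  show ?thesis
    unfolding presented_lift_def lin_def[symmetric]
  proof (rule the_equality)
    show "\<exists>d\<in>pcl S R c. lin G \<phi> c = lin G \<phi> d" using P.pcl_self[OF c] by blast
    fix a assume "\<exists>d\<in>pcl S R c. a = lin G \<phi> d"
    then show "a = lin G \<phi> c" using eq by metis
  qed
qed

end

lemma mackey_closed_mackey:
  assumes "mackey_functor G M" shows "mackey_closed G M"
proof -
  interpret mackey_functor G M by fact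
  show ?thesis
  proof
    fix X m n assume X: "fin_gset G X" and mn: "m \<in> carrier (mval M X)" "n \<in> carrier (mval M X)"
    interpret X: comm_group "mval M X" by (rule val[OF X])
    show "m \<otimes>\<^bsub>mval M X\<^esub> n \<in> carrier (mval M X)" using mn by simp
  qed (auto intro: hom_in_carrier[OF res_hom] hom_in_carrier[OF tr_hom])
qed

section \<open>The product of an ideal and a module\<close>

context tambara_congruence
begin

lemma mackey_closed_ideal: "mackey_closed G (ideal_mackey T I)"
proof
  fix X m n assume X: "fin_gset G X"
    and mn: "m \<in> carrier (mval (ideal_mackey T I) X)" "n \<in> carrier (mval (ideal_mackey T I) X)"
  interpret ideal "I X" "tval T X" by (rule I_ideal[OF X])
  show "m \<otimes>\<^bsub>mval (ideal_mackey T I) X\<^esub> n \<in> carrier (mval (ideal_mackey T I) X)"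
    using mn by (simp add: ideal_mackey_def)
qed (simp_all add: ideal_mackey_def I_res I_tr)

text \<open>The image of \<open>I \<box> P\<close> is generated by transfers of products
  \<open>b a\<close> with \<open>b\<close> in the ideal. Writing \<open>a\<close> as an image under
  the Yoneda map moves the scalar and the transfer into the model, where they stay in
  \<open>I\<close>. Conversely, the Yoneda formula for an element of \<open>I\<close> is itself the
  value of a generator.\<close>

lemma ideal_mult_eq:
  assumes P: "tambara_module G T P" and W: "fin_gset G W" and w: "w \<in> carrier (mval P W)"
    and epi: "\<And>Y. fin_gset G Y \<Longrightarrow> yoneda_map P W w Y ` carrier (tval T (gprod Y W)) = carrier (mval P Y)"
    and X: "fin_gset G X"
  shows "ideal_mult G T I P X = yoneda_map P W w X ` I (gprod X W)"
proof -
  interpret P: tambara_module G T P by fact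
  interpret sP: semi_mackey G "mval P" "mres P" "mtr P"
    by (rule semi_mackey_mackey[OF P.mackey_functor_axioms])
  note \<Phi> = yoneda_tmodule_map[OF P W w]
  let ?M = "ideal_mackey T I" and ?\<Phi> = "yoneda_map P W w"
  have M_simps: "carrier (mval ?M Y) = I Y" "mres ?M = tres T" "mtr ?M = ttr T"
    "a \<otimes>\<^bsub>mval ?M Y\<^esub> b = a \<oplus>\<^bsub>tval T Y\<^esub> b" for Y a b
    by (simp_all add: ideal_mackey_def)
  note Ic = I_carrier
  interpret pair: box_pairing G ?M P P "mact P"
  proof (rule box_pairing.intro[OF sP.semi_mackey_axioms mackey_closed_ideal
        mackey_closed_mackey[OF P.mackey_functor_axioms]], rule box_pairing_axioms.intro, goal_cases)
    case (1 X) then show ?case by (rule P.val)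
  next
    case (2 X m n) then show ?case using P.act_closed[OF 2(1) Ic[OF 2(1)]] by (simp add: M_simps)
  next
    case (3 X m m' n) then show ?case using P.act_add_left[OF 3(1) Ic[OF 3(1)] Ic[OF 3(1)]]
      by (simp add: M_simps)
  next
    case (4 X m n n') then show ?case using P.act_add_right[OF 4(1) Ic[OF 4(1)]]
      by (simp add: M_simps)
  next
    case (5 X Y f m n) then show ?case using P.act_tr_left[OF 5(1-3) Ic[OF 5(1)]]
      by (simp add: M_simps)
  next
    case (6 X Y f m n) then show ?case using P.act_tr_right[OF 6(1-3) Ic[OF 6(2)]]
      by (simp add: M_simps)
  qed
  interpret PX: comm_group "mval P X" by (rule P.val[OF X])
  note pres = box_presentation[OF mackey_closed_ideal mackey_closed_mackey[OF P.mackey_functor_axioms], of X]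
  let ?gens = "box_gens G ?M P X" and ?rels = "box_rels G ?M P X"
  interpret pr: presentation ?gens ?rels by (rule pres)
  have img: "pair.pair_val X ` ?gens \<subseteq> carrier (mval P X)" using pair.pair_val_closed[OF X] by blast
  have lg: "lin (mval P X) (pair.pair_val X) (frag_of g) = pair.pair_val X g" if "g \<in> ?gens" for g
    by (rule PX.lin_frag_of) (rule pair.pair_val_closed[OF X that])
  have lift: "box_lift P (mact P) X (pcl ?gens ?rels c) = lin (mval P X) (pair.pair_val X) c"
    if "Poly_Mapping.keys c \<subseteq> ?gens" for c :: "_ \<Rightarrow>\<^sub>0 int"
    unfolding box_lift_def pair.pair_val_def[symmetric]
    by (rule PX.presented_lift_pcl[OF pres img pair.pair_rels[OF X PX.lin_hom[OF img] lg] that])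
  have "ideal_mult G T I P X = lin (mval P X) (pair.pair_val X) ` {c. Poly_Mapping.keys c \<subseteq> ?gens}"
    using lift by (simp add: ideal_mult_def box_def pr.carrier_presented image_image)
  also have "\<dots> = ?\<Phi> X ` I (gprod X W)"
  proof
    note XW = fin_gset_gprod[OF X W]
    interpret J: ideal "I (gprod X W)" "tval T (gprod X W)" by (rule I_ideal[OF XW])
    show "lin (mval P X) (pair.pair_val X) ` {c. Poly_Mapping.keys c \<subseteq> ?gens} \<subseteq> ?\<Phi> X ` I (gprod X W)"
    proof clarify
      fix c :: "_ \<Rightarrow>\<^sub>0 int" assume c: "Poly_Mapping.keys c \<subseteq> ?gens"
      show "lin (mval P X) (pair.pair_val X) c \<in> ?\<Phi> X ` I (gprod X W)"
      proof (rule free_Abelian_group_induct[OF c])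
        have "\<one>\<^bsub>mval P X\<^esub> \<in> ?\<Phi> X ` I (gprod X W)"
          using free_map_zero[OF P W \<Phi> X]
            by (metis additive_subgroup.zero_closed J.additive_subgroup_axioms imageI)
        then show "lin (mval P X) (pair.pair_val X) 0 \<in> ?\<Phi> X ` I (gprod X W)" by (simp add: lin_def)
      next
        fix x y :: "_ \<Rightarrow>\<^sub>0 int" assume xy: "Poly_Mapping.keys x \<subseteq> ?gens" "Poly_Mapping.keys y \<subseteq> ?gens"
          and "lin (mval P X) (pair.pair_val X) x \<in> ?\<Phi> X ` I (gprod X W)"
            "lin (mval P X) (pair.pair_val X) y \<in> ?\<Phi> X ` I (gprod X W)"
        then obtain s t where st: "s \<in> I (gprod X W)" "t \<in> I (gprod X W)"
          "lin (mval P X) (pair.pair_val X) x = ?\<Phi> X s" "lin (mval P X) (pair.pair_val X) y = ?\<Phi> X t" by blast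
        have "?\<Phi> X (s \<ominus>\<^bsub>tval T (gprod X W)\<^esub> t) = ?\<Phi> X s \<otimes>\<^bsub>mval P X\<^esub> inv\<^bsub>mval P X\<^esub> ?\<Phi> X t"
          by (rule free_map_minus[OF P W \<Phi> X Ic[OF XW st(1)] Ic[OF XW st(2)]])
        then have "lin (mval P X) (pair.pair_val X) (x - y) = ?\<Phi> X (s \<ominus>\<^bsub>tval T (gprod X W)\<^esub> t)"
          using free_hom_diff[OF PX.lin_hom[OF img] PX.is_group xy] st by simp
        moreover have "s \<ominus>\<^bsub>tval T (gprod X W)\<^esub> t \<in> I (gprod X W)" using st by (simp add: a_minus_def)
        ultimately show "lin (mval P X) (pair.pair_val X) (x - y) \<in> ?\<Phi> X ` I (gprod X W)" by simp
      next
        fix g assume g: "g \<in> ?gens"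
        obtain Y f b a where ga: "g = (Y, f, b, a)" by (cases g)
        then have Y: "fin_gset G Y" and f: "f \<in> gmap G Y X" and b: "b \<in> I Y"
          and a: "a \<in> carrier (mval P Y)"
          using g by (simp_all add: M_simps)
        obtain t where t: "t \<in> carrier (tval T (gprod Y W))" "a = ?\<Phi> Y t" using epi[OF Y] a by blast
        let ?r = "tres T (gprod Y W) Y (gfst Y W) b"
        note YW = fin_gset_gprod[OF Y W] and f1 = gfst_gmap[OF Y W]
        interpret JY: ideal "I (gprod Y W)" "tval T (gprod Y W)" by (rule I_ideal[OF YW])
        have m: "?r \<otimes>\<^bsub>tval T (gprod Y W)\<^esub> t \<in> I (gprod Y W)"
          by (rule JY.I_r_closed[OF I_res[OF YW Y f1 b] t(1)])
        have "mact P Y b a = ?\<Phi> Y (?r \<otimes>\<^bsub>tval T (gprod Y W)\<^esub> t)"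
          using free_map_act[OF P W \<Phi> Y Ic[OF Y b] t(1)] t(2) by simp
        then have "pair.pair_val X g = ?\<Phi> X (ttr T (gprod Y W) (gprod X W) (gtimes Y W f) (?r \<otimes>\<^bsub>tval T (gprod Y W)\<^esub> t))"
          using free_map_tr[OF P W \<Phi> Y X f Ic[OF YW m]] by (simp add: ga pair.pair_val_def)
        moreover have "ttr T (gprod Y W) (gprod X W) (gtimes Y W f) (?r \<otimes>\<^bsub>tval T (gprod Y W)\<^esub> t) \<in> I (gprod X W)"
          by (rule I_tr[OF YW XW gtimes_gmap[OF Y W f] m])
        ultimately show "lin (mval P X) (pair.pair_val X) (frag_of g) \<in> ?\<Phi> X ` I (gprod X W)"
          by (simp add: lg[OF g])
      qed
    qed
    show "?\<Phi> X ` I (gprod X W) \<subseteq> lin (mval P X) (pair.pair_val X) ` {c. Poly_Mapping.keys c \<subseteq> ?gens}"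
    proof clarify
      fix c assume c: "c \<in> I (gprod X W)"
      let ?g = "(gprod X W, gfst X W, c, mres P (gprod X W) W (gsnd X W) w)"
      have g: "?g \<in> ?gens"
        using XW gfst_gmap[OF X W] c sP.res_closed[OF XW W gsnd_gmap[OF X W] w]
          by (simp add: M_simps)
      have "?\<Phi> X c = lin (mval P X) (pair.pair_val X) (frag_of ?g)"
        unfolding lg[OF g] by (simp add: pair.pair_val_def yoneda_map_def)
      then show "?\<Phi> X c \<in> lin (mval P X) (pair.pair_val X) ` {c. Poly_Mapping.keys c \<subseteq> ?gens}"
        by (rule image_eqI) (use g in simp)
    qed
  qed
  finally show ?thesis .
qed

end

section \<open>Quotients of modules, computed on representatives\<close>

lemma rcoset_Union:
  assumes A: "group A" and B: "group B" and H: "subgroup H A" and K: "subgroup K B"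
    and a: "a \<in> carrier A" and f: "f \<in> hom A B" and HK: "\<And>h. h \<in> H \<Longrightarrow> f h \<in> K"
  shows "(\<Union>c\<in>H #>\<^bsub>A\<^esub> a. K #>\<^bsub>B\<^esub> f c) = K #>\<^bsub>B\<^esub> f a"
proof -
  interpret A: group A by fact
  interpret B: group B by fact
  interpret H: subgroup H A by fact
  interpret K: subgroup K B by fact
  have fa: "f a \<in> carrier B" by (rule hom_in_carrier[OF f a])
  have "K #>\<^bsub>B\<^esub> f c = K #>\<^bsub>B\<^esub> f a" if c: "c \<in> H #>\<^bsub>A\<^esub> a" for c
  proof -
    obtain h where h: "h \<in> H" "c = h \<otimes>\<^bsub>A\<^esub> a" using c by (auto simp: r_coset_def)
    have "f c = f h \<otimes>\<^bsub>B\<^esub> f a" using h a f by (simp add: hom_mult)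
    then have "K #>\<^bsub>B\<^esub> f c = (K #>\<^bsub>B\<^esub> f h) #>\<^bsub>B\<^esub> f a"
      using B.coset_mult_assoc[OF K.subset K.mem_carrier[OF HK[OF h(1)]] fa] by simp
    also have "K #>\<^bsub>B\<^esub> f h = K"
      using B.coset_join2[OF K.mem_carrier K HK[OF h(1)]] HK[OF h(1)] by simp
    finally show ?thesis .
  qed
  moreover have "a \<in> H #>\<^bsub>A\<^esub> a" by (rule A.rcos_self[OF a H])
  ultimately show ?thesis by blast
qed

text \<open>A submodule \<open>H\<close> that contains all products of \<open>I\<close> with
  \<open>P\<close>: with \<open>H_ideal\<close>, cosets of \<open>I\<close> act on cosets of
  \<open>H\<close>.\<close>

locale submodule_congruence = tambara_congruence G T I
  for G :: "('g, 'b) monoid_scheme" (structure) and T :: "('g, 'a) tambara" and I +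
  fixes P :: "('g, 'a, 'p) tmodule" and H :: "'g gset \<Rightarrow> 'p set"
  assumes module: "tambara_module G T P"
    and H_subgroup: "fin_gset G X \<Longrightarrow> subgroup (H X) (mval P X)"
    and H_res: "\<lbrakk>fin_gset G X; fin_gset G Y; f \<in> gmap G X Y; h \<in> H Y\<rbrakk> \<Longrightarrow> mres P X Y f h \<in> H X"
    and H_tr: "\<lbrakk>fin_gset G X; fin_gset G Y; f \<in> gmap G X Y; h \<in> H X\<rbrakk> \<Longrightarrow> mtr P X Y f h \<in> H Y"
    and H_act: "\<lbrakk>fin_gset G X; t \<in> carrier (tval T X); h \<in> H X\<rbrakk> \<Longrightarrow> mact P X t h \<in> H X"
    and H_ideal: "\<lbrakk>fin_gset G X; t \<in> I X; p \<in> carrier (mval P X)\<rbrakk> \<Longrightarrow> mact P X t p \<in> H X"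
begin

abbreviation mcl :: "'g gset \<Rightarrow> 'p \<Rightarrow> 'p set" where "mcl X p \<equiv> H X #>\<^bsub>mval P X\<^esub> p"

sublocale M: tambara_module G T P by (rule module)

lemma mval_group: "fin_gset G X \<Longrightarrow> group (mval P X)"
  using M.val by (simp add: comm_group_def)

lemma carrier_mquot: "carrier (mval (tmodule_quot P H) X) = mcl X ` carrier (mval P X)"
  by (auto simp: tmodule_quot_def FactGroup_def RCOSETS_def)

lemma mres_mquot:
  assumes "fin_gset G X" "fin_gset G Y" "f \<in> gmap G X Y" "p \<in> carrier (mval P Y)"
  shows "mres (tmodule_quot P H) X Y f (mcl Y p) = mcl X (mres P X Y f p)"
  unfolding tmodule_quot_def mackey.simps
  by (rule rcoset_Union[OF mval_group mval_group H_subgroup H_subgroup _ M.res_hom H_res])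
    (use assms in simp_all)

lemma mtr_mquot:
  assumes "fin_gset G X" "fin_gset G Y" "f \<in> gmap G X Y" "p \<in> carrier (mval P X)"
  shows "mtr (tmodule_quot P H) X Y f (mcl X p) = mcl Y (mtr P X Y f p)"
  unfolding tmodule_quot_def mackey.simps
  by (rule rcoset_Union[OF mval_group mval_group H_subgroup H_subgroup _ M.tr_hom H_tr])
    (use assms in simp_all)

text \<open>Scalar and element both range over cosets. \<open>H_act\<close> absorbs the change of
  the element and \<open>H_ideal\<close> the change of the scalar.\<close>

lemma mact_mquot:
  assumes X: "fin_gset G X" and t: "t \<in> carrier (tval T X)" and p: "p \<in> carrier (mval P X)"
  shows "mact (tmodule_quot P H) X (cl X t) (mcl X p) = mcl X (mact P X t p)"
proof -
  interpret I: ideal "I X" "tval T X" by (rule I_ideal[OF X])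
  interpret P: comm_group "mval P X" by (rule M.val[OF X])
  interpret H: subgroup "H X" "mval P X" by (rule H_subgroup[OF X])
  have "(\<Union>c\<in>mcl X p. mcl X (mact P X b c)) = mcl X (mact P X t p)" if b: "b \<in> cl X t" for b
  proof -
    obtain i where i: "i \<in> I X" "b = i \<oplus>\<^bsub>tval T X\<^esub> t"
      using b by (auto simp: a_r_coset_def')
    have bc: "b \<in> carrier (tval T X)" using i t by simp
    have "(\<Union>c\<in>mcl X p. mcl X (mact P X b c)) = mcl X (mact P X b p)"
      by (rule rcoset_Union[OF P.is_group P.is_group H_subgroup[OF X] H_subgroup[OF X] p _ H_act[OF X bc]])
        (auto intro!: homI simp: M.act_closed M.act_add_right X bc)
    also have "mact P X b p = mact P X i p \<otimes>\<^bsub>mval P X\<^esub> mact P X t p"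
      using i t p X by (simp add: M.act_add_left)
    also have "mcl X \<dots> = (H X #>\<^bsub>mval P X\<^esub> mact P X i p) #>\<^bsub>mval P X\<^esub> mact P X t p"
      using P.coset_mult_assoc[OF H.subset, of "mact P X i p" "mact P X t p"] i t p X
        by (simp add: M.act_closed)
    also have "H X #>\<^bsub>mval P X\<^esub> mact P X i p = H X"
      using P.coset_join2[OF _ H_subgroup[OF X] H_ideal[OF X i(1) p]] H_ideal[OF X i(1) p] by simp
    finally show ?thesis .
  qed
  moreover have "t \<in> cl X t"
    using t by (auto simp: a_r_coset_def' intro!: bexI[of _ "\<zero>\<^bsub>tval T X\<^esub>"])
  ultimately show ?thesis unfolding tmodule_quot_def tmodule.simps by blast
qed

text \<open>All three operations in the Yoneda formula are computed on representatives. By this, a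
  map out of a free module over the quotient is the reduction of one over \<open>T\<close>.\<close>

lemma yoneda_map_mquot:
  assumes W: "fin_gset G W" and p: "p \<in> carrier (mval P W)"
    and Y: "fin_gset G Y" and t: "t \<in> carrier (tval T (gprod Y W))"
  shows "yoneda_map (tmodule_quot P H) W (mcl W p) Y (cl (gprod Y W) t) = mcl Y (yoneda_map P W p Y t)"
proof -
  interpret sP: semi_mackey G "mval P" "mres P" "mtr P"
    by (rule semi_mackey_mackey[OF M.mackey_functor_axioms])
  note YW = fin_gset_gprod[OF Y W] and f = gfst_gmap[OF Y W] gsnd_gmap[OF Y W]
  show ?thesis
    unfolding yoneda_map_def
    using YW f W Y p t sP.res_closed[OF YW W f(2) p] M.act_closed[OF YW t sP.res_closed[OF YW W f(2) p]]
    by (simp add: mres_mquot mtr_mquot mact_mquot)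
qed

end

text \<open>\<open>\<Phi>\<close> is onto and commutes with all operations, so each condition on
  \<open>H\<close> is the image of a closure property of the ideals
  \<open>I(Y \<times> W)\<close>.\<close>

lemma (in tambara_congruence) submodule_congruence_ideal_mult:
  assumes P: "tambara_module G T P" and W: "fin_gset G W"
    and \<Phi>: "tmodule_map G T (free_model T W) P \<Phi>"
    and onto: "\<And>Y. fin_gset G Y \<Longrightarrow> \<Phi> Y ` carrier (tval T (gprod Y W)) = carrier (mval P Y)"
    and H: "\<And>Y. fin_gset G Y \<Longrightarrow> H Y = \<Phi> Y ` I (gprod Y W)"
  shows "submodule_congruence G T I P H"
proof (rule submodule_congruence.intro[OF tambara_congruence_axioms], rule submodule_congruence_axioms.intro)
  note L = free_map_tr[OF P W \<Phi>] free_map_res[OF P W \<Phi>] free_map_act[OF P W \<Phi>]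
  show "tambara_module G T P" by (rule P)
  fix X assume X: "fin_gset G X"
  note XW = fin_gset_gprod[OF X W] and f1 = gfst_gmap[OF X W]
  interpret J: ideal "I (gprod X W)" "tval T (gprod X W)" by (rule I_ideal[OF XW])
  show "subgroup (H X) (mval P X)"
    unfolding H[OF X] by (rule group_hom.subgroup_img_is_subgroup[OF free_map_hom[OF P W \<Phi> X] J.a_subgroup])
  {
    fix t h assume t: "t \<in> carrier (tval T X)" and "h \<in> H X"
    then obtain c where c: "c \<in> I (gprod X W)" "h = \<Phi> X c" by (auto simp: H X)
    have "mact P X t h = \<Phi> X (tres T (gprod X W) X (gfst X W) t \<otimes>\<^bsub>tval T (gprod X W)\<^esub> c)"
      using L(3)[OF X t I_carrier[OF XW c(1)]] c by simp
    then show "mact P X t h \<in> H X"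
      using J.I_l_closed[OF c(1) res_closed[OF XW X f1 t]] by (simp add: H X)
  next
    fix t p assume t: "t \<in> I X" and "p \<in> carrier (mval P X)"
    then obtain c where c: "c \<in> carrier (tval T (gprod X W))" "p = \<Phi> X c" using onto[OF X] by blast
    have "mact P X t p = \<Phi> X (tres T (gprod X W) X (gfst X W) t \<otimes>\<^bsub>tval T (gprod X W)\<^esub> c)"
      using L(3)[OF X I_carrier[OF X t] c(1)] c by simp
    then show "mact P X t p \<in> H X"
      using J.I_r_closed[OF I_res[OF XW X f1 t] c(1)] by (simp add: H X)
  next
    fix Y f h assume Y: "fin_gset G Y" and f: "f \<in> gmap G X Y"
    note YW = fin_gset_gprod[OF Y W] and fW = gtimes_gmap[OF X W f]
    {
      assume "h \<in> H Y"
      then obtain c where c: "c \<in> I (gprod Y W)" "h = \<Phi> Y c" by (auto simp: H Y)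
      show "mres P X Y f h \<in> H X"
        using L(2)[OF X Y f I_carrier[OF YW c(1)]] c I_res[OF XW YW fW c(1)] by (metis H X imageI)
    next
      assume "h \<in> H X"
      then obtain c where c: "c \<in> I (gprod X W)" "h = \<Phi> X c" by (auto simp: H X)
      show "mtr P X Y f h \<in> H Y"
        using L(1)[OF X Y f I_carrier[OF XW c(1)]] c I_tr[OF XW YW fW c(1)] by (metis H Y imageI)
    }
  }
qed

section \<open>Lifting an isomorphism from the quotient to \<open>P\<close>\<close>

context local_cohomological
begin

lemma free_if_quotient_free:
  assumes P: "tambara_module G T P" and fg: "is_fin_gen G T P" and proj: "is_projective G T P"
    and free: "is_free G Q (tmodule_quot P (ideal_mult G T \<mm> P))"
  shows "is_free G T P"
proof -
  interpret P: tambara_module G T P by fact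
  define H where "H = ideal_mult G T \<mm> P"
  obtain W' \<Phi>' where W': "fin_gset G W'" and epi: "tmodule_epi G T (free_model T W') P \<Phi>'"
    using is_fin_gen_imp_free_model[OF fg] by blast
  \<comment> \<open>The given surjection is rewritten as a \<open>yoneda_map\<close>, the form for
    which \<open>ideal_mult_eq\<close> computes \<open>\<mm> P\<close>.\<close>
  define w' where "w' = \<Phi>' W' (free_gen T W')"
  define \<Phi> where "\<Phi> = yoneda_map P W' w'"
  have \<Phi>': "tmodule_map G T (free_model T W') P \<Phi>'"
    and surj: "\<And>Y. fin_gset G Y \<Longrightarrow> \<Phi>' Y ` carrier (tval T (gprod Y W')) = carrier (mval P Y)"
    using epi by (simp_all add: tmodule_epi_def free_model_def)
  have w': "w' \<in> carrier (mval P W')"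
    unfolding w'_def by (rule free_map_closed[OF P W' \<Phi>' W' free_gen_closed[OF W']])
  have \<Phi>: "tmodule_map G T (free_model T W') P \<Phi>"
    unfolding \<Phi>_def by (rule yoneda_tmodule_map[OF P W' w'])
  have onto: "\<Phi> Y ` carrier (tval T (gprod Y W')) = carrier (mval P Y)" if Y: "fin_gset G Y" for Y
  proof -
    have "\<Phi> Y ` carrier (tval T (gprod Y W')) = \<Phi>' Y ` carrier (tval T (gprod Y W'))"
      unfolding \<Phi>_def w'_def by (rule image_cong[OF refl tmodule_map_free_model[OF W' \<Phi>' Y, symmetric]])
    then show ?thesis using surj[OF Y] by simp
  qed
  have H: "H Y = \<Phi> Y ` \<mm> (gprod Y W')" if "fin_gset G Y" for Y
    unfolding H_def \<Phi>_def by (rule ideal_mult_eq[OF P W' w' onto[unfolded \<Phi>_def] that])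
  interpret C: submodule_congruence G T \<mm> P H
    by (rule submodule_congruence_ideal_mult[OF P W' \<Phi> onto H])
  interpret Q: finite_tambara G Q
    using tambara_functor_quot finite_group_axioms by (simp add: finite_tambara_def)
  obtain W \<psi> where W: "fin_gset G W"
    and iso: "tmodule_iso G Q (free_model Q W) (tmodule_quot P H) \<psi>"
    using free unfolding H_def[symmetric] Q.is_free_iff by blast
  have \<psi>: "tmodule_map G Q (free_model Q W) (tmodule_quot P H) \<psi>"
    and bij: "\<And>Y. fin_gset G Y \<Longrightarrow> bij_betw (\<psi> Y) (carrier (tval Q (gprod Y W))) (carrier (mval (tmodule_quot P H) Y))"
    using iso by (simp_all add: tmodule_iso_def free_model_def)
  have "\<psi> W (free_gen Q W) \<in> carrier (mval (tmodule_quot P H) W)"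
    using bij[OF W] Q.free_gen_closed[OF W] by (rule bij_betwE[rule_format])
  then obtain p where p: "p \<in> carrier (mval P W)" and gen: "\<psi> W (free_gen Q W) = C.mcl W p"
    unfolding C.carrier_mquot by blast
  define \<phi> where "\<phi> = yoneda_map P W p"
  have \<phi>: "tmodule_map G T (free_model T W) P \<phi>"
    unfolding \<phi>_def by (rule yoneda_tmodule_map[OF P W p])
  note \<phi>D = free_map_closed[OF P W \<phi>] free_map_zero[OF P W \<phi>] free_map_add[OF P W \<phi>]
    free_map_tr[OF P W \<phi>] free_map_act[OF P W \<phi>] free_map_minus[OF P W \<phi>]
  note \<Phi>D = free_map_closed[OF P W' \<Phi>] free_map_zero[OF P W' \<Phi>] free_map_add[OF P W' \<Phi>]
    free_map_tr[OF P W' \<Phi>] free_map_act[OF P W' \<Phi>] free_map_minus[OF P W' \<Phi>]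
  \<comment> \<open>\<open>\<psi>\<close> is the reduction of \<open>\<phi>\<close>, since both are
    given by the Yoneda formula: one for the image of the generator, the other for its lift
    \<open>p\<close>.\<close>
  have \<psi>_cl: "\<psi> Y (cl (gprod Y W) t) = C.mcl Y (\<phi> Y t)"
    if Y: "fin_gset G Y" and t: "t \<in> carrier (tval T (gprod Y W))" for Y t
    using Q.tmodule_map_free_model[OF W \<psi> Y cl_closed[OF t]] C.yoneda_map_mquot[OF W p Y t]
    by (simp add: gen \<phi>_def)
  note times = fin_gset_gprod gtimes_gmap gfst_gmap
  have \<phi>_onto: "\<Phi> Y t \<in> \<phi> Y ` carrier (tval T (gprod Y W))"
    if Y: "fin_gset G Y" and t: "t \<in> carrier (tval T (gprod Y W'))" for Y t
  proof -
    \<comment> \<open>The preimage under \<open>\<Phi>\<close> of the image of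
      \<open>\<phi>\<close>; if it is everything, then \<open>\<phi>\<close> is onto because
      \<open>\<Phi>\<close> is.\<close>
    define N where "N Y = {t \<in> carrier (tval T (gprod Y W')). \<Phi> Y t \<in> \<phi> Y ` carrier (tval T (gprod Y W))}" for Y
    have "t \<in> N Y"
    proof (rule nakayama[OF W' _ _ _ _ _ _ Y t])
      show "N Y \<subseteq> carrier (tval T (gprod Y W'))" for Y by (auto simp: N_def)
    next
      fix Y assume Y: "fin_gset G Y"
      note YW = fin_gset_gprod[OF Y W] and YW' = fin_gset_gprod[OF Y W']
      interpret R: cring "tval T (gprod Y W)" by (rule val[OF YW])
      interpret R': cring "tval T (gprod Y W')" by (rule val[OF YW'])
      interpret PY: comm_group "mval P Y" by (rule P.val[OF Y])
      show "\<zero>\<^bsub>tval T (gprod Y W')\<^esub> \<in> N Y"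
        using \<Phi>D(2)[OF Y] \<phi>D(2)[OF Y, symmetric]
          by (simp add: N_def image_iff) (use R.zero_closed in blast)
      show "m \<oplus>\<^bsub>tval T (gprod Y W')\<^esub> n \<in> N Y" if mn: "m \<in> N Y" "n \<in> N Y" for m n
      proof -
        obtain a b where ab: "a \<in> carrier (tval T (gprod Y W))" "b \<in> carrier (tval T (gprod Y W))"
          "\<Phi> Y m = \<phi> Y a" "\<Phi> Y n = \<phi> Y b" using mn by (auto simp: N_def)
        then have "\<Phi> Y (m \<oplus>\<^bsub>tval T (gprod Y W')\<^esub> n) = \<phi> Y (a \<oplus>\<^bsub>tval T (gprod Y W)\<^esub> b)"
          using mn Y by (simp add: N_def \<Phi>D(3) \<phi>D(3))
        then show ?thesis using mn ab by (simp add: N_def)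
      qed
      show "tres T (gprod Y W') Y (gfst Y W') r \<otimes>\<^bsub>tval T (gprod Y W')\<^esub> n \<in> N Y"
        if r: "r \<in> carrier (tval T Y)" and n: "n \<in> N Y" for r n
      proof -
        obtain a where a: "a \<in> carrier (tval T (gprod Y W))" "\<Phi> Y n = \<phi> Y a" using n
          by (auto simp: N_def)
        then have "\<Phi> Y (tres T (gprod Y W') Y (gfst Y W') r \<otimes>\<^bsub>tval T (gprod Y W')\<^esub> n)
          = \<phi> Y (tres T (gprod Y W) Y (gfst Y W) r \<otimes>\<^bsub>tval T (gprod Y W)\<^esub> a)"
          using n r Y by (simp add: N_def \<Phi>D(5) \<phi>D(5))
        then show ?thesis
          using n a r res_closed[OF YW Y gfst_gmap[OF Y W] r] res_closed[OF YW' Y gfst_gmap[OF Y W'] r]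
          by (simp add: N_def)
      qed
      show "\<exists>c\<in>\<mm> (gprod Y W'). t \<ominus>\<^bsub>tval T (gprod Y W')\<^esub> c \<in> N Y"
        if t: "t \<in> carrier (tval T (gprod Y W'))" for t
      proof -
        \<comment> \<open>As \<open>\<psi> Y\<close> is onto, \<open>\<Phi> Y t\<close> differs from
          some \<open>\<phi> Y s\<close> by an element of \<open>H Y\<close>, that is, by
          \<open>\<Phi> Y c\<close> with \<open>c\<close> in \<open>\<mm>(Y \<times> W')\<close>.
          The difference of \<open>t\<close> and \<open>c\<close> then lies in
          \<open>N Y\<close>.\<close>
        have "C.mcl Y (\<Phi> Y t) \<in> \<psi> Y ` cl (gprod Y W) ` carrier (tval T (gprod Y W))"
          using bij_betw_imp_surj_on[OF bij[OF Y]] \<Phi>D(1)[OF Y t]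
            by (simp add: C.carrier_mquot carrier_quot)
        then obtain s where s: "s \<in> carrier (tval T (gprod Y W))"
          and "C.mcl Y (\<Phi> Y t) = \<psi> Y (cl (gprod Y W) s)"
          by blast
        then have "C.mcl Y (\<Phi> Y t) = C.mcl Y (\<phi> Y s)" using \<psi>_cl[OF Y s] by simp
        then have "\<Phi> Y t \<in> C.mcl Y (\<phi> Y s)"
          using PY.rcos_self[OF \<Phi>D(1)[OF Y t] C.H_subgroup[OF Y]] by simp
        then obtain h where h: "h \<in> H Y" "\<Phi> Y t = h \<otimes>\<^bsub>mval P Y\<^esub> \<phi> Y s" by (auto simp: r_coset_def)
        then obtain c where c: "c \<in> \<mm> (gprod Y W')" "h = \<Phi> Y c" using H[OF Y] by blast
        note cc = I_carrier[OF YW' c(1)]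
        have "\<Phi> Y (t \<ominus>\<^bsub>tval T (gprod Y W')\<^esub> c) = \<phi> Y s"
          using \<Phi>D(1)[OF Y cc] \<phi>D(1)[OF Y s]
          by (simp add: \<Phi>D(6)[OF Y t cc] h c(2) PY.m_comm[of "\<Phi> Y c"] PY.m_assoc)
        then show ?thesis using c(1) cc s t by (intro bexI[of _ c]) (auto simp: N_def)
      qed
    next
      fix X Y f n assume X: "fin_gset G X" and Y: "fin_gset G Y" and f: "f \<in> gmap G X Y"
        and n: "n \<in> N X"
      then obtain a where a: "a \<in> carrier (tval T (gprod X W))" "\<Phi> X n = \<phi> X a"
        by (auto simp: N_def)
      then have "\<Phi> Y (ttr T (gprod X W') (gprod Y W') (gtimes X W' f) n)
        = \<phi> Y (ttr T (gprod X W) (gprod Y W) (gtimes X W f) a)"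
        using n X Y f by (simp add: N_def \<Phi>D(4) \<phi>D(4))
      then show "ttr T (gprod X W') (gprod Y W') (gtimes X W' f) n \<in> N Y"
        using n a X Y f W W' by (simp add: N_def tr_closed times)
    qed
    then show ?thesis by (simp add: N_def)
  qed
  have \<phi>_epi: "tmodule_epi G T (free_model T W) P \<phi>"
  proof -
    have "\<phi> Y ` carrier (tval T (gprod Y W)) = carrier (mval P Y)" if Y: "fin_gset G Y" for Y
      using \<phi>_onto[OF Y] \<phi>D(1)[OF Y] unfolding onto[OF Y, symmetric]
        by (intro equalityI image_subsetI)
    then show ?thesis using \<phi> by (simp add: tmodule_epi_def free_model_def)
  qed
  obtain \<sigma> where \<sigma>: "tmodule_map G T P (free_model T W) \<sigma>"
    and \<phi>\<sigma>: "\<And>Y p. fin_gset G Y \<Longrightarrow> p \<in> carrier (mval P Y) \<Longrightarrow> \<phi> Y (\<sigma> Y p) = p"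
    using projective_section[OF P proj W \<phi>_epi] by blast
  have \<sigma>\<phi>: "tmodule_map G T (free_model T W) (free_model T W) (\<lambda>Y t. \<sigma> Y (\<phi> Y t))"
    by (rule tmodule_map_comp[OF \<phi> \<sigma>])
  note F = tambara_module_free_model[OF W]
  note \<sigma>\<phi>D = free_map_closed[OF F W \<sigma>\<phi>] free_map_zero[OF F W \<sigma>\<phi>] free_map_add[OF F W \<sigma>\<phi>]
    free_map_tr[OF F W \<sigma>\<phi>] free_map_act[OF F W \<sigma>\<phi>]
  have retract: "\<sigma> Y (\<phi> Y t) = t" if Y: "fin_gset G Y"
    and t: "t \<in> carrier (tval T (gprod Y W))" for Y t
  proof -
    define N where "N Y = {t \<in> carrier (tval T (gprod Y W)). \<sigma> Y (\<phi> Y t) = t}" for Y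
    have "t \<in> N Y"
    proof (rule nakayama[OF W _ _ _ _ _ _ Y t])
      show "N Y \<subseteq> carrier (tval T (gprod Y W))" for Y by (auto simp: N_def)
    next
      fix Y assume Y: "fin_gset G Y"
      note YW = fin_gset_gprod[OF Y W]
      interpret R: cring "tval T (gprod Y W)" by (rule val[OF YW])
      interpret PY: comm_group "mval P Y" by (rule P.val[OF Y])
      show "\<zero>\<^bsub>tval T (gprod Y W)\<^esub> \<in> N Y"
        using \<sigma>\<phi>D(2)[OF Y] by (simp add: N_def free_model_def)
      show "m \<oplus>\<^bsub>tval T (gprod Y W)\<^esub> n \<in> N Y" if "m \<in> N Y" "n \<in> N Y" for m n
        using \<sigma>\<phi>D(3)[OF Y, of m n] that by (simp add: N_def free_model_def)
      show "tres T (gprod Y W) Y (gfst Y W) r \<otimes>\<^bsub>tval T (gprod Y W)\<^esub> n \<in> N Y"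
        if r: "r \<in> carrier (tval T Y)" and n: "n \<in> N Y" for r n
        using \<sigma>\<phi>D(5)[OF Y r, of n] n res_closed[OF YW Y gfst_gmap[OF Y W] r]
          by (simp add: N_def free_model_def)
      show "\<exists>c\<in>\<mm> (gprod Y W). t \<ominus>\<^bsub>tval T (gprod Y W)\<^esub> c \<in> N Y"
        if t: "t \<in> carrier (tval T (gprod Y W))" for t
      proof -
        let ?s = "\<sigma> Y (\<phi> Y t)"
        \<comment> \<open>\<open>\<phi>\<close> kills \<open>?c\<close>, so \<open>\<psi>\<close>
          kills its class, and injectivity of \<open>\<psi> Y\<close> puts \<open>?c\<close> into
          \<open>\<mm>\<close>. What remains of \<open>t\<close> is \<open>?s\<close>, which is a
          fixed point because \<open>\<sigma>\<close> is a section of \<open>\<phi>\<close>.\<close>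
        let ?c = "t \<ominus>\<^bsub>tval T (gprod Y W)\<^esub> ?s"
        have s: "?s \<in> carrier (tval T (gprod Y W))" using \<sigma>\<phi>D(1)[OF Y t]
          by (simp add: free_model_def)
        have \<phi>s: "\<phi> Y ?s = \<phi> Y t" by (rule \<phi>\<sigma>[OF Y \<phi>D(1)[OF Y t]])
        have c: "?c \<in> carrier (tval T (gprod Y W))" using t s by simp
        have "\<phi> Y ?c = \<one>\<^bsub>mval P Y\<^esub>"
          using \<phi>D(6)[OF Y t s] \<phi>D(1)[OF Y t] by (simp add: \<phi>s)
        then have "\<psi> Y (cl (gprod Y W) ?c) = \<psi> Y (cl (gprod Y W) \<zero>\<^bsub>tval T (gprod Y W)\<^esub>)"
          by (simp add: \<psi>_cl[OF Y c] \<psi>_cl[OF Y R.zero_closed] \<phi>D(2)[OF Y])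
        then have "cl (gprod Y W) ?c = cl (gprod Y W) \<zero>\<^bsub>tval T (gprod Y W)\<^esub>"
          by (rule inj_onD[OF bij_betw_imp_inj_on[OF bij[OF Y]] _ cl_closed[OF c] cl_closed[OF R.zero_closed]])
        then have "?c \<ominus>\<^bsub>tval T (gprod Y W)\<^esub> \<zero>\<^bsub>tval T (gprod Y W)\<^esub> \<in> \<mm> (gprod Y W)"
          by (rule cl_eq_iff[OF YW c R.zero_closed, THEN iffD1])
        then have cm: "?c \<in> \<mm> (gprod Y W)" using c by (simp add: R.minus_eq)
        have "t \<ominus>\<^bsub>tval T (gprod Y W)\<^esub> ?c = ?s"
          using t s by (simp add: R.minus_eq R.minus_add R.r_neg2)
        then show ?thesis using cm s \<phi>s by (intro bexI[of _ ?c]) (simp_all add: N_def)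
      qed
    next
      fix X Y f n assume X: "fin_gset G X" and Y: "fin_gset G Y" and f: "f \<in> gmap G X Y"
        and n: "n \<in> N X"
      then show "ttr T (gprod X W) (gprod Y W) (gtimes X W f) n \<in> N Y"
        using \<sigma>\<phi>D(4)[OF X Y f, of n] W by (simp add: N_def tr_closed times free_model_def)
    qed
    then show ?thesis by (simp add: N_def)
  qed
  have "inj_on (\<phi> Y) (carrier (tval T (gprod Y W)))" if "fin_gset G Y" for Y
    by (rule inj_on_inverseI[of _ "\<sigma> Y"]) (rule retract[OF that])
  then have "tmodule_iso G T (free_model T W) P \<phi>"
    using \<phi>_epi by (simp add: tmodule_iso_def tmodule_epi_def bij_betw_def free_model_def)
  then show ?thesis using W is_free_iff by blast
qed

end

theorem theorem3:
  fixes G :: "('g, 'b) monoid_scheme"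
    and T :: "('g, 't) tambara"
    and P :: "('g, 't, 'p) tmodule"
    and \<mm> :: "'g gset \<Rightarrow> 't set"
  assumes "group G" and "finite (carrier G)"
    and "tambara_functor G T"
    and "local_tambara G T"
    and "maximal_tambara_ideal G T \<mm>"
    and "mult_cohomological G T"
    and "tambara_module G T P"
    and "is_fin_gen G T P"
    and "is_projective G T P"
    and "is_free G (tambara_quot T \<mm>) (tmodule_quot P (ideal_mult G T \<mm> P))"
  shows "is_free G T P"
proof -
  have "local_cohomological G T \<mm>"
    using assms by (simp add: local_cohomological_def local_cohomological_axioms_def finite_tambara_def
        finite_group_def finite_group_axioms_def)
  then show ?thesis using assms(7-10) by (rule local_cohomological.free_if_quotient_free)
qed

end
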